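(* Let $\mathbf{R}=k[x_1,\dots,x_d]$ be a polynomial ring over a field $k$ and let $I=(J,a)=(f_1,\dots,f_d,f_{d+1})$, with $a=f_{d+1}$, be an almost complete intersection of finite colength generated by forms of degree $n$, where $J=(f_1,\dots,f_d)$ is a complete intersection. Then the module $T$ of nonlinear relations of $I$ satisfies $\deg T=\lambda(I/J)$. In particular, if $\mathbf{R}[It]$ is almost Cohen--Macaulay, then $T$ can be generated by $\lambda(I/J)$ elements.
   Context: $\lambda$ denotes length. Almost complete intersection here means that $f_1,\dots,f_d$ is a regular sequence and $f_{d+1}\notin J$. The module of nonlinear relations is the kernel $T$ of the natural surjection $\operatorname{Sym}(I)\to\mathbf{R}[It]$, viewed as a module over $\mathbf{S}=\operatorname{Sym}(I)$, a quotient of $\mathbf{B}=\mathbf{R}[\mathbf{T}_1,\dots,\mathbf{T}_{d+1}]$. For a graded $\mathbf{B}$-module $A$, $\deg(A)$ is its multiplicity relative to the maximal homogeneous ideal $(x_1,\dots,x_d,\mathbf{T}_1,\dots,\mathbf{T}_{d+1})$ of $\mathbf{B}$. $\mathbf{R}[It]$ is almost Cohen--Macaulay if $\operatorname{depth}\mathbf{R}[It]\ge d$, depth with respect to the maximal homogeneous ideal. *)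

theory Defs
  imports
    "HOL-Library.Poly_Mapping"
    "HOL-Library.Extended_Nat"
    "HOL-Computational_Algebra.Polynomial"
    "HOL-Algebra.QuotRing"
    "HOL-Algebra.Ideal_Product"
    "HOL-Algebra.Module"
begin

text \<open>
  Concrete rings are subrings of types of class \<open>comm_ring_1\<close> (polynomials are finitely supported
  functions on monomials); \<open>ring_on\<close> turns such a subring into a HOL-Algebra ring, in which ideals,
  quotients, kernels and modules are then taken.
\<close>

definition ring_on :: "'a::comm_ring_1 set \<Rightarrow> 'a ring" where
  "ring_on A = \<lparr>carrier = A, monoid.mult = (*), one = 1, ring.zero = 0, add = (+)\<rparr>"


section \<open>Polynomials\<close>

type_synonym ('v, 'a) mpoly = "('v \<Rightarrow>\<^sub>0 nat) \<Rightarrow>\<^sub>0 'a"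

definition mpolys :: "'a::comm_ring_1 set \<Rightarrow> 'v set \<Rightarrow> ('v, 'a) mpoly set" where
  "mpolys A V = {p. (\<forall>m. Poly_Mapping.lookup p m \<in> A) \<and>
                    (\<forall>m\<in>Poly_Mapping.keys p. Poly_Mapping.keys m \<subseteq> V)}"

definition const :: "'a::comm_ring_1 \<Rightarrow> ('v, 'a) mpoly" where
  "const c = Poly_Mapping.single 0 c"

definition var :: "'v \<Rightarrow> ('v, 'a::comm_ring_1) mpoly" where
  "var v = Poly_Mapping.single (Poly_Mapping.single v 1) 1"

definition form :: "nat \<Rightarrow> ('v, 'a::comm_ring_1) mpoly \<Rightarrow> bool" where
  "form n p \<longleftrightarrow> (\<forall>m\<in>Poly_Mapping.keys p. (\<Sum>v\<in>Poly_Mapping.keys m. Poly_Mapping.lookup m v) = n)"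

definition mpoly_eval ::
    "('a::comm_ring_1 \<Rightarrow> 'b::comm_ring_1) \<Rightarrow> ('v \<Rightarrow> 'b) \<Rightarrow> ('v, 'a) mpoly \<Rightarrow> 'b" where
  "mpoly_eval h g p = (\<Sum>m\<in>Poly_Mapping.keys p.
     h (Poly_Mapping.lookup p m) * (\<Prod>v\<in>Poly_Mapping.keys m. g v ^ Poly_Mapping.lookup m v))"


section \<open>Regular sequences and depth\<close>

definition regular_seq :: "('a, 'm) ring_scheme \<Rightarrow> 'a list \<Rightarrow> bool" where
  "regular_seq S xs \<longleftrightarrow>
     set xs \<subseteq> carrier S \<and> Idl\<^bsub>S\<^esub> (set xs) \<noteq> carrier S \<and>
     (\<forall>i<length xs. \<forall>y\<in>carrier S.
        xs ! i \<otimes>\<^bsub>S\<^esub> y \<in> Idl\<^bsub>S\<^esub> (set (take i xs)) \<longrightarrow> y \<in> Idl\<^bsub>S\<^esub> (set (take i xs)))"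

definition depth :: "('a, 'm) ring_scheme \<Rightarrow> 'a set \<Rightarrow> enat" where
  "depth S I = Sup {enat (length xs) |xs. set xs \<subseteq> I \<and> regular_seq S xs}"


section \<open>Modules, length and multiplicity\<close>

text \<open>
  The record type of modules extends that of rings; the fields \<open>mult\<close> and \<open>one\<close> are ignored by the
  locales \<open>module\<close> and \<open>submodule\<close>.
\<close>

text \<open>An ideal \<open>N\<close> of \<open>S\<close>, as a module over another ring by restriction of scalars along \<open>\<phi>\<close>.\<close>

definition restrict_scalars ::
    "('b \<Rightarrow> 'a) \<Rightarrow> ('a, 'm) ring_scheme \<Rightarrow> 'a set \<Rightarrow> ('b, 'a) module" where
  "restrict_scalars \<phi> S N =
     \<lparr>carrier = N, monoid.mult = monoid.mult S, one = one S, ring.zero = ring.zero S, add = add S,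
      module.smult = (\<lambda>b x. \<phi> b \<otimes>\<^bsub>S\<^esub> x)\<rparr>"

abbreviation ideal_module :: "('a, 'm) ring_scheme \<Rightarrow> 'a set \<Rightarrow> ('a, 'a) module" where
  "ideal_module \<equiv> restrict_scalars (\<lambda>x. x)"

definition quot_module :: "('r, 'a, 'm) module_scheme \<Rightarrow> 'a set \<Rightarrow> ('r, 'a set) module" where
  "quot_module M N =
     \<lparr>carrier = a_rcosets\<^bsub>M\<^esub> N, monoid.mult = (\<lambda>X Y. N), one = N, ring.zero = N, add = set_add M,
      module.smult = (\<lambda>r X. \<Union>x\<in>X. N +>\<^bsub>M\<^esub> (r \<odot>\<^bsub>M\<^esub> x))\<rparr>"

definition mod_length :: "('r, 'n) ring_scheme \<Rightarrow> ('r, 'a, 'm) module_scheme \<Rightarrow> enat" where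
  "mod_length R M = Sup {enat n |n. \<exists>c :: nat \<Rightarrow> 'a set.
     (\<forall>i\<le>n. submodule (c i) R M) \<and> (\<forall>i<n. c i \<subset> c (Suc i))}"

definition ideal_smult ::
    "('r, 'n) ring_scheme \<Rightarrow> 'r set \<Rightarrow> ('r, 'a, 'm) module_scheme \<Rightarrow> 'a set" where
  "ideal_smult R I M = \<Inter>{N. submodule N R M \<and> (\<forall>a\<in>I. \<forall>x\<in>carrier M. a \<odot>\<^bsub>M\<^esub> x \<in> N)}"

definition ideal_pow :: "('a, 'm) ring_scheme \<Rightarrow> 'a set \<Rightarrow> nat \<Rightarrow> 'a set" where
  "ideal_pow R I n = I [^]\<^bsub>ideals_set R\<^esub> n"

text \<open>
  The multiplicity of \<open>M\<close> relative to \<open>I\<close> is \<open>r! a\<^sub>r\<close>, where \<open>a\<^sub>r n\<^sup>r\<close> is the leading term of the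
  Hilbert-Samuel polynomial, the polynomial that agrees with the length of \<open>M / I\<^sup>n M\<close> for large \<open>n\<close>.
\<close>

definition hilbert_samuel ::
    "('r, 'n) ring_scheme \<Rightarrow> 'r set \<Rightarrow> ('r, 'a, 'm) module_scheme \<Rightarrow> real poly \<Rightarrow> bool" where
  "hilbert_samuel R I M P \<longleftrightarrow>
     (\<forall>\<^sub>F n in sequentially. \<exists>l.
        mod_length R (quot_module M (ideal_smult R (ideal_pow R I n) M)) = enat l \<and>
        real l = poly P (real n))"

definition module_multiplicity ::
    "('r, 'n) ring_scheme \<Rightarrow> 'r set \<Rightarrow> ('r, 'a, 'm) module_scheme \<Rightarrow> nat" where
  "module_multiplicity R I M =
     (THE e. \<exists>P. hilbert_samuel R I M P \<and> real e = fact (degree P) * lead_coeff P)"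


section \<open>Rees algebra, symmetric algebra and nonlinear relations\<close>

text \<open>\<open>R[It]\<close> inside \<open>R[t]\<close>, with its maximal homogeneous ideal when \<open>R\<close> is a polynomial ring in
  the variables \<open>X\<close>.\<close>

definition rees :: "'a::comm_ring_1 set \<Rightarrow> 'a set \<Rightarrow> 'a poly set" where
  "rees R I = {p. \<forall>i. coeff p i \<in> ideal_pow (ring_on R) I i}"

definition rees_max ::
    "('v, 'a::comm_ring_1) mpoly set \<Rightarrow> 'v set \<Rightarrow> ('v, 'a) mpoly set \<Rightarrow> ('v, 'a) mpoly poly set" where
  "rees_max R X I = Idl\<^bsub>ring_on (rees R I)\<^esub> ((\<lambda>v. [:var v:]) ` X \<union> (\<lambda>u. monom u 1) ` I)"

text \<open>
  The symmetric algebra of the \<open>R\<close>-module \<open>I\<close> is the polynomial ring over \<open>R\<close> on one variable for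
  each element of \<open>I\<close>, modulo the relations making \<open>u \<mapsto> var u\<close> an \<open>R\<close>-linear map.
\<close>

definition sym_relations :: "'a::comm_ring_1 set \<Rightarrow> 'a set \<Rightarrow> ('a, 'a) mpoly set" where
  "sym_relations R I = Idl\<^bsub>ring_on (mpolys R I)\<^esub>
     ({var (u + v) - var u - var v |u v. u \<in> I \<and> v \<in> I} \<union>
      {var (r * u) - const r * var u |r u. r \<in> R \<and> u \<in> I})"

definition sym_alg :: "'a::comm_ring_1 set \<Rightarrow> 'a set \<Rightarrow> ('a, 'a) mpoly set ring" where
  "sym_alg R I = ring_on (mpolys R I) Quot sym_relations R I"

text \<open>
  The natural surjection \<open>Sym(I) \<rightarrow> R[It]\<close> is induced by \<open>var u \<mapsto> u t\<close>, which is constant on each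
  coset of the relations.
\<close>

definition sym_to_rees :: "('a::comm_ring_1, 'a) mpoly set \<Rightarrow> 'a poly" where
  "sym_to_rees X = the_elem (mpoly_eval (\<lambda>r. [:r:]) (\<lambda>u. monom u 1) ` X)"

definition nonlinear_relations :: "'a::comm_ring_1 set \<Rightarrow> 'a set \<Rightarrow> ('a, 'a) mpoly set set" where
  "nonlinear_relations R I = a_kernel (sym_alg R I) (ring_on (rees R I)) sym_to_rees"

text \<open>
  The presentation \<open>R[T\<^sub>j] \<rightarrow> Sym(I)\<close> that sends \<open>T\<^sub>j\<close> to the class of the generator \<open>f\<^sub>j\<close>, and the
  maximal homogeneous ideal of \<open>R[T\<^sub>j]\<close> when \<open>R\<close> is a polynomial ring in the variables \<open>X\<close>.
\<close>

definition sym_presentation ::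
    "'a::comm_ring_1 set \<Rightarrow> 'a set \<Rightarrow> ('j \<Rightarrow> 'a) \<Rightarrow> ('j, 'a) mpoly \<Rightarrow> ('a, 'a) mpoly set" where
  "sym_presentation R I f b =
     sym_relations R I +>\<^bsub>ring_on (mpolys R I)\<^esub> mpoly_eval const (\<lambda>j. var (f j)) b"

definition biring_max ::
    "('v, 'a::comm_ring_1) mpoly set \<Rightarrow> 'v set \<Rightarrow> 'j set \<Rightarrow> ('j, ('v, 'a) mpoly) mpoly set" where
  "biring_max R X Y = Idl\<^bsub>ring_on (mpolys R Y)\<^esub> ((\<lambda>v. const (var v)) ` X \<union> var ` Y)"

end

theory Submission
  imports Defs "HOL-Library.Product_Lexorder"
begin

text \<open>
  Write \<open>T = P / L\<close>, where \<open>L \<subseteq> P\<close> are the ideals of \<open>B\<close> that define the symmetric and the Rees algebra.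
  Modulo \<open>L\<close>, powers of \<open>f l\<close> annihilate \<open>P\<close>, hence so do all elements of large degree in the \<open>x\<close>.
  Thus \<open>T\<close> is finite over \<open>k[T]\<close> and its multiplicity is read off the dimensions of its components of
  degree \<open>j\<close> in the \<open>T\<close>-variables. Truncating \<open>P\<close> and \<open>L\<close> at a large degree in the \<open>x\<close>, these dimensions
  can be bounded from both sides with leading term \<open>\<lambda>(R / (J : a)) binomial (j + d) d\<close>, and
  \<open>R / (J : a)\<close> is isomorphic to \<open>I / J\<close>.

  For the number of generators, let \<open>M r\<close> define the symmetric algebra of \<open>J r = (f 0, \<dots>, f (r - 1))\<close>.
  The quotients \<open>M (r + 1) / M r\<close> are isomorphic to \<open>(J r : f r) B / M r\<close>, and by induction on \<open>r\<close> the Koszul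
  homology of \<open>B / L\<close> on all variables vanishes above degree \<open>d\<close>. If the depth of the Rees algebra is at
  least \<open>d\<close>, the long exact sequence and the nilpotency of the \<open>x\<close> on \<open>T\<close> give the vanishing of the first
  Koszul homology of \<open>T\<close> on the \<open>T\<close>-variables. So \<open>T\<close> is free over \<open>k[T]\<close>, and its rank is bounded by the
  growth of its components.
\<close>

section \<open>Submodules of a commutative ring and their lengths\<close>

text \<open>A module \<open>V / W\<close> is represented by a pair \<open>W \<subseteq> V\<close> of
  subsets of one ring type; lengths, Koszul homology and isomorphisms are statements about such
  pairs, and quotients of HOL-Algebra enter only in the final translation. The coefficient
  \<open>\<lambda>(R / (J : a))\<close> arises because the last coefficients of the linear relations
  among \<open>f 0, \<dots>, f d\<close> form the ideal \<open>J : a\<close>: modulo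
  \<open>L\<close>, the coefficient of a monomial divisible by \<open>T d\<close> can be reduced
  modulo \<open>J : a\<close>, at the price of monomials with fewer factors \<open>T d\<close>. What
  escapes involves only \<open>d\<close> variables and has order \<open>j ^ (d - 1)\<close>. The
  obstacle is the opposite inequality, which needs an upper bound for the dimension of
  \<open>L\<close>. Relations with last coefficient 0 are relations of a regular sequence, hence
  Koszul, and these too can give up a factor \<open>T d\<close>. The Rees algebra contributes only
  lower order terms: all \<open>f l\<close> have degree \<open>n\<close>, so its part of T-degree
  \<open>j\<close> and bounded x-degree lives in a bounded number of degrees of
  \<open>R\<close>.\<close>

locale subr =
  fixes A :: "'a::comm_ring_1 set"
  assumes zero [simp]: "0 \<in> A" and one [simp]: "1 \<in> A"
    and add: "x \<in> A \<Longrightarrow> y \<in> A \<Longrightarrow> x + y \<in> A"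
    and mult: "x \<in> A \<Longrightarrow> y \<in> A \<Longrightarrow> x * y \<in> A"
    and uminus: "x \<in> A \<Longrightarrow> - x \<in> A"
begin

lemma diff: "x \<in> A \<Longrightarrow> y \<in> A \<Longrightarrow> x - y \<in> A"
  using add[of x "- y"] uminus by simp

lemma sum: "(\<And>i. i \<in> S \<Longrightarrow> g i \<in> A) \<Longrightarrow> sum g S \<in> A"
  by (induction S rule: infinite_finite_induct) (auto intro: add)

lemma prod: "(\<And>i. i \<in> S \<Longrightarrow> g i \<in> A) \<Longrightarrow> prod g S \<in> A"
  by (induction S rule: infinite_finite_induct) (auto intro: mult)

lemma power: "x \<in> A \<Longrightarrow> x ^ n \<in> A"
  by (induction n) (auto intro: mult)

end

text \<open>No inclusion \<open>M \<subseteq> A\<close> is imposed, so that one notion serves for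
  ideals of \<open>A\<close> and for subspaces over a small field of constants.\<close>

definition submod :: "'a::comm_ring_1 set \<Rightarrow> 'a set \<Rightarrow> bool" where
  "submod A M \<longleftrightarrow> 0 \<in> M \<and> (\<forall>x\<in>M. \<forall>y\<in>M. x + y \<in> M) \<and> (\<forall>a\<in>A. \<forall>x\<in>M. a * x \<in> M)"

lemma submodI:
  assumes "0 \<in> M" "\<And>x y. x \<in> M \<Longrightarrow> y \<in> M \<Longrightarrow> x + y \<in> M" "\<And>a x. a \<in> A \<Longrightarrow> x \<in> M \<Longrightarrow> a * x \<in> M"
  shows "submod A M"
  using assms by (auto simp: submod_def)

lemma submod_zero: "submod A M \<Longrightarrow> 0 \<in> M"
  and submod_add: "submod A M \<Longrightarrow> x \<in> M \<Longrightarrow> y \<in> M \<Longrightarrow> x + y \<in> M"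
  and submod_mult: "submod A M \<Longrightarrow> a \<in> A \<Longrightarrow> x \<in> M \<Longrightarrow> a * x \<in> M"
  by (auto simp: submod_def)

lemma submod_sum: "submod A M \<Longrightarrow> (\<And>i. i \<in> S \<Longrightarrow> g i \<in> M) \<Longrightarrow> sum g S \<in> M"
  by (induction S rule: infinite_finite_induct) (auto intro: submod_add submod_zero)

lemma submod_uminus: "subr A \<Longrightarrow> submod A M \<Longrightarrow> x \<in> M \<Longrightarrow> - x \<in> M"
  using submod_mult[of A M "-1" x] subr.uminus[of A 1] subr.one by auto

lemma submod_diff: "subr A \<Longrightarrow> submod A M \<Longrightarrow> x \<in> M \<Longrightarrow> y \<in> M \<Longrightarrow> x - y \<in> M"
  using submod_add[of A M x "- y"] submod_uminus[of A M y] by simp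

lemma submod_diff_iff: "subr A \<Longrightarrow> submod A M \<Longrightarrow> x - y \<in> M \<Longrightarrow> x \<in> M \<longleftrightarrow> y \<in> M"
  using submod_add[of A M "x - y" y] submod_diff[of A M x "x - y"] by auto

lemma submod_subset: "submod A M \<Longrightarrow> A' \<subseteq> A \<Longrightarrow> submod A' M"
  by (auto simp: submod_def)

lemma submod_self: "subr A \<Longrightarrow> submod A A"
  by (simp add: submod_def subr.zero subr.add subr.mult)

lemma submod_Int: "submod A M \<Longrightarrow> submod A N \<Longrightarrow> submod A (M \<inter> N)"
  by (auto simp: submod_def)

lemma submod_zero_set: "submod A {0}"
  by (auto simp: submod_def)

definition msum :: "'a::comm_ring_1 set \<Rightarrow> 'a set \<Rightarrow> 'a set" where
  "msum M N = {x + y |x y. x \<in> M \<and> y \<in> N}"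

lemma msumI: "x \<in> M \<Longrightarrow> y \<in> N \<Longrightarrow> x + y \<in> msum M N"
  by (auto simp: msum_def)

lemma submod_msum:
  assumes "submod A M" "submod A N" shows "submod A (msum M N)"
proof (rule submodI)
  show "0 \<in> msum M N" using msumI[of 0 M 0 N] assms by (auto simp: submod_def)
next
  fix x y assume "x \<in> msum M N" "y \<in> msum M N"
  then obtain a b a' b' where "a \<in> M" "b \<in> N" "a' \<in> M" "b' \<in> N" "x = a + b" "y = a' + b'"
    by (auto simp: msum_def)
  thus "x + y \<in> msum M N"
    using msumI[of "a + a'" M "b + b'" N] assms by (auto simp: submod_def algebra_simps)
next
  fix c x assume "c \<in> A" "x \<in> msum M N"
  then obtain a b where "a \<in> M" "b \<in> N" "x = a + b"
    by (auto simp: msum_def)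
  thus "c * x \<in> msum M N"
    using msumI[of "c * a" M "c * b" N] assms `c \<in> A` by (auto simp: submod_def distrib_left)
qed

lemma msum_upper: "submod A M \<Longrightarrow> submod A N \<Longrightarrow> M \<subseteq> msum M N \<and> N \<subseteq> msum M N"
  using msumI[of _ M 0 N] msumI[of 0 M _ N] by (auto dest: submod_zero)

lemma msum_least: "submod A N \<Longrightarrow> X \<subseteq> N \<Longrightarrow> Y \<subseteq> N \<Longrightarrow> msum X Y \<subseteq> N"
  by (auto simp: msum_def submod_def)

text \<open>Linear combinations are built one term at a time, which gives inductions that treat a
  single generator per step.\<close>

inductive_set gen :: "'a::comm_ring_1 set \<Rightarrow> 'a set \<Rightarrow> 'a set" for A X where
  zero: "0 \<in> gen A X"
| step: "a \<in> A \<Longrightarrow> x \<in> X \<Longrightarrow> y \<in> gen A X \<Longrightarrow> a * x + y \<in> gen A X"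

lemma gen_add: "x \<in> gen A X \<Longrightarrow> y \<in> gen A X \<Longrightarrow> x + y \<in> gen A X"
  by (induction rule: gen.induct) (simp_all add: add.assoc gen.step)

lemma submod_gen:
  assumes "subr A" shows "submod A (gen A X)"
proof (rule submodI)
  fix a x assume "a \<in> A" "x \<in> gen A X"
  from this(2,1) show "a * x \<in> gen A X"
  proof (induction rule: gen.induct)
    case (step b x y)
    hence "(a * b) * x + a * y \<in> gen A X"
      using subr.mult[OF assms] by (intro gen.step) auto
    thus ?case by (simp add: algebra_simps)
  qed (simp add: gen.zero)
qed (auto intro: gen.zero gen_add)

lemma gen_superset: "subr A \<Longrightarrow> X \<subseteq> gen A X"
  using gen.step[of 1 A _ X 0] gen.zero subr.one[of A] by auto

lemma gen_least: "submod A N \<Longrightarrow> X \<subseteq> N \<Longrightarrow> gen A X \<subseteq> N"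
proof
  fix x assume "submod A N" "X \<subseteq> N" "x \<in> gen A X"
  from this(3,1,2) show "x \<in> N"
    by (induction rule: gen.induct) (auto simp: submod_def)
qed

lemma gen_mono: "subr A \<Longrightarrow> X \<subseteq> Y \<Longrightarrow> gen A X \<subseteq> gen A Y"
  using gen_least[OF submod_gen] gen_superset by blast

lemma gen_submod: "subr A \<Longrightarrow> submod A N \<Longrightarrow> gen A N = N"
  using gen_least[of A N N] gen_superset[of A N] by auto

lemma gen_Un: "subr A \<Longrightarrow> gen A (X \<union> Y) = msum (gen A X) (gen A Y)"
proof (rule antisym)
  assume A: "subr A"
  have "X \<subseteq> gen A X" "Y \<subseteq> gen A Y" using gen_superset[OF A] by auto
  thus "gen A (X \<union> Y) \<subseteq> msum (gen A X) (gen A Y)"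
    using msum_upper[OF submod_gen[OF A, of X] submod_gen[OF A, of Y]]
    by (intro gen_least submod_msum submod_gen A) auto
  show "msum (gen A X) (gen A Y) \<subseteq> gen A (X \<union> Y)"
    by (intro msum_least[OF submod_gen[OF A]] gen_mono A) auto
qed

lemma gen_Un_submod: "subr A \<Longrightarrow> submod A W \<Longrightarrow> gen A (W \<union> Y) = msum W (gen A Y)"
  by (simp add: gen_Un gen_submod)

lemma gen_singleton:
  assumes "subr A" shows "gen A {e} = {a * e |a. a \<in> A}"
proof (rule antisym)
  have "submod A {a * e |a. a \<in> A}"
  proof (rule submodI)
    show "0 \<in> {a * e |a. a \<in> A}" using subr.zero[OF assms] by (force intro: exI[of _ 0])
  next
    fix x y assume "x \<in> {a * e |a. a \<in> A}" "y \<in> {a * e |a. a \<in> A}"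
    thus "x + y \<in> {a * e |a. a \<in> A}"
      using subr.add[OF assms] by (auto simp: distrib_right[symmetric])
  next
    fix c x assume "c \<in> A" "x \<in> {a * e |a. a \<in> A}"
    thus "c * x \<in> {a * e |a. a \<in> A}"
      using subr.mult[OF assms] by (auto simp: mult.assoc[symmetric])
  qed
  moreover have "e \<in> {a * e |a. a \<in> A}" using subr.one[OF assms] by (force intro: exI[of _ 1])
  ultimately show "gen A {e} \<subseteq> {a * e |a. a \<in> A}" by (intro gen_least) auto
  show "{a * e |a. a \<in> A} \<subseteq> gen A {e}"
    using submod_gen[OF assms] gen_superset[OF assms, of "{e}"] by (auto simp: submod_def)
qed

lemma gen_insert_submod:
  assumes "subr A" "submod A W" shows "gen A (insert e W) = {w + a * e |w a. w \<in> W \<and> a \<in> A}"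
proof -
  have "gen A (insert e W) = msum W (gen A {e})"
    using gen_Un_submod[OF assms, of "{e}"] by simp
  thus ?thesis unfolding gen_singleton[OF assms(1)] msum_def by auto
qed

lemma gen_image_sum:
  assumes "subr A" "finite S" shows "gen A (g ` S) = {(\<Sum>i\<in>S. a i * g i) |a. \<forall>i\<in>S. a i \<in> A}"
  using assms(2)
proof (induction S)
  case empty
  have "gen A {} = {0}"
    using gen_least[of A "{0}" "{}"] gen.zero[of A "{}"] by (auto simp: submod_zero_set)
  thus ?case by auto
next
  case (insert j S)
  have "gen A (g ` insert j S) = msum (gen A {g j}) (gen A (g ` S))"
    using gen_Un[OF assms(1), of "{g j}" "g ` S"] by simp
  also have "\<dots> = {(\<Sum>i\<in>insert j S. a i * g i) |a. \<forall>i\<in>insert j S. a i \<in> A}"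
  proof (intro Set.set_eqI iffI)
    fix x assume "x \<in> msum (gen A {g j}) (gen A (g ` S))"
    then obtain b a where b: "b \<in> A" "\<forall>i\<in>S. a i \<in> A" "x = b * g j + (\<Sum>i\<in>S. a i * g i)"
      unfolding insert.IH gen_singleton[OF assms(1)] msum_def by auto
    have "(\<Sum>i\<in>insert j S. (a(j := b)) i * g i) = b * g j + (\<Sum>i\<in>S. (a(j := b)) i * g i)"
      using insert.hyps by simp
    also have "(\<Sum>i\<in>S. (a(j := b)) i * g i) = (\<Sum>i\<in>S. a i * g i)"
      using insert.hyps by (intro sum.cong) auto
    finally show "x \<in> {(\<Sum>i\<in>insert j S. a i * g i) |a. \<forall>i\<in>insert j S. a i \<in> A}"
      using b by (intro CollectI exI[of _ "a(j := b)"]) auto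
  next
    fix x assume "x \<in> {(\<Sum>i\<in>insert j S. a i * g i) |a. \<forall>i\<in>insert j S. a i \<in> A}"
    thus "x \<in> msum (gen A {g j}) (gen A (g ` S))"
      unfolding insert.IH gen_singleton[OF assms(1)] msum_def using insert.hyps by auto
  qed
  finally show ?case .
qed

section \<open>Chains and lengths of subquotients\<close>

definition chain :: "'a::comm_ring_1 set \<Rightarrow> 'a set \<Rightarrow> 'a set \<Rightarrow> (nat \<Rightarrow> 'a set) \<Rightarrow> nat \<Rightarrow> bool" where
  "chain A W V c n \<longleftrightarrow> (\<forall>i\<le>n. submod A (c i) \<and> W \<subseteq> c i \<and> c i \<subseteq> V) \<and> (\<forall>i<n. c i \<subset> c (Suc i))"

text \<open>The length of \<open>V / W\<close>, whose submodules correspond to the submodules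
  between \<open>W\<close> and \<open>V\<close>.\<close>

definition len :: "'a::comm_ring_1 set \<Rightarrow> 'a set \<Rightarrow> 'a set \<Rightarrow> enat" where
  "len A W V = Sup {enat n |n. \<exists>c. chain A W V c n}"

lemma chain_le_len: "chain A W V c n \<Longrightarrow> enat n \<le> len A W V"
  unfolding len_def by (rule Sup_upper) auto

lemma len_leI: "(\<And>n c. chain A W V c n \<Longrightarrow> enat n \<le> N) \<Longrightarrow> len A W V \<le> N"
  unfolding len_def by (rule Sup_least) auto

text \<open>If every member were below \<open>n\<close>, the supremum would be at most
  \<open>n - 1\<close>. Positivity of \<open>n\<close> excludes the empty set, whose supremum is
  0.\<close>

lemma enat_le_Sup_obtain:
  assumes "enat n \<le> Sup S" "n > 0" obtains x where "x \<in> S" "enat n \<le> x"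
proof -
  have "\<exists>x\<in>S. enat n \<le> x"
proof (rule ccontr)
  assume *: "\<not> (\<exists>x\<in>S. enat n \<le> x)"
  have "x < enat n" if x: "x \<in> S" for x
    using * x by (auto simp: not_le)
  hence "x \<le> enat (n - 1)" if "x \<in> S" for x
    using that assms(2) by (cases x) fastforce+
  hence "Sup S \<le> enat (n - 1)" by (rule Sup_least)
  with assms(1) have "enat n \<le> enat (n - 1)" by (rule order_trans)
  with assms(2) show False by simp
qed
  thus thesis using that by blast
qed

lemma chain_prefix: "chain A W V c n \<Longrightarrow> m \<le> n \<Longrightarrow> chain A W V c m"
  by (auto simp: chain_def)

lemma le_len_obtain:
  assumes "enat n \<le> len A W V" "submod A W" "W \<subseteq> V"
  obtains c where "chain A W V c n"
proof (cases "n = 0")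
  case True
  hence "chain A W V (\<lambda>_. W) n" using assms by (auto simp: chain_def)
  thus thesis by (rule that)
next
  case False
  with enat_le_Sup_obtain[OF assms(1)[unfolded len_def]] obtain x
    where "x \<in> {enat n |n. \<exists>c. chain A W V c n}" "enat n \<le> x" by blast
  then obtain c m where "chain A W V c m" "n \<le> m" by auto
  thus thesis using that chain_prefix by blast
qed

lemma len_mono: "W \<subseteq> W' \<Longrightarrow> V' \<subseteq> V \<Longrightarrow> len A W' V' \<le> len A W V"
proof (rule len_leI, rule chain_le_len)
  fix n c assume "W \<subseteq> W'" "V' \<subseteq> V" "chain A W' V' c n"
  thus "chain A W V c n" unfolding chain_def by (meson order_trans)
qed

lemma len_antimono_ring: "A' \<subseteq> A \<Longrightarrow> len A W V \<le> len A' W V"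
proof (rule len_leI, rule chain_le_len)
  fix n c assume "A' \<subseteq> A" "chain A W V c n"
  thus "chain A' W V c n" using submod_subset unfolding chain_def by blast
qed

text \<open>Tests a sum of two suprema on finite lower bounds of the summands, so that infinite
  lengths need no separate treatment in \<open>len_add\<close>.\<close>

lemma enat_add_leI:
  fixes x y z :: enat
  assumes "\<And>a b. enat a \<le> x \<Longrightarrow> enat b \<le> y \<Longrightarrow> enat (a + b) \<le> z" shows "x + y \<le> z"
proof -
  have inf: "z = \<infinity>" if "\<And>n. enat n \<le> z"
    using that[of "Suc (the_enat z)"] by (cases z) auto
  show ?thesis
  proof (cases x)
    case x: (enat a)
    show ?thesis
    proof (cases y)
      case (enat b) thus ?thesis using assms[of a b] x by simp
    next
      case infinity
      thus ?thesis using inf assms[of 0] x by (simp add: zero_enat_def[symmetric])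
    qed
  next
    case infinity
    thus ?thesis using inf assms[of _ 0] by (simp add: zero_enat_def[symmetric])
  qed
qed

lemma chain_concat:
  assumes c: "chain A W U c n" and c': "chain A U V c' m" and "W \<subseteq> U" "U \<subseteq> V"
  shows "chain A W V (\<lambda>i. if i \<le> n then c i else c' (i - n)) (n + m)"
  unfolding chain_def
proof (intro conjI allI impI)
  fix i assume "i \<le> n + m"
  hence "i - n \<le> m" by simp
  hence "submod A (c' (i - n)) \<and> U \<subseteq> c' (i - n) \<and> c' (i - n) \<subseteq> V"
    using c' by (auto simp: chain_def)
  moreover have "submod A (c i) \<and> W \<subseteq> c i \<and> c i \<subseteq> U" if "i \<le> n"
    using c that by (auto simp: chain_def)
  ultimately show "submod A (if i \<le> n then c i else c' (i - n))"
    "W \<subseteq> (if i \<le> n then c i else c' (i - n))" "(if i \<le> n then c i else c' (i - n)) \<subseteq> V"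
    using assms(3,4) by (auto split: if_splits)
next
  fix i assume i: "i < n + m"
  consider "Suc i \<le> n" | "i = n" | "i > n" by linarith
  thus "(if i \<le> n then c i else c' (i - n)) \<subset> (if Suc i \<le> n then c (Suc i) else c' (Suc i - n))"
  proof cases
    case 1 thus ?thesis using c by (auto simp: chain_def)
  next
    case 2
    hence "c n \<subseteq> U" "U \<subseteq> c' 0" "c' 0 \<subset> c' (Suc 0)" using c c' i by (auto simp: chain_def)
    thus ?thesis using 2 by auto
  next
    case 3
    thus ?thesis using c' i by (auto simp: chain_def Suc_diff_le)
  qed
qed

text \<open>Intersecting a strict chain with a submodule, or adding a submodule to it, leaves only a
  weak chain; its strict steps still bound the length from below.\<close>

lemma weak_chain_len:
  assumes "\<And>i. i \<le> n \<Longrightarrow> submod A (c i)" "\<And>i. i < n \<Longrightarrow> c i \<subseteq> c (Suc i)"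
    and "submod A W" "W \<subseteq> c 0"
  shows "enat (card {i. i < n \<and> c i \<noteq> c (Suc i)}) \<le> len A W (c n)"
  using assms(1,2)
proof (induction n)
  case 0 show ?case by (simp add: zero_enat_def[symmetric])
next
  case (Suc n)
  let ?S = "\<lambda>n. {i. i < n \<and> c i \<noteq> c (Suc i)}"
  have IH: "enat (card (?S n)) \<le> len A W (c n)" using Suc by auto
  have "c 0 \<subseteq> c m" if "m \<le> n" for m
    using that Suc.prems(2) by (induction m) (auto, meson Suc_leD Suc_le_lessD le_imp_less_Suc subsetD)
  hence "c 0 \<subseteq> c n" by simp
  hence W: "W \<subseteq> c n" using assms by auto
  show ?case
  proof (cases "c n = c (Suc n)")
    case True
    hence "?S (Suc n) = ?S n" by (auto simp: less_Suc_eq)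
    thus ?thesis using IH True by simp
  next
    case False
    hence "?S (Suc n) = insert n (?S n)" by (auto simp: less_Suc_eq)
    hence card: "card (?S (Suc n)) = Suc (card (?S n))" by simp
    obtain b where b: "chain A W (c n) b (card (?S n))"
      using le_len_obtain[OF IH assms(3) W] by blast
    have "chain A (c n) (c (Suc n)) (\<lambda>i. if i = 0 then c n else c (Suc n)) 1"
      using False Suc.prems by (auto simp: chain_def)
    from chain_concat[OF b this] W Suc.prems(2) show ?thesis
      unfolding card using chain_le_len by fastforce
  qed
qed

text \<open>Chains concatenate, which gives one inequality. For the other, the modular law shows
  that a strict step of a chain from \<open>W\<close> to \<open>V\<close> stays strict after
  intersecting with \<open>U\<close> or after adding \<open>U\<close>.\<close>

lemma len_add:
  assumes A: "subr A" and sub: "submod A W" "submod A U" "submod A V" and le: "W \<subseteq> U" "U \<subseteq> V"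
  shows "len A W V = len A W U + len A U V"
proof (rule antisym)
  show "len A W U + len A U V \<le> len A W V"
  proof (rule enat_add_leI)
    fix a b assume "enat a \<le> len A W U" "enat b \<le> len A U V"
    then obtain c c' where "chain A W U c a" "chain A U V c' b"
      using le_len_obtain[OF _ sub(1) le(1)] le_len_obtain[OF _ sub(2) le(2)] by metis
    from chain_le_len[OF chain_concat[OF this le]] show "enat (a + b) \<le> len A W V" .
  qed
next
  show "len A W V \<le> len A W U + len A U V"
  proof (rule len_leI)
    fix n c assume c: "chain A W V c n"
    let ?c1 = "\<lambda>i. c i \<inter> U" and ?c2 = "\<lambda>i. msum (c i) U"
    let ?S1 = "{i. i < n \<and> ?c1 i \<noteq> ?c1 (Suc i)}" and ?S2 = "{i. i < n \<and> ?c2 i \<noteq> ?c2 (Suc i)}"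
    have sc: "submod A (c i)" "W \<subseteq> c i" "c i \<subseteq> V" if "i \<le> n" for i using c that by (auto simp: chain_def)
    have inc: "c i \<subset> c (Suc i)" if "i < n" for i using c that by (auto simp: chain_def)
    have "enat (card ?S1) \<le> len A W (?c1 n)"
    proof (rule weak_chain_len)
      show "?c1 i \<subseteq> ?c1 (Suc i)" if "i < n" for i using inc[OF that] by auto
      show "W \<subseteq> ?c1 0" using sc(2)[of 0] le by auto
      show "submod A (?c1 i)" if "i \<le> n" for i using sc(1)[OF that] sub by (intro submod_Int)
    qed (rule sub)
    also have "\<dots> \<le> len A W U" by (rule len_mono) auto
    finally have 1: "enat (card ?S1) \<le> len A W U" .
    have "enat (card ?S2) \<le> len A U (?c2 n)"
    proof (rule weak_chain_len)
      show "U \<subseteq> ?c2 0" using msum_upper[OF sc(1) sub(2), of 0] by auto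
      show "?c2 i \<subseteq> ?c2 (Suc i)" if "i < n" for i
        using inc[OF that] unfolding msum_def by blast
      show "submod A (?c2 i)" if "i \<le> n" for i using sc(1)[OF that] sub by (intro submod_msum)
    qed (rule sub)
    also have "\<dots> \<le> len A U V"
      using msum_least[OF sub(3) sc(3) le(2), of n] by (intro len_mono) auto
    finally have 2: "enat (card ?S2) \<le> len A U V" .
    have "{..<n} \<subseteq> ?S1 \<union> ?S2"
    proof
      fix i assume "i \<in> {..<n}"
      hence i: "i < n" by simp
      obtain x where x: "x \<in> c (Suc i)" "x \<notin> c i" using inc[OF i] by auto
      show "i \<in> ?S1 \<union> ?S2"
      proof (rule ccontr)
        assume "i \<notin> ?S1 \<union> ?S2"
        hence e1: "?c1 i = ?c1 (Suc i)" and e2: "?c2 i = ?c2 (Suc i)" using i by auto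
        have "x \<in> ?c2 (Suc i)" using x(1) msum_upper[OF sc(1)[of "Suc i"] sub(2)] i by auto
        hence "x \<in> ?c2 i" using e2 by simp
        then obtain y u where yu: "y \<in> c i" "u \<in> U" "x = y + u"
          unfolding msum_def by blast
        have "y \<in> c (Suc i)" using inc[OF i] yu by auto
        hence "x - y \<in> c (Suc i)" using submod_diff[OF A sc(1)[of "Suc i"] x(1)] i by auto
        hence "u \<in> ?c1 (Suc i)" using yu by auto
        hence "u \<in> c i" using e1 by auto
        hence "x \<in> c i" using yu submod_add[OF sc(1)[of i]] i by auto
        with x show False by simp
      qed
    qed
    hence "card {..<n} \<le> card (?S1 \<union> ?S2)" by (intro card_mono) auto
    also have "\<dots> \<le> card ?S1 + card ?S2" by (rule card_Un_le)
    finally have "enat n \<le> enat (card ?S1) + enat (card ?S2)" by simp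
    also have "\<dots> \<le> len A W U + len A U V" using 1 2 by (rule add_mono)
    finally show "enat n \<le> len A W U + len A U V" .
  qed
qed

lemma len_self [simp]: "len A W W = 0"
proof -
  have "n = 0" if "chain A W W c n" for c n
    using that by (cases n) (auto simp: chain_def, metis le0 le_eq_less_or_eq Suc_leI psubset_eq subset_antisym zero_less_Suc)
  hence "len A W W \<le> 0" by (intro len_leI) (auto simp: zero_enat_def)
  thus ?thesis by simp
qed

lemma len_pos: "submod A W \<Longrightarrow> submod A V \<Longrightarrow> W \<subset> V \<Longrightarrow> 1 \<le> len A W V"
  unfolding one_enat_def
  by (rule chain_le_len[of A W V "\<lambda>i. if i = 0 then W else V" 1]) (auto simp: chain_def)

text \<open>The isomorphism theorem for \<open>g\<close> followed by reduction modulo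
  \<open>W'\<close>: images and preimages of chains are chains. The change of scalars along
  \<open>h\<close> is used when evaluation sends constants of \<open>B\<close> to constants of
  \<open>R\<close>.\<close>

lemma len_iso:
  assumes A: "subr A" and A': "subr A'" and h: "h ` A = A'"
    and V: "submod A V" and W': "submod A' W'"
    and add: "\<And>x y. x \<in> V \<Longrightarrow> y \<in> V \<Longrightarrow> g (x + y) = g x + g y"
    and scale: "\<And>a x. a \<in> A \<Longrightarrow> x \<in> V \<Longrightarrow> g (a * x) = h a * g x"
  shows "len A {x\<in>V. g x \<in> W'} V = len A' W' (msum (g ` V) W')"
proof -
  have g0: "g 0 = 0" using add[of 0 0] V by (auto simp: submod_def)
  have gdiff: "g (x - y) = g x - g y" if "x \<in> V" "y \<in> V" for x y
    using add[of "x - y" y] submod_diff[OF A V that] that by simp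
  have img: "submod A' (g ` M)" if M: "submod A M" "M \<subseteq> V" for M
  proof (rule submodI)
    show "0 \<in> g ` M" using g0 M by (auto simp: submod_def intro: rev_image_eqI)
  next
    fix x y assume "x \<in> g ` M" "y \<in> g ` M"
    then obtain u v where uv: "u \<in> M" "v \<in> M" "x = g u" "y = g v" by auto
    hence "x + y = g (u + v)" using M(2) by (simp add: add subset_iff)
    thus "x + y \<in> g ` M" using submod_add[OF M(1) uv(1,2)] by simp
  next
    fix a x assume "a \<in> A'" "x \<in> g ` M"
    then obtain b u where bu: "b \<in> A" "u \<in> M" "x = g u" "a = h b" using h by auto
    hence "a * x = g (b * u)" using M(2) by (simp add: scale subset_iff)
    thus "a * x \<in> g ` M" using submod_mult[OF M(1) bu(1,2)] by simp
  qed
  have pre: "submod A {x\<in>V. g x \<in> N}" if N: "submod A' N" for N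
  proof (rule submodI)
    show "0 \<in> {x\<in>V. g x \<in> N}" using g0 N V by (auto simp: submod_def)
  next
    fix x y assume "x \<in> {x\<in>V. g x \<in> N}" "y \<in> {x\<in>V. g x \<in> N}"
    thus "x + y \<in> {x\<in>V. g x \<in> N}" using add N V by (auto simp: submod_def)
  next
    fix a x assume "a \<in> A" "x \<in> {x\<in>V. g x \<in> N}"
    thus "a * x \<in> {x\<in>V. g x \<in> N}" using scale N V h by (auto simp: submod_def)
  qed
  show ?thesis
  proof (rule antisym)
    show "len A {x\<in>V. g x \<in> W'} V \<le> len A' W' (msum (g ` V) W')"
    proof (rule len_leI)
      fix n c assume c: "chain A {x\<in>V. g x \<in> W'} V c n"
      have sc: "submod A (c i)" "{x\<in>V. g x \<in> W'} \<subseteq> c i" "c i \<subseteq> V" if "i \<le> n" for i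
        using c that by (auto simp: chain_def)
      have "chain A' W' (msum (g ` V) W') (\<lambda>i. msum (g ` c i) W') n"
        unfolding chain_def
      proof (intro conjI allI impI)
        fix i assume i: "i \<le> n"
        show "submod A' (msum (g ` c i) W')" using img sc[OF i] W' by (intro submod_msum) auto
        show "W' \<subseteq> msum (g ` c i) W'" using msum_upper[OF img W'] sc[OF i] by auto
        show "msum (g ` c i) W' \<subseteq> msum (g ` V) W'" using sc(3)[OF i] unfolding msum_def by blast
      next
        fix i assume i: "i < n"
        hence "c i \<subset> c (Suc i)" using c by (auto simp: chain_def)
        then obtain x where x: "x \<in> c (Suc i)" "x \<notin> c i" and le: "c i \<subseteq> c (Suc i)" by auto
        have "g x \<in> msum (g ` c (Suc i)) W'" using x msum_upper[OF img W', of "c (Suc i)"] sc[of "Suc i"] i by auto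
        moreover have "g x \<notin> msum (g ` c i) W'"
        proof
          assume "g x \<in> msum (g ` c i) W'"
          then obtain y w where y: "y \<in> c i" "w \<in> W'" "g x = g y + w" by (auto simp: msum_def)
          have xV: "x \<in> V" "y \<in> V" using sc[of "Suc i"] sc[of i] i x y by auto
          hence "x - y \<in> {x\<in>V. g x \<in> W'}" using gdiff y submod_diff[OF A V] by auto
          hence "x - y \<in> c i" using sc[of i] i by auto
          hence "x \<in> c i" using submod_add[OF sc(1)[of i], of y "x - y"] i y by auto
          with x show False by simp
        qed
        ultimately show "msum (g ` c i) W' \<subset> msum (g ` c (Suc i)) W'"
          using le unfolding msum_def by blast
      qed
      thus "enat n \<le> len A' W' (msum (g ` V) W')" by (rule chain_le_len)
    qed
  next
    show "len A' W' (msum (g ` V) W') \<le> len A {x\<in>V. g x \<in> W'} V"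
    proof (rule len_leI)
      fix n c assume c: "chain A' W' (msum (g ` V) W') c n"
      have sc: "submod A' (c i)" "W' \<subseteq> c i" "c i \<subseteq> msum (g ` V) W'" if "i \<le> n" for i
        using c that by (auto simp: chain_def)
      have "chain A {x\<in>V. g x \<in> W'} V (\<lambda>i. {x\<in>V. g x \<in> c i}) n"
        unfolding chain_def
      proof (intro conjI allI impI)
        fix i assume i: "i \<le> n"
        show "submod A {x\<in>V. g x \<in> c i}" using pre sc[OF i] by auto
      next
        fix i assume i: "i < n"
        hence "c i \<subset> c (Suc i)" using c by (auto simp: chain_def)
        then obtain z where z: "z \<in> c (Suc i)" "z \<notin> c i" and le: "c i \<subseteq> c (Suc i)" by auto
        obtain x w where x: "x \<in> V" "w \<in> W'" "z = g x + w"
          using z(1) sc(3)[of "Suc i"] i by (auto simp: msum_def)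
        have "g x \<in> c (Suc i)"
          using submod_diff[OF A' sc(1)[of "Suc i"] z(1), of w] x sc(2)[of "Suc i"] i by auto
        moreover have "g x \<notin> c i"
          using submod_add[OF sc(1)[of i], of "g x" w] x z sc(2)[of i] i by auto
        ultimately show "{x\<in>V. g x \<in> c i} \<subset> {x\<in>V. g x \<in> c (Suc i)}" using le x by auto
      qed (use sc in auto)
      thus "enat n \<le> len A {x\<in>V. g x \<in> W'} V" by (rule chain_le_len)
    qed
  qed
qed

text \<open>The second isomorphism theorem, obtained from the inclusion map.\<close>

lemma len_inclusion:
  assumes "subr A" "submod A V" "submod A W"
  shows "len A (V \<inter> W) V = len A W (msum V W)"
proof -
  have "V \<inter> W = {x\<in>V. x \<in> W}" by auto
  thus ?thesis
    using len_iso[OF assms(1,1) _ assms(2,3), of id id] by (simp add: id_def)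
qed

section \<open>Dimension over a field of constants\<close>

locale subf = subr +
  assumes inv: "x \<in> A \<Longrightarrow> x \<noteq> 0 \<Longrightarrow> \<exists>y\<in>A. y * x = 1"
begin

lemma len_insert_le:
  assumes W: "submod A W" shows "len A W (gen A (insert e W)) \<le> 1"
proof (rule len_leI)
  fix n c assume c: "chain A W (gen A (insert e W)) c n"
  show "enat n \<le> 1"
  proof (rule ccontr)
    assume "\<not> enat n \<le> 1"
    hence n: "n \<ge> 2" by (simp add: one_enat_def)
    have sc: "submod A (c i)" "W \<subseteq> c i" "c i \<subseteq> gen A (insert e W)" if "i \<le> n" for i
      using c that by (auto simp: chain_def)
    have "c 0 \<subset> c (Suc 0)" and c12: "c (Suc 0) \<subset> c (Suc (Suc 0))" using c n by (auto simp: chain_def)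
    then obtain x where x: "x \<in> c (Suc 0)" "x \<notin> c 0" by auto
    have "x \<in> gen A (insert e W)" using x sc(3)[of "Suc 0"] n by auto
    then obtain w a where wa: "w \<in> W" "a \<in> A" "x = w + a * e"
      unfolding gen_insert_submod[OF subr_axioms W] by auto
    have "a \<noteq> 0" using wa x sc(2)[of 0] by auto
    then obtain b where b: "b \<in> A" "b * a = 1" using inv wa by blast
    have "w \<in> c (Suc 0)" using wa sc(2)[of "Suc 0"] n by auto
    hence "a * e \<in> c (Suc 0)"
      using submod_diff[OF subr_axioms sc(1)[of "Suc 0"] x(1)] wa n by fastforce
    hence "b * (a * e) \<in> c (Suc 0)" using submod_mult[OF sc(1)[of "Suc 0"] b(1)] n by auto
    hence "e \<in> c (Suc 0)" using b by (simp add: mult.assoc[symmetric])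
    hence "gen A (insert e W) \<subseteq> c (Suc 0)"
      using sc[of "Suc 0"] n by (intro gen_least) auto
    with c12 sc(3)[of "Suc (Suc 0)"] n show False by auto
  qed
qed

lemma len_insert:
  assumes W: "submod A W" "e \<notin> W" shows "len A W (gen A (insert e W)) = 1"
proof (rule antisym[OF len_insert_le[OF W(1)]])
  have "insert e W \<subseteq> gen A (insert e W)" by (rule gen_superset[OF subr_axioms])
  thus "1 \<le> len A W (gen A (insert e W))"
    using W by (intro len_pos submod_gen subr_axioms) auto
qed

text \<open>A greedy basis: running through \<open>S\<close> in increasing order, an element raises
  the dimension exactly when it is not in the span of \<open>W\<close> and the smaller ones. The
  order is kept explicit because a monomial order will make the discarded indices closed under
  multiplication.\<close>

lemma len_gen_linorder:
  fixes e :: "'i::linorder \<Rightarrow> 'a"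
  assumes W: "submod A W" and "finite S"
  shows "len A W (gen A (W \<union> e ` S)) = enat (card {i\<in>S. e i \<notin> gen A (W \<union> e ` {j\<in>S. j < i})})"
  using assms(2)
proof (induction S rule: finite_linorder_max_induct)
  case empty show ?case by (simp add: gen_submod[OF subr_axioms W] zero_enat_def)
next
  case (insert b S)
  let ?G = "\<lambda>S. gen A (W \<union> e ` S)" and ?N = "\<lambda>S. {i\<in>S. e i \<notin> gen A (W \<union> e ` {j\<in>S. j < i})}"
  have sG: "submod A (?G S)" for S by (rule submod_gen[OF subr_axioms])
  have sup: "W \<union> e ` S \<subseteq> ?G S" for S by (rule gen_superset[OF subr_axioms])
  have step: "?G (insert b S) = gen A (insert (e b) (?G S))"
  proof (rule antisym)
    have "insert (e b) (?G S) \<subseteq> gen A (insert (e b) (?G S))" by (rule gen_superset[OF subr_axioms])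
    hence "W \<union> e ` insert b S \<subseteq> gen A (insert (e b) (?G S))" using sup[of S] by auto
    thus "?G (insert b S) \<subseteq> gen A (insert (e b) (?G S))"
      by (rule gen_least[OF submod_gen[OF subr_axioms]])
    have "?G S \<subseteq> ?G (insert b S)" by (intro gen_mono subr_axioms) auto
    moreover have "e b \<in> ?G (insert b S)" using sup[of "insert b S"] by auto
    ultimately have "insert (e b) (?G S) \<subseteq> ?G (insert b S)" by auto
    thus "gen A (insert (e b) (?G S)) \<subseteq> ?G (insert b S)" by (rule gen_least[OF sG])
  qed
  have "?G S \<subseteq> ?G (insert b S)" by (intro gen_mono subr_axioms) auto
  hence add: "len A W (?G (insert b S)) = len A W (?G S) + len A (?G S) (?G (insert b S))"
    using sup[of S] by (intro len_add subr_axioms W sG) auto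
  have lt: "{j \<in> insert b S. j < b} = S" "\<And>i. i \<in> S \<Longrightarrow> {j \<in> insert b S. j < i} = {j\<in>S. j < i}"
    using insert.hyps by auto
  have b: "b \<notin> S" using insert.hyps by auto
  show ?case
  proof (cases "e b \<in> ?G S")
    case True
    hence "?G (insert b S) = ?G S" unfolding step using gen_submod[OF subr_axioms sG] by (simp add: insert_absorb)
    moreover have "?N (insert b S) = ?N S" using True lt by auto
    ultimately show ?thesis using insert.IH by simp
  next
    case False
    have "?N (insert b S) = insert b (?N S)" using False lt by auto
    hence "card (?N (insert b S)) = Suc (card (?N S))" using b insert.hyps by simp
    moreover have "len A (?G S) (?G (insert b S)) = 1" unfolding step by (rule len_insert[OF sG False])
    ultimately show ?thesis using add insert.IH by (simp add: one_enat_def)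
  qed
qed

lemma len_le_card:
  assumes "submod A W" "finite E" "V \<subseteq> gen A (W \<union> E)"
  shows "len A W V \<le> enat (card E)"
proof -
  have "len A W (gen A (W \<union> E)) \<le> enat (card E)"
    using assms(2)
  proof (induction E)
    case empty thus ?case by (simp add: gen_submod[OF subr_axioms assms(1)] zero_enat_def)
  next
    case (insert e E)
    let ?G = "gen A (W \<union> E)" and ?H = "gen A (insert e (gen A (W \<union> E)))"
    have G: "submod A ?G" "W \<union> E \<subseteq> ?G" by (intro submod_gen gen_superset subr_axioms)+
    have H: "submod A ?H" "insert e ?G \<subseteq> ?H" by (intro submod_gen gen_superset subr_axioms)+
    have "gen A (W \<union> insert e E) \<subseteq> ?H" using G H by (intro gen_least) auto
    hence "len A W (gen A (W \<union> insert e E)) \<le> len A W ?H" by (intro len_mono) auto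
    also have "\<dots> = len A W ?G + len A ?G ?H" using G H by (intro len_add subr_axioms assms(1)) auto
    also have "\<dots> \<le> enat (card E) + 1" using insert.IH len_insert_le[OF G(1)] by (rule add_mono)
    finally show ?case using insert.hyps by (simp add: one_enat_def)
  qed
  thus ?thesis using len_mono[OF subset_refl assms(3)] by (rule order_trans[rotated])
qed

lemma len_ge_family:
  assumes W: "submod A W" and V: "submod A V" "W \<subseteq> V" and S: "finite S" "e ` S \<subseteq> V"
    and indep: "\<And>a s. (\<And>s. s \<in> S \<Longrightarrow> a s \<in> A) \<Longrightarrow> (\<Sum>s\<in>S. a s * e s) \<in> W \<Longrightarrow> s \<in> S \<Longrightarrow> a s = 0"
  shows "enat (card S) \<le> len A W V"
proof -
  have "enat (card T) \<le> len A W (gen A (W \<union> e ` T))" if "T \<subseteq> S" for T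
    using finite_subset[OF that S(1)] that
  proof (induction T)
    case empty thus ?case by (simp add: zero_enat_def[symmetric])
  next
    case (insert t T)
    let ?G = "gen A (W \<union> e ` T)" and ?H = "gen A (insert (e t) (gen A (W \<union> e ` T)))"
    have G: "submod A ?G" "W \<union> e ` T \<subseteq> ?G" by (intro submod_gen gen_superset subr_axioms)+
    have H: "submod A ?H" "insert (e t) ?G \<subseteq> ?H" by (intro submod_gen gen_superset subr_axioms)+
    have "e t \<notin> ?G"
    proof
      assume "e t \<in> ?G"
      then obtain w a where w: "w \<in> W" "\<forall>s\<in>T. a s \<in> A" "e t = w + (\<Sum>s\<in>T. a s * e s)"
        unfolding gen_Un_submod[OF subr_axioms W] gen_image_sum[OF subr_axioms insert.hyps(1)] msum_def by auto
      \<comment> \<open>A dependence of \<open>e t\<close> on earlier members modulo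
        \<open>W\<close> becomes a relation on all of \<open>S\<close> with coefficient 1 at
        \<open>t\<close>.\<close>
      define b where "b s = (if s = t then 1 else if s \<in> T then - a s else 0)" for s
      have "(\<Sum>s\<in>S. b s * e s) = (\<Sum>s\<in>insert t T. b s * e s)"
        using insert.prems S(1) by (intro sum.mono_neutral_right) (auto simp: b_def)
      also have "\<dots> = e t + (\<Sum>s\<in>T. b s * e s)" using insert.hyps by (simp add: b_def)
      also have "(\<Sum>s\<in>T. b s * e s) = - (\<Sum>s\<in>T. a s * e s)"
        unfolding sum_negf[symmetric] using insert.hyps by (intro sum.cong) (auto simp: b_def)
      finally have "(\<Sum>s\<in>S. b s * e s) = w" using w(3) by simp
      moreover have "b s \<in> A" for s using w(2) uminus by (auto simp: b_def)
      ultimately have "b t = 0" using indep[of b t] w(1) insert.prems by auto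
      thus False by (simp add: b_def)
    qed
    hence "len A ?G ?H = 1" by (rule len_insert[OF G(1)])
    hence "enat (card T) + 1 \<le> len A W ?G + len A ?G ?H" using insert by (intro add_mono) auto
    also have "\<dots> = len A W ?H" using G H by (intro len_add[symmetric] subr_axioms W) auto
    also have "\<dots> \<le> len A W (gen A (W \<union> e ` insert t T))"
    proof (intro len_mono gen_least submod_gen subr_axioms)
      have "?G \<subseteq> gen A (W \<union> e ` insert t T)" by (intro gen_mono subr_axioms) auto
      thus "insert (e t) ?G \<subseteq> gen A (W \<union> e ` insert t T)"
        using gen_superset[OF subr_axioms, of "W \<union> e ` insert t T"] by auto
    qed simp
    finally show ?case using insert.hyps by (simp add: one_enat_def)
  qed
  hence "enat (card S) \<le> len A W (gen A (W \<union> e ` S))" by simp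
  also have "\<dots> \<le> len A W V" using V S(2) by (intro len_mono gen_least) auto
  finally show ?thesis .
qed

end

section \<open>Polynomials\<close>

type_synonym 'k bipoly = "(nat, (nat, 'k) mpoly) mpoly"

abbreviation coef :: "('i \<Rightarrow>\<^sub>0 'c::zero) \<Rightarrow> 'i \<Rightarrow> 'c" where "coef \<equiv> Poly_Mapping.lookup"
abbreviation single :: "'i \<Rightarrow> 'c::zero \<Rightarrow> 'i \<Rightarrow>\<^sub>0 'c" where "single \<equiv> Poly_Mapping.single"
abbreviation keys :: "('i \<Rightarrow>\<^sub>0 'c::zero) \<Rightarrow> 'i set" where "keys \<equiv> Poly_Mapping.keys"

definition deg :: "('v \<Rightarrow>\<^sub>0 nat) \<Rightarrow> nat" where
  "deg m = (\<Sum>v\<in>keys m. coef m v)"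

lemma form_iff: "form n p \<longleftrightarrow> (\<forall>m\<in>keys p. deg m = n)"
  by (simp add: form_def deg_def)

lemma deg_superset: "finite S \<Longrightarrow> keys m \<subseteq> S \<Longrightarrow> deg m = (\<Sum>v\<in>S. coef m v)"
  unfolding deg_def by (rule sum.mono_neutral_left) (auto simp: in_keys_iff)

lemma deg_add [simp]: "deg (m + m') = deg m + deg m'"
proof -
  have "keys (m + m') \<subseteq> keys m \<union> keys m'" by (rule Poly_Mapping.keys_add)
  thus ?thesis
    using deg_superset[of "keys m \<union> keys m'" m] deg_superset[of "keys m \<union> keys m'" m']
      deg_superset[of "keys m \<union> keys m'" "m + m'"]
    by (simp add: lookup_add sum.distrib)
qed

lemma deg_zero [simp]: "deg 0 = 0"
  by (simp add: deg_def)

lemma deg_single [simp]: "deg (single v n) = n"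
  by (cases "n = 0") (auto simp: deg_def)

lemma deg_eq_0_iff [simp]: "deg m = 0 \<longleftrightarrow> m = 0"
  unfolding deg_def by (auto simp: in_keys_iff poly_mapping_eq_iff fun_eq_iff)

lemma poly_mapping_expand:
  assumes "finite S" "keys p \<subseteq> S" shows "p = (\<Sum>m\<in>S. single m (coef p m))"
proof (rule poly_mapping_eqI)
  fix k
  have "(\<Sum>m\<in>S. coef (single m (coef p m)) k) = (\<Sum>m\<in>S. if m = k then coef p k else 0)"
    by (rule sum.cong) (auto simp: lookup_single)
  thus "coef p k = coef (\<Sum>m\<in>S. single m (coef p m)) k"
    using assms by (auto simp: lookup_sum in_keys_iff)
qed

lemma monom_expand: "p = (\<Sum>m\<in>keys p. single m (coef p m))"
  by (rule poly_mapping_expand) auto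

lemma lookup_var_mult_add:
  fixes p :: "('v, 'a::comm_ring_1) mpoly"
  shows "coef (single nu c * p) (nu + m) = c * coef p m"
proof -
  have "single nu c * p = (\<Sum>k\<in>keys p. single (nu + k) (c * coef p k))"
    by (subst monom_expand[of p]) (simp_all add: sum_distrib_left mult_single)
  hence "coef (single nu c * p) (nu + m) = (\<Sum>k\<in>keys p. if k = m then c * coef p m else 0)"
    by (simp add: lookup_sum lookup_single when_def cong: if_cong)
  thus ?thesis by (auto simp: in_keys_iff)
qed

lemma const_0 [simp]: "const 0 = 0" and const_1 [simp]: "const 1 = 1"
  and const_add: "const (a + b) = const a + const b"
  and const_mult: "const (a * b) = const a * const b"
  and const_minus: "const (- a) = - const a"
  by (simp_all add: const_def single_add mult_single single_uminus)

lemma const_diff: "const (a - b) = const a - const b"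
  by (simp add: const_def single_diff)

lemma const_sum: "const (sum g S) = (\<Sum>i\<in>S. const (g i))"
  by (induction S rule: infinite_finite_induct) (auto simp: const_add)

lemma coef_const_mult: "coef (const c * p) m = c * coef (p :: ('v, 'a::comm_ring_1) mpoly) m"
  using lookup_var_mult_add[of 0 c p m] by (simp add: const_def)

lemma coef_const: "coef (const c) m = (if m = 0 then c else 0)"
  by (auto simp: const_def lookup_single)

lemma const_single: "const c * single m 1 = (single m c :: ('v, 'a::comm_ring_1) mpoly)"
  by (simp add: const_def mult_single)

subsection \<open>Filtering monomials\<close>

definition filt :: "('i \<Rightarrow> bool) \<Rightarrow> ('i \<Rightarrow>\<^sub>0 'c::comm_monoid_add) \<Rightarrow> 'i \<Rightarrow>\<^sub>0 'c" where
  "filt Q p = (\<Sum>m\<in>{m\<in>keys p. Q m}. single m (coef p m))"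

lemma coef_filt: "coef (filt Q p) m = (if Q m then coef p m else 0)"
proof -
  have "coef (filt Q p) m = (\<Sum>k\<in>{m\<in>keys p. Q m}. if k = m then coef p m else 0)"
    unfolding filt_def lookup_sum by (rule sum.cong) (auto simp: lookup_single)
  thus ?thesis by (auto simp: in_keys_iff)
qed

lemma filt_add: "filt Q (p + q) = filt Q p + filt Q q"
  by (rule poly_mapping_eqI) (auto simp: coef_filt lookup_add)

lemma filt_0 [simp]: "filt Q 0 = 0"
  by (rule poly_mapping_eqI) (auto simp: coef_filt)

lemma filt_sum: "filt Q (sum g S) = (\<Sum>i\<in>S. filt Q (g i))"
  by (induction S rule: infinite_finite_induct) (auto simp: filt_add)

lemma filt_diff: "filt Q (p - q) = filt Q p - filt Q (q :: 'i \<Rightarrow>\<^sub>0 'c::ab_group_add)"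
  by (rule poly_mapping_eqI) (auto simp: coef_filt lookup_minus)

lemma keys_filt: "keys (filt Q p) = {m\<in>keys p. Q m}"
  by (auto simp: in_keys_iff coef_filt split: if_splits)

lemma filt_single: "filt Q (single m c) = (if Q m then single m c else 0)"
  by (rule poly_mapping_eqI) (auto simp: coef_filt lookup_single when_def)

lemma filt_id: "(\<And>m. m \<in> keys p \<Longrightarrow> Q m) \<Longrightarrow> filt Q p = p"
  by (rule poly_mapping_eqI) (auto simp: coef_filt in_keys_iff)

lemma filt_none: "(\<And>m. m \<in> keys p \<Longrightarrow> \<not> Q m) \<Longrightarrow> filt Q p = 0"
  by (rule poly_mapping_eqI) (auto simp: coef_filt in_keys_iff)

lemma filt_split: "p = filt Q p + filt (\<lambda>m. \<not> Q m) p"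
  by (rule poly_mapping_eqI) (auto simp: coef_filt lookup_add)

lemma filt_single_mult:
  fixes p :: "('v, 'a::comm_ring_1) mpoly"
  shows "filt Q (single nu c * p) = single nu c * filt (\<lambda>m. Q (nu + m)) p"
proof -
  have "filt Q (single nu c * p) = (\<Sum>k\<in>keys p. filt Q (single (nu + k) (c * coef p k)))"
    by (subst monom_expand[of p]) (simp_all add: sum_distrib_left mult_single filt_sum)
  also have "\<dots> = (\<Sum>k\<in>keys p. single nu c * filt (\<lambda>m. Q (nu + m)) (single k (coef p k)))"
    by (rule sum.cong) (auto simp: filt_single mult_single)
  also have "\<dots> = single nu c * filt (\<lambda>m. Q (nu + m)) p"
    using monom_expand[of p]
    by (simp add: sum_distrib_left[symmetric] filt_sum[symmetric])
  finally show ?thesis .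
qed

text \<open>Multiplication by a form of degree \<open>n\<close> shifts every degree by exactly
  \<open>n\<close>. All truncations of expressions in the \<open>f l\<close> rest on this.\<close>

lemma filt_form_mult:
  fixes p :: "('v, 'a::comm_ring_1) mpoly"
  assumes "form n q" shows "filt (\<lambda>m. Q (deg m)) (q * p) = q * filt (\<lambda>m. Q (n + deg m)) p"
proof -
  have "filt (\<lambda>m. Q (deg m)) (q * p) = (\<Sum>k\<in>keys q. filt (\<lambda>m. Q (deg m)) (single k (coef q k) * p))"
    by (subst monom_expand[of q]) (simp_all add: sum_distrib_right filt_sum)
  also have "\<dots> = (\<Sum>k\<in>keys q. single k (coef q k) * filt (\<lambda>m. Q (n + deg m)) p)"
    using assms by (intro sum.cong) (auto simp: filt_single_mult form_iff)
  also have "\<dots> = q * filt (\<lambda>m. Q (n + deg m)) p"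
    using monom_expand[of q] by (simp add: sum_distrib_right[symmetric])
  finally show ?thesis .
qed

section \<open>Homogeneous polynomials\<close>

abbreviation dg :: "nat \<Rightarrow> ('v \<Rightarrow>\<^sub>0 nat) \<Rightarrow> bool" where
  "dg j \<equiv> \<lambda>m. deg m = j"

lemma form_add: "form n p \<Longrightarrow> form n q \<Longrightarrow> form n (p + q)"
  using Poly_Mapping.keys_add[of p q] by (auto simp: form_iff)

lemma form_0 [simp]: "form n 0"
  by (simp add: form_iff)

lemma form_sum: "(\<And>i. i \<in> S \<Longrightarrow> form n (g i)) \<Longrightarrow> form n (sum g S)"
  by (induction S rule: infinite_finite_induct) (auto intro: form_add)

lemma form_mult: "form n p \<Longrightarrow> form k q \<Longrightarrow> form (n + k) (p * q)"
  unfolding form_iff using keys_mult[of p q] by fastforce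

lemma form_minus: "form n p \<Longrightarrow> form n (- (p :: ('v, 'a::comm_ring_1) mpoly))"
  by (simp add: form_iff in_keys_iff)

lemma form_diff: "form n p \<Longrightarrow> form n q \<Longrightarrow> form n (p - (q :: ('v, 'a::comm_ring_1) mpoly))"
  using form_add[of n p "- q"] form_minus[of n q] by simp

lemma form_single: "deg m = n \<Longrightarrow> form n (single m c)"
  by (auto simp: form_iff split: if_splits)

lemma form_const: "form 0 (const c)"
  by (simp add: const_def form_single)

lemma form_var: "form 1 (var v)"
  by (simp add: var_def form_single)

lemma form_power: "form n p \<Longrightarrow> form (n * k) (p ^ k)"
  using form_mult form_single[of 0 0 1] by (induction k) (auto simp: single_one)

lemma form_filt: "form n (filt (dg n) p)"
  by (auto simp: form_iff keys_filt)

lemma form_filt': "form n p \<Longrightarrow> form n (filt Q p)"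
  by (auto simp: form_iff keys_filt)

lemma filt_deg_form: "form n p \<Longrightarrow> filt (dg j) p = (if j = n then p else 0)"
  by (auto simp: form_iff intro!: filt_id filt_none)

lemma sum_filt_deg:
  assumes "\<And>m. m \<in> keys p \<Longrightarrow> deg m < N"
  shows "p = (\<Sum>j<N. filt (dg j) p)"
proof (rule poly_mapping_eqI)
  fix m
  have "coef (\<Sum>j<N. filt (dg j) p) m = (\<Sum>j<N. if deg m = j then coef p m else 0)"
    unfolding lookup_sum by (rule sum.cong) (auto simp: coef_filt)
  thus "coef p m = coef (\<Sum>j<N. filt (dg j) p) m"
    using assms[of m] by (auto simp: in_keys_iff)
qed

lemma deg_bounded: obtains N where "\<And>m. m \<in> keys p \<Longrightarrow> deg m < N"
proof
  fix m assume "m \<in> keys p"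
  thus "deg m < Suc (Max (deg ` keys p))" by (simp add: le_imp_less_Suc)
qed

subsection \<open>Evaluation\<close>

definition mev :: "('v \<Rightarrow> 'b::comm_ring_1) \<Rightarrow> ('v \<Rightarrow>\<^sub>0 nat) \<Rightarrow> 'b" where
  "mev g m = (\<Prod>v\<in>keys m. g v ^ coef m v)"

lemma mev_superset: "finite S \<Longrightarrow> keys m \<subseteq> S \<Longrightarrow> mev g m = (\<Prod>v\<in>S. g v ^ coef m v)"
  unfolding mev_def by (rule prod.mono_neutral_left) (auto simp: in_keys_iff)

lemma mev_add: "mev g (m + m') = mev g m * mev g m'"
proof -
  have "keys (m + m') \<subseteq> keys m \<union> keys m'" by (rule Poly_Mapping.keys_add)
  thus ?thesis
    using mev_superset[of "keys m \<union> keys m'" m g] mev_superset[of "keys m \<union> keys m'" m' g]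
      mev_superset[of "keys m \<union> keys m'" "m + m'" g]
    by (simp add: lookup_add power_add prod.distrib)
qed

lemma mev_0 [simp]: "mev g 0 = 1"
  by (simp add: mev_def)

lemma mev_single: "mev g (single v n) = g v ^ n"
  by (cases "n = 0") (auto simp: mev_def)

locale rhom =
  fixes h :: "'a::comm_ring_1 \<Rightarrow> 'b::comm_ring_1"
  assumes h_add: "h (a + b) = h a + h b" and h_mult: "h (a * b) = h a * h b" and h_one: "h 1 = 1"
begin

lemma h_zero: "h 0 = 0"
  using h_add[of 0 0] by simp

lemma h_minus: "h (- a) = - h a"
  using h_add[of a "- a"] h_zero by (simp add: eq_neg_iff_add_eq_0 add.commute)

lemma h_diff: "h (a - b) = h a - h b"
  using h_add[of a "- b"] h_minus by simp

lemma h_sum: "h (sum g S) = (\<Sum>i\<in>S. h (g i))"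
  by (induction S rule: infinite_finite_induct) (auto simp: h_zero h_add)

lemma h_power: "h (a ^ n) = h a ^ n"
  by (induction n) (auto simp: h_one h_mult)

lemma eval_superset:
  "finite S \<Longrightarrow> keys p \<subseteq> S \<Longrightarrow> mpoly_eval h g p = (\<Sum>m\<in>S. h (coef p m) * mev g m)"
  unfolding mpoly_eval_def mev_def[symmetric]
  by (rule sum.mono_neutral_left) (auto simp: in_keys_iff h_zero)

lemma eval_add: "mpoly_eval h g (p + q) = mpoly_eval h g p + mpoly_eval h g q"
proof -
  have "keys (p + q) \<subseteq> keys p \<union> keys q" by (rule Poly_Mapping.keys_add)
  thus ?thesis
    using eval_superset[of "keys p \<union> keys q" p] eval_superset[of "keys p \<union> keys q" q]
      eval_superset[of "keys p \<union> keys q" "p + q"]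
    by (simp add: lookup_add h_add distrib_right sum.distrib)
qed

lemma eval_0: "mpoly_eval h g 0 = 0"
  by (simp add: mpoly_eval_def)

lemma eval_single: "mpoly_eval h g (single m c) = h c * mev g m"
  by (cases "c = 0") (auto simp: mpoly_eval_def mev_def h_zero)

lemma eval_sum: "mpoly_eval h g (sum F S) = (\<Sum>i\<in>S. mpoly_eval h g (F i))"
  by (induction S rule: infinite_finite_induct) (auto simp: eval_0 eval_add)

lemma eval_mult: "mpoly_eval h g (p * q) = mpoly_eval h g p * mpoly_eval h g q"
proof -
  have "p * q = (\<Sum>m\<in>keys p. \<Sum>k\<in>keys q. single m (coef p m) * single k (coef q k))"
    by (subst monom_expand[of p],
        subst monom_expand[of q]) (simp add: sum_product)
  hence "mpoly_eval h g (p * q) = (\<Sum>m\<in>keys p. \<Sum>k\<in>keys q. h (coef p m * coef q k) * mev g (m + k))"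
    by (simp add: eval_sum mult_single eval_single)
  also have "\<dots> = (\<Sum>m\<in>keys p. h (coef p m) * mev g m) * (\<Sum>k\<in>keys q. h (coef q k) * mev g k)"
    unfolding sum_product by (intro sum.cong refl) (simp add: h_mult mev_add)
  finally show ?thesis by (simp add: mpoly_eval_def mev_def)
qed

lemma eval_const: "mpoly_eval h g (const c) = h c"
  by (simp add: const_def eval_single)

lemma eval_var: "mpoly_eval h g (var v) = g v"
  by (simp add: var_def eval_single mev_single h_one)

lemma rhom_eval: "rhom (mpoly_eval h g)"
  by unfold_locales (auto simp: eval_add eval_mult eval_single h_one simp flip: single_one)

lemma eval_in:
  assumes A: "subr A" and p: "\<And>m. m \<in> keys p \<Longrightarrow> h (coef p m) \<in> A"
    "\<And>m v. m \<in> keys p \<Longrightarrow> v \<in> keys m \<Longrightarrow> g v \<in> A"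
  shows "mpoly_eval h g p \<in> A"
  unfolding mpoly_eval_def using p
  by (intro subr.sum[OF A] subr.mult[OF A] subr.prod[OF A] subr.power[OF A]) auto

end

lemma rhom_id: "rhom (\<lambda>x. x)" by unfold_locales auto
lemma rhom_const: "rhom const" by unfold_locales (auto simp: const_add const_mult)
lemma rhom_pCons: "rhom (\<lambda>r. [:r:])" by unfold_locales (auto simp: one_pCons)

interpretation hid: rhom "\<lambda>x. x" by (rule rhom_id)
interpretation hconst: rhom const by (rule rhom_const)
interpretation hpCons: rhom "\<lambda>r. [:r:]" by (rule rhom_pCons)

lemma rhom_comp: "rhom h \<Longrightarrow> rhom h' \<Longrightarrow> rhom (\<lambda>x. h' (h x))"
  by (simp add: rhom_def)

lemma rhom_eval_comp:
  fixes p :: "('d, 'a::comm_ring_1) mpoly"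
  assumes "rhom h" "rhom h'"
  shows "h' (mpoly_eval h g p) = mpoly_eval (\<lambda>x. h' (h x)) (\<lambda>v. h' (g v)) p"
proof -
  have "h' (prod F S) = (\<Prod>i\<in>S. h' (F i))" for F and S :: "'d set"
    by (induction S rule: infinite_finite_induct)
      (auto simp: rhom.h_one[OF assms(2)] rhom.h_mult[OF assms(2)])
  thus ?thesis
    unfolding mpoly_eval_def
    by (simp add: rhom.h_sum[OF assms(2)] rhom.h_mult[OF assms(2)] rhom.h_power[OF assms(2)])
qed

subsection \<open>The ring of polynomials over a subring\<close>

lemma mpolysI: "(\<And>m. coef p m \<in> A) \<Longrightarrow> (\<And>m. m \<in> keys p \<Longrightarrow> keys m \<subseteq> V) \<Longrightarrow> p \<in> mpolys A V"
  by (auto simp: mpolys_def)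

lemma mpolys_coef: "p \<in> mpolys A V \<Longrightarrow> coef p m \<in> A"
  and mpolys_keys: "p \<in> mpolys A V \<Longrightarrow> m \<in> keys p \<Longrightarrow> keys m \<subseteq> V"
  by (auto simp: mpolys_def)

lemma single_mpolys: "0 \<in> A \<Longrightarrow> c \<in> A \<Longrightarrow> keys m \<subseteq> V \<Longrightarrow> single m c \<in> mpolys A V"
  by (auto simp: mpolys_def lookup_single when_def split: if_splits)

lemma mpolys_mono: "A \<subseteq> A' \<Longrightarrow> V \<subseteq> V' \<Longrightarrow> mpolys A V \<subseteq> mpolys A' V'"
  by (fastforce simp: mpolys_def)

lemma keys_plus_subset: "keys m \<subseteq> V \<Longrightarrow> keys m' \<subseteq> V \<Longrightarrow> keys (m + m') \<subseteq> (V :: 'v set)"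
  for m m' :: "'v \<Rightarrow>\<^sub>0 nat"
  using Poly_Mapping.keys_add[of m m'] by blast

lemma keys_plus_nat: "keys (m + m') = keys m \<union> keys (m' :: 'v \<Rightarrow>\<^sub>0 nat)"
  by (auto simp: in_keys_iff lookup_add)

lemma mpolys_add_closed:
  assumes "\<And>a b. a \<in> Q \<Longrightarrow> b \<in> Q \<Longrightarrow> a + b \<in> Q" "p \<in> mpolys Q V" "q \<in> mpolys Q V"
  shows "p + q \<in> mpolys Q V"
  using assms Poly_Mapping.keys_add[of p q] by (fastforce simp: mpolys_def lookup_add)

lemma mpolys_sum:
  assumes "submod R Q" "\<And>i. i \<in> S \<Longrightarrow> F i \<in> mpolys Q V" shows "sum F S \<in> mpolys Q V"
proof -
  have "0 \<in> mpolys Q V" using submod_zero[OF assms(1)] by (simp add: mpolys_def)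
  moreover have "p + q \<in> mpolys Q V" if "p \<in> mpolys Q V" "q \<in> mpolys Q V" for p q
    using that submod_add[OF assms(1)] by (intro mpolys_add_closed) auto
  ultimately show ?thesis
    using assms(2) by (induction S rule: infinite_finite_induct) auto
qed

lemma submod_mpolys:
  assumes R: "subr R" and Q: "submod R Q" shows "submod (mpolys R V) (mpolys Q V)"
proof (rule submodI)
  show zero: "0 \<in> mpolys Q V" using submod_zero[OF Q] by (auto simp: mpolys_def)
  show add: "p + q \<in> mpolys Q V" if "p \<in> mpolys Q V" "q \<in> mpolys Q V" for p q
    using that submod_add[OF Q] by (intro mpolys_add_closed) auto
  fix b q assume b: "b \<in> mpolys R V" and q: "q \<in> mpolys Q V"
  have "b * q = (\<Sum>m\<in>keys b. \<Sum>k\<in>keys q. single m (coef b m) * single k (coef q k))"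
    by (subst monom_expand[of b],
        subst monom_expand[of q]) (simp add: sum_product)
  also have "\<dots> \<in> mpolys Q V"
    unfolding mult_single using b q submod_mult[OF Q] submod_zero[OF Q]
    by (intro mpolys_sum[OF Q] single_mpolys keys_plus_subset) (auto dest: mpolys_coef mpolys_keys)
  finally show "b * q \<in> mpolys Q V" .
qed

lemma subr_mpolys: assumes R: "subr R" shows "subr (mpolys R V)"
proof
  note sub = submod_mpolys[OF R submod_self[OF R], of V]
  show "0 \<in> mpolys R V" using submod_zero[OF sub] .
  show "1 \<in> mpolys R V" using subr.one[OF R] subr.zero[OF R] single_mpolys[of R 1 0 V] by (simp add: single_one)
  show "x + y \<in> mpolys R V" if "x \<in> mpolys R V" "y \<in> mpolys R V" for x y
    using submod_add[OF sub that] .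
  show "x * y \<in> mpolys R V" if "x \<in> mpolys R V" "y \<in> mpolys R V" for x y
    using submod_mult[OF sub that] .
  show "- x \<in> mpolys R V" if "x \<in> mpolys R V" for x
    using that subr.uminus[OF R] by (auto simp: mpolys_def in_keys_iff)
qed

lemma const_mpolys: "0 \<in> A \<Longrightarrow> c \<in> A \<Longrightarrow> const c \<in> mpolys A V"
  unfolding const_def by (rule single_mpolys) auto

lemma var_mpolys: "0 \<in> A \<Longrightarrow> 1 \<in> A \<Longrightarrow> v \<in> V \<Longrightarrow> var v \<in> mpolys A V"
  unfolding var_def by (rule single_mpolys) auto

lemma filt_mpolys: "0 \<in> A \<Longrightarrow> p \<in> mpolys A V \<Longrightarrow> filt Q p \<in> mpolys A V"
  by (auto simp: mpolys_def coef_filt keys_filt)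

lemma mpolys_expand_induct [consumes 1, case_names zero add single]:
  assumes p: "p \<in> mpolys A V" and "P 0" "\<And>p q. P p \<Longrightarrow> P q \<Longrightarrow> P (p + q)"
    and "\<And>m c. m \<in> keys p \<Longrightarrow> c \<in> A \<Longrightarrow> keys m \<subseteq> V \<Longrightarrow> P (single m c)"
  shows "P p"
proof -
  have "P (\<Sum>m\<in>S. single m (coef p m))" if "finite S" "S \<subseteq> keys p" for S
    using that by (induction S) (auto intro!: assms(2-) simp: mpolys_coef[OF p] dest: mpolys_keys[OF p])
  from this[of "keys p"] show ?thesis using monom_expand[of p] by simp
qed

text \<open>Division by one variable, monomial by monomial. The clauses on degrees let inductions on
  the degree pass to the quotient and the remainder.\<close>

lemma split_var:
  fixes p :: "('v, 'a::comm_ring_1) mpoly"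
  assumes p: "p \<in> mpolys A V" and A: "subr A"
  obtains p1 p0 where "p = var v * p1 + p0" "p1 \<in> mpolys A V" "p0 \<in> mpolys A (V - {v})"
    "\<And>j. form j p \<Longrightarrow> form j p0" "\<And>j. form (Suc j) p \<Longrightarrow> form j p1" "form 0 p \<Longrightarrow> p1 = 0"
proof -
  define p0 where "p0 = filt (\<lambda>m. coef m v = 0) p"
  define S where "S = {m\<in>keys p. coef m v \<noteq> 0}"
  define p1 where "p1 = (\<Sum>m\<in>S. single (m - single v 1) (coef p m))"
  \<comment> \<open>Subtraction of exponents is truncated at 0; it is exact on \<open>S\<close>,
    where \<open>v\<close> occurs.\<close>
  have sub: "single v 1 + (m - single v 1) = m" if "m \<in> S" for m
    using that by (intro poly_mapping_eqI) (auto simp: S_def lookup_add lookup_minus lookup_single when_def)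
  have "var v * p1 = (\<Sum>m\<in>S. single m (coef p m))"
    unfolding p1_def sum_distrib_left var_def mult_single
    by (rule sum.cong) (use sub in auto)
  also have "\<dots> = filt (\<lambda>m. coef m v \<noteq> 0) p" by (simp add: filt_def S_def)
  finally have eq: "p = var v * p1 + p0"
    using filt_split[of p "\<lambda>m. coef m v \<noteq> 0"] by (simp add: p0_def)
  have keys_sub: "keys (m - single v 1) \<subseteq> keys m" for m :: "'v \<Rightarrow>\<^sub>0 nat"
    by (auto simp: in_keys_iff lookup_minus)
  have "p1 \<in> mpolys A V"
    unfolding p1_def
  proof (rule subr.sum[OF subr_mpolys[OF A]])
    fix m assume "m \<in> S"
    hence "keys m \<subseteq> V" using mpolys_keys[OF p] by (auto simp: S_def)
    thus "single (m - single v 1) (coef p m) \<in> mpolys A V"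
      using keys_sub[of m] by (intro single_mpolys subr.zero[OF A] mpolys_coef[OF p]) auto
  qed
  moreover have "p0 \<in> mpolys A (V - {v})"
    unfolding p0_def using p subr.zero[OF A] by (auto simp: mpolys_def coef_filt keys_filt in_keys_iff)
  moreover have "form j p0" if "form j p" for j using that by (simp add: p0_def form_filt')
  moreover have "form j p1" if "form (Suc j) p" for j
    unfolding p1_def
  proof (intro form_sum form_single)
    fix m assume m: "m \<in> S"
    hence "deg m = Suc j" using that by (auto simp: form_iff S_def)
    moreover have "deg m = 1 + deg (m - single v 1)"
      by (subst sub[OF m, symmetric]) (simp only: deg_add deg_single)
    ultimately show "deg (m - single v 1) = j" by simp
  qed
  moreover have "p1 = 0" if "form 0 p"
  proof -
    have "S = {}" using that by (auto simp: form_iff S_def)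
    thus ?thesis by (simp add: p1_def)
  qed
  ultimately show thesis using that eq by blast
qed

lemma form_0_const:
  assumes "form 0 p" shows "p = const (coef p 0)"
  using assms by (intro poly_mapping_eqI) (auto simp: form_iff coef_const in_keys_iff)

text \<open>Divide by the last variable and recurse on the remainder, which has one variable less.
  When no variable is left, a form of positive degree is 0.\<close>

lemma split_vars:
  fixes p :: "(nat, 'a::comm_ring_1) mpoly"
  assumes "p \<in> mpolys A {..<r}" "subr A" "form (Suc j) p"
  obtains q where "p = (\<Sum>l<r. var l * q l)" "\<And>l. l < r \<Longrightarrow> q l \<in> mpolys A {..<r}" "\<And>l. l < r \<Longrightarrow> form j (q l)"
proof -
  have "\<exists>q. p = (\<Sum>l<r. var l * q l) \<and> (\<forall>l<r. q l \<in> mpolys A {..<r} \<and> form j (q l))"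
    using assms(1,3)
  proof (induction r arbitrary: p)
    case 0
    have "m = 0" if "m \<in> keys p" for m using mpolys_keys[OF 0(1) that] by simp
    hence "keys p = {}" using 0(2) deg_zero unfolding form_iff by (metis all_not_in_conv nat.distinct(1))
    thus ?case by simp
  next
    case (Suc r)
    obtain p1 p0 where p: "p = var r * p1 + p0" "p1 \<in> mpolys A {..<Suc r}" "p0 \<in> mpolys A ({..<Suc r} - {r})"
      "form (Suc j) p0" "form j p1"
      using split_var[OF Suc.prems(1) assms(2), of r] Suc.prems(2) by metis
    have "{..<Suc r} - {r} = {..<r}" by auto
    then obtain q where q: "p0 = (\<Sum>l<r. var l * q l)" "\<forall>l<r. q l \<in> mpolys A {..<r} \<and> form j (q l)"
      using Suc.IH[of p0] p by auto
    have "mpolys A {..<r} \<subseteq> mpolys A {..<Suc r}" by (rule mpolys_mono) auto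
    thus ?case using p q
      by (intro exI[of _ "q(r := p1)"]) (auto simp: less_Suc_eq)
  qed
  thus thesis using that by blast
qed

text \<open>The ideal generated in the polynomial ring by the constants \<open>f l\<close> consists
  of the polynomials with coefficients in the ideal of the \<open>f l\<close>. Supports do not grow,
  so that forms are decomposed into forms.\<close>

lemma split_coeffs:
  fixes p :: "('v, 'a::comm_ring_1) mpoly"
  assumes "p \<in> mpolys (gen R (f ` {..<r::nat})) V" "subr R"
  obtains q where "p = (\<Sum>l<r. const (f l) * q l)" "\<And>l. q l \<in> mpolys R V" "\<And>l. keys (q l) \<subseteq> keys p"
proof -
  have "\<exists>a. (\<forall>l<r. a l \<in> R) \<and> coef p m = (\<Sum>l<r. a l * f l)" for m
    using mpolys_coef[OF assms(1), of m] unfolding gen_image_sum[OF assms(2) finite_lessThan] by auto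
  then obtain a where a: "\<And>m l. l < r \<Longrightarrow> a m l \<in> R" "\<And>m. coef p m = (\<Sum>l<r. a m l * f l)" by metis
  define q where "q l = (\<Sum>m\<in>keys p. single m (if l < r then a m l else 0))" for l
  have "(\<Sum>l<r. const (f l) * q l) = (\<Sum>m\<in>keys p. \<Sum>l<r. const (f l) * single m (a m l))"
    unfolding q_def sum_distrib_left by (subst sum.swap) simp
  also have "\<dots> = (\<Sum>m\<in>keys p. single m (coef p m))"
  proof (rule sum.cong)
    fix m
    have "(\<Sum>l<r. const (f l) * single m (a m l)) = (\<Sum>l<r. const (a m l * f l) * single m 1)"
      by (rule sum.cong) (auto simp: const_single[symmetric, of m "a m _"] const_mult mult_ac)
    also have "\<dots> = const (coef p m) * single m 1"
      by (simp add: a(2) const_sum sum_distrib_right)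
    finally show "(\<Sum>l<r. const (f l) * single m (a m l)) = single m (coef p m)"
      by (simp add: const_single)
  qed simp
  also have "\<dots> = p" using monom_expand[of p] by simp
  finally have "p = (\<Sum>l<r. const (f l) * q l)" by simp
  moreover have "q l \<in> mpolys R V" for l
    unfolding q_def using a(1) mpolys_keys[OF assms(1)] subr.zero[OF assms(2)]
    by (intro subr.sum[OF subr_mpolys[OF assms(2)]] single_mpolys) auto
  moreover have "keys (q l) \<subseteq> keys p" for l
  proof
    fix k assume "k \<in> keys (q l)"
    hence "(\<Sum>m\<in>keys p. coef (single m (if l < r then a m l else 0)) k) \<noteq> 0"
      by (simp add: q_def in_keys_iff lookup_sum)
    then obtain m where "m \<in> keys p" "coef (single m (if l < r then a m l else 0)) k \<noteq> 0"
      by (meson sum.neutral)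
    thus "k \<in> keys p" by (auto simp: lookup_single when_def split: if_splits)
  qed
  ultimately show thesis using that by blast
qed

lemma form_subset: "form n p \<Longrightarrow> keys q \<subseteq> keys p \<Longrightarrow> form n q"
  by (auto simp: form_iff)

section \<open>Koszul complexes\<close>

definition ksgn :: "nat \<Rightarrow> nat set \<Rightarrow> 'b::comm_ring_1" where
  "ksgn v A = (-1) ^ card (A \<inter> {..<v})"

text \<open>Contraction and exterior multiplication by the \<open>v\<close>-th basis vector. A chain assigns to a finite
  set \<open>A\<close> the coefficient of the exterior product of the basis vectors in \<open>A\<close>; its values on
  infinite sets are irrelevant.\<close>

definition kcon :: "nat \<Rightarrow> (nat set \<Rightarrow> 'b::comm_ring_1) \<Rightarrow> nat set \<Rightarrow> 'b" where
  "kcon v c A = (if v \<in> A then 0 else ksgn v A * c (insert v A))"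

definition kext :: "nat \<Rightarrow> (nat set \<Rightarrow> 'b::comm_ring_1) \<Rightarrow> nat set \<Rightarrow> 'b" where
  "kext v c A = (if v \<in> A then ksgn v A * c (A - {v}) else 0)"

text \<open>The Koszul differential on \<open>y 0, \<dots>, y (m - 1)\<close>. Its value on a set
  with \<open>q\<close> elements is computed from the values of \<open>c\<close> on sets with
  \<open>q + 1\<close> elements.\<close>

definition kd :: "(nat \<Rightarrow> 'b) \<Rightarrow> nat \<Rightarrow> (nat set \<Rightarrow> 'b::comm_ring_1) \<Rightarrow> nat set \<Rightarrow> 'b" where
  "kd y m c A = (\<Sum>v<m. y v * kcon v c A)"

lemma ksgn_insert: "u \<notin> A \<Longrightarrow> u \<noteq> v \<Longrightarrow> ksgn v (insert u A) = (if u < v then - ksgn v A else ksgn v A)"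
  by (auto simp: ksgn_def)

lemma ksgn_square: "ksgn v A * ksgn v A = (1 :: 'b::comm_ring_1)"
  by (simp add: ksgn_def power_mult_distrib[symmetric])

lemma kcon_kcon: "kcon u (kcon v c) A = - kcon v (kcon u c) A"
  by (auto simp: kcon_def ksgn_insert insert_commute)

lemma kcon_kcon_same: "kcon v (kcon v c) A = 0"
  by (auto simp: kcon_def)

text \<open>The anticommutation relation between contraction and exterior multiplication, from which
  the null-homotopies come.\<close>

lemma kcon_kext:
  fixes c :: "nat set \<Rightarrow> 'b::comm_ring_1"
  shows "kcon u (kext v c) A + kext v (kcon u c) A = (if u = v then c A else 0)"
proof (cases "u = v")
  case True
  have "insert v (A - {v}) = A" if "v \<in> A" using that by auto
  moreover have "ksgn v (insert v A) = (ksgn v A :: 'b)" "ksgn v (A - {v}) = (ksgn v A :: 'b)"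
    unfolding ksgn_def by (rule arg_cong[of _ _ "\<lambda>S. (-1) ^ card S"], auto)+
  ultimately show ?thesis
    using True by (auto simp: kcon_def kext_def ksgn_square mult.assoc[symmetric])
next
  case False
  have *: "ksgn u (A - {v}) = (if v < u then - ksgn u A else (ksgn u A :: 'b))" if "v \<in> A"
  proof -
    have "ksgn u (insert v (A - {v})) = (if v < u then - ksgn u (A - {v}) else (ksgn u (A - {v}) :: 'b))"
      using False by (intro ksgn_insert) auto
    moreover have "insert v (A - {v}) = A" using that by auto
    ultimately show ?thesis by simp
  qed
  have "insert u A - {v} = insert u (A - {v})" using False by auto
  thus ?thesis using False
    by (auto simp: kcon_def kext_def ksgn_insert * simp del: insert_Diff_single)
qed

lemma kd_Suc: "kd y (Suc m) c A = kd y m c A + y m * kcon m c A"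
  by (simp add: kd_def)

lemma kcon_add: "kcon v (\<lambda>A. c A + c' A) A = kcon v c A + kcon v c' A"
  by (simp add: kcon_def distrib_left)

lemma kcon_diff: "kcon v (\<lambda>A. c A - c' A) A = kcon v c A - kcon v c' A"
  by (simp add: kcon_def right_diff_distrib)

lemma kcon_mult: "kcon v (\<lambda>A. r * c A) A = r * kcon v c A"
  by (simp add: kcon_def)

lemma kcon_sum: "kcon v (\<lambda>A. \<Sum>i\<in>I. g i A) A = (\<Sum>i\<in>I. kcon v (g i) A)"
  by (simp add: kcon_def sum_distrib_left)

lemma kd_add: "kd y m (\<lambda>A. c A + c' A) A = kd y m c A + kd y m c' A"
  by (simp add: kd_def kcon_add distrib_left sum.distrib)

lemma kd_diff: "kd y m (\<lambda>A. c A - c' A) A = kd y m c A - kd y m c' A"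
  by (simp add: kd_def kcon_diff right_diff_distrib sum_subtractf)

lemma kd_mult: "kd y m (\<lambda>A. r * c A) A = r * kd y m c A"
  by (simp add: kd_def kcon_mult sum_distrib_left mult.left_commute)

lemma kd_sum: "kd y m (\<lambda>A. \<Sum>i\<in>I. g i A) A = (\<Sum>i\<in>I. kd y m (g i) A)"
  by (simp add: kd_def kcon_sum sum_distrib_left) (rule sum.swap)

lemma kcon_kd: "kcon v (kd y m c) A = - kd y m (kcon v c) A"
proof -
  have "kcon v (kd y m c) A = (\<Sum>u<m. kcon v (\<lambda>A. y u * kcon u c A) A)"
    unfolding kd_def by (rule kcon_sum)
  also have "\<dots> = (\<Sum>u<m. - (y u * kcon u (kcon v c) A))"
    by (rule sum.cong) (simp_all add: kcon_mult kcon_kcon[of v])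
  finally show ?thesis by (simp add: kd_def sum_negf)
qed

text \<open>Contractions anticommute and have square zero, so in the induction on \<open>m\<close>
  the mixed terms cancel.\<close>

lemma kd_kd: "kd y m (kd y m c) A = 0"
proof (induction m arbitrary: c A)
  case 0 show ?case by (simp add: kd_def)
next
  case (Suc m)
  have "kd y (Suc m) c = (\<lambda>A. kd y m c A + y m * kcon m c A)" by (rule ext) (rule kd_Suc)
  thus ?case
    using Suc by (simp add: kd_Suc kd_add kd_mult kcon_add kcon_mult kcon_kd kcon_kcon_same)
qed

lemma kext_sum: "kext v (\<lambda>A. \<Sum>i\<in>I. g i A) A = (\<Sum>i\<in>I. kext v (g i) A)"
  by (simp add: kext_def sum_distrib_left)

lemma kext_mult: "kext v (\<lambda>A. r * c A) A = r * kext v c A"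
  by (simp add: kext_def)

text \<open>Exterior multiplication by the \<open>v\<close>-th basis vector is a homotopy between
  multiplication by \<open>y v\<close> and zero.\<close>

lemma kd_kext: "v < m \<Longrightarrow> kd y m (kext v c) A + kext v (kd y m c) A = y v * c A"
proof -
  assume v: "v < m"
  have "kext v (kd y m c) A = (\<Sum>u<m. y u * kext v (kcon u c) A)"
    unfolding kd_def kext_sum by (simp add: kext_mult)
  hence "kd y m (kext v c) A + kext v (kd y m c) A
      = (\<Sum>u<m. y u * (kcon u (kext v c) A + kext v (kcon u c) A))"
    by (simp add: kd_def distrib_left sum.distrib)
  also have "\<dots> = (\<Sum>u<m. if u = v then y v * c A else 0)"
    by (rule sum.cong) (auto simp: kcon_kext)
  finally show ?thesis using v by simp
qed

lemma kd_cong: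
  assumes "\<And>v. v < m \<Longrightarrow> v \<notin> A \<Longrightarrow> c (insert v A) = c' (insert v A)"
  shows "kd y m c A = kd y m c' A"
  unfolding kd_def kcon_def using assms by (intro sum.cong) auto

lemma ksgn_mult_in: "subr B \<Longrightarrow> submod B X \<Longrightarrow> x \<in> X \<Longrightarrow> ksgn v A * x \<in> X"
  using submod_uminus[of B X x] by (cases "even (card (A \<inter> {..<v}))") (auto simp: ksgn_def)

lemma kd_in:
  assumes "subr B" "submod B X" "\<And>v. v < m \<Longrightarrow> y v \<in> B"
    and "\<And>v. v < m \<Longrightarrow> v \<notin> A \<Longrightarrow> c (insert v A) \<in> X"
  shows "kd y m c A \<in> X"
  unfolding kd_def kcon_def
  using assms by (intro submod_sum[OF assms(2)]) (auto intro: submod_mult ksgn_mult_in submod_zero)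

lemma kext_in:
  assumes "subr B" "submod B X" "v \<in> A \<Longrightarrow> c (A - {v}) \<in> X"
  shows "kext v c A \<in> X"
  unfolding kext_def using assms by (auto intro: ksgn_mult_in submod_zero)

text \<open>\<open>van y m q X Y\<close> says that the Koszul complex of \<open>X / Y\<close> on \<open>y 0, \<dots>, y (m - 1)\<close> is exact in
  degree \<open>q\<close>.\<close>

definition van :: "(nat \<Rightarrow> 'b::comm_ring_1) \<Rightarrow> nat \<Rightarrow> nat \<Rightarrow> 'b set \<Rightarrow> 'b set \<Rightarrow> bool" where
  "van y m q X Y \<longleftrightarrow> (\<forall>z. (\<forall>A. z A \<in> X) \<longrightarrow>
     (\<forall>A. A \<subseteq> {..<m} \<longrightarrow> Suc (card A) = q \<longrightarrow> kd y m z A \<in> Y) \<longrightarrow>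
     (\<exists>w. (\<forall>A. w A \<in> X) \<and> (\<forall>A. A \<subseteq> {..<m} \<longrightarrow> card A = q \<longrightarrow> z A - kd y m w A \<in> Y)))"

lemma vanI:
  assumes "\<And>z. (\<And>A. z A \<in> X) \<Longrightarrow> (\<And>A. A \<subseteq> {..<m} \<Longrightarrow> Suc (card A) = q \<Longrightarrow> kd y m z A \<in> Y) \<Longrightarrow>
    \<exists>w. (\<forall>A. w A \<in> X) \<and> (\<forall>A. A \<subseteq> {..<m} \<longrightarrow> card A = q \<longrightarrow> z A - kd y m w A \<in> Y)"
  shows "van y m q X Y"
  unfolding van_def using assms by blast

lemma vanE:
  assumes "van y m q X Y" "\<And>A. z A \<in> X"
    and "\<And>A. A \<subseteq> {..<m} \<Longrightarrow> Suc (card A) = q \<Longrightarrow> kd y m z A \<in> Y"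
  obtains w where "\<And>A. w A \<in> X" "\<And>A. A \<subseteq> {..<m} \<Longrightarrow> card A = q \<Longrightarrow> z A - kd y m w A \<in> Y"
  using assms unfolding van_def by blast

lemma card_insert_lessThan: "A \<subseteq> {..<m::nat} \<Longrightarrow> v \<notin> A \<Longrightarrow> card (insert v A) = Suc (card A)"
  by (metis card_insert_disjoint finite_lessThan finite_subset)

locale koszul = subr B for B :: "'b::comm_ring_1 set" +
  fixes y :: "nat \<Rightarrow> 'b" and m :: nat
  assumes y: "\<And>v. v < m \<Longrightarrow> y v \<in> B"
begin

lemma van_vacuous:
  assumes "q > m" "submod B X" shows "van y m q X Y"
proof (rule vanI, rule exI[of _ "\<lambda>_. 0"], intro conjI allI impI)
  fix A :: "nat set" assume "A \<subseteq> {..<m}" "card A = q"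
  thus "z A - kd y m (\<lambda>_. 0) A \<in> Y" for z using assms card_mono[of "{..<m}" A] by simp
qed (use assms submod_zero in auto)

text \<open>A piece of the long exact sequence of \<open>X' / Y\<close>, \<open>X / Y\<close> and
  \<open>X / X'\<close>: the differential of a cycle of \<open>X / X'\<close> is a cycle of
  \<open>X' / Y\<close>, and subtracting a chain of \<open>X'\<close> with the same differential
  modulo \<open>Y\<close> produces a cycle of \<open>X / Y\<close>.\<close>

lemma van_quot:
  assumes sub: "submod B X" "submod B X'" "submod B Y" and le: "Y \<subseteq> X'" "X' \<subseteq> X"
    and v: "van y m (Suc p) X Y" "van y m p X' Y"
  shows "van y m (Suc p) X X'"
proof (rule vanI)
  fix z assume z: "\<And>A. z A \<in> X" "\<And>A. A \<subseteq> {..<m} \<Longrightarrow> Suc (card A) = Suc p \<Longrightarrow> kd y m z A \<in> X'"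
  \<comment> \<open>Chains must take values in the module on all sets, so \<open>t\<close> is set to
    0 where nothing is known; the differential in the degree considered does not see this.\<close>
  define t where "t A = (if A \<subseteq> {..<m} \<and> card A = p then kd y m z A else 0)" for A
  have t: "t A \<in> X'" for A using z(2) submod_zero[OF sub(2)] by (auto simp: t_def)
  have "kd y m t A \<in> Y" if A: "A \<subseteq> {..<m}" "Suc (card A) = p" for A
  proof -
    have "kd y m t A = kd y m (kd y m z) A"
      using A by (intro kd_cong) (auto simp: t_def card_insert_lessThan)
    thus ?thesis by (simp add: kd_kd submod_zero[OF sub(3)])
  qed
  then obtain t' where t': "\<And>A. t' A \<in> X'"
    "\<And>A. A \<subseteq> {..<m} \<Longrightarrow> card A = p \<Longrightarrow> t A - kd y m t' A \<in> Y"
    using vanE[OF v(2), of t] t by blast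
  have "z A - t' A \<in> X" for A using z(1) t'(1) le submod_diff[OF subr_axioms sub(1)] by blast
  moreover have "kd y m (\<lambda>A. z A - t' A) A \<in> Y" if "A \<subseteq> {..<m}" "Suc (card A) = Suc p" for A
    using t'(2)[of A] that by (simp add: kd_diff t_def)
  ultimately obtain w where w: "\<And>A. w A \<in> X"
    "\<And>A. A \<subseteq> {..<m} \<Longrightarrow> card A = Suc p \<Longrightarrow> z A - t' A - kd y m w A \<in> Y"
    using vanE[OF v(1), of "\<lambda>A. z A - t' A"] by blast
  have "z A - kd y m w A \<in> X'" if "A \<subseteq> {..<m}" "card A = Suc p" for A
    using submod_add[OF sub(2), of "z A - t' A - kd y m w A" "t' A"] w(2)[OF that] le t'(1)[of A]
    by (auto simp: algebra_simps)
  thus "\<exists>w. (\<forall>A. w A \<in> X) \<and> (\<forall>A. A \<subseteq> {..<m} \<longrightarrow> card A = Suc p \<longrightarrow> z A - kd y m w A \<in> X')"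
    using w(1) by blast
qed

text \<open>The companion piece of the long exact sequence: a cycle of \<open>X' / Y\<close> is the
  boundary of some \<open>w\<close> in \<open>X\<close>; this \<open>w\<close> is a cycle of
  \<open>X / X'\<close>, hence a boundary there, and subtracting that boundary moves
  \<open>w\<close> into \<open>X'\<close>.\<close>

lemma van_sub:
  assumes sub: "submod B X" "submod B X'" "submod B Y" and le: "Y \<subseteq> X'" "X' \<subseteq> X"
    and v: "van y m (Suc q) X X'" "van y m q X Y"
  shows "van y m q X' Y"
proof (rule vanI)
  fix z assume z: "\<And>A. z A \<in> X'" "\<And>A. A \<subseteq> {..<m} \<Longrightarrow> Suc (card A) = q \<Longrightarrow> kd y m z A \<in> Y"
  obtain w where w: "\<And>A. w A \<in> X" "\<And>A. A \<subseteq> {..<m} \<Longrightarrow> card A = q \<Longrightarrow> z A - kd y m w A \<in> Y"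
    using vanE[OF v(2), of z] z le by blast
  have "kd y m w A \<in> X'" if "A \<subseteq> {..<m}" "Suc (card A) = Suc q" for A
    using submod_diff[OF subr_axioms sub(2) z(1)[of A], of "z A - kd y m w A"] w(2)[of A] that le by auto
  then obtain u where u: "\<And>A. u A \<in> X"
    "\<And>A. A \<subseteq> {..<m} \<Longrightarrow> card A = Suc q \<Longrightarrow> w A - kd y m u A \<in> X'"
    using vanE[OF v(1), of w] w(1) by blast
  define t where "t A = (if A \<subseteq> {..<m} \<and> card A = Suc q then w A - kd y m u A else 0)" for A
  have t: "t A \<in> X'" for A using u(2) submod_zero[OF sub(2)] by (auto simp: t_def)
  have "kd y m t A = kd y m w A" if A: "A \<subseteq> {..<m}" "card A = q" for A
  proof -
    have "kd y m t A = kd y m (\<lambda>A. w A - kd y m u A) A"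
      using A by (intro kd_cong) (auto simp: t_def card_insert_lessThan)
    thus ?thesis by (simp add: kd_diff kd_kd)
  qed
  thus "\<exists>w. (\<forall>A. w A \<in> X') \<and> (\<forall>A. A \<subseteq> {..<m} \<longrightarrow> card A = q \<longrightarrow> z A - kd y m w A \<in> Y)"
    using t w(2) by (intro exI[of _ t]) auto
qed

text \<open>Multiplication by an element of the ideal generated by the \<open>y v\<close> is null-homotopic.\<close>

lemma van_regular:
  assumes sub: "submod B X" "submod B Y" and le: "Y \<subseteq> X"
    and a: "a \<in> gen B (y ` {..<m})"
    and reg: "\<And>x. x \<in> X \<Longrightarrow> a * x \<in> Y \<Longrightarrow> x \<in> Y"
    and v: "van y m (Suc q) X (msum Y ((*) a ` X))"
  shows "van y m q X Y"
proof (rule vanI)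
  fix z assume z: "\<And>A. z A \<in> X" "\<And>A. A \<subseteq> {..<m} \<Longrightarrow> Suc (card A) = q \<Longrightarrow> kd y m z A \<in> Y"
  obtain c where c: "\<And>v. v < m \<Longrightarrow> c v \<in> B" "a = (\<Sum>v<m. c v * y v)"
    using a unfolding gen_image_sum[OF subr_axioms finite_lessThan] by auto
  \<comment> \<open>The null-homotopy applied to \<open>z\<close>: its differential is
    \<open>a * z\<close> modulo \<open>Y\<close>, so \<open>u\<close> is a cycle modulo
    \<open>Y + a X\<close>.\<close>
  define u where "u A = (\<Sum>v<m. c v * kext v z A)" for A
  have u: "u A \<in> X" for A
    unfolding u_def using z(1) c sub(1) subr_axioms
    by (intro submod_sum[OF sub(1)] submod_mult[OF sub(1)] kext_in) auto
  have du: "a * z A - kd y m u A \<in> Y" if A: "A \<subseteq> {..<m}" "card A = q" for A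
  proof -
    have "kd y m u A = (\<Sum>v<m. c v * kd y m (kext v z) A)"
      unfolding u_def kd_sum by (simp add: kd_mult)
    also have "\<dots> = (\<Sum>v<m. c v * (y v * z A - kext v (kd y m z) A))"
      using kd_kext[of _ m y z A]
      by (intro sum.cong refl arg_cong[of _ _ "(*) _"]) (simp add: eq_diff_eq)
    also have "\<dots> = a * z A - (\<Sum>v<m. c v * kext v (kd y m z) A)"
      unfolding c by (simp add: right_diff_distrib sum_subtractf sum_distrib_right mult.assoc)
    finally have "a * z A - kd y m u A = (\<Sum>v<m. c v * kext v (kd y m z) A)" by simp
    moreover have "kext v (kd y m z) A \<in> Y" for v
    proof (rule kext_in[OF subr_axioms sub(2)])
      assume "v \<in> A"
      moreover have "finite A" using A finite_subset by blast
      ultimately show "kd y m z (A - {v}) \<in> Y"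
        using A card_Suc_Diff1[of A v] by (intro z(2)) auto
    qed
    ultimately show ?thesis using c sub by (auto intro!: submod_sum submod_mult)
  qed
  have "submod B ((*) a ` X)"
  proof (rule submodI)
    show "0 \<in> (*) a ` X" using submod_zero[OF sub(1)] by (auto intro: rev_image_eqI)
  next
    fix s t assume "s \<in> (*) a ` X" "t \<in> (*) a ` X"
    thus "s + t \<in> (*) a ` X"
      using submod_add[OF sub(1)] by (auto simp: distrib_left[symmetric])
  next
    fix b t assume "b \<in> B" "t \<in> (*) a ` X"
    thus "b * t \<in> (*) a ` X"
      using submod_mult[OF sub(1)] by (auto simp: mult.left_commute)
  qed
  hence sub': "submod B (msum Y ((*) a ` X))" and up: "Y \<subseteq> msum Y ((*) a ` X)" "(*) a ` X \<subseteq> msum Y ((*) a ` X)"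
    using submod_msum[OF sub(2)] msum_upper[OF sub(2)] by auto
  have "kd y m u A \<in> msum Y ((*) a ` X)" if A: "A \<subseteq> {..<m}" "Suc (card A) = Suc q" for A
  proof -
    have "a * z A \<in> msum Y ((*) a ` X)" using up z(1) by blast
    thus ?thesis
      using submod_diff[OF subr_axioms sub', of "a * z A" "a * z A - kd y m u A"] du[of A] A up by auto
  qed
  then obtain w where w: "\<And>A. w A \<in> X"
    "\<And>A. A \<subseteq> {..<m} \<Longrightarrow> card A = Suc q \<Longrightarrow> u A - kd y m w A \<in> msum Y ((*) a ` X)"
    using vanE[OF v, of u] u by blast
  have "\<exists>x. x \<in> X \<and> (A \<subseteq> {..<m} \<longrightarrow> card A = Suc q \<longrightarrow> u A - kd y m w A - a * x \<in> Y)" for A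
  proof (cases "A \<subseteq> {..<m} \<and> card A = Suc q")
    case True
    with w(2) obtain s x where "s \<in> Y" "x \<in> X" "u A - kd y m w A = s + a * x"
      unfolding msum_def by blast
    thus ?thesis by (intro exI[of _ x]) auto
  next
    case False
    thus ?thesis using submod_zero[OF sub(1)] by blast
  qed
  then obtain u' where u': "\<And>A. u' A \<in> X"
    "\<And>A. A \<subseteq> {..<m} \<Longrightarrow> card A = Suc q \<Longrightarrow> u A - kd y m w A - a * u' A \<in> Y"
    by metis
  \<comment> \<open>Since \<open>u - kd y m w\<close> equals \<open>a * u'\<close> modulo
    \<open>Y\<close>, taking differentials puts \<open>a * (z - kd y m u')\<close> into
    \<open>Y\<close>, and \<open>a\<close> cancels by regularity.\<close>
  have "z A - kd y m u' A \<in> Y" if A: "A \<subseteq> {..<m}" "card A = q" for A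
  proof (rule reg)
    show "z A - kd y m u' A \<in> X"
      using z(1) u'(1) y by (intro submod_diff[OF subr_axioms sub(1)] kd_in[OF subr_axioms sub(1)]) auto
    have "kd y m (\<lambda>A. u A - kd y m w A - a * u' A) A \<in> Y"
      using A by (intro kd_in[OF subr_axioms sub(2) y] u'(2)) (auto simp: card_insert_lessThan)
    hence "kd y m u A - a * kd y m u' A \<in> Y" by (simp add: kd_diff kd_kd kd_mult)
    thus "a * (z A - kd y m u' A) \<in> Y"
      using submod_add[OF sub(2) du[OF A]] by (fastforce simp: algebra_simps)
  qed
  thus "\<exists>w. (\<forall>A. w A \<in> X) \<and> (\<forall>A. A \<subseteq> {..<m} \<longrightarrow> card A = q \<longrightarrow> z A - kd y m w A \<in> Y)"
    using u'(1) by blast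
qed

text \<open>The relation \<open>Phi\<close> is the graph of an isomorphism between \<open>X' / Y'\<close> and \<open>X / Y\<close>.\<close>

lemma van_transfer:
  assumes Phi: "\<And>x. x \<in> X \<Longrightarrow> \<exists>x'\<in>X'. Phi x' x" "\<And>x'. x' \<in> X' \<Longrightarrow> \<exists>x\<in>X. Phi x' x"
    and add: "\<And>x' x u' u. Phi x' x \<Longrightarrow> Phi u' u \<Longrightarrow> Phi (x' + u') (x + u)"
    and mult: "\<And>x' x b. b \<in> B \<Longrightarrow> Phi x' x \<Longrightarrow> Phi (b * x') (b * x)"
    and mem: "\<And>x' x. Phi x' x \<Longrightarrow> x' \<in> Y' \<longleftrightarrow> x \<in> Y"
    and v: "van y m q X' Y'" and sub: "submod B X'" "submod B Y'"
  shows "van y m q X Y"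
proof (rule vanI)
  have zero: "Phi 0 0" using Phi(2)[OF submod_zero[OF sub(1)]] mult[of 0] by auto
  have diff: "Phi (x' - u') (x - u)" if "Phi x' x" "Phi u' u" for x' x u' u
    using add[OF that(1) mult[OF _ that(2), of "-1"]] uminus[of 1] by auto
  have sum: "Phi (sum g' I) (sum g I)" if "\<And>i. i \<in> I \<Longrightarrow> Phi (g' i) (g i)" for g' g and I :: "nat set"
    using that by (induction I rule: infinite_finite_induct) (auto intro: zero add)
  have kd: "Phi (kd y m c' A) (kd y m c A)" if "\<And>A. Phi (c' A) (c A)" for c' c A
  proof -
    have "Phi (ksgn v A * c' A') (ksgn v A * c A')" for v A'
      using that[of A'] mult[OF _ that, of "-1"] uminus[of 1]
      by (cases "even (card (A \<inter> {..<v}))") (auto simp: ksgn_def)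
    thus ?thesis unfolding kd_def kcon_def using y
      by (intro sum) (auto intro: mult zero)
  qed
  fix z assume z: "\<And>A. z A \<in> X" "\<And>A. A \<subseteq> {..<m} \<Longrightarrow> Suc (card A) = q \<Longrightarrow> kd y m z A \<in> Y"
  obtain z' where z': "\<And>A. z' A \<in> X'" "\<And>A. Phi (z' A) (z A)"
    using Phi(1)[OF z(1)] by metis
  have "kd y m z' A \<in> Y'" if "A \<subseteq> {..<m}" "Suc (card A) = q" for A
    using z(2)[OF that] mem[OF kd[of z' z A]] z'(2) by blast
  then obtain w' where w': "\<And>A. w' A \<in> X'"
    "\<And>A. A \<subseteq> {..<m} \<Longrightarrow> card A = q \<Longrightarrow> z' A - kd y m w' A \<in> Y'"
    using vanE[OF v, of z'] z'(1) by blast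
  obtain w where w: "\<And>A. w A \<in> X" "\<And>A. Phi (w' A) (w A)"
    using Phi(2)[OF w'(1)] by metis
  have "z A - kd y m w A \<in> Y" if "A \<subseteq> {..<m}" "card A = q" for A
    using w'(2)[OF that] mem[OF diff[OF z'(2)[of A] kd[of w' w A]]] w(2) by blast
  thus "\<exists>w. (\<forall>A. w A \<in> X) \<and> (\<forall>A. A \<subseteq> {..<m} \<longrightarrow> card A = q \<longrightarrow> z A - kd y m w A \<in> Y)"
    using w(1) by blast
qed

end

text \<open>An element acting nilpotently can be dropped from the sequence at the cost of one degree.\<close>

lemma (in koszul) van_drop:
  assumes sub: "submod B X" "submod B Y" and le: "Y \<subseteq> X"
    and m: "m = Suc n" and nil: "\<And>x. x \<in> X \<Longrightarrow> y n ^ e * x \<in> Y"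
    and v: "van y m (Suc q) X Y"
  shows "van y n q X Y"
proof (rule vanI)
  have yn: "y n \<in> B" and ylt: "\<And>v. v < n \<Longrightarrow> y v \<in> B" using y m by auto
  \<comment> \<open>One factor \<open>y n\<close> is removed: if \<open>y n * z\<close> is a
    boundary for the shorter sequence modulo \<open>Y\<close>, then so is \<open>z\<close>.\<close>
  have key: "\<exists>w. (\<forall>A. w A \<in> X) \<and> (\<forall>A. A \<subseteq> {..<n} \<longrightarrow> card A = q \<longrightarrow> z A - kd y n w A \<in> Y)"
    if z: "\<And>A. z A \<in> X" "\<And>A. A \<subseteq> {..<n} \<Longrightarrow> Suc (card A) = q \<Longrightarrow> kd y n z A \<in> Y"
      and w: "\<And>A. w A \<in> X" "\<And>A. A \<subseteq> {..<n} \<Longrightarrow> card A = q \<Longrightarrow> y n * z A - kd y n w A \<in> Y" for z w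
  proof -
    \<comment> \<open>A chain for the longer sequence: \<open>z\<close> on the sets containing
      \<open>n\<close>, and the bounding chain \<open>w\<close> on the others. The sign comes from
      the \<open>q\<close> elements that precede \<open>n\<close>; it makes \<open>y n * z\<close>
      and the differential of \<open>w\<close> cancel.\<close>
    define Z where "Z A = (if n \<in> A then z (A - {n}) else - ((-1) ^ q * w A))" for A
    have ZX: "Z A \<in> X" for A
    proof -
      have "(-1) ^ q * w A \<in> X" using w(1)[of A] submod_uminus[OF subr_axioms sub(1)]
        by (cases "even q") auto
      thus ?thesis using z(1) submod_uminus[OF subr_axioms sub(1)] by (auto simp: Z_def)
    qed
    have split: "A \<subseteq> {..<m} \<Longrightarrow> n \<notin> A \<Longrightarrow> A \<subseteq> {..<n}" for A unfolding m by (auto simp: less_Suc_eq)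
    have "kd y m Z A \<in> Y" if A: "A \<subseteq> {..<m}" "Suc (card A) = Suc q" for A
    proof (cases "n \<in> A")
      case True
      have kc: "kcon v Z A = kcon v z (A - {n})" if "v < n" for v
      proof -
        have "insert v A - {n} = insert v (A - {n})" using that by auto
        moreover have "(A - {n}) \<inter> {..<v} = A \<inter> {..<v}" using that by auto
        ultimately show ?thesis using that True by (simp add: kcon_def Z_def ksgn_def)
      qed
      have "kd y m Z A = kd y n Z A" using True by (simp add: m kd_Suc kcon_def)
      also have "\<dots> = kd y n z (A - {n})" unfolding kd_def by (rule sum.cong) (auto simp: kc)
      also have "\<dots> \<in> Y"
      proof (rule z(2))
        show "A - {n} \<subseteq> {..<n}" using split[of "A - {n}"] A by auto
        show "Suc (card (A - {n})) = q"
          using A True card_Suc_Diff1[of A n] finite_subset[OF A(1)] by simp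
      qed
      finally show ?thesis .
    next
      case False
      hence An: "A \<subseteq> {..<n}" "card A = q" "A \<inter> {..<n} = A" using split A by auto
      have "kd y n Z A = kd y n (\<lambda>A. - ((-1) ^ q) * w A) A"
        using False by (intro kd_cong) (auto simp: Z_def)
      also have "\<dots> = - ((-1) ^ q) * kd y n w A" by (rule kd_mult)
      finally have "kd y m Z A = (-1) ^ q * (y n * z A - kd y n w A)"
        using False An by (simp add: m kd_Suc kcon_def Z_def ksgn_def algebra_simps)
      thus ?thesis
        using w(2)[OF An(1,2)] submod_uminus[OF subr_axioms sub(2) w(2)[OF An(1,2)]]
        by (cases "even q") (auto simp: minus_diff_eq)
    qed
    then obtain W where W: "\<And>A. W A \<in> X"
      "\<And>A. A \<subseteq> {..<m} \<Longrightarrow> card A = Suc q \<Longrightarrow> Z A - kd y m W A \<in> Y"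
      using vanE[OF v, of Z] ZX by blast
    have "z A - kd y n (\<lambda>A. W (insert n A)) A \<in> Y" if A: "A \<subseteq> {..<n}" "card A = q" for A
    proof -
      have nA: "n \<notin> A" using A by auto
      have kc: "kcon v W (insert n A) = kcon v (\<lambda>A. W (insert n A)) A" if "v < n" for v
      proof -
        have "insert n A \<inter> {..<v} = A \<inter> {..<v}" using that by auto
        thus ?thesis using that by (simp add: kcon_def ksgn_def insert_commute)
      qed
      have "kd y m W (insert n A) = kd y n W (insert n A)" by (simp add: m kd_Suc kcon_def)
      also have "\<dots> = kd y n (\<lambda>A. W (insert n A)) A"
        unfolding kd_def by (rule sum.cong) (auto simp: kc)
      finally have "kd y m W (insert n A) = kd y n (\<lambda>A. W (insert n A)) A" .
      moreover have "Z (insert n A) = z A" using nA by (simp add: Z_def)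
      moreover have "insert n A \<subseteq> {..<m}" "card (insert n A) = Suc q"
        using A nA m card_insert_lessThan[OF A(1)] by auto
      ultimately show ?thesis using W(2)[of "insert n A"] by simp
    qed
    thus ?thesis using W(1) by (intro exI[of _ "\<lambda>A. W (insert n A)"]) auto
  qed
  fix z assume z: "\<And>A. z A \<in> X" "\<And>A. A \<subseteq> {..<n} \<Longrightarrow> Suc (card A) = q \<Longrightarrow> kd y n z A \<in> Y"
  have "\<exists>w. (\<forall>A. w A \<in> X) \<and> (\<forall>A. A \<subseteq> {..<n} \<longrightarrow> card A = q \<longrightarrow> y n ^ (e - i) * z A - kd y n w A \<in> Y)"
    if "i \<le> e" for i
    using that
  proof (induction i)
    case 0
    show ?case
      using nil z(1) submod_zero[OF sub(1)] by (intro exI[of _ "\<lambda>_. 0"]) (simp_all add: kd_def kcon_def cong: if_cong)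
  next
    case (Suc i)
    then obtain w where w: "\<And>A. w A \<in> X"
      "\<And>A. A \<subseteq> {..<n} \<Longrightarrow> card A = q \<Longrightarrow> y n ^ (e - i) * z A - kd y n w A \<in> Y" by auto
    have eq: "y n ^ (e - i) = y n * y n ^ (e - Suc i)"
      using Suc.prems by (metis Suc_diff_Suc Suc_le_lessD power_Suc)
    show ?case
    proof (rule key[OF _ _ w(1)])
      show "y n ^ (e - Suc i) * z A \<in> X" for A
        using z(1) power[OF yn] sub(1) by (intro submod_mult) auto
      show "kd y n (\<lambda>A. y n ^ (e - Suc i) * z A) A \<in> Y" if "A \<subseteq> {..<n}" "Suc (card A) = q" for A
        unfolding kd_mult using z(2)[OF that] power[OF yn] sub(2) by (intro submod_mult) auto
      show "y n * (y n ^ (e - Suc i) * z A) - kd y n w A \<in> Y" if "A \<subseteq> {..<n}" "card A = q" for A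
        using w(2)[OF that] unfolding eq by (simp add: mult.assoc)
    qed
  qed
  from this[of e] show "\<exists>w. (\<forall>A. w A \<in> X) \<and> (\<forall>A. A \<subseteq> {..<n} \<longrightarrow> card A = q \<longrightarrow> z A - kd y n w A \<in> Y)"
    by simp
qed

section \<open>Regular sequences are of linear type\<close>

locale reg = subr R for R :: "'r::idom set" +
  fixes f :: "nat \<Rightarrow> 'r" and d :: nat
  assumes f_R: "\<And>l. l \<le> d \<Longrightarrow> f l \<in> R"
    and regular: "\<And>r c. r < d \<Longrightarrow> c \<in> R \<Longrightarrow> f r * c \<in> gen R (f ` {..<r}) \<Longrightarrow> c \<in> gen R (f ` {..<r})"
begin

definition J :: "nat \<Rightarrow> 'r set" where "J r = gen R (f ` {..<r})"
definition B :: "(nat, 'r) mpoly set" where "B = mpolys R {..d}"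
definition lin :: "nat \<Rightarrow> (nat \<Rightarrow> 'r) \<Rightarrow> (nat, 'r) mpoly" where "lin r a = (\<Sum>l<r. const (a l) * var l)"
definition syz :: "nat \<Rightarrow> (nat \<Rightarrow> 'r) \<Rightarrow> bool" where
  "syz r a \<longleftrightarrow> (\<forall>l<r. a l \<in> R) \<and> (\<Sum>l<r. a l * f l) = 0"

text \<open>The defining ideal of the symmetric algebra of \<open>J r\<close>, extended to \<open>B\<close>.\<close>

definition M :: "nat \<Rightarrow> (nat, 'r) mpoly set" where "M r = gen B {lin r a |a. syz r a}"

abbreviation evf :: "(nat, 'r) mpoly \<Rightarrow> 'r" where "evf \<equiv> mpoly_eval (\<lambda>x. x) f"

lemma submod_J: "submod R (J r)"
  unfolding J_def by (rule submod_gen[OF subr_axioms])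

lemma J_subset: "r \<le> Suc d \<Longrightarrow> J r \<subseteq> R"
  unfolding J_def by (intro gen_least submod_self subr_axioms) (auto intro: f_R)

lemma J_iff: "c \<in> J r \<longleftrightarrow> (\<exists>a. (\<forall>l<r. a l \<in> R) \<and> c = (\<Sum>l<r. a l * f l))"
  unfolding J_def gen_image_sum[OF subr_axioms finite_lessThan] by auto

lemma subr_B: "subr B"
  unfolding B_def by (rule subr_mpolys[OF subr_axioms])

sublocale sB: subr B by (rule subr_B)

lemma submod_M: "submod B (M r)"
  unfolding M_def by (rule submod_gen[OF subr_B])

lemma lin_in_M: "syz r a \<Longrightarrow> lin r a \<in> M r"
  unfolding M_def by (rule subsetD[OF gen_superset[OF subr_B]]) blast

lemma const_B: "c \<in> R \<Longrightarrow> const c \<in> B" and var_B: "l \<le> d \<Longrightarrow> var l \<in> B"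
  unfolding B_def by (auto intro: const_mpolys var_mpolys)

lemma M_mono: "r \<le> r' \<Longrightarrow> M r \<subseteq> M r'"
proof (induction r' rule: dec_induct)
  case (step r')
  have "lin r' a \<in> M (Suc r')" if "syz r' a" for a
  proof -
    have "syz (Suc r') (a(r' := 0))" "lin r' a = lin (Suc r') (a(r' := 0))"
      using that by (auto simp: syz_def lin_def)
    thus ?thesis using lin_in_M by simp
  qed
  hence "M r' \<subseteq> M (Suc r')"
    unfolding M_def[of r'] by (intro gen_least submod_M) auto
  thus ?case using step.IH by simp
qed simp

lemma koszul_relation:
  assumes "l < r" "r \<le> d"
  shows "const (f l) * var r - const (f r) * var l \<in> M (Suc r)"
proof -
  let ?a = "\<lambda>i. if i = r then f l else if i = l then - f r else 0"
  have "(\<Sum>i<r. ?a i * f i) = (\<Sum>i<r. if i = l then - f r * f l else 0)"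
    by (rule sum.cong) auto
  hence "syz (Suc r) ?a" using assms uminus f_R by (auto simp: syz_def mult.commute)
  moreover have "(\<Sum>i<r. const (?a i) * var i) = (\<Sum>i<r. if i = l then - const (f r) * var l else (0 :: (nat, 'r) mpoly))"
    by (rule sum.cong) (auto simp: const_minus)
  hence "lin (Suc r) ?a = const (f l) * var r - const (f r) * var l"
    using assms by (simp add: lin_def)
  ultimately show ?thesis using lin_in_M by metis
qed

text \<open>Relations of a regular sequence are Koszul. Regularity puts the last coefficient into
  \<open>J r\<close>, with coefficients \<open>c\<close>; adding the Koszul relations of
  \<open>f r\<close> with the \<open>f l\<close>, weighted by \<open>c\<close>, leaves a relation of
  the first \<open>r\<close> elements.\<close>

lemma syz_koszul:
  assumes "r \<le> d" "syz r a"
  obtains C where "\<And>l k. l < r \<Longrightarrow> k < r \<Longrightarrow> C l k \<in> R" "\<And>l k. C k l = - C l k" "\<And>l. C l l = 0"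
    "\<And>l. l < r \<Longrightarrow> a l = (\<Sum>k<r. C l k * f k)"
proof -
  have "\<exists>C. (\<forall>l<r. \<forall>k<r. C l k \<in> R) \<and> (\<forall>l k. C k l = - C l k) \<and> (\<forall>l. C l l = 0) \<and>
    (\<forall>l<r. a l = (\<Sum>k<r. C l k * f k))"
    using assms
  proof (induction r arbitrary: a)
    case 0 show ?case by (intro exI[of _ "\<lambda>_ _. 0"]) simp
  next
    case (Suc r)
    have a: "\<And>l. l \<le> r \<Longrightarrow> a l \<in> R" "(\<Sum>l<r. a l * f l) + a r * f r = 0"
      using Suc.prems(2) by (auto simp: syz_def)
    have "f r * a r = (\<Sum>l<r. - a l * f l)"
      using a(2) by (simp add: sum_negf eq_neg_iff_add_eq_0 add.commute mult.commute)
    hence "f r * a r \<in> J r" using a(1) uminus unfolding J_iff by (intro exI[of _ "\<lambda>l. - a l"]) auto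
    hence "a r \<in> J r" using regular[of r "a r"] a(1) Suc.prems(1) by (simp add: J_def)
    then obtain c where c: "\<And>l. l < r \<Longrightarrow> c l \<in> R" "a r = (\<Sum>l<r. c l * f l)"
      unfolding J_iff by blast
    have "(\<Sum>l<r. (a l + c l * f r) * f l) = (\<Sum>l<r. a l * f l) + (\<Sum>l<r. c l * f l) * f r"
      unfolding sum_distrib_right sum.distrib[symmetric] by (rule sum.cong) (auto simp: algebra_simps)
    hence "syz r (\<lambda>l. a l + c l * f r)"
      using a c f_R Suc.prems(1) by (auto simp: syz_def intro!: add mult)
    hence "\<exists>C. (\<forall>l<r. \<forall>k<r. C l k \<in> R) \<and> (\<forall>l k. C k l = - C l k) \<and> (\<forall>l. C l l = 0) \<and>
      (\<forall>l<r. a l + c l * f r = (\<Sum>k<r. C l k * f k))"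
      using Suc.prems(1) by (intro Suc.IH) simp
    then obtain C where C: "\<forall>l<r. \<forall>k<r. C l k \<in> R" "\<forall>l k. C k l = - C l k" "\<forall>l. C l l = 0"
      "\<forall>l<r. a l + c l * f r = (\<Sum>k<r. C l k * f k)" by blast
    \<comment> \<open>The matrix of the shorter relation is bordered by \<open>c\<close>, with
      opposite signs in the new row and column.\<close>
    define C' where "C' l k = (if l < r \<and> k < r then C l k else if l < r \<and> k = r then - c l
      else if l = r \<and> k < r then c k else 0)" for l k
    have C1: "C' k l = - C' l k" for l k
    proof (cases "l < r \<and> k < r")
      case True
      have "C k l = - C l k" using C(2) by blast
      thus ?thesis using True by (simp add: C'_def)
    next
      case False
      thus ?thesis
        by (cases "l < r"; cases "k < r"; cases "l = r"; cases "k = r") (simp_all add: C'_def)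
    qed
    have C2: "C' l l = 0" for l
    proof -
      have "C l l = 0" using C(3) by blast
      thus ?thesis by (simp add: C'_def)
    qed
    have C3: "C' l k \<in> R" if "l < Suc r" "k < Suc r" for l k
      using that C(1) c(1) uminus by (auto simp: C'_def less_Suc_eq)
    have C4: "a l = (\<Sum>k<Suc r. C' l k * f k)" if "l < Suc r" for l
    proof (cases "l = r")
      case True
      thus ?thesis using c by (simp add: C'_def)
    next
      case False
      hence l: "l < r" using that by simp
      hence "(\<Sum>k<r. C' l k * f k) = a l + c l * f r" using C(4) by (auto simp: C'_def intro: sum.cong)
      thus ?thesis using l by (simp add: C'_def)
    qed
    show ?case by (intro exI[of _ C'] conjI allI impI; (rule C1 | rule C2 | (rule C3; assumption) | (rule C4; assumption)))
  qed
  thus thesis using that by blast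
qed

lemma syz_in_J:
  assumes "r \<le> d" "syz r a" "l < r" shows "a l \<in> J r"
proof -
  obtain C where C: "\<And>l k. l < r \<Longrightarrow> k < r \<Longrightarrow> C l k \<in> R" "\<And>l k. C k l = - C l k" "\<And>l. C l l = 0"
    "\<And>l. l < r \<Longrightarrow> a l = (\<Sum>k<r. C l k * f k)"
    by (rule syz_koszul[OF assms(1,2)]) (rule that)
  thus ?thesis unfolding J_iff using C(1,4)[OF assms(3)] by blast
qed

text \<open>Relations of a regular sequence have coefficients in the ideal it generates. This turns
  statements about \<open>M r\<close> into coefficientwise statements modulo
  \<open>J r\<close>.\<close>

lemma M_subset_JB:
  assumes "r \<le> d" shows "M r \<subseteq> mpolys (J r) {..d}"
proof -
  note sub = submod_mpolys[OF subr_axioms submod_J, of "{..d}" r, folded B_def]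
  have "const (a l) * var l \<in> mpolys (J r) {..d}" if "syz r a" "l < r" for a l
    using submod_mult[OF sub var_B, of l "const (a l)"] syz_in_J[OF assms that] that assms submod_zero[OF submod_J]
    by (simp add: const_mpolys mult.commute)
  hence "lin r a \<in> mpolys (J r) {..d}" if "syz r a" for a
    unfolding lin_def using that by (intro submod_sum[OF sub]) auto
  thus ?thesis unfolding M_def by (intro gen_least sub) auto
qed

section \<open>Polynomial relations of a regular sequence\<close>

lemmas ev_simps = hid.eval_add hid.eval_mult hid.eval_const
  hid.eval_var hid.eval_sum rhom.h_diff[OF hid.rhom_eval]

abbreviation Rf :: "nat \<Rightarrow> (nat, 'r) mpoly set" where "Rf r \<equiv> mpolys R {..<r}"

lemma subr_Rf: "subr (Rf r)" by (rule subr_mpolys[OF subr_axioms])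

lemma Rf_B: "r \<le> Suc d \<Longrightarrow> Rf r \<subseteq> B"
  unfolding B_def by (rule mpolys_mono) auto

lemma Rf_mono: "r \<le> s \<Longrightarrow> Rf r \<subseteq> Rf s"
  by (rule mpolys_mono) auto

text \<open>The power \<open>J r ^ s\<close>, as the set of values of forms of degree
  \<open>s\<close>.\<close>

definition Jp :: "nat \<Rightarrow> nat \<Rightarrow> 'r set" where "Jp r s = {evf q |q. q \<in> Rf r \<and> form s q}"

text \<open>In the step from \<open>r\<close>, the element \<open>f r\<close> must be regular modulo
  every power of \<open>J r\<close>; this is proved inside from the case \<open>r\<close>. A
  relation is then divided by \<open>T r\<close>, and its quotient is corrected to become itself a
  relation, of smaller degree.\<close>

lemma linear_type_forms:
  assumes "r \<le> d" "p \<in> Rf r" "form j p" "evf p = 0"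
  shows "p \<in> M r"
  using assms
proof (induction r arbitrary: p j)
  case 0
  have "form 0 p"
  proof (cases j)
    case 0 thus ?thesis using `form j p` by simp
  next
    case (Suc i)
    then obtain q where "p = (\<Sum>l<0::nat. var l * q l)"
      using split_vars[OF 0(2) subr_axioms, of i] `form j p` by blast
    thus ?thesis by simp
  qed
  hence "p = const (coef p 0)" by (rule form_0_const)
  hence "p = 0" using 0(4) ev_simps(3) by (metis const_0)
  thus ?case by (simp add: submod_zero[OF submod_M])
next
  case (Suc r)
  have r: "r < d" "r \<le> d" using Suc.prems(1) by auto
  note A = Suc.IH[OF r(2)]
  have fc: "const (f l) \<in> Rf k" if "l \<le> d" for l k using f_R[OF that] by (intro const_mpolys) auto
  have vr: "l < k \<Longrightarrow> var l \<in> Rf k" for l k by (rule var_mpolys) auto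
  \<comment> \<open>By induction \<open>c\<close> lies in the power \<open>s\<close>, say
    \<open>c = evf p\<close>. Comparing \<open>f r * p\<close> with a form of the same value that
    has coefficients in \<open>J r\<close>, the case \<open>r\<close> and \<open>M_subset_JB\<close>
    put the coefficients of \<open>f r * p\<close>, hence those of \<open>p\<close>, into
    \<open>J r\<close>, which raises the power by one.\<close>
  have power_regular: "c \<in> Jp r s" if "c \<in> R" "f r * c \<in> Jp r s" for c s
    using that(2)
  proof (induction s)
    case 0
    show ?case unfolding Jp_def
      using that(1) by (intro CollectI exI[of _ "const c"]) (auto simp: ev_simps const_mpolys form_const)
  next
    case (Suc s)
    then obtain p' where p': "f r * c = evf p'" "p' \<in> Rf r" "form (Suc s) p'" by (auto simp: Jp_def)
    obtain p'' where p'': "p' = (\<Sum>l<r. var l * p'' l)" "\<And>l. l < r \<Longrightarrow> p'' l \<in> Rf r" "\<And>l. l < r \<Longrightarrow> form s (p'' l)"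
      using split_vars[OF p'(2) subr_axioms p'(3)] by blast
    \<comment> \<open>One variable in each term is replaced by its value: \<open>w\<close> has the
      value of \<open>p'\<close>, one degree less, and coefficients in \<open>J r\<close>.\<close>
    define w where "w = (\<Sum>l<r. const (f l) * p'' l)"
    have w: "w \<in> Rf r" "form s w" "evf w = f r * c"
      unfolding w_def p'(1) p''(1)
      using p''(2,3) r form_mult[OF form_const p''(3)]
      by (auto intro!: subr.sum[OF subr_Rf] subr.mult[OF subr_Rf] fc form_sum simp: ev_simps)
    hence "f r * c \<in> Jp r s" unfolding Jp_def by (metis (mono_tags, lifting) mem_Collect_eq)
    then obtain p where p: "c = evf p" "p \<in> Rf r" "form s p" using Suc.IH by (auto simp: Jp_def)
    have "const (f r) * p - w \<in> M r"
    proof (rule A)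
      show "const (f r) * p - w \<in> Rf r"
        using p w r by (intro subr.diff[OF subr_Rf] subr.mult[OF subr_Rf] fc) auto
      show "form s (const (f r) * p - w)"
        using form_diff[OF _ w(2)] form_mult[OF form_const p(3)] by simp
      show "evf (const (f r) * p - w) = 0" using w p by (simp add: ev_simps)
    qed
    hence "const (f r) * p - w \<in> mpolys (J r) {..d}" using M_subset_JB[OF r(2)] by blast
    moreover note sub = submod_mpolys[OF subr_axioms submod_J, of "{..d}" r, folded B_def]
    have "w \<in> mpolys (J r) {..d}"
      unfolding w_def
    proof (rule submod_sum[OF sub])
      fix l assume "l \<in> {..<r}"
      hence l: "l < r" by simp
      have "f l \<in> J r" unfolding J_def using gen_superset[OF subr_axioms, of "f ` {..<r}"] l by auto
      hence "p'' l * const (f l) \<in> mpolys (J r) {..d}"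
        using subsetD[OF Rf_B p''(2)[OF l]] r submod_zero[OF submod_J]
        by (intro submod_mult[OF sub] const_mpolys) auto
      thus "const (f l) * p'' l \<in> mpolys (J r) {..d}" by (simp add: mult.commute)
    qed
    ultimately have "const (f r) * p \<in> mpolys (J r) {..d}"
      using submod_add[OF sub, of "const (f r) * p - w" w] by simp
    hence "f r * coef p k \<in> J r" for k
      using mpolys_coef[of _ "J r" _ k] coef_const_mult[of "f r" p k] by metis
    hence "coef p k \<in> J r" for k
      using regular[OF r(1) mpolys_coef[OF p(2)]] by (simp add: J_def)
    hence pJ: "p \<in> mpolys (gen R (f ` {..<r})) {..<r}" using p(2) by (auto simp: mpolys_def J_def)
    obtain q where q: "p = (\<Sum>l<r. const (f l) * q l)" "\<And>l. q l \<in> Rf r" "\<And>l. keys (q l) \<subseteq> keys p"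
      using split_coeffs[OF pJ subr_axioms] by blast
    have "c = evf (\<Sum>l<r. var l * q l)" unfolding p(1) by (subst q(1)) (simp add: ev_simps)
    moreover have "(\<Sum>l<r. var l * q l) \<in> Rf r"
      using q(2) vr by (intro subr.sum[OF subr_Rf] subr.mult[OF subr_Rf]) auto
    moreover have "form (Suc s) (\<Sum>l<r. var l * q l)"
      using form_mult[OF form_var form_subset[OF p(3) q(3)]] by (intro form_sum) simp
    ultimately show ?case unfolding Jp_def by blast
  qed
  show ?case
    using Suc.prems(2-4)
  proof (induction j arbitrary: p)
    case 0
    have "p = const (coef p 0)" using 0(2) by (rule form_0_const)
    hence "p = 0" using 0(3) ev_simps(3) by (metis const_0)
    thus ?case by (simp add: submod_zero[OF submod_M])
  next
    case (Suc j)
    obtain p1 p0 where p: "p = var r * p1 + p0" "p1 \<in> Rf (Suc r)" "p0 \<in> mpolys R ({..<Suc r} - {r})"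
      "form (Suc j) p0" "form j p1"
      using split_var[OF Suc.prems(1) subr_axioms, of r] Suc.prems(2) by metis
    have "{..<Suc r} - {r} = {..<r}" by auto
    hence p0: "p0 \<in> Rf r" using p(3) by simp
    have ev0: "f r * evf p1 + evf p0 = 0" using Suc.prems(3) p(1) by (simp add: ev_simps)
    hence "f r * evf p1 = evf (- p0)"
      by (simp add: rhom.h_minus[OF hid.rhom_eval] eq_neg_iff_add_eq_0)
    hence "f r * evf p1 \<in> Jp r (Suc j)"
      unfolding Jp_def using subr.uminus[OF subr_Rf p0] form_minus[OF p(4)] by blast
    moreover have "evf p1 \<in> R"
      using p(2) Suc.prems r f_R
      by (intro hid.eval_in[OF subr_axioms] mpolys_coef) (auto dest!: mpolys_keys simp: subset_iff)
    ultimately have "evf p1 \<in> Jp r (Suc j)" using power_regular by blast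
    then obtain p1' where p1': "evf p1 = evf p1'" "p1' \<in> Rf r" "form (Suc j) p1'" by (auto simp: Jp_def)
    obtain c where c: "p1' = (\<Sum>l<r. var l * c l)" "\<And>l. l < r \<Longrightarrow> c l \<in> Rf r" "\<And>l. l < r \<Longrightarrow> form j (c l)"
      using split_vars[OF p1'(2) subr_axioms p1'(3)] by blast
    \<comment> \<open>Again one variable per term is replaced by its value. Now \<open>w\<close> has
      degree \<open>j\<close> and the value of \<open>p1\<close>, so that \<open>p1 - w\<close> is a
      relation to which the induction on the degree applies.\<close>
    define w where "w = (\<Sum>l<r. const (f l) * c l)"
    have w: "w \<in> Rf r" "form j w" "evf w = evf p1"
      unfolding w_def p1'(1) c(1) using c(2) form_mult[OF form_const c(3)] r
      by (auto intro!: subr.sum[OF subr_Rf] subr.mult[OF subr_Rf] fc form_sum simp: ev_simps)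
    have "p1 - w \<in> M (Suc r)"
      using p(2,5) w subr.diff[OF subr_Rf] Rf_mono[of r "Suc r"] form_diff
      by (intro Suc.IH) (auto simp: ev_simps)
    hence 1: "var r * (p1 - w) \<in> M (Suc r)"
      using submod_mult[OF submod_M var_B] r by auto
    have "const (f r) * p1' + p0 \<in> M r"
    proof (rule A)
      show "const (f r) * p1' + p0 \<in> Rf r"
        using p1' p0 r by (intro subr.add[OF subr_Rf] subr.mult[OF subr_Rf] fc) auto
      show "form (Suc j) (const (f r) * p1' + p0)"
        using form_add[OF _ p(4)] form_mult[OF form_const p1'(3)] by simp
      show "evf (const (f r) * p1' + p0) = 0" using ev0 p1'(1) by (simp add: ev_simps)
    qed
    hence 2: "const (f r) * p1' + p0 \<in> M (Suc r)" using M_mono[of r "Suc r"] by auto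
    have "c l * (const (f l) * var r - const (f r) * var l) \<in> M (Suc r)" if "l < r" for l
      using that c(2) Rf_B[of r] r koszul_relation[OF that r(2)] by (intro submod_mult[OF submod_M]) auto
    hence 3: "(\<Sum>l<r. c l * (const (f l) * var r - const (f r) * var l)) \<in> M (Suc r)"
      by (intro submod_sum[OF submod_M]) auto
    \<comment> \<open>Koszul relations trade \<open>T r * w\<close> for
      \<open>f r * p1'\<close>.\<close>
    have "(\<Sum>l<r. c l * (const (f l) * var r - const (f r) * var l)) = var r * w - const (f r) * p1'"
      unfolding w_def c(1) by (simp add: right_diff_distrib sum_subtractf sum_distrib_left mult_ac)
    hence "p = var r * (p1 - w) + (const (f r) * p1' + p0)
        + (\<Sum>l<r. c l * (const (f l) * var r - const (f r) * var l))"
      using p(1) by (simp add: algebra_simps)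
    thus ?case using submod_add[OF submod_M submod_add[OF submod_M 1 2] 3] by simp
  qed
qed

text \<open>Sends the first \<open>r\<close> variables into the Rees algebra of \<open>J r\<close>
  and keeps the others. For \<open>r \<le> d\<close> its kernel in \<open>B\<close> is
  \<open>M r\<close> (\<open>emb_M\<close> and \<open>linear_type\<close>), so that
  \<open>B / M r\<close> embeds into a domain.\<close>

definition emb :: "nat \<Rightarrow> (nat, 'r) mpoly \<Rightarrow> (nat, 'r) mpoly poly" where
  "emb r = mpoly_eval (\<lambda>c. [:const c:]) (\<lambda>l. if l < r then [:0, const (f l):] else [:var l:])"

lemma rhom_cc: "rhom (\<lambda>c. [:const c:])"
  by (rule rhom_comp[OF rhom_const rhom_pCons])

lemma rhom_emb: "rhom (emb r)"
  unfolding emb_def by (rule rhom.rhom_eval[OF rhom_cc])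

lemma emb_const: "emb r (const c) = [:const c:]" and emb_var: "emb r (var l) = (if l < r then [:0, const (f l):] else [:var l:])"
  by (simp_all add: emb_def rhom.eval_const[OF rhom_cc] rhom.eval_var[OF rhom_cc])

lemma emb_lin: "emb r (lin r a) = [:0, const (\<Sum>l<r. a l * f l):]"
proof -
  have "[:0, const (sum g S):] = (\<Sum>l\<in>S. [:0, const (g l) :: (nat, 'r) mpoly:])" for g :: "nat \<Rightarrow> 'r" and S
    using sum_comp_morphism[of "\<lambda>c. [:0, const c :: (nat, 'r) mpoly:]" g S] by (simp add: const_add o_def)
  thus ?thesis
    by (simp add: lin_def rhom.h_sum[OF rhom_emb] rhom.h_mult[OF rhom_emb] emb_const emb_var const_mult mult.commute)
qed

lemma emb_M: "x \<in> M r \<Longrightarrow> emb r x = 0"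
proof -
  assume "x \<in> M r"
  moreover have "submod B {x. emb r x = 0}"
    by (rule submodI) (auto simp: rhom.h_zero[OF rhom_emb] rhom.h_add[OF rhom_emb] rhom.h_mult[OF rhom_emb])
  moreover have "emb r (lin r a) = 0" if "syz r a" for a
    using that by (simp add: emb_lin syz_def)
  ultimately show ?thesis
    using gen_least[of B "{x. emb r x = 0}" "{lin r a |a. syz r a}"] unfolding M_def by auto
qed

lemma emb_single:
  "emb r (single ka c) = monom (single (filt (\<lambda>l. \<not> l < r) ka)
     (c * mev f (filt (\<lambda>l. l < r) ka))) (deg (filt (\<lambda>l. l < r) ka))"
proof -
  define g :: "nat \<Rightarrow> (nat, 'r) mpoly poly" where "g l = (if l < r then [:0, const (f l):] else [:var l:])" for l
  have low: "mev g mu = monom (const (mev f mu)) (deg mu)" if "keys mu \<subseteq> {..<r}" for mu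
  proof -
    have "g l ^ n = monom (const (f l ^ n)) n" if "l < r" for l n
    proof -
      have "g l = monom (const (f l)) 1" using that by (simp add: g_def monom_Suc monom_0)
      thus ?thesis by (simp add: monom_power hconst.h_power)
    qed
    hence "mev g mu = (\<Prod>l\<in>keys mu. monom (const (f l ^ coef mu l)) (coef mu l))"
      unfolding mev_def using that by (intro prod.cong) auto
    also have "(\<Prod>l\<in>S. monom (const (f l ^ coef mu l)) (coef mu l))
        = monom (const (\<Prod>l\<in>S. f l ^ coef mu l)) (\<Sum>l\<in>S. coef mu l)" for S
      by (induction S rule: infinite_finite_induct) (auto simp: mult_monom const_mult)
    finally show ?thesis by (simp add: mev_def deg_def)
  qed
  have high: "mev g mu = [:single mu 1:]" if "keys mu \<inter> {..<r} = {}" for mu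
  proof -
    have "var l ^ n = (single (single l n) 1 :: (nat, 'r) mpoly)" for l n
      by (induction n) (auto simp: var_def mult_single single_add[symmetric])
    hence "mev g mu = (\<Prod>l\<in>keys mu. [:single (single l (coef mu l)) 1:])"
      unfolding mev_def using that
      by (intro prod.cong) (auto simp: g_def hpCons.h_power[symmetric])
    also have "(\<Prod>l\<in>S. [:single (single l (coef mu l)) (1::'r):]) = [:single (\<Sum>l\<in>S. single l (coef mu l)) 1:]" for S
      by (induction S rule: infinite_finite_induct) (auto simp: mult_single one_pCons add.commute)
    finally show ?thesis using monom_expand[of mu] by simp
  qed
  let ?lo = "filt (\<lambda>l. l < r) ka" and ?hi = "filt (\<lambda>l. \<not> l < r) ka"
  have "emb r (single ka c) = [:const c:] * mev g ka"
    unfolding emb_def by (subst rhom.eval_single[OF rhom_cc]) (simp add: mev_def mev_def g_def)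
  also have "mev g ka = mev g ?lo * mev g ?hi"
    using mev_add[of g ?lo ?hi] filt_split[of ka "\<lambda>l. l < r"] by simp
  also have "mev g ?lo = monom (const (mev f ?lo)) (deg ?lo)"
    by (rule low) (auto simp: keys_filt)
  also have "mev g ?hi = [:single ?hi 1:]"
    by (rule high) (auto simp: keys_filt)
  finally show ?thesis
    by (simp add: monom_0[symmetric] mult_monom const_mult[symmetric] mult.assoc[symmetric])
      (simp add: const_def mult_single)
qed

text \<open>Monomials are grouped by their part in the kept variables and by the degree of the other
  part. Different groups contribute to different monomials of the target, so each group evaluates to
  0 and \<open>linear_type_forms\<close> applies to it.\<close>

lemma linear_type:
  assumes r: "r \<le> d" and x: "x \<in> B" "emb r x = 0"
  shows "x \<in> M r"
proof -
  let ?lo = "\<lambda>ka. filt (\<lambda>l. l < r) ka" and ?hi = "\<lambda>ka. filt (\<lambda>l. \<not> l < r) ka"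
  let ?S = "\<lambda>z. {ka\<in>keys x. (?hi ka, deg (?lo ka)) = z}"
  define part where "part z = (\<Sum>ka\<in>?S z. single (?lo ka) (coef x ka))" for z
  have keysB: "keys ka \<subseteq> {..d}" if "ka \<in> keys x" for ka using mpolys_keys x(1) that unfolding B_def by blast
  have "x = (\<Sum>ka\<in>keys x. single ka (coef x ka))" using monom_expand[of x] by simp
  also have "\<dots> = (\<Sum>z\<in>(\<lambda>ka. (?hi ka, deg (?lo ka))) ` keys x. \<Sum>ka\<in>?S z. single ka (coef x ka))"
    by (rule sum.image_gen) simp
  also have "\<dots> = (\<Sum>z\<in>(\<lambda>ka. (?hi ka, deg (?lo ka))) ` keys x. single (fst z) 1 * part z)"
  proof (rule sum.cong)
    fix z
    have "single (fst z) 1 * part z = (\<Sum>ka\<in>?S z. single (?hi ka + ?lo ka) (coef x ka))"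
      unfolding part_def sum_distrib_left mult_single by (rule sum.cong) auto
    also have "\<dots> = (\<Sum>ka\<in>?S z. single ka (coef x ka))"
      by (rule sum.cong) (auto simp: add.commute[of "?hi _"] filt_split[symmetric])
    finally show "(\<Sum>ka\<in>?S z. single ka (coef x ka)) = single (fst z) 1 * part z" by simp
  qed simp
  also have "\<dots> \<in> M r"
  proof (rule submod_sum[OF submod_M submod_mult[OF submod_M]])
    fix z assume "z \<in> (\<lambda>ka. (?hi ka, deg (?lo ka))) ` keys x"
    then obtain ka0 where "ka0 \<in> keys x" "z = (?hi ka0, deg (?lo ka0))" by auto
    thus "single (fst z) 1 \<in> B"
      unfolding B_def using keysB[of ka0] by (intro single_mpolys) (auto simp: keys_filt)
    show "part z \<in> M r"
    proof (rule linear_type_forms[OF r])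
      show "part z \<in> Rf r"
        unfolding part_def
        using mpolys_coef x(1) unfolding B_def
        by (intro subr.sum[OF subr_Rf] single_mpolys) (auto simp: keys_filt)
      show "form (snd z) (part z)" unfolding part_def by (intro form_sum form_single) auto
      have "coef (coeff (emb r x) (snd z)) (fst z)
          = (\<Sum>ka\<in>keys x. coef (coeff (emb r (single ka (coef x ka))) (snd z)) (fst z))"
        by (subst monom_expand[of x]) (simp_all add: rhom.h_sum[OF rhom_emb] coeff_sum lookup_sum)
      also have "\<dots> = (\<Sum>ka\<in>keys x. if ka \<in> ?S z then coef x ka * mev f (?lo ka) else 0)"
        by (rule sum.cong) (auto simp: emb_single lookup_single when_def prod_eq_iff)
      also have "\<dots> = (\<Sum>ka\<in>?S z. coef x ka * mev f (?lo ka))"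
        by (simp add: sum.If_cases Int_def)
      also have "\<dots> = evf (part z)"
        by (simp add: part_def ev_simps hid.eval_single)
      finally show "evf (part z) = 0" using x(2) by simp
    qed
  qed
  finally show ?thesis .
qed

end

section \<open>Vanishing of Koszul homology for symmetric algebras\<close>

lemma coef_single_mult:
  fixes p :: "('v, 'a::comm_ring_1) mpoly"
  obtains mu where "ka = nu + mu" "coef (single nu c * p) ka = c * coef p mu" | "coef (single nu c * p) ka = 0"
proof (cases "\<exists>mu. ka = nu + mu")
  case True
  thus thesis using that(1) lookup_var_mult_add by blast
next
  case False
  have "single nu c * p = (\<Sum>k\<in>keys p. single (nu + k) (c * coef p k))"
    by (subst monom_expand[of p]) (simp_all add: sum_distrib_left mult_single)
  hence "coef (single nu c * p) ka = (\<Sum>k\<in>keys p. coef (single (nu + k) (c * coef p k)) ka)"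
    by (simp add: lookup_sum)
  also have "\<dots> = 0" using False by (intro sum.neutral) (auto simp: lookup_single when_def)
  finally show thesis by (rule that(2))
qed

lemma coef_var_mult:
  assumes "v \<notin> keys ka" shows "coef (var v * p) ka = 0"
proof (rule coef_single_mult[of ka "single v 1" 1 p])
  fix mu assume "ka = single v 1 + mu"
  with assms show ?thesis by (auto simp: keys_plus_nat)
qed (simp add: var_def)

locale reg_koszul = reg +
  fixes xs :: "nat \<Rightarrow> 'a"
  assumes d_pos: "d \<ge> 1" and xs_R: "\<And>u. u < d \<Longrightarrow> xs u \<in> R"
    and f_xs: "\<And>l. l < d \<Longrightarrow> f l \<in> gen R (xs ` {..<d})"
begin

text \<open>The variables \<open>T\<close> come first and the elements \<open>xs\<close> last,
  because \<open>van_drop\<close> removes elements from the end of the sequence.\<close>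

definition y :: "nat \<Rightarrow> (nat, 'a) mpoly" where
  "y v = (if v \<le> d then var v else const (xs (v - Suc d)))"

abbreviation m :: nat where "m \<equiv> Suc (2 * d)"

sublocale K: koszul B y m
proof (rule koszul.intro[OF subr_B], unfold_locales)
  fix v assume "v < m"
  thus "y v \<in> B" using var_B const_B[OF xs_R, of "v - Suc d"] by (auto simp: y_def)
qed

lemma const_f_in_gen: "l < d \<Longrightarrow> const (f l) \<in> gen B (y ` {..<m})"
proof -
  assume "l < d"
  then obtain a where a: "\<forall>u<d. a u \<in> R" "f l = (\<Sum>u<d. a u * xs u)"
    using f_xs[of l] unfolding gen_image_sum[OF subr_axioms finite_lessThan] by auto
  have "const (a u) * const (xs u) \<in> gen B (y ` {..<m})" if "u < d" for u
  proof (rule submod_mult[OF submod_gen[OF subr_B]])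
    show "const (a u) \<in> B" using a that by (intro const_B) auto
    have "y (Suc d + u) = const (xs u)" by (simp add: y_def)
    moreover have "y (Suc d + u) \<in> y ` {..<m}" using that by (intro imageI) simp
    ultimately show "const (xs u) \<in> gen B (y ` {..<m})" using gen_superset[OF subr_B, of "y ` {..<m}"] by auto
  qed
  thus ?thesis unfolding a(2) const_sum const_mult
    by (intro submod_sum[OF submod_gen[OF subr_B]]) auto
qed

text \<open>For an ideal \<open>Q\<close> of \<open>R\<close>, this is the ideal generated by
  \<open>Q\<close> and \<open>T 0, \<dots>, T (v - 1)\<close>, described by the coefficients at the
  monomials free of these variables.\<close>

definition Yi :: "nat \<Rightarrow> 'a set \<Rightarrow> (nat, 'a) mpoly set" where
  "Yi v Q = {x \<in> B. \<forall>ka. keys ka \<inter> {..<v} = {} \<longrightarrow> coef x ka \<in> Q}"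

lemma submod_Yi:
  assumes Q: "submod R Q" shows "submod B (Yi v Q)"
proof (rule submodI)
  show "0 \<in> Yi v Q" using submod_zero[OF Q] sB.zero by (auto simp: Yi_def)
  show add: "x + x' \<in> Yi v Q" if "x \<in> Yi v Q" "x' \<in> Yi v Q" for x x'
    using that submod_add[OF Q] sB.add by (auto simp: Yi_def lookup_add)
  fix b x assume b: "b \<in> B" and x: "x \<in> Yi v Q"
  have "coef (b * x) ka \<in> Q" if ka: "keys ka \<inter> {..<v} = {}" for ka
  proof -
    have "b * x = (\<Sum>nu\<in>keys b. single nu (coef b nu) * x)"
      by (subst monom_expand[of b]) (simp_all add: sum_distrib_right)
    hence "coef (b * x) ka = (\<Sum>nu\<in>keys b. coef (single nu (coef b nu) * x) ka)" by (simp add: lookup_sum)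
    also have "\<dots> \<in> Q"
    proof (rule submod_sum[OF Q])
      fix nu assume "nu \<in> keys b"
      show "coef (single nu (coef b nu) * x) ka \<in> Q"
      proof (rule coef_single_mult[of ka nu "coef b nu" x])
        fix mu assume "ka = nu + mu" "coef (single nu (coef b nu) * x) ka = coef b nu * coef x mu"
        moreover from this have "keys mu \<inter> {..<v} = {}" using ka by (auto simp: keys_plus_nat)
        ultimately show ?thesis using x b submod_mult[OF Q mpolys_coef, of b "{..d}" "coef x mu" nu]
          by (simp add: Yi_def B_def)
      qed (simp add: submod_zero[OF Q])
    qed
    finally show ?thesis .
  qed
  thus "b * x \<in> Yi v Q" using sB.mult[OF b] x by (auto simp: Yi_def)
qed

lemma Yi_0: "Q \<subseteq> R \<Longrightarrow> Yi 0 Q = mpolys Q {..d}"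
  by (auto simp: Yi_def B_def mpolys_def)

text \<open>\<open>T v\<close> is regular modulo \<open>Yi v Q\<close>, and adding it to that ideal
  gives \<open>Yi (Suc v) Q\<close>.\<close>

lemma van_Yi_step:
  assumes Q: "submod R Q" and v: "v \<le> d" and van: "van y m (Suc q) B (Yi (Suc v) Q)"
  shows "van y m q B (Yi v Q)"
proof (rule K.van_regular[OF submod_self[OF subr_B] submod_Yi[OF Q], where a = "var v"])
  show "Yi v Q \<subseteq> B" by (auto simp: Yi_def)
  have "var v \<in> y ` {..<m}" using v by (intro rev_image_eqI[of v]) (auto simp: y_def)
  thus "var v \<in> gen B (y ` {..<m})" using gen_superset[OF subr_B, of "y ` {..<m}"] by auto
  have shift: "coef (var v * x) (single v 1 + ka) = coef x ka" for x :: "(nat, 'a) mpoly" and ka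
    unfolding var_def lookup_var_mult_add by simp
  show "x \<in> Yi v Q" if "x \<in> B" "var v * x \<in> Yi v Q" for x
  proof -
    have "coef x ka \<in> Q" if ka: "keys ka \<inter> {..<v} = {}" for ka
    proof -
      have "keys (single v 1 + ka) \<inter> {..<v} = {}" using ka by (auto simp: keys_plus_nat)
      thus ?thesis using `var v * x \<in> Yi v Q` shift[of x ka] unfolding Yi_def by (metis (mono_tags, lifting) mem_Collect_eq)
    qed
    thus ?thesis using that by (simp add: Yi_def)
  qed
  have "Yi (Suc v) Q = msum (Yi v Q) ((*) (var v) ` B)"
  proof (intro subset_antisym subsetI)
    fix x assume x: "x \<in> Yi (Suc v) Q"
    hence "x \<in> mpolys R {..d}" by (simp add: Yi_def B_def)
    then obtain p1 p0 where p: "x = var v * p1 + p0" "p1 \<in> B" "p0 \<in> mpolys R ({..d} - {v})"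
      using split_var[OF _ subr_axioms, of x "{..d}" v] unfolding B_def by metis
    have "coef p0 ka \<in> Q" if ka: "keys ka \<inter> {..<v} = {}" for ka
    proof (cases "v \<in> keys ka")
      case True
      hence "ka \<notin> keys p0" using mpolys_keys[OF p(3)] by auto
      thus ?thesis using submod_zero[OF Q] by (simp add: in_keys_iff)
    next
      case False
      hence "coef (var v * p1) ka = 0" by (rule coef_var_mult)
      hence "coef p0 ka = coef x ka" by (simp add: p(1) lookup_add)
      moreover have "keys ka \<inter> {..<Suc v} = {}" using ka False by (auto simp: less_Suc_eq)
      ultimately show ?thesis using x by (simp add: Yi_def)
    qed
    moreover have "p0 \<in> B" using p(3) mpolys_mono[of R R "{..d} - {v}" "{..d}"] by (auto simp: B_def)
    ultimately have "p0 \<in> Yi v Q" by (simp add: Yi_def)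
    thus "x \<in> msum (Yi v Q) ((*) (var v) ` B)"
      using p(1,2) msumI[of p0 "Yi v Q" "var v * p1" "(*) (var v) ` B"] by (auto simp: add.commute)
  next
    fix x assume "x \<in> msum (Yi v Q) ((*) (var v) ` B)"
    then obtain x0 b where x: "x0 \<in> Yi v Q" "b \<in> B" "x = x0 + var v * b" by (auto simp: msum_def)
    have "x0 \<in> Yi (Suc v) Q" using x(1) by (auto simp: Yi_def lessThan_Suc)
    moreover have "var v * b \<in> Yi (Suc v) Q"
    proof -
      have "coef (var v * b) ka = 0" if "keys ka \<inter> {..<Suc v} = {}" for ka
        using that by (intro coef_var_mult) auto
      thus ?thesis using sB.mult[OF var_B[OF v] x(2)] submod_zero[OF Q] by (simp add: Yi_def)
    qed
    ultimately show "x \<in> Yi (Suc v) Q" unfolding x(3) by (rule submod_add[OF submod_Yi[OF Q]])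
  qed
  thus "van y m (Suc q) B (msum (Yi v Q) ((*) (var v) ` B))" using van by simp
qed

lemma van_Yi:
  assumes Q: "submod R Q" "Q \<subseteq> R" and van: "van y m (q + Suc d) B (Yi (Suc d) Q)"
  shows "van y m q B (mpolys Q {..d})"
proof -
  have "van y m (q + Suc d - k) B (Yi (Suc d - k) Q)" if "k \<le> Suc d" for k
    using that
  proof (induction k)
    case (Suc k)
    have eq: "Suc (q + Suc d - Suc k) = q + Suc d - k" "Suc (Suc d - Suc k) = Suc d - k" using Suc.prems by auto
    have "van y m (Suc (q + Suc d - Suc k)) B (Yi (Suc (Suc d - Suc k)) Q)"
      unfolding eq using Suc.prems by (intro Suc.IH) simp
    thus ?case by (rule van_Yi_step[OF Q(1), rotated]) simp
  qed (use van in simp)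
  from this[of "Suc d"] show ?thesis using Yi_0[OF Q(2)] by simp
qed

text \<open>Above degree \<open>m = 2 * d + 1\<close> there are no sets to consider. The
  \<open>d + 1\<close> variables \<open>T\<close> form a regular sequence on \<open>B / Q B\<close>,
  and each of them lowers the bound by one.\<close>

lemma van_ideal:
  assumes "submod R Q" "Q \<subseteq> R" "q > d" shows "van y m q B (mpolys Q {..d})"
  using assms by (intro van_Yi K.van_vacuous submod_self subr_B) auto

lemma J_Suc: "J (Suc r) = {w + a * f r |w a. w \<in> J r \<and> a \<in> R}"
proof -
  have "J (Suc r) = gen R (J r \<union> {f r})"
  proof (rule antisym)
    have "J r \<union> {f r} \<subseteq> gen R (J r \<union> {f r})" by (rule gen_superset[OF subr_axioms])
    moreover have "f ` {..<r} \<subseteq> J r" unfolding J_def by (rule gen_superset[OF subr_axioms])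
    ultimately show "J (Suc r) \<subseteq> gen R (J r \<union> {f r})"
      unfolding J_def[of "Suc r"] by (intro gen_least submod_gen subr_axioms) (auto simp: lessThan_Suc)
    have "f ` {..<Suc r} \<subseteq> J (Suc r)" unfolding J_def by (rule gen_superset[OF subr_axioms])
    moreover have "J r \<subseteq> J (Suc r)" unfolding J_def by (intro gen_mono subr_axioms) auto
    ultimately show "gen R (J r \<union> {f r}) \<subseteq> J (Suc r)" by (intro gen_least submod_J) auto
  qed
  thus ?thesis using gen_insert_submod[OF subr_axioms submod_J, of "f r" r] by simp
qed

text \<open>The elements \<open>f r, \<dots>, f (d - 1)\<close> are regular modulo
  \<open>J r\<close> and lower the bound \<open>d\<close> of \<open>van_ideal\<close> by another
  \<open>d - r\<close>.\<close>

lemma van_J: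
  assumes "r \<le> d" "q > r" shows "van y m q B (mpolys (J r) {..d})"
proof (rule van_Yi[OF submod_J])
  show "J r \<subseteq> R" using J_subset assms by auto
  have "van y m (q' + (d - r)) B (Yi (Suc d) (J d)) \<Longrightarrow> van y m q' B (Yi (Suc d) (J r))" for q'
    using assms(1)
  proof (induction r arbitrary: q' rule: inc_induct)
    case (step r)
    have "van y m (Suc q') B (Yi (Suc d) (J (Suc r)))"
      using step.prems step.hyps by (intro step.IH) (simp add: Suc_diff_Suc)
    moreover have "Yi (Suc d) (J (Suc r)) = msum (Yi (Suc d) (J r)) ((*) (const (f r)) ` B)"
    proof (intro subset_antisym subsetI)
      fix x assume x: "x \<in> Yi (Suc d) (J (Suc r))"
      hence "coef x 0 \<in> J (Suc r)" by (simp add: Yi_def)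
      then obtain w c where w: "w \<in> J r" "c \<in> R" "coef x 0 = w + c * f r" unfolding J_Suc by auto
      have "x - const (f r) * const c \<in> Yi (Suc d) (J r)"
      proof -
        have "coef (x - const (f r) * const c) ka \<in> J r" if ka: "keys ka \<inter> {..<Suc d} = {}" for ka
        proof (cases "ka = 0")
          case True
          thus ?thesis using w by (simp add: const_mult[symmetric] lookup_minus coef_const mult.commute)
        next
          case False
          have "ka \<notin> keys x"
          proof
            assume "ka \<in> keys x"
            hence "keys ka \<subseteq> {..d}" using x mpolys_keys[of x R "{..d}"] unfolding Yi_def B_def by blast
            with ka have "keys ka = {}" unfolding lessThan_Suc_atMost by blast
            with False show False by (auto simp: in_keys_iff poly_mapping_eq_iff fun_eq_iff)
          qed
          thus ?thesis using False submod_zero[OF submod_J]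
            by (simp add: const_mult[symmetric] lookup_minus coef_const in_keys_iff)
        qed
        moreover have "x - const (f r) * const c \<in> B"
          using x w f_R[of r] step.hyps
          by (intro sB.diff sB.mult const_B) (auto simp: Yi_def)
        ultimately show ?thesis by (simp add: Yi_def)
      qed
      thus "x \<in> msum (Yi (Suc d) (J r)) ((*) (const (f r)) ` B)"
        using msumI[of "x - const (f r) * const c" _ "const (f r) * const c" "(*) (const (f r)) ` B"] const_B[OF w(2)]
        by auto
    next
      fix x assume "x \<in> msum (Yi (Suc d) (J r)) ((*) (const (f r)) ` B)"
      then obtain x0 b where x: "x0 \<in> Yi (Suc d) (J r)" "b \<in> B" "x = x0 + const (f r) * b" by (auto simp: msum_def)
      have "coef x ka \<in> J (Suc r)" if "keys ka \<inter> {..<Suc d} = {}" for ka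
        unfolding J_Suc x(3) lookup_add coef_const_mult
        using x(1,2) that mpolys_coef[of b R "{..d}" ka]
        by (intro CollectI exI[of _ "coef x0 ka"] exI[of _ "coef b ka"]) (auto simp: Yi_def mult.commute B_def)
      moreover have "x \<in> B" unfolding x(3) using x(1,2) f_R[of r] step.hyps
        by (intro sB.add sB.mult const_B) (auto simp: Yi_def)
      ultimately show "x \<in> Yi (Suc d) (J (Suc r))" by (simp add: Yi_def)
    qed
    ultimately have 1: "van y m (Suc q') B (msum (Yi (Suc d) (J r)) ((*) (const (f r)) ` B))" by simp
    show ?case
    proof (rule K.van_regular[OF submod_self[OF subr_B] submod_Yi[OF submod_J] _ const_f_in_gen _ 1])
      show "Yi (Suc d) (J r) \<subseteq> B" by (auto simp: Yi_def)
      show "r < d" using step.hyps by simp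
      show "x \<in> Yi (Suc d) (J r)" if "x \<in> B" "const (f r) * x \<in> Yi (Suc d) (J r)" for x
        using that regular[OF `r < d`] mpolys_coef[of x R "{..d}"]
        by (auto simp: Yi_def coef_const_mult B_def J_def)
    qed
  qed simp
  moreover have "van y m (q + Suc d + (d - r)) B (Yi (Suc d) (J d))"
    using assms by (intro K.van_vacuous submod_self subr_B) simp
  ultimately show "van y m (q + Suc d) B (Yi (Suc d) (J r))" by blast
qed

section \<open>Colon ideals and the successive quotients of the ideals \<open>M r\<close>\<close>

definition colon :: "nat \<Rightarrow> 'a set" where "colon r = {c \<in> R. c * f r \<in> J r}"

lemma submod_colon: "submod R (colon r)"
  unfolding colon_def using submod_J[of r] add mult
  by (intro submodI) (auto simp: submod_zero submod_add submod_mult distrib_right mult.assoc)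

lemma colon_eq_J: "r < d \<Longrightarrow> colon r = J r"
  unfolding colon_def using regular[of r] J_subset[of r] submod_mult[OF submod_J _, of "f r" _ r] f_R[of r]
  by (auto simp: J_def mult.commute)

lemma J_subset_colon: "r \<le> d \<Longrightarrow> J r \<subseteq> colon r"
  unfolding colon_def using J_subset[of r] submod_mult[OF submod_J _, of "f r" _ r] f_R[of r]
  by (auto simp: mult.commute)

text \<open>Below \<open>d\<close>, regularity makes the colon ideal equal to \<open>J r\<close>.
  For \<open>r = d\<close> the general bound for ideals of \<open>R\<close> is just
  sufficient.\<close>

lemma van_colon:
  assumes "r \<le> d" "q > r" shows "van y m q B (mpolys (colon r) {..d})"
proof (cases "r = d")
  case True
  thus ?thesis using assms submod_colon by (intro van_ideal) (auto simp: colon_def)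
next
  case False
  thus ?thesis using assms van_J colon_eq_J[of r] by simp
qed

text \<open>Multiplication by \<open>T r - f r t\<close> maps \<open>(J r : f r) B / M r\<close> isomorphically to \<open>M (Suc r) / M r\<close>.\<close>

lemma van_M_transfer:
  assumes r: "r \<le> d" and v: "van y m q (mpolys (colon r) {..d}) (M r)"
  shows "van y m q (M (Suc r)) (M r)"
proof -
  define w where "w = ([:var r:] :: (nat, 'a) mpoly poly) - [:0, const (f r):]"
  \<comment> \<open>Multiplication by \<open>w\<close>, read in the domain that contains
    \<open>B / M r\<close>. As representatives are determined only modulo \<open>M r\<close>, it is
    handled as a relation.\<close>
  define Phi where "Phi x' x \<longleftrightarrow> x' \<in> B \<and> x \<in> B \<and> emb r x = w * emb r x'" for x' x
  have "coeff w 0 = var r" by (simp add: w_def)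
  moreover have "coef (var r :: (nat, 'a) mpoly) (single r 1) = 1" unfolding var_def by (rule lookup_single_eq)
  hence "var r \<noteq> (0 :: (nat, 'a) mpoly)" by auto
  ultimately have w0: "w \<noteq> 0" by auto
  have sub: "submod B (mpolys (colon r) {..d})"
    unfolding B_def by (rule submod_mpolys[OF subr_axioms submod_colon])
  have colon_B: "mpolys (colon r) {..d} \<subseteq> B" unfolding B_def by (rule mpolys_mono) (auto simp: colon_def)
  have M_B: "M k \<subseteq> B" if "k \<le> Suc d" for k
    unfolding M_def lin_def using that
    by (intro gen_least submod_self subr_B) (auto intro!: sB.sum sB.mult const_B var_B simp: syz_def)
  \<comment> \<open>The combination of the first \<open>r\<close> elements equals minus the last
    term, so the image of a linear relation is \<open>w\<close> times its last coefficient.\<close>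
  have emb_c: "emb r (lin (Suc r) a) = w * [:const (a r):]" if "syz (Suc r) a" for a
  proof -
    have "(\<Sum>l<r. a l * f l) = - (a r * f r)" using that by (simp add: syz_def eq_neg_iff_add_eq_0)
    moreover have "lin (Suc r) a = lin r a + const (a r) * var r" by (simp add: lin_def)
    ultimately have "emb r (lin (Suc r) a) = [:0, const (- (a r * f r)):] + [:const (a r):] * [:var r:]"
      by (simp add: rhom.h_add[OF rhom_emb] rhom.h_mult[OF rhom_emb] emb_lin emb_const emb_var)
    thus ?thesis by (simp add: w_def const_minus const_mult algebra_simps)
  qed
  show ?thesis
  proof (rule K.van_transfer[of "M (Suc r)" "mpolys (colon r) {..d}" Phi "M r"])
    show add: "Phi (x' + u') (x + u)" if "Phi x' x" "Phi u' u" for x' x u' u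
      using that by (auto simp: Phi_def sB.add rhom.h_add[OF rhom_emb] distrib_left)
    show mult: "Phi (b * x') (b * x)" if "b \<in> B" "Phi x' x" for b x' x
      using that by (auto simp: Phi_def sB.mult rhom.h_mult[OF rhom_emb])
    have zero: "Phi 0 0" by (simp add: Phi_def sB.zero rhom.h_zero[OF rhom_emb])
    show "\<exists>x'\<in>mpolys (colon r) {..d}. Phi x' x" if "x \<in> M (Suc r)" for x
    proof -
      have "submod B {x. \<exists>x'\<in>mpolys (colon r) {..d}. Phi x' x}"
        using zero add mult sub by (intro submodI) (auto simp: submod_def; blast)+
      moreover have "\<exists>x'\<in>mpolys (colon r) {..d}. Phi x' (lin (Suc r) a)" if a: "syz (Suc r) a" for a
      proof (rule bexI[of _ "const (a r)"])
        have ar: "a r \<in> R" using a by (simp add: syz_def)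
        have "a r * f r = (\<Sum>l<r. - a l * f l)"
          using a by (simp add: syz_def sum_negf eq_neg_iff_add_eq_0 add.commute)
        hence "a r * f r \<in> J r" using a uminus unfolding J_iff syz_def by (intro exI[of _ "\<lambda>l. - a l"]) auto
        hence "a r \<in> colon r" using ar by (simp add: colon_def)
        thus "const (a r) \<in> mpolys (colon r) {..d}" using submod_zero[OF submod_colon] by (intro const_mpolys) auto
        have "lin (Suc r) a \<in> B" using lin_in_M[OF a] M_B r by auto
        thus "Phi (const (a r)) (lin (Suc r) a)" using emb_c[OF a] const_B[OF ar] by (simp add: Phi_def emb_const)
      qed
      ultimately have "M (Suc r) \<subseteq> {x. \<exists>x'\<in>mpolys (colon r) {..d}. Phi x' x}"
        unfolding M_def[of "Suc r"] by (intro gen_least) auto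
      thus ?thesis using that by blast
    qed
    show "\<exists>x\<in>M (Suc r). Phi x' x" if "x' \<in> mpolys (colon r) {..d}" for x'
      using that
    proof (induction rule: mpolys_expand_induct)
      case zero
      thus ?case using `Phi 0 0` submod_zero[OF submod_M] by blast
    next
      case (add p q)
      thus ?case using `\<And>x' x u' u. Phi x' x \<Longrightarrow> Phi u' u \<Longrightarrow> Phi (x' + u') (x + u)` submod_add[OF submod_M] by blast
    next
      case (single ka c)
      then obtain b where b: "\<forall>l<r. b l \<in> R" "c * f r = (\<Sum>l<r. b l * f l)" and c: "c \<in> R"
        unfolding colon_def J_iff by auto
      define a where "a l = (if l = r then c else - b l)" for l
      have "(\<Sum>l<r. a l * f l) = (\<Sum>l<r. - (b l * f l))" unfolding a_def by (rule sum.cong) auto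
      hence a: "syz (Suc r) a" "a r = c"
        using b c uminus by (auto simp: syz_def a_def sum_negf)
      have ka: "single ka 1 \<in> B" using single(3) unfolding B_def by (intro single_mpolys) auto
      have "Phi (const c) (lin (Suc r) a)"
        using emb_c[OF a(1)] const_B[OF c] lin_in_M[OF a(1)] M_B r by (auto simp: Phi_def emb_const a(2))
      hence "Phi (single ka 1 * const c) (single ka 1 * lin (Suc r) a)" by (rule mult[OF ka])
      moreover have "single ka 1 * const c = single ka c" by (simp add: const_def mult_single)
      ultimately show ?case using submod_mult[OF submod_M ka lin_in_M[OF a(1)]] by auto
    qed
    show "x' \<in> M r \<longleftrightarrow> x \<in> M r" if "Phi x' x" for x' x
      using that linear_type[OF r] emb_M w0 unfolding Phi_def by (metis mult_eq_0_iff)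
    show "van y m q (mpolys (colon r) {..d}) (M r)" by (rule v)
  qed (use sub submod_M in auto)
qed

lemma M_subset_B: "r \<le> Suc d \<Longrightarrow> M r \<subseteq> B"
  unfolding M_def lin_def
  by (intro gen_least submod_self subr_B)
    (auto intro!: sB.sum sB.mult const_B var_B simp: syz_def)

text \<open>For \<open>r = 1\<close> the ideal is 0, since a single regular element has only the
  trivial relation. In the step, \<open>B / colon r B\<close> and \<open>B / M r\<close> give
  vanishing for \<open>colon r B / M r\<close> from degree \<open>r\<close> on; this module is
  isomorphic to \<open>M (Suc r) / M r\<close>, and passing to \<open>B / M (Suc r)\<close> costs
  one degree.\<close>

lemma van_M:
  assumes "1 \<le> r" "r \<le> Suc d" "q \<ge> r" shows "van y m q B (M r)"
  using assms
proof (induction r arbitrary: q rule: dec_induct)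
  case base
  have "J 0 = {0}" using J_iff[of _ 0] by auto
  hence "x = 0" if "x \<in> mpolys (J 0) {..d}" for x :: "(nat, 'a) mpoly"
    using mpolys_coef[OF that] by (intro poly_mapping_eqI) simp
  hence "mpolys (J 0) {..d} = {0}"
    using submod_zero[OF submod_mpolys[OF subr_axioms submod_J]] by blast
  moreover have "M 1 = {0}"
  proof -
    have "lin 1 a = 0" if "syz 1 a" for a
    proof -
      have "f 0 * a 0 = 0" "a 0 \<in> R" using that by (auto simp: syz_def mult.commute)
      hence "a 0 \<in> J 0" using regular[of 0 "a 0"] d_pos `J 0 = {0}` by (simp add: J_def)
      thus ?thesis using `J 0 = {0}` by (simp add: lin_def)
    qed
    hence "M 1 \<subseteq> {0}" unfolding M_def by (intro gen_least submod_zero_set) auto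
    thus ?thesis using submod_zero[OF submod_M] by blast
  qed
  ultimately show ?case using van_J[of 0 q] base by simp
next
  case (step r)
  have r: "r \<le> d" "1 \<le> r" using step by auto
  have sub: "submod B (mpolys (colon r) {..d})"
    unfolding B_def by (rule submod_mpolys[OF subr_axioms submod_colon])
  have colon_B: "mpolys (colon r) {..d} \<subseteq> B" unfolding B_def by (rule mpolys_mono) (auto simp: colon_def)
  have "M r \<subseteq> mpolys (colon r) {..d}"
    using M_subset_JB[OF r(1)] mpolys_mono[OF J_subset_colon[OF r(1)]] by blast
  obtain p where p: "q = Suc p" "p \<ge> r" using step.prems by (cases q) auto
  have "van y m p (mpolys (colon r) {..d}) (M r)"
    using van_colon[OF r(1), of "Suc p"] step.IH[of p] p r
    by (intro K.van_sub[OF submod_self[OF subr_B] sub submod_M `M r \<subseteq> _` colon_B]) auto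
  hence "van y m p (M (Suc r)) (M r)" by (rule van_M_transfer[OF r(1)])
  moreover have "van y m (Suc p) B (M r)" using p(2) r by (intro step.IH) auto
  ultimately show ?case
    unfolding p(1) using r M_mono[of r "Suc r"] M_subset_B[of "Suc r"]
      K.van_quot[OF submod_self[OF subr_B] submod_M[of "Suc r"] submod_M[of r], of p] by simp
qed

end

section \<open>Counting monomials\<close>

definition Mon :: "nat \<Rightarrow> nat \<Rightarrow> (nat \<Rightarrow>\<^sub>0 nat) set" where
  "Mon m n = {mu. keys mu \<subseteq> {..<m} \<and> deg mu = n}"

lemma lessThan_Suc_split:
  fixes mu :: "nat \<Rightarrow>\<^sub>0 nat"
  assumes "keys mu \<subseteq> {..<Suc m}"
  obtains nu where "mu = nu + single m (coef mu m)" "keys nu \<subseteq> {..<m}" "deg mu = deg nu + coef mu m"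
proof -
  define nu where "nu = filt (\<lambda>v. v \<noteq> m) mu"
  have eq: "mu = nu + single m (coef mu m)"
    by (rule poly_mapping_eqI) (simp add: nu_def coef_filt lookup_add lookup_single when_def)
  moreover have "keys nu \<subseteq> {..<m}" using assms by (auto simp: nu_def keys_filt less_Suc_eq)
  moreover have "deg mu = deg nu + coef mu m" using arg_cong[OF eq, of deg] by simp
  ultimately show thesis by (rule that)
qed

lemma add_single_inj:
  fixes mu mu' :: "nat \<Rightarrow>\<^sub>0 nat"
  assumes "mu + single m a = mu' + single m a'" "keys mu \<subseteq> {..<m}" "keys mu' \<subseteq> {..<m}"
  shows "a = a' \<and> mu = mu'"
proof -
  have "coef mu m = 0" "coef mu' m = 0" using assms(2,3) by (auto simp: in_keys_iff)
  hence "a = a'" using arg_cong[OF assms(1), of "\<lambda>mu. coef mu m"] by (simp add: lookup_add)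
  thus ?thesis using assms(1) by simp
qed

lemma finite_Mon [simp]: "finite (Mon m n)"
proof (induction m arbitrary: n)
  case 0
  have "Mon 0 n \<subseteq> {0}" by (auto simp: Mon_def)
  thus ?case using finite_subset by blast
next
  case (Suc m)
  have "Mon (Suc m) n \<subseteq> (\<Union>a\<le>n. (\<lambda>nu. nu + single m a) ` Mon m (n - a))"
  proof
    fix mu assume "mu \<in> Mon (Suc m) n"
    hence mu: "keys mu \<subseteq> {..<Suc m}" "deg mu = n" by (auto simp: Mon_def)
    obtain nu where nu: "mu = nu + single m (coef mu m)" "keys nu \<subseteq> {..<m}" "deg mu = deg nu + coef mu m"
      using lessThan_Suc_split[OF mu(1)] .
    hence "nu \<in> Mon m (n - coef mu m)" "coef mu m \<le> n" using mu by (auto simp: Mon_def)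
    thus "mu \<in> (\<Union>a\<le>n. (\<lambda>nu. nu + single m a) ` Mon m (n - a))" using nu(1) by blast
  qed
  thus ?case using Suc by (auto intro: finite_subset)
qed

lemma Mon_0: "Mon m 0 = {0}"
  by (auto simp: Mon_def)

text \<open>Pascal's rule: a monomial of positive degree either avoids the last variable or is
  divisible by it.\<close>

lemma card_Mon_Suc: "card (Mon (Suc m) (Suc n)) = card (Mon m (Suc n)) + card (Mon (Suc m) n)"
proof -
  have "Mon (Suc m) (Suc n) = Mon m (Suc n) \<union> (\<lambda>mu. mu + single m 1) ` Mon (Suc m) n"
  proof (intro subset_antisym subsetI)
    fix mu assume "mu \<in> Mon (Suc m) (Suc n)"
    hence mu: "keys mu \<subseteq> {..<Suc m}" "deg mu = Suc n" by (auto simp: Mon_def)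
    obtain nu where nu: "mu = nu + single m (coef mu m)" "keys nu \<subseteq> {..<m}" "deg mu = deg nu + coef mu m"
      using lessThan_Suc_split[OF mu(1)] .
    show "mu \<in> Mon m (Suc n) \<union> (\<lambda>mu. mu + single m 1) ` Mon (Suc m) n"
    proof (cases "coef mu m")
      case 0
      hence "mu \<in> Mon m (Suc n)" using nu mu by (auto simp: Mon_def)
      thus ?thesis by blast
    next
      case (Suc a)
      hence "mu = (nu + single m a) + single m 1"
        using nu(1) by (simp add: single_add[symmetric] add.assoc)
      moreover have "nu + single m a \<in> Mon (Suc m) n"
        using nu mu Suc by (auto simp: Mon_def keys_plus_nat split: if_splits)
      ultimately show ?thesis by blast
    qed
  qed (auto simp: Mon_def keys_plus_nat)
  moreover have "Mon m (Suc n) \<inter> (\<lambda>mu. mu + single m 1) ` Mon (Suc m) n = {}"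
    by (auto simp: Mon_def keys_plus_nat)
  moreover have "card ((\<lambda>mu. mu + single m 1) ` Mon (Suc m) n) = card (Mon (Suc m) n)"
    by (rule card_image) (auto intro: inj_onI)
  ultimately show ?thesis by (simp add: card_Un_disjoint)
qed

lemma card_Mon: "card (Mon (Suc m) n) = (n + m) choose m"
proof (induction m arbitrary: n)
  case 0
  show ?case
  proof (induction n)
    case (Suc n)
    have "Mon 0 (Suc n) = {}" by (auto simp: Mon_def)
    thus ?case using Suc by (simp add: card_Mon_Suc)
  qed (simp add: Mon_0)
next
  case (Suc m)
  show ?case
  proof (induction n)
    case (Suc n)
    have "card (Mon (Suc (Suc m)) (Suc n)) = ((Suc n + m) choose m) + ((n + Suc m) choose Suc m)"
      unfolding card_Mon_Suc[of "Suc m"] using Suc `\<And>n. card (Mon (Suc m) n) = (n + m choose m)` by simp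
    thus ?case by simp
  qed (simp add: Mon_0)
qed

subsection \<open>Dickson's lemma\<close>

lemma nat_seq_mono_subseq:
  fixes s :: "nat \<Rightarrow> nat" obtains r :: "nat \<Rightarrow> nat" where "strict_mono r" "mono (s \<circ> r)"
proof -
  obtain g :: "nat \<Rightarrow> nat" where g: "strict_mono g" "monoseq (\<lambda>n. s (g n))" using seq_monosub by blast
  show thesis
  proof (cases "mono (s \<circ> g)")
    case True thus thesis using that g by blast
  next
    case False
    hence dec: "s (g n) \<le> s (g m)" if "m \<le> n" for m n
      using g(2) that by (auto simp: monoseq_def mono_def)
    \<comment> \<open>A decreasing sequence of natural numbers is constant from a place
      \<open>N\<close> of its minimum on, and a constant sequence is monotone.\<close>
    define N where "N = (ARG_MIN (\<lambda>n. s (g n)) n. True)"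
    have min: "s (g N) \<le> s (g n)" for n unfolding N_def by (rule arg_min_nat_le) simp
    have "s (g (N + n)) = s (g N)" for n using dec[of N "N + n"] min[of "N + n"] by simp
    moreover have "strict_mono (\<lambda>n. g (N + n))" using g(1) by (simp add: strict_mono_def)
    ultimately show thesis by (intro that[of "\<lambda>n. g (N + n)"]) (auto simp: mono_def)
  qed
qed

lemma dickson_subseq:
  fixes s :: "nat \<Rightarrow> nat \<Rightarrow>\<^sub>0 nat"
  obtains r :: "nat \<Rightarrow> nat" where "strict_mono r" "\<And>v. v < m \<Longrightarrow> mono (\<lambda>k. coef (s (r k)) v)"
proof -
  have "\<exists>r :: nat \<Rightarrow> nat. strict_mono r \<and> (\<forall>v<m. mono (\<lambda>k. coef (s (r k)) v))"
  proof (induction m)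
    case 0
    have "strict_mono (id :: nat \<Rightarrow> nat)" by (simp add: strict_mono_def)
    thus ?case by blast
  next
    case (Suc m)
    then obtain r :: "nat \<Rightarrow> nat" where r: "strict_mono r" "\<forall>v<m. mono (\<lambda>k. coef (s (r k)) v)" by blast
    obtain r' :: "nat \<Rightarrow> nat" where r': "strict_mono r'" "mono ((\<lambda>k. coef (s (r k)) m) \<circ> r')"
      using nat_seq_mono_subseq[of "\<lambda>k. coef (s (r k)) m"] .
    have "mono r'" using r'(1) by (rule strict_mono_mono)
    hence "mono (\<lambda>k. coef (s (r (r' k))) v)" if "v < Suc m" for v
      using r(2) r'(2) that by (cases "v = m") (auto simp: mono_def)
    moreover have "strict_mono (r \<circ> r')" using r(1) r'(1) by (simp add: strict_mono_def)
    ultimately show ?case by (intro exI[of _ "r \<circ> r'"]) (auto simp: o_def)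
  qed
  thus thesis using that by blast
qed

text \<open>Along a subsequence on which every exponent is monotone, the first member divides the
  second.\<close>

lemma dickson:
  fixes s :: "nat \<Rightarrow> nat \<Rightarrow>\<^sub>0 nat"
  assumes "\<And>i. keys (s i) \<subseteq> {..<m}"
  obtains i j nu where "i < j" "s j = s i + nu" "keys nu \<subseteq> {..<m}"
proof -
  obtain r :: "nat \<Rightarrow> nat" where r: "strict_mono r" "\<And>v. v < m \<Longrightarrow> mono (\<lambda>k. coef (s (r k)) v)"
    by (rule dickson_subseq[of m s]) (rule that)
  have "coef (s (r 0)) v \<le> coef (s (r 1)) v" for v
  proof (cases "v < m")
    case True thus ?thesis using r(2)[OF True] by (auto simp: mono_def)
  next
    case False hence "v \<notin> keys (s (r 0))" using assms[of "r 0"] by auto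
    thus ?thesis by (simp add: in_keys_iff)
  qed
  hence eq: "s (r 1) = s (r 0) + (s (r 1) - s (r 0))"
    by (intro poly_mapping_eqI) (simp add: lookup_add lookup_minus)
  moreover have "keys (s (r 1) - s (r 0)) \<subseteq> {..<m}" using assms[of "r 1"] arg_cong[OF eq, of keys] by (simp add: keys_plus_nat)
  moreover have "r 0 < r 1" using r(1) by (simp add: strict_mono_def)
  ultimately show thesis using that by blast
qed

text \<open>\<open>F\<close> consists of the minimal elements for divisibility; an infinite set of
  them would contain a comparable pair. That minimal divisors exist follows by induction on the
  degree.\<close>

lemma dickson_basis:
  assumes "\<And>mu. mu \<in> G \<Longrightarrow> keys mu \<subseteq> {..<m::nat}"
  obtains F where "finite F" "F \<subseteq> G" "\<And>mu. mu \<in> G \<Longrightarrow> \<exists>phi\<in>F. \<exists>nu. keys nu \<subseteq> {..<m} \<and> mu = phi + (nu :: nat \<Rightarrow>\<^sub>0 nat)"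
proof -
  define F where "F = {mu\<in>G. \<forall>phi\<in>G. \<forall>nu. mu = phi + nu \<longrightarrow> nu = 0}"
  have "finite F"
  proof (rule ccontr)
    assume "infinite F"
    then obtain s :: "nat \<Rightarrow> nat \<Rightarrow>\<^sub>0 nat" where s: "inj s" "range s \<subseteq> F"
      using infinite_countable_subset by blast
    hence "keys (s i) \<subseteq> {..<m}" for i using assms by (auto simp: F_def image_subset_iff)
    then obtain i j nu where ij: "i < j" "s j = s i + nu" by (rule dickson)
    hence "nu = 0" using s(2) by (auto simp: F_def image_subset_iff)
    thus False using ij s(1) by (auto dest: injD)
  qed
  moreover have "\<exists>phi\<in>F. \<exists>nu. keys nu \<subseteq> {..<m} \<and> mu = phi + nu" if "mu \<in> G" for mu
    using that
  proof (induction "deg mu" arbitrary: mu rule: less_induct)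
    case less
    show ?case
    proof (cases "mu \<in> F")
      case True thus ?thesis by (intro bexI[of _ mu] exI[of _ 0]) auto
    next
      case False
      then obtain phi nu where phi: "phi \<in> G" "mu = phi + nu" "nu \<noteq> 0" using less.prems by (auto simp: F_def)
      hence "deg phi < deg mu" by (auto simp: zero_less_iff_neq_zero)
      then obtain \<psi> nu' where "\<psi> \<in> F" "keys nu' \<subseteq> {..<m}" "phi = \<psi> + nu'" using less.hyps phi(1) by blast
      moreover have "keys nu \<subseteq> {..<m}" using assms[OF less.prems] phi(2) by (auto simp: keys_plus_nat)
      ultimately show ?thesis using phi(2)
        by (intro bexI[of _ \<psi>] exI[of _ "nu' + nu"]) (auto simp: keys_plus_nat add.assoc)
    qed
  qed
  moreover have "F \<subseteq> G" by (auto simp: F_def)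
  ultimately show thesis using that by blast
qed

subsection \<open>Eventually polynomial functions\<close>

definition evpoly :: "(nat \<Rightarrow> nat) \<Rightarrow> bool" where
  "evpoly g \<longleftrightarrow> (\<exists>P :: real poly. \<forall>\<^sub>F n in sequentially. real (g n) = poly P (real n))"

lemma evpoly_const: "evpoly (\<lambda>_. c)"
  unfolding evpoly_def by (rule exI[of _ "[:real c:]"]) simp

lemma evpoly_add: "evpoly g \<Longrightarrow> evpoly g' \<Longrightarrow> evpoly (\<lambda>n. g n + g' n)"
proof -
  assume "evpoly g" "evpoly g'"
  then obtain P P' :: "real poly" where
    "\<forall>\<^sub>F n in sequentially. real (g n) = poly P (real n)"
    "\<forall>\<^sub>F n in sequentially. real (g' n) = poly P' (real n)" by (auto simp: evpoly_def)
  hence "\<forall>\<^sub>F n in sequentially. real (g n + g' n) = poly (P + P') (real n)"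
    by eventually_elim simp
  thus ?thesis unfolding evpoly_def by blast
qed

lemma evpoly_sum: "(\<And>i. i \<in> S \<Longrightarrow> evpoly (g i)) \<Longrightarrow> evpoly (\<lambda>n. \<Sum>i\<in>S. g i n)"
  by (induction S rule: infinite_finite_induct) (auto intro: evpoly_const evpoly_add)

lemma evpoly_cong: "\<forall>\<^sub>F n in sequentially. g n = g' n \<Longrightarrow> evpoly g \<longleftrightarrow> evpoly g'"
  unfolding evpoly_def by (intro ex_cong1 eventually_subst) (auto elim: eventually_mono)

lemma evpoly_shift:
  assumes "evpoly g" shows "evpoly (\<lambda>n. g (n - a))"
proof -
  obtain P :: "real poly" where "\<forall>\<^sub>F n in sequentially. real (g n) = poly P (real n)"
    using assms by (auto simp: evpoly_def)
  then obtain N where N: "real (g n) = poly P (real n)" if "n \<ge> N" for n by (auto simp: eventually_sequentially)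
  have "real (g (n - a)) = poly (pcompose P [:- real a, 1:]) (real n)" if "n \<ge> N + a" for n
    using N[of "n - a"] that by (simp add: poly_pcompose of_nat_diff)
  thus ?thesis unfolding evpoly_def eventually_sequentially by blast
qed

text \<open>The expansion of \<open>(x + 1) ^ Suc k - x ^ Suc k\<close> is
  \<open>Suc k * x ^ k\<close> plus multiples of lower powers, whose antidifferences are known by
  induction.\<close>

lemma power_antidifference: "\<exists>Q :: real poly. \<forall>x. poly Q (x + 1) - poly Q x = x ^ k"
proof (induction k rule: less_induct)
  case (less k)
  then obtain Q :: "nat \<Rightarrow> real poly" where Q: "\<And>i x. i < k \<Longrightarrow> poly (Q i) (x + 1) - poly (Q i) x = x ^ i"
    by metis
  define C where "C i = real (Suc k choose i)" for i
  let ?Q = "Polynomial.smult (1 / real (Suc k)) (monom 1 (Suc k) - (\<Sum>i<k. Polynomial.smult (C i) (Q i)))"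
  have "poly ?Q (x + 1) - poly ?Q x = x ^ k" for x
  proof -
    have "(x + 1) ^ Suc k = (\<Sum>i\<le>Suc k. C i * x ^ i)"
      using binomial_ring[of x 1 "Suc k"] by (simp add: C_def)
    also have "\<dots> = (\<Sum>i<k. C i * x ^ i) + real (Suc k) * x ^ k + x ^ Suc k"
      by (simp add: lessThan_Suc_atMost[symmetric] C_def binomial_Suc_n)
    also have "(\<Sum>i<k. C i * x ^ i) = (\<Sum>i<k. C i * poly (Q i) (x + 1)) - (\<Sum>i<k. C i * poly (Q i) x)"
      unfolding sum_subtractf[symmetric] by (rule sum.cong) (auto simp: Q[symmetric] algebra_simps)
    finally have "poly (monom 1 (Suc k) - (\<Sum>i<k. Polynomial.smult (C i) (Q i))) (x + 1)
        - poly (monom 1 (Suc k) - (\<Sum>i<k. Polynomial.smult (C i) (Q i))) x = real (Suc k) * x ^ k"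
      by (simp add: poly_monom poly_sum)
    hence "(1 / real (Suc k)) * (poly (monom 1 (Suc k) - (\<Sum>i<k. Polynomial.smult (C i) (Q i))) (x + 1)
        - poly (monom 1 (Suc k) - (\<Sum>i<k. Polynomial.smult (C i) (Q i))) x) = x ^ k"
      by (simp del: of_nat_Suc)
    thus ?thesis by (simp only: poly_smult right_diff_distrib)
  qed
  thus ?case by blast
qed

lemma antidifference: "\<exists>Q :: real poly. \<forall>x. poly Q (x + 1) - poly Q x = poly P x"
proof -
  obtain Q :: "nat \<Rightarrow> real poly" where Q: "\<And>k x. poly (Q k) (x + 1) - poly (Q k) x = x ^ k"
    using power_antidifference by metis
  have "poly (\<Sum>k\<le>degree P. Polynomial.smult (coeff P k) (Q k)) (x + 1) - poly (\<Sum>k\<le>degree P. Polynomial.smult (coeff P k) (Q k)) x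
      = poly P x" for x
    unfolding poly_altdef[of P] poly_sum sum_subtractf[symmetric]
    by (rule sum.cong) (auto simp: Q[symmetric] algebra_simps)
  thus ?thesis by blast
qed

lemma evpoly_cumulative:
  assumes "evpoly g" shows "evpoly (\<lambda>n. \<Sum>i<n. g i)"
proof -
  obtain P :: "real poly" where "\<forall>\<^sub>F n in sequentially. real (g n) = poly P (real n)"
    using assms by (auto simp: evpoly_def)
  then obtain N where N: "\<And>n. n \<ge> N \<Longrightarrow> real (g n) = poly P (real n)" by (auto simp: eventually_sequentially)
  obtain Q where Q: "\<And>x. poly Q (x + 1) - poly Q x = poly P x" using antidifference by blast
  have "real (\<Sum>i<n. g i) = poly (Q + [:real (\<Sum>i<N. g i) - poly Q (real N):]) (real n)" if "n \<ge> N" for n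
    using that
  proof (induction n rule: dec_induct)
    case (step n)
    thus ?case using N[of n] Q[of "real n"] by (simp add: add.commute)
  qed simp
  thus ?thesis unfolding evpoly_def eventually_sequentially by blast
qed

text \<open>Slicing by the exponent of the last variable gives a decreasing sequence of down-sets in
  one variable less, which stabilises by Dickson's lemma. The count is then a finite sum of shifted
  counts plus a cumulative sum, and both operations preserve eventual polynomiality.\<close>

lemma downset_count_evpoly:
  fixes D :: "(nat \<Rightarrow>\<^sub>0 nat) set"
  assumes "\<And>mu. mu \<in> D \<Longrightarrow> keys mu \<subseteq> {..<m}"
    and "\<And>mu nu. keys nu \<subseteq> {..<m} \<Longrightarrow> mu + nu \<in> D \<Longrightarrow> mu \<in> D"
  shows "evpoly (\<lambda>n. card {mu\<in>D. deg mu = n})"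
  using assms
proof (induction m arbitrary: D)
  case 0
  have "{mu\<in>D. deg mu = n} = {}" if "n > 0" for n using 0(1) that by fastforce
  hence "\<forall>\<^sub>F n in sequentially. card {mu\<in>D. deg mu = n} = 0"
    unfolding eventually_sequentially by (metis card.empty less_eq_Suc_le)
  from evpoly_cong[OF this] show ?case using evpoly_const[of 0] by blast
next
  case (Suc m)
  define S where "S a = {mu. keys mu \<subseteq> {..<m} \<and> mu + single m a \<in> D}" for a
  have fin: "finite {mu\<in>S a. deg mu = n}" for a n
    by (rule finite_subset[OF _ finite_Mon[of m n]]) (auto simp: S_def Mon_def)
  have dec: "S b \<subseteq> S a" if "a \<le> b" for a b
  proof
    fix mu assume mu: "mu \<in> S b"
    have "mu + single m b = mu + single m a + single m (b - a)"
      using that by (simp add: add.assoc single_add[symmetric])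
    thus "mu \<in> S a" using mu Suc.prems(2)[of "single m (b - a)" "mu + single m a"] by (auto simp: S_def)
  qed
  have down: "mu \<in> S a" if "keys nu \<subseteq> {..<m}" "mu + nu \<in> S a" for mu nu a
  proof -
    have "mu + single m a + nu \<in> D" using that by (simp add: S_def add_ac)
    moreover have "keys nu \<subseteq> {..<Suc m}" using that by auto
    ultimately show ?thesis using Suc.prems(2) that(2) by (auto simp: S_def keys_plus_nat)
  qed
  have poly: "evpoly (\<lambda>n. card {mu\<in>S a. deg mu = n})" for a
  proof (rule Suc.IH)
    show "keys mu \<subseteq> {..<m}" if "mu \<in> S a" for mu using that by (simp add: S_def)
    show "mu \<in> S a" if "keys nu \<subseteq> {..<m}" "mu + nu \<in> S a" for mu nu using down[OF that] .
  qed
  \<comment> \<open>If the slices never stabilised, a strictly shrinking subsequence would provide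
    monomials \<open>s k\<close> that are lost at step \<open>k\<close>. One of them would divide a
    later one and would have to survive as long as that one.\<close>
  have "\<exists>a0. \<forall>a\<ge>a0. S a = S a0"
  proof (rule ccontr)
    assume no: "\<not> (\<exists>a0. \<forall>a\<ge>a0. S a = S a0)"
    have "\<exists>b>a. S b \<noteq> S a" for a
    proof (rule ccontr)
      assume no': "\<not> (\<exists>b>a. S b \<noteq> S a)"
      have "S b = S a" if "b \<ge> a" for b using no' that by (cases "b = a") auto
      thus False using no by blast
    qed
    then obtain nx where nx: "\<And>a. nx a > a" "\<And>a. S (nx a) \<noteq> S a" by metis
    define q where "q k = (nx ^^ k) 0" for k
    have qS: "q (Suc k) = nx (q k)" for k by (simp add: q_def)
    have "strict_mono q" by (simp add: strict_mono_Suc_iff qS nx)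
    have "\<exists>mu. mu \<in> S (q k) \<and> mu \<notin> S (q (Suc k))" for k
      using dec[of "q k" "q (Suc k)"] nx(1)[of "q k"] nx(2)[of "q k"] by (auto simp: qS)
    then obtain s where s: "\<And>k. s k \<in> S (q k)" "\<And>k. s k \<notin> S (q (Suc k))" by metis
    have "keys (s k) \<subseteq> {..<m}" for k using s(1)[of k] by (simp add: S_def)
    then obtain i j nu where ij: "i < j" "s j = s i + nu" "keys nu \<subseteq> {..<m}" by (rule dickson)
    have "s i \<in> S (q j)" using down[OF ij(3), of "s i" "q j"] s(1)[of j] ij(2) by simp
    moreover have "q (Suc i) \<le> q j" using `strict_mono q` ij(1) by (simp add: strict_mono_less_eq)
    ultimately show False using dec s(2) by blast
  qed
  then obtain a0 where a0: "\<And>a. a \<ge> a0 \<Longrightarrow> S a = S a0" by blast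
  have split: "card {mu\<in>D. deg mu = n} = (\<Sum>a\<le>n. card {mu\<in>S a. deg mu = n - a})" for n
  proof -
    have "{mu\<in>D. deg mu = n} = (\<Union>a\<le>n. (\<lambda>mu. mu + single m a) ` {mu\<in>S a. deg mu = n - a})"
    proof (intro subset_antisym subsetI)
      fix mu assume mu: "mu \<in> {mu\<in>D. deg mu = n}"
      hence keys: "keys mu \<subseteq> {..<Suc m}" using Suc.prems(1) by blast
      obtain nu a where nu: "mu = nu + single m a" "keys nu \<subseteq> {..<m}" "deg mu = deg nu + a"
        using lessThan_Suc_split[OF keys] by blast
      hence "nu \<in> {mu\<in>S a. deg mu = n - a}" "a \<le> n" using mu by (auto simp: S_def)
      thus "mu \<in> (\<Union>a\<le>n. (\<lambda>mu. mu + single m a) ` {mu\<in>S a. deg mu = n - a})" using nu(1) by blast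
    qed (auto simp: S_def)
    hence "card {mu\<in>D. deg mu = n} = (\<Sum>a\<le>n. card ((\<lambda>mu. mu + single m a) ` {mu\<in>S a. deg mu = n - a}))"
      using fin by (simp, intro card_UN_disjoint) (auto simp: S_def dest!: add_single_inj)
    also have "\<dots> = (\<Sum>a\<le>n. card {mu\<in>S a. deg mu = n - a})"
      by (intro sum.cong refl card_image inj_onI) simp
    finally show ?thesis .
  qed
  \<comment> \<open>Finitely many slices below \<open>a0\<close>, each shifted by its exponent, and
    the stable slice summed over the remaining degrees \<open>0, \<dots>, n - a0\<close>.\<close>
  let ?g = "\<lambda>n. (\<Sum>a<a0. card {mu\<in>S a. deg mu = n - a}) + (\<Sum>b<n - a0 + 1. card {mu\<in>S a0. deg mu = b})"
  have "card {mu\<in>D. deg mu = n} = ?g n" if n: "n \<ge> a0" for n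
  proof -
    have "(\<Sum>a\<in>{a0..n}. card {mu\<in>S a. deg mu = n - a}) = (\<Sum>a\<in>{a0..n}. card {mu\<in>S a0. deg mu = n - a})"
    proof (rule sum.cong)
      fix a assume "a \<in> {a0..n}"
      hence "S a = S a0" by (intro a0) simp
      thus "card {mu\<in>S a. deg mu = n - a} = card {mu\<in>S a0. deg mu = n - a}" by simp
    qed simp
    also have "\<dots> = (\<Sum>b<n - a0 + 1. card {mu\<in>S a0. deg mu = b})"
      by (rule sum.reindex_bij_witness[of _ "\<lambda>b. n - b" "\<lambda>a. n - a"]) (use n in auto)
    finally have "(\<Sum>a\<in>{a0..n}. card {mu\<in>S a. deg mu = n - a}) = (\<Sum>b<n - a0 + 1. card {mu\<in>S a0. deg mu = b})" .
    moreover have "{..n} = {..<a0} \<union> {a0..n}" "{..<a0} \<inter> {a0..n} = {}" using n by auto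
    ultimately show ?thesis unfolding split by (simp add: sum.union_disjoint)
  qed
  hence ev: "\<forall>\<^sub>F n in sequentially. card {mu\<in>D. deg mu = n} = ?g n"
    unfolding eventually_sequentially by blast
  have "evpoly ?g"
  proof (intro evpoly_add evpoly_sum evpoly_shift[OF poly])
    have "evpoly (\<lambda>n. (\<Sum>b<n. card {mu\<in>S a0. deg mu = b}) + card {mu\<in>S a0. deg mu = n})"
      by (intro evpoly_add evpoly_cumulative poly)
    from evpoly_shift[OF this, of a0] show "evpoly (\<lambda>n. \<Sum>b<n - a0 + 1. card {mu\<in>S a0. deg mu = b})" by simp
  qed
  thus ?case using evpoly_cong[OF ev] by blast
qed

section \<open>Finitely generated algebras over a field\<close>

lemma Mon_split:
  assumes "keys mu \<subseteq> {..<m::nat}" "n \<le> deg mu"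
  obtains mu1 mu2 where "mu = mu1 + mu2" "keys mu1 \<subseteq> {..<m}" "keys mu2 \<subseteq> {..<m}" "deg mu1 = n"
proof -
  have "\<exists>mu1 mu2. mu = mu1 + mu2 \<and> keys mu1 \<subseteq> {..<m} \<and> keys mu2 \<subseteq> {..<m} \<and> deg mu1 = n"
    using assms(2)
  proof (induction n)
    case 0 thus ?case using assms(1) by (intro exI[of _ 0] exI[of _ mu]) auto
  next
    case (Suc n)
    then obtain mu1 mu2 where mu: "mu = mu1 + mu2" "keys mu1 \<subseteq> {..<m}" "keys mu2 \<subseteq> {..<m}" "deg mu1 = n" by auto
    hence "mu2 \<noteq> 0" using Suc.prems by auto
    then obtain v where v: "v \<in> keys mu2" by (metis deg_eq_0_iff deg_def sum.empty equals0I)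
    hence eq: "mu2 = single v 1 + (mu2 - single v 1)"
      by (intro poly_mapping_eqI) (auto simp: in_keys_iff lookup_add lookup_minus lookup_single when_def)
    hence "keys (mu2 - single v 1) \<subseteq> {..<m}" using mu(3) by (metis keys_plus_nat le_sup_iff)
    moreover have "mu = (mu1 + single v 1) + (mu2 - single v 1)" using mu(1) eq by (metis add.assoc)
    moreover have "keys (mu1 + single v 1) \<subseteq> {..<m}" using mu(2,3) v by (auto simp: keys_plus_nat)
    moreover have "deg (mu1 + single v 1) = Suc n" using mu(4) by simp
    ultimately show ?case by blast
  qed
  thus thesis using that by blast
qed

lemma deg_1_single:
  fixes mu :: "'v \<Rightarrow>\<^sub>0 nat"
  assumes "deg mu = 1" obtains v where "mu = single v 1"
proof -
  have "keys mu \<noteq> {}" using assms by (auto simp: deg_def)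
  then obtain v where v: "v \<in> keys mu" by blast
  hence eq: "mu = single v 1 + (mu - single v 1)"
    by (intro poly_mapping_eqI) (auto simp: in_keys_iff lookup_add lookup_minus lookup_single when_def)
  have "deg (mu - single v 1) = 0" using assms arg_cong[OF eq, of deg] unfolding deg_add deg_single by simp
  hence "mu - single v 1 = 0" by simp
  with eq have "mu = single v 1" by (metis add.right_neutral)
  thus thesis by (rule that)
qed

text \<open>Only a spanning set of monomials is recorded, so an element has no canonical leading
  monomial; the notions below work modulo spans of smaller monomials instead.\<close>

locale fg_alg = K: subf K + B: subr B for K B :: "'b::comm_ring_1 set" +
  fixes z :: "nat \<Rightarrow> 'b" and m :: nat
  assumes z_B: "\<And>v. v < m \<Longrightarrow> z v \<in> B" and K_B: "K \<subseteq> B"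
    and B_span: "B \<subseteq> gen K {mev z mu |mu. keys mu \<subseteq> {..<m}}"
begin

abbreviation mnm :: "(nat \<Rightarrow>\<^sub>0 nat) \<Rightarrow> 'b" where "mnm \<equiv> mev z"

lemma subr_K: "subr K" by (rule K.subr_axioms)
lemma subr_B: "subr B" by (rule B.subr_axioms)

lemma mnm_add: "mnm (mu + nu) = mnm mu * mnm nu"
  by (rule mev_add)

lemma mnm_0: "mnm 0 = 1"
  by (rule mev_0)

lemma mnm_B: "keys mu \<subseteq> {..<m} \<Longrightarrow> mnm mu \<in> B"
  unfolding mev_def using z_B by (intro B.prod B.power) auto

lemma submod_K: "submod B M \<Longrightarrow> submod K M"
  using submod_subset K_B by blast

subsection \<open>Hilbert's basis theorem\<close>

text \<open>Comparing degrees before exponents keeps this set finite.\<close>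

definition low :: "(nat \<Rightarrow>\<^sub>0 nat) \<Rightarrow> (nat \<Rightarrow>\<^sub>0 nat) set" where
  "low mu = {mu'. keys mu' \<subseteq> {..<m} \<and> (deg mu', mu') < (deg mu, mu)}"

lemma finite_low: "finite (low mu)"
proof -
  have "low mu \<subseteq> (\<Union>n\<le>deg mu. Mon m n)" by (auto simp: low_def Mon_def)
  thus ?thesis by (rule finite_subset) simp
qed

lemma deg_lex_add: "(deg mu', mu') < (deg mu, mu) \<Longrightarrow> (deg (mu' + nu), mu' + nu) < (deg (mu + nu), mu + (nu :: nat \<Rightarrow>\<^sub>0 nat))"
  by (auto intro: add_strict_right_mono)

lemma mnm_low: "keys nu \<subseteq> {..<m} \<Longrightarrow> x \<in> gen K (mnm ` low mu) \<Longrightarrow> mnm nu * x \<in> gen K (mnm ` low (mu + nu))"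
proof -
  assume nu: "keys nu \<subseteq> {..<m}"
  assume "x \<in> gen K (mnm ` low mu)"
  thus ?thesis
  proof (induction rule: gen.induct)
    case (step a x y)
    then obtain mu' where mu': "mu' \<in> low mu" "x = mnm mu'" by auto
    hence "mu' + nu \<in> low (mu + nu)"
      using deg_lex_add[of mu' mu nu] nu unfolding low_def by (auto simp: keys_plus_nat simp del: less_prod_simp)
    hence "a * mnm (mu' + nu) + mnm nu * y \<in> gen K (mnm ` low (mu + nu))"
      using step by (intro gen.step) auto
    thus ?case by (simp add: mu'(2) mnm_add algebra_simps)
  qed (simp add: gen.zero)
qed

text \<open>Division with respect to leading monomials: by Dickson's lemma finitely many members of
  \<open>P\<close> have leading monomials that divide all the others, and subtracting a multiple of
  one of them lowers the leading monomial. The induction counts the monomials still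
  available.\<close>

lemma hilbert_basis:
  assumes P: "submod B P" "P \<subseteq> B"
  obtains G where "finite G" "G \<subseteq> P" "P = gen B G"
proof -
  define LG where "LG = {mu. keys mu \<subseteq> {..<m} \<and> (\<exists>x\<in>P. x - mnm mu \<in> gen K (mnm ` low mu))}"
  obtain F where F: "finite F" "F \<subseteq> LG"
    "\<And>mu. mu \<in> LG \<Longrightarrow> \<exists>phi\<in>F. \<exists>nu. keys nu \<subseteq> {..<m} \<and> mu = phi + nu"
    by (rule dickson_basis[of LG m]) (auto simp: LG_def)
  have "\<exists>x\<in>P. x - mnm phi \<in> gen K (mnm ` low phi)" if "phi \<in> F" for phi using F(2) that by (auto simp: LG_def)
  then obtain x where x: "\<And>phi. phi \<in> F \<Longrightarrow> x phi \<in> P" "\<And>phi. phi \<in> F \<Longrightarrow> x phi - mnm phi \<in> gen K (mnm ` low phi)"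
    by metis
  have xP: "x ` F \<subseteq> P" using x(1) by auto
  have sub: "submod B (gen B (x ` F))" by (rule submod_gen[OF subr_B])
  have subK: "submod K (gen K S)" for S by (rule submod_gen[OF subr_K])
  have key: "p \<in> gen B (x ` F)" if "p \<in> P" "p \<in> gen K (mnm ` low mu)" for p mu
    using that
  proof (induction "card (low mu)" arbitrary: p mu rule: less_induct)
    case less
    show ?case
    proof (cases "low mu = {}")
      case True
      hence "p = 0" using less.prems(2) gen_least[OF submod_zero_set, of "{}" K] by auto
      thus ?thesis by (simp add: gen.zero)
    next
      case False
      \<comment> \<open>Isolates the largest available monomial. If its coefficient in
        \<open>p\<close> vanishes, the bound drops at once; otherwise it is a leading monomial of
        \<open>P\<close>.\<close>
      define S where "S = (\<lambda>mu. (deg mu, mu)) ` low mu"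
      have "finite S" "S \<noteq> {}" using finite_low False by (auto simp: S_def)
      hence "Max S \<in> S" by (rule Max_in)
      then obtain mu1 where mu1: "mu1 \<in> low mu" "Max S = (deg mu1, mu1)" by (auto simp: S_def)
      have max: "(deg nu, nu) \<le> (deg mu1, mu1)" if "nu \<in> low mu" for nu
        unfolding mu1(2)[symmetric] using `finite S` that by (intro Max_ge) (auto simp: S_def)
      have low1: "low mu = insert mu1 (low mu1)"
      proof (intro subset_antisym subsetI)
        fix nu assume nu: "nu \<in> low mu"
        hence "(deg nu, nu) < (deg mu1, mu1) \<or> nu = mu1"
          using max[OF nu] unfolding order_le_less by blast
        thus "nu \<in> insert mu1 (low mu1)" using nu unfolding low_def by blast
      next
        fix nu assume nu: "nu \<in> insert mu1 (low mu1)"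
        show "nu \<in> low mu"
        proof (cases "nu = mu1")
          case True thus ?thesis using mu1(1) by simp
        next
          case False
          hence "nu \<in> low mu1" using nu by simp
          thus ?thesis using mu1(1) less_trans unfolding low_def by blast
        qed
      qed
      have "mu1 \<notin> low mu1" unfolding low_def by blast
      hence card: "card (low mu1) < card (low mu)" unfolding low1 using finite_low by simp
      have "p \<in> gen K (insert (mnm mu1) (gen K (mnm ` low mu1)))"
      proof -
        have "mnm ` low mu \<subseteq> insert (mnm mu1) (gen K (mnm ` low mu1))"
          unfolding low1 using gen_superset[OF subr_K, of "mnm ` low mu1"] by auto
        thus ?thesis using less.prems(2) gen_mono[OF subr_K] by blast
      qed
      then obtain l a where l: "l \<in> gen K (mnm ` low mu1)" "a \<in> K" "p = l + a * mnm mu1"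
        unfolding gen_insert_submod[OF subr_K subK] by blast
      show ?thesis
      proof (cases "a = 0")
        case True
        thus ?thesis using less.hyps[OF card less.prems(1)] l by simp
      next
        case False
        then obtain b where b: "b \<in> K" "b * a = 1" using K.inv l(2) by blast
        have "b * p - mnm mu1 = b * l" using b(2) by (simp add: l(3) distrib_left mult.assoc[symmetric])
        hence "b * p - mnm mu1 \<in> gen K (mnm ` low mu1)" using submod_mult[OF subK b(1) l(1)] by simp
        moreover have "b * p \<in> P" using submod_mult[OF P(1) _ less.prems(1)] b(1) K_B by auto
        ultimately have "mu1 \<in> LG" using mu1(1) unfolding LG_def low_def by blast
        then obtain phi nu where phi: "phi \<in> F" "keys nu \<subseteq> {..<m}" "mu1 = phi + nu" using F(3) by blast
        let ?c = "a * mnm nu"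
        have cB: "?c \<in> B" using mnm_B[OF phi(2)] l(2) K_B by (auto intro: B.mult)
        have "p - ?c * x phi = l - a * (mnm nu * (x phi - mnm phi))"
          by (simp add: l(3) phi(3) mnm_add algebra_simps)
        also have "\<dots> \<in> gen K (mnm ` low mu1)"
          using submod_diff[OF subr_K subK l(1) submod_mult[OF subK l(2)]] mnm_low[OF phi(2) x(2)[OF phi(1)]]
          by (simp add: phi(3))
        finally have "p - ?c * x phi \<in> gen K (mnm ` low mu1)" .
        moreover have "p - ?c * x phi \<in> P"
          using less.prems(1) submod_mult[OF P(1) cB x(1)[OF phi(1)]] by (rule submod_diff[OF subr_B P(1)])
        ultimately have "p - ?c * x phi \<in> gen B (x ` F)" using less.hyps[OF card] by blast
        moreover have "?c * x phi \<in> gen B (x ` F)"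
          using gen_superset[OF subr_B, of "x ` F"] phi(1) by (intro submod_mult[OF sub cB]) auto
        ultimately show ?thesis using submod_add[OF sub, of "p - ?c * x phi" "?c * x phi"] by simp
      qed
    qed
  qed
  have "p \<in> gen B (x ` F)" if p: "p \<in> P" for p
  proof -
    have "\<exists>mu. x \<in> gen K (mnm ` low mu)" if "x \<in> gen K {mnm mu |mu. keys mu \<subseteq> {..<m}}" for x
      using that
    proof (induction rule: gen.induct)
      case zero thus ?case by (auto intro: gen.zero)
    next
      case (step a x y)
      then obtain mu mu' where mu: "x = mnm mu" "keys mu \<subseteq> {..<m}" "y \<in> gen K (mnm ` low mu')" by auto
      \<comment> \<open>Only the degree of this bound matters, which exceeds both others;
        \<open>low\<close> restricts the variables of its members and not those of the
        bound.\<close>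
      define M where "M = single (0::nat) (Suc (deg mu + deg mu'))"
      have "mu \<in> low M" using mu(2) by (simp add: low_def M_def)
      have "low mu' \<subseteq> low M" by (auto simp: low_def M_def)
      hence "y \<in> gen K (mnm ` low M)" using subsetD[OF gen_mono[OF subr_K image_mono] mu(3)] by simp
      moreover have "x \<in> mnm ` low M" using mu(1) `mu \<in> low M` by simp
      ultimately show ?case using gen.step[OF step(1)] by blast
    qed
    moreover have "p \<in> gen K {mnm mu |mu. keys mu \<subseteq> {..<m}}" using p P(2) B_span by blast
    ultimately obtain mu where "p \<in> gen K (mnm ` low mu)" by blast
    thus ?thesis by (rule key[OF p])
  qed
  hence "P \<subseteq> gen B (x ` F)" by (rule subsetI)
  moreover have "gen B (x ` F) \<subseteq> P" by (rule gen_least[OF P(1) xP])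
  ultimately have "P = gen B (x ` F)" by (rule antisym)
  thus thesis using that[of "x ` F"] F(1) xP by blast
qed

subsection \<open>Hilbert--Samuel functions are eventually polynomial\<close>

text \<open>For submodules \<open>P\<close> and \<open>L\<close> this is \<open>I ^ n P + L\<close>,
  with \<open>I\<close> the ideal of the \<open>z v\<close>.\<close>

definition Npow :: "nat \<Rightarrow> 'b set \<Rightarrow> 'b set \<Rightarrow> 'b set" where
  "Npow n P L = gen B ({mnm mu * p |mu p. mu \<in> Mon m n \<and> p \<in> P} \<union> L)"

lemma submod_Npow: "submod B (Npow n P L)"
  unfolding Npow_def by (rule submod_gen[OF subr_B])

lemma L_Npow: "L \<subseteq> Npow n P L"
  unfolding Npow_def using gen_superset[OF subr_B] by blast

lemma mnm_Npow:
  assumes "submod B P" "keys mu \<subseteq> {..<m}" "n \<le> deg mu" "p \<in> P"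
  shows "mnm mu * p \<in> Npow n P L"
proof -
  obtain mu1 mu2 where mu: "mu = mu1 + mu2" "keys mu1 \<subseteq> {..<m}" "keys mu2 \<subseteq> {..<m}" "deg mu1 = n"
    using Mon_split[OF assms(2,3)] .
  have "mnm mu2 * p \<in> P" using submod_mult[OF assms(1) mnm_B[OF mu(3)] assms(4)] .
  hence "mnm mu1 * (mnm mu2 * p) \<in> {mnm mu * p |mu p. mu \<in> Mon m n \<and> p \<in> P}" using mu by (auto simp: Mon_def)
  hence "mnm mu1 * (mnm mu2 * p) \<in> Npow n P L"
    unfolding Npow_def by (intro subsetD[OF gen_superset[OF subr_B]] UnI1)
  thus ?thesis by (simp add: mu(1) mnm_add mult.assoc)
qed

lemma mnm_mult_Npow:
  assumes "submod B P" "submod B L" "keys nu \<subseteq> {..<m}" "x \<in> Npow n P L"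
  shows "mnm nu * x \<in> Npow (n + deg nu) P L"
  using assms(4) unfolding Npow_def[of n]
proof (induction rule: gen.induct)
  case zero thus ?case by (simp add: submod_zero[OF submod_Npow])
next
  case (step a x y)
  have "mnm nu * x \<in> Npow (n + deg nu) P L"
  proof (cases "x \<in> L")
    case True
    thus ?thesis using submod_mult[OF assms(2) mnm_B[OF assms(3)]] L_Npow by blast
  next
    case False
    then obtain mu p where "x = mnm mu * p" "mu \<in> Mon m n" "p \<in> P" using step by auto
    thus ?thesis
      using mnm_Npow[OF assms(1), of "nu + mu" "n + deg nu" p] assms(3)
      by (auto simp: mnm_add mult.assoc Mon_def keys_plus_nat)
  qed
  hence "a * (mnm nu * x) + mnm nu * y \<in> Npow (n + deg nu) P L"
    using submod_add[OF submod_Npow submod_mult[OF submod_Npow step(1)] step.IH] by simp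
  thus ?case by (simp add: algebra_simps)
qed

lemma Npow_mono:
  assumes "submod B P" "submod B L" "n \<le> n'" shows "Npow n' P L \<subseteq> Npow n P L"
  unfolding Npow_def[of n']
proof (rule gen_least[OF submod_Npow], rule Un_least)
  show "L \<subseteq> Npow n P L" by (rule L_Npow)
  show "{mnm mu * p |mu p. mu \<in> Mon m n' \<and> p \<in> P} \<subseteq> Npow n P L"
    using mnm_Npow[OF assms(1)] assms(3) by (auto simp: Mon_def)
qed

lemma Npow_subset: "submod B P \<Longrightarrow> submod B L \<Longrightarrow> L \<subseteq> P \<Longrightarrow> Npow n P L \<subseteq> P"
  unfolding Npow_def by (rule gen_least) (auto simp: Mon_def intro!: submod_mult[of B P] mnm_B)

lemma Npow_0: "submod B P \<Longrightarrow> submod B L \<Longrightarrow> L \<subseteq> P \<Longrightarrow> Npow 0 P L = P"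
proof (rule antisym[OF Npow_subset])
  assume "submod B P"
  thus "P \<subseteq> Npow 0 P L" using mnm_Npow[of P 0 0] by (auto simp: mnm_0)
qed

lemma B_decompose:
  assumes "b \<in> B"
  obtains ka b' where "ka \<in> K" "b = ka + b'" "b' \<in> gen K {mnm mu |mu. keys mu \<subseteq> {..<m} \<and> 1 \<le> deg mu}"
proof -
  have "b \<in> gen K {mnm mu |mu. keys mu \<subseteq> {..<m}}" using assms B_span by auto
  hence "\<exists>ka b'. ka \<in> K \<and> b = ka + b' \<and> b' \<in> gen K {mnm mu |mu. keys mu \<subseteq> {..<m} \<and> 1 \<le> deg mu}"
  proof (induction rule: gen.induct)
    case zero show ?case by (intro exI[of _ 0]) (auto intro: gen.zero)
  next
    case (step a x y)
    then obtain ka b' mu where *: "ka \<in> K" "y = ka + b'" "b' \<in> gen K {mnm mu |mu. keys mu \<subseteq> {..<m} \<and> 1 \<le> deg mu}"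
      "x = mnm mu" "keys mu \<subseteq> {..<m}" by auto
    show ?case
    proof (cases "mu = 0")
      case True
      hence "a * x + y = (a + ka) + b'" using * by (simp add: mnm_0)
      thus ?thesis using * step(1) K.add by blast
    next
      case False
      hence "1 \<le> deg mu" by (simp add: Suc_le_eq zero_less_iff_neq_zero)
      hence "a * x + b' \<in> gen K {mnm mu |mu. keys mu \<subseteq> {..<m} \<and> 1 \<le> deg mu}"
        using * step(1) by (intro gen.step) auto
      moreover have "a * x + y = ka + (a * x + b')" using * by (simp add: add.left_commute)
      ultimately show ?thesis using *(1) by blast
    qed
  qed
  thus thesis using that by blast
qed

text \<open>The \<open>n\<close>-th graded piece of the associated graded module is spanned by the products of monomials
  of degree \<open>n\<close> with generators of \<open>P\<close>. Those that do not depend on smaller ones form a down-set.\<close>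

lemma Npow_evpoly:
  assumes P: "submod B P" and L: "submod B L" "L \<subseteq> P" and G: "finite G" "P = gen B (G \<union> L)"
  obtains l where "evpoly l" "\<And>n. len K (Npow n P L) P = enat (l n)"
proof -
  obtain g where g: "G = g ` {..<card G}"
    using ex_bij_betw_nat_finite[OF G(1)] by (metis atLeast0LessThan bij_betw_imp_surj_on)
  let ?k = "card G"
  define W where "W n = Npow n P L" for n
  define e where "e i = mnm (snd i) * g (fst i)" for i :: "nat \<times> (nat \<Rightarrow>\<^sub>0 nat)"
  define I where "I n = {..<?k} \<times> Mon m n" for n
  \<comment> \<open>Membership in the greedy basis of the \<open>n\<close>-th layer, for the order
    by generator index and then by exponent; see \<open>len_gen_linorder\<close>.\<close>
  define std where "std n i \<longleftrightarrow> e i \<notin> gen K (W (Suc n) \<union> e ` {j \<in> I n. j < i})" for n i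
  have subW: "submod B (W n)" for n unfolding W_def by (rule submod_Npow)
  have gP: "g q \<in> P" if "q < ?k" for q
    using that gen_superset[OF subr_B, of "G \<union> L"] G(2) g by auto
  have shift: "b * x \<in> W (Suc n)"
    if "b \<in> gen K {mnm mu |mu. keys mu \<subseteq> {..<m} \<and> 1 \<le> deg mu}" "x \<in> W n" for b x n
    using that(1)
  proof (induction rule: gen.induct)
    case zero thus ?case by (simp add: submod_zero[OF subW])
  next
    case (step a u y)
    then obtain mu where mu: "u = mnm mu" "keys mu \<subseteq> {..<m}" "1 \<le> deg mu" by auto
    have "mnm mu * x \<in> W (Suc n)"
      using mnm_mult_Npow[OF P L(1) mu(2) that(2)[unfolded W_def]] Npow_mono[OF P L(1), of "Suc n" "n + deg mu"] mu(3)
      by (auto simp: W_def)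
    moreover have "a \<in> B" using step(1) K_B by auto
    ultimately have "a * (u * x) + y * x \<in> W (Suc n)"
      using submod_add[OF subW submod_mult[OF subW] step.IH, of a "u * x"] mu(1) by simp
    thus ?case by (simp add: algebra_simps)
  qed
  \<comment> \<open>The span over \<open>K\<close> suffices: the part of positive degree of a
    coefficient pushes \<open>W n\<close> into \<open>W (Suc n)\<close>.\<close>
  have span: "W n = gen K (W (Suc n) \<union> e ` I n)" for n
  proof (rule antisym)
    let ?H = "gen K (W (Suc n) \<union> e ` I n)"
    have subH: "submod K ?H" by (rule submod_gen[OF subr_K])
    have supH: "W (Suc n) \<union> e ` I n \<subseteq> ?H" by (rule gen_superset[OF subr_K])
    have H_W: "?H \<subseteq> W n"
    proof (rule gen_least[OF submod_K[OF subW]])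
      have "e i \<in> W n" if "i \<in> I n" for i
        unfolding e_def W_def using that gP by (intro mnm_Npow[OF P]) (auto simp: I_def Mon_def)
      thus "W (Suc n) \<union> e ` I n \<subseteq> W n" using Npow_mono[OF P L(1), of n "Suc n"] by (auto simp: W_def)
    qed
    have subBH: "submod B ?H"
    proof (rule submodI)
      fix b x assume b: "b \<in> B" and x: "x \<in> ?H"
      obtain ka b' where ka: "ka \<in> K" "b = ka + b'" "b' \<in> gen K {mnm mu |mu. keys mu \<subseteq> {..<m} \<and> 1 \<le> deg mu}"
        using B_decompose[OF b] .
      have "b' * x \<in> ?H" using shift[OF ka(3)] x H_W supH by blast
      thus "b * x \<in> ?H"
        unfolding ka(2) distrib_right using submod_mult[OF subH ka(1) x] by (intro submod_add[OF subH])
    qed (use submod_zero[OF subH] submod_add[OF subH] in auto)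
    have gen: "mnm mu * p \<in> ?H" if mu: "mu \<in> Mon m n" and p: "p \<in> P" for mu p
      using p unfolding G(2)
    proof (induction rule: gen.induct)
      case zero thus ?case by (simp add: submod_zero[OF subH])
    next
      case (step b x y)
      have "mnm mu * x \<in> ?H"
      proof (cases "x \<in> L")
        case True
        hence "mnm mu * x \<in> L" using mu by (intro submod_mult[OF L(1)] mnm_B) (auto simp: Mon_def)
        hence "mnm mu * x \<in> W (Suc n)" using L_Npow by (auto simp: W_def)
        thus ?thesis using supH by blast
      next
        case False
        then obtain q where "q < ?k" "x = g q" using step(2) g by auto
        hence "mnm mu * x = e (q, mu)" "(q, mu) \<in> I n" using mu by (auto simp: e_def I_def)
        thus ?thesis using supH by blast
      qed
      hence "b * (mnm mu * x) + mnm mu * y \<in> ?H"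
        using submod_add[OF subBH submod_mult[OF subBH step(1)] step.IH] by simp
      thus ?case by (simp add: algebra_simps)
    qed
    have "L \<subseteq> W (Suc n)" unfolding W_def by (rule L_Npow)
    thus "W n \<subseteq> ?H"
      unfolding W_def[of n] Npow_def using supH gen by (intro gen_least[OF subBH]) auto
    show "?H \<subseteq> W n" by (rule H_W)
  qed
  have finI: "finite (I n)" for n by (simp add: I_def)
  have step: "len K (W (Suc n)) (W n) = enat (card {i \<in> I n. std n i})" for n
    using K.len_gen_linorder[OF submod_K[OF subW] finI, of "Suc n" e n]
    by (simp add: span[of n, symmetric] std_def)
  define D where "D q = {mu. keys mu \<subseteq> {..<m} \<and> std (deg mu) (q, mu)}" for q
  have "evpoly (\<lambda>n. card {mu\<in>D q. deg mu = n})" if q: "q < ?k" for q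
  proof (rule downset_count_evpoly)
    show "keys mu \<subseteq> {..<m}" if "mu \<in> D q" for mu using that by (simp add: D_def)
    \<comment> \<open>Multiplication by a monomial preserves the order of the indices and shifts the
      filtration, so a dependence at \<open>mu\<close> yields one at \<open>mu + nu\<close>.\<close>
    show "mu \<in> D q" if nu: "keys nu \<subseteq> {..<m}" and D: "mu + nu \<in> D q" for mu nu
    proof (rule ccontr)
      assume "mu \<notin> D q"
      moreover have mu: "keys mu \<subseteq> {..<m}" using D by (auto simp: D_def keys_plus_nat)
      ultimately have "e (q, mu) \<in> gen K (W (Suc (deg mu)) \<union> e ` {j \<in> I (deg mu). j < (q, mu)})"
        by (simp add: D_def std_def)
      moreover have "mnm nu * x \<in> gen K (W (Suc (deg (mu + nu))) \<union> e ` {j \<in> I (deg (mu + nu)). j < (q, mu + nu)})"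
        (is "_ \<in> gen K ?T") if "x \<in> gen K (W (Suc (deg mu)) \<union> e ` {j \<in> I (deg mu). j < (q, mu)})" for x
        using that
      proof (induction rule: gen.induct)
        case (step a u y)
        have "mnm nu * u \<in> ?T"
        proof (cases "u \<in> W (Suc (deg mu))")
          case True
          thus ?thesis using mnm_mult_Npow[OF P L(1) nu, of u "Suc (deg mu)"] by (simp add: W_def)
        next
          case False
          then obtain q' mu' where *: "u = e (q', mu')" "(q', mu') \<in> I (deg mu)" "(q', mu') < (q, mu)" using step(2) by auto
          have "(q', mu' + nu) < (q, mu + nu)" using *(3) by (auto intro: add_strict_right_mono)
          moreover have "(q', mu' + nu) \<in> I (deg (mu + nu))" using *(2) nu by (auto simp: I_def Mon_def keys_plus_nat)
          moreover have "mnm nu * u = e (q', mu' + nu)" by (simp add: *(1) e_def mnm_add mult_ac)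
          ultimately show ?thesis by blast
        qed
        hence "a * (mnm nu * u) + mnm nu * y \<in> gen K ?T" using step by (intro gen.step) auto
        thus ?case by (simp add: algebra_simps)
      qed (simp add: gen.zero)
      ultimately have "mnm nu * e (q, mu) \<in> gen K (W (Suc (deg (mu + nu))) \<union> e ` {j \<in> I (deg (mu + nu)). j < (q, mu + nu)})"
        by blast
      moreover have "mnm nu * e (q, mu) = e (q, mu + nu)" by (simp add: e_def mnm_add mult_ac)
      ultimately show False using D by (simp add: D_def std_def)
    qed
  qed
  hence ev: "evpoly (\<lambda>n. \<Sum>q<?k. card {mu\<in>D q. deg mu = n})" by (intro evpoly_sum) auto
  have "card {i \<in> I n. std n i} = (\<Sum>q<?k. card {mu\<in>D q. deg mu = n})" for n
  proof -
    have "{i \<in> I n. std n i} = (SIGMA q:{..<?k}. {mu\<in>D q. deg mu = n})" by (auto simp: I_def D_def Mon_def)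
    moreover have "finite {mu\<in>D q. deg mu = n}" for q
      by (rule finite_subset[OF _ finite_Mon[of m n]]) (auto simp: D_def Mon_def)
    ultimately show ?thesis by simp
  qed
  hence step': "len K (W (Suc n)) (W n) = enat (\<Sum>q<?k. card {mu\<in>D q. deg mu = n})" for n
    using step by simp
  have "len K (W n) P = enat (\<Sum>i<n. \<Sum>q<?k. card {mu\<in>D q. deg mu = i})" for n
  proof (induction n)
    case 0 show ?case using Npow_0[OF P L] by (simp add: W_def zero_enat_def)
  next
    case (Suc n)
    have "W (Suc n) \<subseteq> W n" "W n \<subseteq> P"
      using Npow_mono[OF P L(1), of n "Suc n"] Npow_subset[OF P L] by (auto simp: W_def)
    hence "len K (W (Suc n)) P = len K (W (Suc n)) (W n) + len K (W n) P"
      by (intro len_add subr_K submod_K subW P)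
    thus ?case using step'[of n] Suc by simp
  qed
  thus thesis using that[OF evpoly_cumulative[OF ev]] by (simp add: W_def)
qed

end

section \<open>Dimensions\<close>

context subf
begin

lemma exists_basis:
  assumes "submod A W" "submod A V" "W \<subseteq> V" "len A W V = enat k"
  obtains E where "finite E" "E \<subseteq> V" "card E = k" "V = gen A (W \<union> E)"
proof -
  have "\<exists>E. finite E \<and> E \<subseteq> V \<and> card E = k \<and> V = gen A (W \<union> E)"
    using assms(1,3,4)
  proof (induction k arbitrary: W)
    case 0
    hence "W = V" using len_pos[OF 0(1) assms(2)] by (fastforce simp: one_enat_def zero_enat_def)
    thus ?case using gen_submod[OF subr_axioms 0(1)] by (intro exI[of _ "{}"]) auto
  next
    case (Suc k)
    have "W \<noteq> V" using Suc.prems(3) by (auto simp: zero_enat_def)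
    then obtain e where e: "e \<in> V" "e \<notin> W" using Suc.prems(2) by auto
    let ?W = "gen A (insert e W)"
    have sub: "submod A ?W" by (rule submod_gen[OF subr_axioms])
    have WW: "W \<subseteq> ?W" "e \<in> ?W" using gen_superset[OF subr_axioms, of "insert e W"] by auto
    have WV: "?W \<subseteq> V" using e Suc.prems(2) by (intro gen_least assms(2)) auto
    have "len A W V = 1 + len A ?W V"
      using len_add[OF subr_axioms Suc.prems(1) sub assms(2) WW(1) WV] len_insert[OF Suc.prems(1) e(2)] by simp
    hence "len A ?W V = enat k" using Suc.prems(3) by (cases "len A ?W V") (auto simp: one_enat_def)
    then obtain E where E: "finite E" "E \<subseteq> V" "card E = k" "V = gen A (?W \<union> E)"
      using Suc.IH[OF sub WV] by blast
    have "V = gen A (W \<union> insert e E)"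
    proof (rule antisym)
      have "insert e W \<union> E \<subseteq> gen A (W \<union> insert e E)" using gen_superset[OF subr_axioms, of "W \<union> insert e E"] by auto
      hence "?W \<union> E \<subseteq> gen A (W \<union> insert e E)"
        using gen_least[OF submod_gen[OF subr_axioms], of "insert e W"] by auto
      thus "V \<subseteq> gen A (W \<union> insert e E)"
        using gen_least[OF submod_gen[OF subr_axioms], of "?W \<union> E" "W \<union> insert e E"] E(4) by auto
      show "gen A (W \<union> insert e E) \<subseteq> V" using E(2) e Suc.prems(2) by (intro gen_least assms(2)) auto
    qed
    moreover have "e \<notin> E"
    proof
      assume "e \<in> E"
      hence "?W \<union> E = ?W \<union> (E - {e})" using WW(2) by blast
      hence "V = gen A (?W \<union> (E - {e}))" using E(4) by simp
      hence "len A ?W V \<le> enat (card (E - {e}))" using E(1) by (intro len_le_card sub) auto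
      thus False using `len A ?W V = enat k` E(3) card_Diff1_less[OF E(1) `e \<in> E`] by simp
    qed
    ultimately show ?case using E e by (intro exI[of _ "insert e E"]) auto
  qed
  thus thesis using that by blast
qed

lemma len_basis:
  assumes "finite S" "submod A V" "e ` S \<subseteq> V" "V \<subseteq> gen A (e ` S)"
    and indep: "\<And>a s. (\<And>s. s \<in> S \<Longrightarrow> a s \<in> A) \<Longrightarrow> (\<Sum>s\<in>S. a s * e s) = 0 \<Longrightarrow> s \<in> S \<Longrightarrow> a s = 0"
  shows "len A {0} V = enat (card S)"
proof (rule antisym)
  have "len A {0} V \<le> enat (card (e ` S))"
    using assms(1,4) gen_mono[OF subr_axioms, of "e ` S" "{0} \<union> e ` S"]
    by (intro len_le_card submod_zero_set) auto
  also have "\<dots> \<le> enat (card S)" using card_image_le[OF assms(1)] by simp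
  finally show "len A {0} V \<le> enat (card S)" .
  show "enat (card S) \<le> len A {0} V"
  proof (rule len_ge_family[OF submod_zero_set assms(2) _ assms(1,3)])
    show "{0} \<subseteq> V" using submod_zero[OF assms(2)] by simp
    show "a s = 0" if "\<And>s. s \<in> S \<Longrightarrow> a s \<in> A" "(\<Sum>s\<in>S. a s * e s) \<in> {0}" "s \<in> S" for a s
      using indep[OF that(1) _ that(3)] that(2) by simp
  qed
qed

end

context fg_alg
begin

text \<open>Elements of \<open>B\<close> act on \<open>U / U'\<close> through their scalar part, so
  every \<open>K\<close>-subspace between \<open>U'\<close> and \<open>U\<close> is a
  \<open>B\<close>-submodule.\<close>

lemma len_layer:
  assumes "submod B U" "submod B U'" "U' \<subseteq> U" "\<And>v x. v < m \<Longrightarrow> x \<in> U \<Longrightarrow> z v * x \<in> U'"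
  shows "len B U' U = len K U' U"
proof (rule antisym)
  show "len B U' U \<le> len K U' U" by (rule len_antimono_ring[OF K_B])
  show "len K U' U \<le> len B U' U"
  proof (rule len_leI, rule chain_le_len)
    fix n c assume c: "chain K U' U c n"
    have "submod B (c i)" if "i \<le> n" for i
    proof (rule submodI)
      have ci: "submod K (c i)" "U' \<subseteq> c i" "c i \<subseteq> U" using c that by (auto simp: chain_def)
      show "0 \<in> c i" "\<And>x y. x \<in> c i \<Longrightarrow> y \<in> c i \<Longrightarrow> x + y \<in> c i"
        using submod_zero[OF ci(1)] submod_add[OF ci(1)] by auto
      have pos: "mnm mu * x \<in> U'" if h: "keys mu \<subseteq> {..<m}" "1 \<le> deg mu" "x \<in> U" for mu x
      proof -
        obtain mu1 mu2 where mu: "mu = mu1 + mu2" "keys mu1 \<subseteq> {..<m}" "keys mu2 \<subseteq> {..<m}" "deg mu1 = 1"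
          using Mon_split[OF h(1,2)] .
        obtain v where v: "mu1 = single v 1" using mu(4) by (rule deg_1_single)
        hence "mnm mu * x = mnm mu2 * (z v * x)"
          using mev_single[of z v 1] by (simp add: mu(1) mnm_add mult_ac)
        moreover have "z v * x \<in> U'" using assms(4) v mu(2) h(3) by auto
        ultimately show ?thesis using submod_mult[OF assms(2) mnm_B[OF mu(3)]] by simp
      qed
      fix b x assume b: "b \<in> B" and x: "x \<in> c i"
      obtain ka b' where ka: "ka \<in> K" "b = ka + b'" "b' \<in> gen K {mnm mu |mu. keys mu \<subseteq> {..<m} \<and> 1 \<le> deg mu}"
        using B_decompose[OF b] .
      have "b' * x \<in> U'"
        using ka(3)
      proof (induction rule: gen.induct)
        case zero thus ?case by (simp add: submod_zero[OF assms(2)])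
      next
        case (step a u y)
        hence "u * x \<in> U'" "a \<in> B" using pos x ci(3) K_B by auto
        hence "a * (u * x) + y * x \<in> U'" using submod_add[OF assms(2) submod_mult[OF assms(2)] step.IH] by simp
        thus ?case by (simp add: algebra_simps)
      qed
      thus "b * x \<in> c i"
        unfolding ka(2) distrib_right using submod_add[OF ci(1) submod_mult[OF ci(1) ka(1) x]] ci(2) by auto
    qed
    thus "chain B U' U c n" using c by (auto simp: chain_def)
  qed
qed

text \<open>Each layer of the filtration by powers is annihilated by the \<open>z v\<close>, so
  \<open>len_layer\<close> applies to it, and lengths add up.\<close>

lemma len_Npow:
  assumes "submod B P" "submod B L" "L \<subseteq> P"
  shows "len B (Npow n P L) P = len K (Npow n P L) P"
proof (induction n)
  case 0 thus ?case using Npow_0[OF assms] by simp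
next
  case (Suc n)
  have sub: "Npow (Suc n) P L \<subseteq> Npow n P L" "Npow n P L \<subseteq> P"
    using Npow_mono[OF assms(1,2), of n "Suc n"] Npow_subset[OF assms] by auto
  have "z v * x \<in> Npow (Suc n) P L" if "v < m" "x \<in> Npow n P L" for v x
    using mnm_mult_Npow[OF assms(1,2) _ that(2), of "single v 1"] that(1)
      mev_single[of z v 1] by simp
  hence "len B (Npow (Suc n) P L) (Npow n P L) = len K (Npow (Suc n) P L) (Npow n P L)"
    using sub by (intro len_layer submod_Npow) auto
  thus ?case
    using len_add[OF subr_B submod_Npow submod_Npow assms(1) sub] Suc
      len_add[OF subr_K submod_K[OF submod_Npow] submod_K[OF submod_Npow] submod_K[OF assms(1)] sub] by simp
qed

end

section \<open>Almost complete intersections\<close>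

text \<open>The ideal-theoretic data in terms of \<open>gen\<close>. That \<open>n\<close> is
  positive is derived in the final theorem from the regular sequence and the properness of its
  ideal.\<close>

locale aci =
  fixes d n :: nat and f :: "nat \<Rightarrow> (nat, 'k::field) mpoly"
  assumes d_ge: "d \<ge> 1" and n_ge: "n \<ge> 1"
    and f_in: "\<And>l. l \<le> d \<Longrightarrow> f l \<in> mpolys UNIV {..<d}"
    and f_form: "\<And>l. l \<le> d \<Longrightarrow> form n (f l)"
    and f_regular: "\<And>r c. r < d \<Longrightarrow> c \<in> mpolys UNIV {..<d} \<Longrightarrow>
      f r * c \<in> gen (mpolys UNIV {..<d}) (f ` {..<r}) \<Longrightarrow> c \<in> gen (mpolys UNIV {..<d}) (f ` {..<r})"
    and f_almost: "f d \<notin> gen (mpolys UNIV {..<d}) (f ` {..<d})"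

lemma subr_UNIV: "subr UNIV"
  by unfold_locales auto

definition K0 :: "(nat, 'k::field) mpoly set" where "K0 = range const"

lemma subf_K0: "subf (K0 :: (nat, 'k::field) mpoly set)"
proof (unfold_locales)
  show "(0 :: (nat, 'k) mpoly) \<in> K0" "(1 :: (nat, 'k) mpoly) \<in> K0"
    using const_0 const_1 unfolding K0_def by (metis rangeI)+
  fix x y :: "(nat, 'k) mpoly" assume "x \<in> K0"
  then obtain a where a: "x = const a" unfolding K0_def by auto
  thus "- x \<in> K0" unfolding K0_def by (auto simp flip: const_minus)
  show "\<exists>y\<in>K0. y * x = 1" if "x \<noteq> 0"
  proof (rule bexI[of _ "const (inverse a)"])
    have "a \<noteq> 0" using that a by auto
    thus "const (inverse a) * x = 1" unfolding a by (simp flip: const_mult)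
  qed (simp add: K0_def)
  assume "y \<in> K0"
  then obtain b where "y = const b" unfolding K0_def by auto
  thus "x + y \<in> K0" "x * y \<in> K0" using a unfolding K0_def by (auto simp flip: const_add const_mult)
qed

lemma mev_var: "mev var mu = (single mu 1 :: ('v, 'a::comm_ring_1) mpoly)"
proof -
  have "var l ^ i = (single (single l i) 1 :: ('v, 'a) mpoly)" for l i
    by (induction i) (auto simp: var_def mult_single single_add[symmetric])
  hence "mev var mu = (\<Prod>l\<in>keys mu. (single (single l (coef mu l)) 1 :: ('v, 'a) mpoly))"
    unfolding mev_def by simp
  also have "(\<Prod>l\<in>S. (single (single l (coef mu l)) 1 :: ('v, 'a) mpoly)) = single (\<Sum>l\<in>S. single l (coef mu l)) 1" for S
    by (induction S rule: infinite_finite_induct) (auto simp: mult_single)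
  finally show ?thesis using monom_expand[of mu] by simp
qed

lemma mpolys_ring_induct [consumes 2, case_names const var add mult]:
  assumes A: "subr A" and p: "p \<in> mpolys A V"
    and "\<And>a. a \<in> A \<Longrightarrow> Q (const a)" "\<And>v. v \<in> V \<Longrightarrow> Q (var v)"
    and "\<And>p q. Q p \<Longrightarrow> Q q \<Longrightarrow> Q (p + q)" "\<And>p q. Q p \<Longrightarrow> Q q \<Longrightarrow> Q (p * q)"
  shows "Q p"
  using p
proof (induction rule: mpolys_expand_induct)
  case zero show ?case using assms(3)[OF subr.zero[OF A]] by simp
next
  case (add p q) thus ?case by (rule assms(5))
next
  case (single mu c)
  have one: "Q 1" using assms(3)[OF subr.one[OF A]] by simp
  have "Q (p ^ i)" if "Q p" for p i using that one by (induction i) (auto intro: assms(6))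
  hence "Q (\<Prod>v\<in>S. var v ^ coef mu v)" if "S \<subseteq> V" for S
    using that one by (induction S rule: infinite_finite_induct) (auto intro!: assms(4,6))
  hence "Q (const c * mev var mu)"
    unfolding mev_def using single by (intro assms(3,6)) auto
  thus ?case by (simp add: mev_var const_single)
qed

text \<open>It suffices to compare two homomorphisms on constants and variables. Membership of the
  values in \<open>C\<close> is carried through the induction because the product rule multiplies
  congruences by values.\<close>

lemma rhom_congruent:
  assumes A: "subr A" and C: "subr C" and Q: "submod C Q" and F: "rhom F" "rhom F'"
    and "\<And>a. a \<in> A \<Longrightarrow> F (const a) \<in> C \<and> F' (const a) \<in> C \<and> F (const a) - F' (const a) \<in> Q"
    and "\<And>v. v \<in> V \<Longrightarrow> F (var v) \<in> C \<and> F' (var v) \<in> C \<and> F (var v) - F' (var v) \<in> Q"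
    and "p \<in> mpolys A V"
  shows "F p - F' p \<in> Q"
proof -
  have "F p \<in> C \<and> F' p \<in> C \<and> F p - F' p \<in> Q"
    using A assms(8)
  proof (induction rule: mpolys_ring_induct)
    case (add p q)
    hence "(F p - F' p) + (F q - F' q) \<in> Q" using submod_add[OF Q] by blast
    thus ?case using add subr.add[OF C] by (simp add: rhom.h_add[OF F(1)] rhom.h_add[OF F(2)] algebra_simps)
  next
    case (mult p q)
    hence "F p * (F q - F' q) + F' q * (F p - F' p) \<in> Q" using submod_add[OF Q] submod_mult[OF Q] by blast
    thus ?case using mult subr.mult[OF C] by (simp add: rhom.h_mult[OF F(1)] rhom.h_mult[OF F(2)] algebra_simps)
  qed (use assms(6,7) in auto)
  thus ?thesis by blast
qed

context aci
begin

abbreviation R :: "(nat, 'k) mpoly set" where "R \<equiv> mpolys UNIV {..<d}"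

lemma subr_R: "subr R"
  by (rule subr_mpolys[OF subr_UNIV])

lemma R_iff: "p \<in> R \<longleftrightarrow> (\<forall>mu\<in>keys p. keys mu \<subseteq> {..<d})"
  by (auto simp: mpolys_def)

lemma R_expand: "p \<in> R \<Longrightarrow> p \<in> gen K0 ((\<lambda>mu. single mu 1) ` keys p)"
proof -
  have "(\<Sum>mu\<in>keys p. const (coef p mu) * single mu 1) \<in> gen K0 ((\<lambda>mu. single mu 1) ` keys p)"
    using gen_superset[OF subf.axioms(1)[OF subf_K0], of "(\<lambda>mu. single mu 1) ` keys p"]
    by (intro submod_sum[OF submod_gen] submod_mult[OF submod_gen] subf.axioms(1)[OF subf_K0]) (auto simp: K0_def)
  thus ?thesis using monom_expand[of p] by (simp add: const_single)
qed

sublocale RR: fg_alg K0 R var d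
proof (intro fg_alg.intro subf_K0 subr_R fg_alg_axioms.intro)
  show "var v \<in> R" if "v < d" for v using that by (intro var_mpolys) auto
  show "K0 \<subseteq> R" by (auto simp: K0_def intro: const_mpolys)
  show "R \<subseteq> gen K0 {mev var mu |mu. keys mu \<subseteq> {..<d}}"
  proof
    fix p assume p: "p \<in> R"
    have "(\<lambda>mu. single mu 1) ` keys p \<subseteq> {mev var mu |mu. keys mu \<subseteq> {..<d}}"
      using p by (auto simp: R_iff mev_var)
    thus "p \<in> gen K0 {mev var mu |mu. keys mu \<subseteq> {..<d}}"
      using R_expand[OF p] gen_mono[OF subf.axioms(1)[OF subf_K0]] by blast
  qed
qed

lemma form_pos_in_gen: "p \<in> R \<Longrightarrow> form k p \<Longrightarrow> k \<ge> 1 \<Longrightarrow> p \<in> gen R (var ` {..<d})"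
proof -
  assume p: "p \<in> R" "form k p" "k \<ge> 1"
  obtain q where q: "p = (\<Sum>l<d. var l * q l)" "\<And>l. l < d \<Longrightarrow> q l \<in> R"
    using split_vars[OF p(1) subr_UNIV, of "k - 1"] p(2,3) by auto
  have "(\<Sum>l<d. q l * var l) \<in> gen R (var ` {..<d})"
    using gen_superset[OF subr_R, of "var ` {..<d}"] q(2)
    by (intro submod_sum[OF submod_gen[OF subr_R]] submod_mult[OF submod_gen[OF subr_R]]) auto
  thus ?thesis by (simp add: q(1) mult.commute)
qed

sublocale reg_koszul R f d var
proof (intro reg_koszul.intro reg.intro subr_R reg_axioms.intro reg_koszul_axioms.intro)
  show "f l \<in> gen R (var ` {..<d})" if "l < d" for l
    using that f_in f_form n_ge by (intro form_pos_in_gen) auto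
qed (use d_ge f_in f_regular RR.z_B in auto)

subsection \<open>The Hilbert function of a complete intersection\<close>

definition Rdeg :: "nat \<Rightarrow> (nat, 'k) mpoly set" where "Rdeg i = {p \<in> R. form i p}"

lemma submod_Rdeg: "submod K0 (Rdeg i)"
proof (rule submodI)
  fix a x :: "(nat, 'k) mpoly" assume "a \<in> K0" "x \<in> Rdeg i"
  thus "a * x \<in> Rdeg i"
    using form_mult[OF form_const, of i x] RR.B.mult[OF _, of a x] RR.K_B by (auto simp: Rdeg_def K0_def)
qed (auto simp: Rdeg_def RR.B.zero RR.B.add form_add)

lemma submod_K0: "submod R Q \<Longrightarrow> submod K0 Q"
  by (rule RR.submod_K)

lemma filt_J: "r \<le> Suc d \<Longrightarrow> x \<in> J r \<Longrightarrow> filt (\<lambda>mu. Q (deg mu)) x \<in> J r"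
proof -
  assume r: "r \<le> Suc d" and "x \<in> J r"
  then obtain a where a: "\<forall>l<r. a l \<in> R" "x = (\<Sum>l<r. a l * f l)" unfolding J_iff by auto
  have "filt (\<lambda>mu. Q (deg mu)) x = (\<Sum>l<r. filt (\<lambda>mu. Q (n + deg mu)) (a l) * f l)"
    unfolding a(2) filt_sum
    using filt_form_mult[OF f_form, of _ Q] r by (intro sum.cong) (auto simp: mult.commute)
  thus ?thesis unfolding J_iff
    using a(1) by (intro exI[of _ "\<lambda>l. filt (\<lambda>mu. Q (n + deg mu)) (a l)"]) (auto intro: filt_mpolys)
qed

lemma len_Rdeg: "len K0 {0} (Rdeg i) = enat (card (Mon d i))"
proof (rule RR.K.len_basis[where e = "\<lambda>mu. single mu 1"])
  show "(\<lambda>mu. single mu 1) ` Mon d i \<subseteq> Rdeg i"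
    by (auto simp: Rdeg_def Mon_def form_single intro: single_mpolys)
  show "Rdeg i \<subseteq> gen K0 ((\<lambda>mu. single mu 1) ` Mon d i)"
  proof
    fix p assume p: "p \<in> Rdeg i"
    hence "keys p \<subseteq> Mon d i" by (auto simp: Rdeg_def Mon_def R_iff form_iff)
    thus "p \<in> gen K0 ((\<lambda>mu. single mu 1) ` Mon d i)"
      using R_expand[of p] p gen_mono[OF RR.subr_K image_mono] unfolding Rdeg_def by blast
  qed
  fix a s assume a: "\<And>s. s \<in> Mon d i \<Longrightarrow> a s \<in> K0" "(\<Sum>s\<in>Mon d i. a s * single s 1) = 0" and s: "s \<in> Mon d i"
  have "coef (a t * single t 1) s = (if t = s then coef (a s) 0 else 0)" if "t \<in> Mon d i" for t
    using a(1)[OF that] by (auto simp: K0_def const_single lookup_single when_def coef_const)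
  hence "coef (\<Sum>t\<in>Mon d i. a t * single t 1) s = coef (a s) 0"
    using s by (simp add: lookup_sum)
  hence "coef (a s) 0 = 0" using a(2) by simp
  thus "a s = 0" using a(1)[OF s] by (auto simp: K0_def coef_const)
qed (use submod_Rdeg in auto)

text \<open>The count on the right is the Hilbert function modulo the \<open>n\<close>-th powers of
  the first \<open>r\<close> variables. Both sides obey the same recursion: by regularity,
  multiplication by \<open>f r\<close> identifies degree \<open>i - n\<close> of
  \<open>R / J r\<close> with degree \<open>i\<close> of \<open>J (Suc r) / J r\<close>.\<close>

lemma hilbert_complete_intersection:
  "r \<le> d \<Longrightarrow> len K0 (J r \<inter> Rdeg i) (Rdeg i) = enat (card {mu \<in> Mon d i. \<forall>l<r. coef mu l < n})"
proof (induction r arbitrary: i)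
  case 0
  have "J 0 = {0}" using J_iff[of _ 0] by auto
  hence "J 0 \<inter> Rdeg i = {0}" using submod_zero[OF submod_Rdeg] by auto
  thus ?case using len_Rdeg by simp
next
  case (Suc r)
  have r: "r < d" "r \<le> d" using Suc.prems by auto
  let ?S = "\<lambda>r i. {mu \<in> Mon d i. \<forall>l<r. coef mu l < n}"
  note IH = Suc.IH[OF r(2)]
  have subJ: "submod K0 (J r \<inter> Rdeg i)" for r i
    using submod_K0[OF submod_J] submod_Rdeg by (intro submod_Int)
  have "J r \<subseteq> J (Suc r)" unfolding J_def by (intro gen_mono subr_R) auto
  hence add: "len K0 (J r \<inter> Rdeg i) (Rdeg i)
      = len K0 (J r \<inter> Rdeg i) (J (Suc r) \<inter> Rdeg i) + len K0 (J (Suc r) \<inter> Rdeg i) (Rdeg i)"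
    by (intro len_add RR.subr_K subJ submod_Rdeg) auto
  show ?case
  proof (cases "n \<le> i")
    case True
    let ?g = "\<lambda>x. f r * x"
    have fr: "f r \<in> R" "form n (f r)" using f_in f_form r by auto
    have gR: "?g x \<in> Rdeg i" if "x \<in> Rdeg (i - n)" for x
      using that fr form_mult[OF fr(2), of "i - n" x] True RR.B.mult by (auto simp: Rdeg_def)
    have "{x \<in> Rdeg (i - n). ?g x \<in> J r \<inter> Rdeg i} = J r \<inter> Rdeg (i - n)"
    proof (intro Set.set_eqI iffI)
      fix x assume "x \<in> {x \<in> Rdeg (i - n). ?g x \<in> J r \<inter> Rdeg i}"
      thus "x \<in> J r \<inter> Rdeg (i - n)" using f_regular[OF r(1), of x] by (auto simp: Rdeg_def J_def)
    next
      fix x assume "x \<in> J r \<inter> Rdeg (i - n)"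
      thus "x \<in> {x \<in> Rdeg (i - n). ?g x \<in> J r \<inter> Rdeg i}"
        using gR submod_mult[OF submod_J fr(1)] by auto
    qed
    moreover have "msum (?g ` Rdeg (i - n)) (J r \<inter> Rdeg i) = J (Suc r) \<inter> Rdeg i"
    proof (intro subset_antisym subsetI)
      fix x assume "x \<in> msum (?g ` Rdeg (i - n)) (J r \<inter> Rdeg i)"
      then obtain a w where x: "a \<in> Rdeg (i - n)" "w \<in> J r" "w \<in> Rdeg i" "x = f r * a + w" by (auto simp: msum_def)
      hence "x \<in> J (Suc r)" unfolding J_Suc by (auto simp: Rdeg_def add.commute mult.commute)
      moreover have "x \<in> Rdeg i" unfolding x(4) using gR[OF x(1)] x(3) by (rule submod_add[OF submod_Rdeg])
      ultimately show "x \<in> J (Suc r) \<inter> Rdeg i" by simp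
    next
      fix x assume x: "x \<in> J (Suc r) \<inter> Rdeg i"
      then obtain w a where w: "w \<in> J r" "a \<in> R" "x = w + a * f r" unfolding J_Suc by auto
      let ?F = "filt (dg i)" and ?F' = "filt (\<lambda>mu. n + deg mu = i)"
      have "x = ?F x" using x by (simp add: filt_deg_form[of i x] Rdeg_def)
      also have "\<dots> = f r * ?F' a + ?F w"
        unfolding w(3) filt_add using filt_form_mult[OF fr(2), of "\<lambda>j. j = i" a] by (simp add: mult.commute add.commute)
      finally have eq: "x = f r * ?F' a + ?F w" .
      have "?F' a \<in> Rdeg (i - n)" using w(2) by (auto simp: Rdeg_def form_iff keys_filt intro: filt_mpolys)
      moreover have "?F w \<in> J r" using filt_J[OF _ w(1), of "\<lambda>j. j = i"] r by simp
      moreover have "?F w \<in> Rdeg i"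
        using J_subset[of r] w(1) r by (auto simp: Rdeg_def form_filt intro!: filt_mpolys)
      ultimately show "x \<in> msum (?g ` Rdeg (i - n)) (J r \<inter> Rdeg i)"
        using eq by (auto simp: msum_def)
    qed
    ultimately have "len K0 (J r \<inter> Rdeg (i - n)) (Rdeg (i - n)) = len K0 (J r \<inter> Rdeg i) (J (Suc r) \<inter> Rdeg i)"
      using len_iso[OF RR.subr_K RR.subr_K, of "\<lambda>x. x" "Rdeg (i - n)" "J r \<inter> Rdeg i" ?g] submod_Rdeg subJ
      by (simp add: distrib_left mult.left_commute)
    hence "enat (card (?S r i)) = enat (card (?S r (i - n))) + len K0 (J (Suc r) \<inter> Rdeg i) (Rdeg i)"
      using add IH by simp
    \<comment> \<open>On the side of monomials, the \<open>n\<close>-th power of the variable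
      \<open>r\<close> plays the role of \<open>f r\<close>.\<close>
    moreover have "card (?S r i) = card (?S r (i - n)) + card (?S (Suc r) i)"
    proof -
      let ?h = "\<lambda>mu. mu + single r n"
      have "?S r i = ?h ` ?S r (i - n) \<union> ?S (Suc r) i"
      proof (intro subset_antisym subsetI)
        fix mu assume mu: "mu \<in> ?S r i"
        show "mu \<in> ?h ` ?S r (i - n) \<union> ?S (Suc r) i"
        proof (cases "coef mu r < n")
          case True thus ?thesis using mu by (auto simp: less_Suc_eq)
        next
          case False
          have eq: "mu = ?h (mu - single r n)"
            using False by (intro poly_mapping_eqI) (auto simp: lookup_add lookup_minus lookup_single when_def)
          have "keys (mu - single r n) \<subseteq> {..<d}" "deg (mu - single r n) = i - n"
            using mu arg_cong[OF eq, of deg] arg_cong[OF eq, of keys] by (auto simp: Mon_def keys_plus_nat)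
          moreover have "coef (mu - single r n) l < n" if "l < r" for l
            using mu that by (auto simp: lookup_minus lookup_single when_def)
          ultimately have "mu - single r n \<in> ?S r (i - n)" by (auto simp: Mon_def)
          thus ?thesis using eq by blast
        qed
      qed (use True r in \<open>auto simp: Mon_def keys_plus_nat lookup_add lookup_single when_def less_Suc_eq split: if_splits\<close>)
      moreover have "?h ` ?S r (i - n) \<inter> ?S (Suc r) i = {}" by (auto simp: lookup_add)
      moreover have "card (?h ` ?S r (i - n)) = card (?S r (i - n))" by (intro card_image inj_onI) simp
      ultimately show ?thesis by (simp add: card_Un_disjoint)
    qed
    ultimately show ?thesis by (cases "len K0 (J (Suc r) \<inter> Rdeg i) (Rdeg i)") auto
  next
    case False
    have "J (Suc r) \<inter> Rdeg i \<subseteq> J r \<inter> Rdeg i"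
    proof
      fix x assume x: "x \<in> J (Suc r) \<inter> Rdeg i"
      then obtain w a where w: "w \<in> J r" "a \<in> R" "x = w + a * f r" unfolding J_Suc by auto
      have "x = filt (dg i) x" using x by (simp add: filt_deg_form[of i x] Rdeg_def)
      also have "\<dots> = filt (dg i) w + f r * filt (\<lambda>mu. n + deg mu = i) a"
        unfolding w(3) filt_add using filt_form_mult[OF f_form, of r "\<lambda>j. j = i" a] r by (simp add: mult.commute)
      also have "filt (\<lambda>mu. n + deg mu = i) a = 0" using False by (intro filt_none) auto
      finally have "x = filt (dg i) w" by simp
      thus "x \<in> J r \<inter> Rdeg i" using x filt_J[OF _ w(1), of "\<lambda>j. j = i"] r by auto
    qed
    hence "J (Suc r) \<inter> Rdeg i = J r \<inter> Rdeg i" using `J r \<subseteq> J (Suc r)` by blast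
    moreover have "?S (Suc r) i = ?S r i"
    proof -
      have "coef mu r < n" if "mu \<in> Mon d i" for mu
      proof -
        have "coef mu r \<le> deg mu"
          using r that deg_superset[of "{..<d}" mu] member_le_sum[of r "{..<d}" "coef mu"] by (auto simp: Mon_def)
        thus ?thesis using False that by (auto simp: Mon_def)
      qed
      thus ?thesis by (auto simp: less_Suc_eq)
    qed
    ultimately show ?thesis using IH by simp
  qed
qed

text \<open>A monomial in \<open>d\<close> variables with all exponents below \<open>n\<close> has
  degree below \<open>d * n\<close>. This is the origin of the constant \<open>d * n\<close> in the
  later bounds.\<close>

lemma Rdeg_in_J:
  assumes "d * n \<le> i" shows "Rdeg i \<subseteq> J d"
proof -
  have "{mu \<in> Mon d i. \<forall>l<d. coef mu l < n} = {}"
  proof (rule ccontr)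
    assume "\<not> ?thesis"
    then obtain mu where mu: "mu \<in> Mon d i" "\<forall>l<d. coef mu l < n" by auto
    have "deg mu = (\<Sum>l<d. coef mu l)" using mu(1) by (intro deg_superset) (auto simp: Mon_def)
    also have "\<dots> < (\<Sum>l<d. n)" using mu(2) d_ge by (intro sum_strict_mono) (auto simp: lessThan_empty_iff)
    finally show False using mu(1) assms by (simp add: Mon_def)
  qed
  hence "len K0 (J d \<inter> Rdeg i) (Rdeg i) = 0"
    using hilbert_complete_intersection[of d i] by (simp only: card.empty zero_enat_def order_refl)
  moreover have "submod K0 (J d \<inter> Rdeg i)" by (intro submod_Int submod_K0[OF submod_J] submod_Rdeg)
  ultimately show ?thesis using len_pos[of K0 "J d \<inter> Rdeg i" "Rdeg i"] submod_Rdeg by fastforce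
qed

section \<open>Truncations of \<open>R\<close> and the length of \<open>R / (J : a)\<close>\<close>

definition Rlt :: "nat \<Rightarrow> (nat, 'k) mpoly set" where "Rlt s = {p \<in> R. \<forall>mu\<in>keys p. deg mu < s}"

lemma high_in_J:
  assumes "p \<in> R" "\<And>mu. mu \<in> keys p \<Longrightarrow> d * n \<le> deg mu" shows "p \<in> J d"
proof -
  obtain N where N: "\<And>mu. mu \<in> keys p \<Longrightarrow> deg mu < N" using deg_bounded by blast
  have "filt (dg i) p \<in> J d" for i
  proof (cases "d * n \<le> i")
    case True
    thus ?thesis using Rdeg_in_J[OF True] assms(1) by (auto simp: Rdeg_def form_filt intro!: filt_mpolys)
  next
    case False
    hence "filt (dg i) p = 0" using assms(2) by (intro filt_none) auto
    thus ?thesis by (simp add: submod_zero[OF submod_J])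
  qed
  hence "(\<Sum>i<N. filt (dg i) p) \<in> J d" by (intro submod_sum[OF submod_J]) auto
  thus ?thesis using sum_filt_deg[of p N] N by simp
qed

lemma submod_Rlt: "submod K0 (Rlt s)"
proof (rule submodI)
  show "x + y \<in> Rlt s" if "x \<in> Rlt s" "y \<in> Rlt s" for x y
    using that Poly_Mapping.keys_add[of x y] RR.B.add by (fastforce simp: Rlt_def)
  fix a x :: "(nat, 'k) mpoly" assume "a \<in> K0" "x \<in> Rlt s"
  then obtain c where "a = const c" by (auto simp: K0_def)
  thus "a * x \<in> Rlt s"
    using `x \<in> Rlt s` RR.B.mult[of a x] RR.K_B `a \<in> K0`
    by (auto simp: Rlt_def in_keys_iff coef_const_mult)
qed (auto simp: Rlt_def RR.B.zero)

lemma Rlt_filt: "p \<in> R \<Longrightarrow> filt (\<lambda>mu. deg mu < s) p \<in> Rlt s"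
  by (auto simp: Rlt_def keys_filt intro: filt_mpolys)

abbreviation aa :: "(nat, 'k) mpoly set" where "aa \<equiv> colon d"

lemma high_in_aa: "p \<in> R \<Longrightarrow> (\<And>mu. mu \<in> keys p \<Longrightarrow> d * n \<le> deg mu) \<Longrightarrow> p \<in> aa"
  using high_in_J J_subset_colon[of d] by blast

lemma len_Rlt: "len K0 {0} (Rlt s) = enat (\<Sum>i<s. card (Mon d i))"
proof (induction s)
  case 0
  have "p = 0" if "p \<in> Rlt 0" for p
    using that by (intro poly_mapping_eqI) (auto simp: Rlt_def in_keys_iff)
  hence "Rlt 0 = {0}" using submod_zero[OF submod_Rlt] by blast
  thus ?case by (simp add: zero_enat_def)
next
  case (Suc s)
  have "Rlt s \<subseteq> Rlt (Suc s)" by (auto simp: Rlt_def)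
  hence "len K0 {0} (Rlt (Suc s)) = len K0 {0} (Rlt s) + len K0 (Rlt s) (Rlt (Suc s))"
    using submod_zero[OF submod_Rlt] by (intro len_add RR.subr_K submod_Rlt submod_zero_set) auto
  also have "len K0 (Rlt s) (Rlt (Suc s)) = len K0 {0} (Rdeg s)"
  proof -
    have "Rdeg s \<inter> Rlt s = {0}"
      using submod_zero[OF submod_Rdeg] submod_zero[OF submod_Rlt]
      by (auto simp: Rdeg_def Rlt_def form_iff in_keys_iff intro!: poly_mapping_eqI)
    moreover have "msum (Rdeg s) (Rlt s) = Rlt (Suc s)"
    proof (intro subset_antisym subsetI)
      have "Rdeg s \<subseteq> Rlt (Suc s)" "Rlt s \<subseteq> Rlt (Suc s)" by (auto simp: Rdeg_def Rlt_def form_iff)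
      thus "x \<in> Rlt (Suc s)" if "x \<in> msum (Rdeg s) (Rlt s)" for x
        using that msum_least[OF submod_Rlt] by blast
      fix x assume x: "x \<in> Rlt (Suc s)"
      have "filt (dg s) x \<in> Rdeg s" using x by (auto simp: Rlt_def Rdeg_def form_filt intro: filt_mpolys)
      moreover have "filt (\<lambda>mu. deg mu \<noteq> s) x \<in> Rlt s"
        using x by (auto simp: Rlt_def keys_filt less_Suc_eq intro: filt_mpolys)
      ultimately show "x \<in> msum (Rdeg s) (Rlt s)"
        using filt_split[of x "dg s"] msumI by metis
    qed
    ultimately show ?thesis using len_inclusion[OF RR.subr_K submod_Rdeg submod_Rlt, of s s] by simp
  qed
  finally show ?case using Suc len_Rdeg by simp
qed

text \<open>Polynomials without terms below degree \<open>d * n\<close> lie in \<open>J d\<close>,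
  hence in \<open>aa\<close>, so every class modulo \<open>aa\<close> has a representative of degree
  below \<open>s\<close>.\<close>

lemma len_aa_Rlt:
  assumes "d * n \<le> s" shows "len K0 (aa \<inter> Rlt s) (Rlt s) = len K0 aa R"
proof -
  have sub: "submod K0 aa" "submod K0 R" using submod_K0[OF submod_colon] submod_K0[OF submod_self[OF subr_R]] by auto
  have "msum (Rlt s) aa = R"
  proof (intro subset_antisym subsetI)
    show "x \<in> R" if "x \<in> msum (Rlt s) aa" for x
      using that msum_least[OF sub(2), of "Rlt s" aa] by (auto simp: Rlt_def colon_def)
    fix x assume x: "x \<in> R"
    have "filt (\<lambda>mu. \<not> deg mu < s) x \<in> aa"
      using x assms by (intro high_in_aa filt_mpolys) (auto simp: keys_filt)
    thus "x \<in> msum (Rlt s) aa"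
      using filt_split[of x "\<lambda>mu. deg mu < s"] Rlt_filt[OF x] msumI by metis
  qed
  thus ?thesis using len_inclusion[OF RR.subr_K submod_Rlt sub(1), of s] by (simp add: Int_commute)
qed

text \<open>The length of \<open>R / (J : a)\<close>, computed over the field; that it is finite is
  part of \<open>len_aa\<close>.\<close>

definition lam :: nat where "lam = the_enat (len K0 aa R)"

lemma len_aa: "len K0 aa R = enat lam"
proof -
  have "len K0 (aa \<inter> Rlt (d * n)) (Rlt (d * n)) \<le> len K0 {0} (Rlt (d * n))"
    using submod_zero[OF submod_colon] submod_zero[OF submod_Rlt] by (intro len_mono) auto
  then obtain l where "len K0 aa R = enat l" unfolding len_aa_Rlt[OF order_refl] len_Rlt by (auto dest!: enat_ile)
  thus ?thesis unfolding lam_def by simp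
qed

text \<open>Multiplication by \<open>f d\<close> identifies \<open>R / (J : f d)\<close> with \<open>I / J\<close>.\<close>

lemma len_I_J: "len R (J d) (J (Suc d)) = enat lam"
proof -
  have fd: "f d \<in> R" using f_in by simp
  have "len R {x \<in> R. f d * x \<in> J d} R = len R (J d) (msum ((*) (f d) ` R) (J d))"
    using len_iso[OF subr_R subr_R, of "\<lambda>x. x" R "J d" "(*) (f d)"] submod_self[OF subr_R] submod_J
    by (simp add: distrib_left mult.left_commute)
  moreover have "{x \<in> R. f d * x \<in> J d} = aa" by (auto simp: colon_def mult.commute)
  moreover have "msum ((*) (f d) ` R) (J d) = J (Suc d)"
    unfolding J_Suc msum_def by (auto simp: mult.commute[of "f d"]; metis add.commute imageI)
  ultimately have "len R (J d) (J (Suc d)) = len R aa R" by simp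
  \<comment> \<open>\<open>aa\<close> contains a power of the maximal ideal, so the length over
    \<open>R\<close> is a dimension over the field.\<close>
  also have "RR.Npow (d * n) R aa = aa"
  proof (rule antisym[OF _ RR.L_Npow])
    have "{mev var mu * p |mu p. mu \<in> Mon d (d * n) \<and> p \<in> R} \<subseteq> aa"
    proof clarify
      fix mu p assume mu: "mu \<in> Mon d (d * n)" and p: "p \<in> R"
      have "mev var mu \<in> R" using mu by (intro RR.mnm_B) (auto simp: Mon_def)
      moreover have "mev var mu \<in> aa"
        using mu calculation by (intro high_in_aa) (auto simp: mev_var Mon_def)
      ultimately have "p * mev var mu \<in> aa" using submod_mult[OF submod_colon p] by blast
      thus "mev var mu * p \<in> aa" by (simp add: mult.commute)
    qed
    thus "RR.Npow (d * n) R aa \<subseteq> aa" unfolding RR.Npow_def by (intro gen_least submod_colon) auto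
  qed
  hence "len R aa R = len K0 aa R"
    using RR.len_Npow[OF submod_self[OF subr_R] submod_colon[of d], of "d * n"] by (auto simp: colon_def)
  finally show ?thesis using len_aa by simp
qed

lemma lam_pos: "lam \<ge> 1"
proof -
  have "1 \<notin> aa" using f_almost by (simp add: colon_def J_def)
  moreover have "aa \<subseteq> R" by (auto simp: colon_def)
  ultimately have "aa \<subset> R" using RR.B.one by blast
  hence "1 \<le> len K0 aa R"
    using submod_K0[OF submod_colon] submod_K0[OF submod_self[OF subr_R]] by (intro len_pos)
  thus ?thesis by (simp add: len_aa one_enat_def)
qed

end

text \<open>The base field inside \<open>B\<close>, as constants of constants.\<close>

definition K1 :: "('j, (nat, 'k::field) mpoly) mpoly set" where "K1 = const ` K0"

lemma subf_image_const:
  fixes A :: "'a::comm_ring_1 set"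
  assumes "subf A" shows "subf (const ` A :: ('v, 'a) mpoly set)"
proof -
  interpret subf A by (rule assms)
  show ?thesis
  proof (unfold_locales)
    show "(0 :: ('v, 'a) mpoly) \<in> const ` A" by (rule rev_image_eqI[of 0]) auto
    show "(1 :: ('v, 'a) mpoly) \<in> const ` A" by (rule rev_image_eqI[of 1]) auto
    fix x y :: "('v, 'a) mpoly" assume "x \<in> const ` A"
    then obtain a where a: "x = const a" "a \<in> A" by auto
    thus "- x \<in> const ` A" using uminus by (auto simp flip: const_minus)
    show "\<exists>y\<in>const ` A. y * x = 1" if "x \<noteq> 0"
    proof -
      have "a \<noteq> 0" using that a by auto
      then obtain b where "b \<in> A" "b * a = 1" using inv a by blast
      thus ?thesis using a by (intro bexI[of _ "const b"]) (auto simp flip: const_mult)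
    qed
    assume "y \<in> const ` A"
    then obtain b where "y = const b" "b \<in> A" by auto
    thus "x + y \<in> const ` A" "x * y \<in> const ` A"
      using a add mult by (auto simp flip: const_add const_mult)
  qed
qed

lemma subf_K1: "subf (K1 :: ('j, (nat, 'k::field) mpoly) mpoly set)"
  unfolding K1_def by (rule subf_image_const[OF subf_K0])

lemma Mon_Suc_0: "nu \<in> Mon (Suc d) j \<Longrightarrow> coef nu d = 0 \<Longrightarrow> nu \<in> Mon d j"
proof -
  assume "nu \<in> Mon (Suc d) j" "coef nu d = 0"
  hence "keys nu \<subseteq> insert d {..<d}" "d \<notin> keys nu" "deg nu = j"
    by (auto simp: Mon_def lessThan_Suc in_keys_iff)
  thus ?thesis by (auto simp: Mon_def)
qed

lemma const_prod: "const (prod g S) = (\<Prod>i\<in>S. const (g i))"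
  by (induction S rule: infinite_finite_induct) (auto simp: const_mult)

context aci
begin

subsection \<open>Monomials of \<open>B\<close>\<close>

abbreviation bm :: "(nat \<Rightarrow>\<^sub>0 nat) \<Rightarrow> (nat \<Rightarrow>\<^sub>0 nat) \<Rightarrow> 'k bipoly" where
  "bm nu mu \<equiv> single nu (single mu 1)"

lemma single_K1: "single nu (c :: (nat, 'k) mpoly) = (\<Sum>mu\<in>keys c. const (const (coef c mu)) * bm nu mu)"
proof -
  have "(\<Sum>mu\<in>S. const (const (coef c mu)) * bm nu mu) = single nu (\<Sum>mu\<in>S. single mu (coef c mu))" for S
    by (induction S rule: infinite_finite_induct)
      (auto simp: const_def mult_single single_add)
  thus ?thesis using monom_expand[of c] by simp
qed

lemma B_expand: "b = (\<Sum>nu\<in>keys b. \<Sum>mu\<in>keys (coef b nu). const (const (coef (coef b nu) mu)) * bm nu mu)"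
  unfolding single_K1[symmetric] using monom_expand[of b] by simp

lemma in_gen_bm:
  assumes "\<And>nu mu. nu \<in> keys b \<Longrightarrow> mu \<in> keys (coef b nu) \<Longrightarrow> bm nu mu \<in> S"
  shows "b \<in> gen K1 S"
proof -
  have "(\<Sum>nu\<in>keys b. \<Sum>mu\<in>keys (coef b nu). const (const (coef (coef b nu) mu)) * bm nu mu) \<in> gen K1 S"
    using assms gen_superset[OF subf.axioms(1)[OF subf_K1], of S]
    by (intro submod_sum[OF submod_gen] submod_mult[OF submod_gen] subf.axioms(1)[OF subf_K1])
      (auto simp: K1_def K0_def)
  thus ?thesis using B_expand[of b] by simp
qed

sublocale BB: fg_alg K1 B y m
proof (intro fg_alg.intro subf_K1 subr_B fg_alg_axioms.intro K.y)
  show "K1 \<subseteq> B" using RR.K_B const_B by (auto simp: K1_def)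
  define S where "S = {mev y ka |ka. keys ka \<subseteq> {..<m}}"
  have one: "1 \<in> S" using mev_0[of y] unfolding S_def by (intro CollectI exI[of _ 0]) simp
  have mult: "a * b \<in> S" if ab: "a \<in> S" "b \<in> S" for a b
  proof -
    obtain ka ka' where "a = mev y ka" "b = mev y ka'" "keys ka \<subseteq> {..<m}" "keys ka' \<subseteq> {..<m}"
      using ab unfolding S_def by blast
    thus ?thesis
      using mev_add[of y ka ka'] unfolding S_def by (intro CollectI exI[of _ "ka + ka'"]) (auto simp: keys_plus_nat)
  qed
  have yS: "y v \<in> S" if "v < m" for v
    using that mev_single[of y v 1] unfolding S_def by (intro CollectI exI[of _ "single v 1"]) auto
  have pow: "a ^ i \<in> S" if "a \<in> S" for a i using that by (induction i) (auto intro: one mult)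
  have prod: "prod g T \<in> S" if "\<And>i. i \<in> T \<Longrightarrow> g i \<in> S" for g and T :: "nat set"
    using that by (induction T rule: infinite_finite_induct) (auto intro: one mult)
  have "B \<subseteq> gen K1 S"
  proof
    fix b assume b: "b \<in> B"
    show "b \<in> gen K1 S"
    proof (rule in_gen_bm)
      fix nu mu assume nu: "nu \<in> keys b" "mu \<in> keys (coef b nu)"
      have keys: "keys nu \<subseteq> {..d}" "keys mu \<subseteq> {..<d}"
        using b nu mpolys_keys[of b R "{..d}" nu] mpolys_keys[OF mpolys_coef[of b R "{..d}" nu], of mu]
        by (simp_all add: B_def)
      have "mev var nu \<in> S"
        unfolding mev_def
      proof (intro prod pow)
        fix l assume "l \<in> keys nu"
        hence "l \<le> d" using keys by auto
        thus "var l \<in> S" using yS[of l] by (simp add: y_def)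
      qed
      moreover have "const (mev var mu) \<in> S"
      proof -
        have "const (mev var mu) = (\<Prod>u\<in>keys mu. const (var u) ^ coef mu u)"
          unfolding mev_def const_prod hconst.h_power ..
        also have "\<dots> \<in> S"
        proof (intro prod pow)
          fix u assume "u \<in> keys mu"
          hence "u < d" using keys by auto
          thus "const (var u) \<in> S" using yS[of "Suc d + u"] by (simp add: y_def)
        qed
        finally show ?thesis .
      qed
      ultimately have "const (mev var mu) * mev var nu \<in> S" by (intro mult)
      moreover have "const (mev var mu) * mev var nu = bm nu mu"
        by (simp add: mev_var const_single)
      ultimately show "bm nu mu \<in> S" by simp
    qed
  qed
  thus "B \<subseteq> gen K1 {mev y ka |ka. keys ka \<subseteq> {..<m}}" by (simp add: S_def)
qed

lemma single_gen: "e \<in> gen K0 E \<Longrightarrow> single nu e \<in> gen K1 (single nu ` E)"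
proof (induction rule: gen.induct)
  case (step a x e)
  have "const a * single nu x + single nu e \<in> gen K1 (single nu ` E)"
    using step by (intro gen.step) (auto simp: K1_def)
  moreover have "const a * single nu x = single nu (a * x)" by (simp add: const_def mult_single)
  ultimately show ?case by (simp add: single_add)
qed (simp add: gen.zero)

subsection \<open>Truncations\<close>

text \<open>A finite-dimensional window of \<open>B\<close>: T-degree exactly \<open>j\<close>,
  x-degree below \<open>s\<close>.\<close>

definition Bt :: "nat \<Rightarrow> nat \<Rightarrow> 'k bipoly set" where
  "Bt s j = {b \<in> B. form j b \<and> (\<forall>nu. coef b nu \<in> Rlt s)}"

abbreviation L where "L \<equiv> M (Suc d)"
abbreviation h where "h j \<equiv> card (Mon (Suc d) j)"
abbreviation h' where "h' j \<equiv> card (Mon d j)"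

definition Xlt :: "nat \<Rightarrow> (nat \<Rightarrow>\<^sub>0 nat) set" where "Xlt s = {mu. keys mu \<subseteq> {..<d} \<and> deg mu < s}"

definition D :: "nat \<Rightarrow> nat" where "D s = (\<Sum>i<s. card (Mon d i))"

lemma Xlt_eq: "Xlt s = (\<Union>i<s. Mon d i)"
  by (auto simp: Xlt_def Mon_def)

lemma finite_Xlt [simp]: "finite (Xlt s)"
  unfolding Xlt_eq by (rule finite_UN_I) auto

lemma card_Xlt: "card (Xlt s) = D s"
  unfolding Xlt_eq D_def
proof (rule card_UN_disjoint)
  show "\<forall>i\<in>{..<s}. finite (Mon d i)" by simp
qed (auto simp: Mon_def)

lemma submod_Bt: "submod K1 (Bt s j)"
proof (rule submodI)
  show "x + y \<in> Bt s j" if "x \<in> Bt s j" "y \<in> Bt s j" for x y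
    using that submod_add[OF submod_Rlt] sB.add form_add by (auto simp: Bt_def lookup_add)
  show "0 \<in> Bt s j" using submod_zero[OF submod_Rlt] sB.zero by (auto simp: Bt_def)
  fix a x assume a: "a \<in> (K1 :: 'k bipoly set)" and x: "x \<in> Bt s j"
  then obtain c where "a = const c" "c \<in> K0" by (auto simp: K1_def)
  thus "a * x \<in> Bt s j"
    using x form_mult[OF form_const, of j x c] submod_mult[OF submod_Rlt] sB.mult[OF _, of a x] BB.K_B a
    by (auto simp: Bt_def coef_const_mult)
qed

lemma Bt_keys: "b \<in> Bt s j \<Longrightarrow> nu \<in> keys b \<Longrightarrow> nu \<in> Mon (Suc d) j"
  using mpolys_keys[of b R "{..d}" nu] by (auto simp: Bt_def B_def Mon_def form_iff lessThan_Suc_atMost)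

lemma Bt_keys': "b \<in> Bt s j \<Longrightarrow> mu \<in> keys (coef b nu) \<Longrightarrow> mu \<in> Xlt s"
  by (auto simp: Bt_def Rlt_def Xlt_def R_iff)

lemma bm_Bt: "nu \<in> Mon (Suc d) j \<Longrightarrow> mu \<in> Xlt s \<Longrightarrow> bm nu mu \<in> Bt s j"
  using submod_zero[OF submod_Rlt] by (auto simp: Bt_def Mon_def Xlt_def B_def Rlt_def form_single lookup_single when_def lessThan_Suc_atMost
      intro!: single_mpolys)

lemma len_Bt: "len K1 {0} (Bt s j) = enat (D s * h j)"
proof -
  have "len K1 {0} (Bt s j) = enat (card (Mon (Suc d) j \<times> Xlt s))"
  proof (rule BB.K.len_basis[where e = "\<lambda>(nu, mu). bm nu mu"])
    show "Bt s j \<subseteq> gen K1 ((\<lambda>(nu, mu). bm nu mu) ` (Mon (Suc d) j \<times> Xlt s))"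
    proof
      fix b assume b: "b \<in> Bt s j"
      show "b \<in> gen K1 ((\<lambda>(nu, mu). bm nu mu) ` (Mon (Suc d) j \<times> Xlt s))"
        using Bt_keys[OF b] Bt_keys'[OF b] by (intro in_gen_bm) force
    qed
    fix a s' assume a: "\<And>z. z \<in> Mon (Suc d) j \<times> Xlt s \<Longrightarrow> a z \<in> K1"
      "(\<Sum>z\<in>Mon (Suc d) j \<times> Xlt s. a z * (case z of (nu, mu) \<Rightarrow> bm nu mu)) = 0" and s': "s' \<in> Mon (Suc d) j \<times> Xlt s"
    obtain nu' mu' where z': "s' = (nu', mu')" by (cases s')
    have "coef (coef (a z * (case z of (nu, mu) \<Rightarrow> bm nu mu)) nu') mu' = (if z = s' then coef (coef (a s') 0) 0 else 0)"
      if "z \<in> Mon (Suc d) j \<times> Xlt s" for z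
      using a(1)[OF that] z'
      by (auto simp: K1_def K0_def coef_const_mult const_single lookup_single when_def coef_const split: prod.splits)
    hence "coef (coef (\<Sum>z\<in>Mon (Suc d) j \<times> Xlt s. a z * (case z of (nu, mu) \<Rightarrow> bm nu mu)) nu') mu' = coef (coef (a s') 0) 0"
      using s' by (simp add: lookup_sum)
    hence "coef (coef (a s') 0) 0 = 0" using a(2) by simp
    thus "a s' = 0" using a(1)[OF s'] by (auto simp: K1_def K0_def coef_const)
  qed (use submod_Bt bm_Bt in auto)
  thus ?thesis by (simp add: card_cartesian_product card_Xlt mult.commute)
qed

lemma sum_trunc:
  assumes "r \<le> Suc d"
  shows "filt (\<lambda>mu. deg mu < n + s) (\<Sum>l<r. c l * f l) = (\<Sum>l<r. filt (\<lambda>mu. deg mu < s) (c l) * f l)"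
  unfolding filt_sum
proof (rule sum.cong)
  fix l assume "l \<in> {..<r}"
  thus "filt (\<lambda>mu. deg mu < n + s) (c l * f l) = filt (\<lambda>mu. deg mu < s) (c l) * f l"
    using filt_form_mult[OF f_form, of l "\<lambda>i. i < n + s" "c l"] assms by (simp add: mult.commute)
qed simp

lemma Rlt_filt_id: "c \<in> Rlt s \<Longrightarrow> filt (\<lambda>mu. deg mu < s) c = c"
  by (rule filt_id) (auto simp: Rlt_def)

lemma submod_aa_Rlt: "submod K0 (aa \<inter> Rlt s)"
  by (intro submod_Int submod_K0[OF submod_colon] submod_Rlt)

text \<open>An element of \<open>J : a\<close> is the last coefficient of a linear relation. As all
  \<open>f l\<close> have the same degree, truncating the other coefficients below degree
  \<open>s\<close> keeps the relation.\<close>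

lemma aa_relation:
  assumes "a \<in> aa \<inter> Rlt s"
  obtains b where "syz (Suc d) b" "b d = a" "\<And>l. l \<le> d \<Longrightarrow> b l \<in> Rlt s"
proof -
  obtain c where c: "\<forall>l<d. c l \<in> R" "a * f d = (\<Sum>l<d. c l * f l)" and a: "a \<in> R"
    using assms unfolding colon_def J_iff by auto
  define b where "b l = (if l = d then a else - filt (\<lambda>mu. deg mu < s) (c l))" for l
  have "a * f d = filt (\<lambda>mu. deg mu < n + s) (a * f d)"
    using filt_form_mult[OF f_form, of d "\<lambda>i. i < n + s" a] Rlt_filt_id[of a s] assms
    by (simp add: mult.commute)
  also have "\<dots> = (\<Sum>l<d. filt (\<lambda>mu. deg mu < s) (c l) * f l)" unfolding c(2) by (rule sum_trunc) simp
  finally have "a * f d = - (\<Sum>l<d. b l * f l)" by (simp add: b_def sum_negf)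
  moreover have "b l \<in> Rlt s" if "l \<le> d" for l
    using that c(1) assms Rlt_filt[of "c l" s] submod_uminus[OF RR.subr_K submod_Rlt]
    by (cases "l = d") (auto simp: b_def)
  moreover from this have "b l \<in> R" if "l \<le> d" for l using that by (auto simp: Rlt_def)
  moreover have "b d = a" by (simp add: b_def)
  ultimately show thesis by (intro that[of b]) (auto simp: syz_def less_Suc_eq)
qed

lemma lin_single: "lin r a = (\<Sum>l<r. single (single l 1) (a l))"
  unfolding lin_def by (rule sum.cong) (auto simp: const_def var_def mult_single)

subsection \<open>Upper bound\<close>

text \<open>Modulo \<open>L\<close> the window is spanned by all T-monomials with coefficients in a
  basis of \<open>R / (J : a)\<close>, together with the T-monomials free of \<open>T d\<close> with
  all x-monomials. A coefficient in \<open>J : a\<close> next to \<open>T d\<close> is pushed to the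
  other variables by a linear relation; the induction is on the exponent of
  \<open>T d\<close>.\<close>

lemma len_L_Bt:
  assumes s: "d * n \<le> s" shows "len K1 (L \<inter> Bt s j) (Bt s j) \<le> enat (lam * h j + D s * h' j)"
proof -
  have "len K0 (aa \<inter> Rlt s) (Rlt s) = enat lam" using len_aa_Rlt[OF s] len_aa by simp
  then obtain E where E: "finite E" "E \<subseteq> Rlt s" "card E = lam" "Rlt s = gen K0 ((aa \<inter> Rlt s) \<union> E)"
    using RR.K.exists_basis[OF submod_aa_Rlt submod_Rlt Int_lower2] by blast
  define E1 where "E1 = (\<lambda>(nu, e). single nu e) ` (Mon (Suc d) j \<times> E)"
  define E2 where "E2 = (\<lambda>(nu, mu). bm nu mu) ` (Mon d j \<times> Xlt s)"
  let ?G = "gen K1 (L \<union> (E1 \<union> E2))"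
  have subG: "submod K1 ?G" by (rule submod_gen[OF BB.subr_K])
  have supG: "L \<union> (E1 \<union> E2) \<subseteq> ?G" by (rule gen_superset[OF BB.subr_K])
  have key: "single nu c \<in> ?G" if "nu \<in> Mon (Suc d) j" "coef nu d = k" "c \<in> Rlt s" for nu c k
    using that
  proof (induction k arbitrary: nu c)
    case 0
    have "nu \<in> Mon d j" using 0(1,2) by (rule Mon_Suc_0)
    hence *: "bm nu mu \<in> E2" if "mu \<in> Xlt s" for mu
      unfolding E2_def using that by (intro image_eqI[of _ _ "(nu, mu)"]) auto
    have "single nu c \<in> gen K1 E2"
    proof (rule in_gen_bm)
      fix nu' mu :: "nat \<Rightarrow>\<^sub>0 nat" assume "nu' \<in> keys (single nu c)" "mu \<in> keys (coef (single nu c) nu')"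
      hence "nu' = nu" "mu \<in> keys c" by (auto split: if_splits)
      thus "bm nu' mu \<in> E2" using * 0(3) by (auto simp: Rlt_def Xlt_def R_iff)
    qed
    thus ?case using gen_mono[OF BB.subr_K, of E2 "L \<union> (E1 \<union> E2)"] by auto
  next
    case (Suc k)
    obtain a e where ae: "c = a + e" "a \<in> aa \<inter> Rlt s" "e \<in> gen K0 E"
      using Suc.prems(3) E(4) gen_Un_submod[OF RR.subr_K submod_aa_Rlt, of s E] unfolding msum_def by blast
    have "single nu ` E \<subseteq> L \<union> (E1 \<union> E2)" using Suc.prems(1) by (auto simp: E1_def)
    hence e: "single nu e \<in> ?G" using subsetD[OF gen_mono[OF BB.subr_K] single_gen[OF ae(3)]] by simp
    obtain b where b: "syz (Suc d) b" "b d = a" "\<And>l. l \<le> d \<Longrightarrow> b l \<in> Rlt s"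
      using aa_relation[OF ae(2)] by blast
    define nu' where "nu' = nu - single d 1"
    have nu': "nu = nu' + single d 1"
      unfolding nu'_def using Suc.prems(2)
      by (intro poly_mapping_eqI) (auto simp: lookup_add lookup_minus lookup_single when_def)
    have mnu': "keys nu' \<subseteq> {..<Suc d}" "Suc (deg nu') = j" "coef nu' d = k"
      using Suc.prems(1,2) unfolding nu' by (auto simp: Mon_def keys_plus_nat lookup_add)
    have 1: "single nu' 1 * lin (Suc d) b \<in> L"
      using mnu'(1) lin_in_M[OF b(1)] by (intro submod_mult[OF submod_M]) (auto simp: B_def lessThan_Suc_atMost intro!: single_mpolys)
    have "single (nu' + single l 1) (b l) \<in> ?G" if "l < d" for l
      using that mnu' b(3)[of l]
      by (intro Suc.IH) (auto simp: Mon_def keys_plus_nat lookup_add lookup_single)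
    hence 2: "(\<Sum>l<d. single (nu' + single l 1) (b l)) \<in> ?G" by (intro submod_sum[OF subG]) auto
    \<comment> \<open>The relation with last coefficient \<open>a\<close>, multiplied by the rest
      \<open>nu'\<close> of the monomial, trades one \<open>T d\<close> for the other
      variables.\<close>
    have "single nu' 1 * lin (Suc d) b = single nu a + (\<Sum>l<d. single (nu' + single l 1) (b l))"
      by (simp add: lin_single distrib_left sum_distrib_left mult_single b(2) nu' add.commute)
    hence "single nu a = single nu' 1 * lin (Suc d) b - (\<Sum>l<d. single (nu' + single l 1) (b l))" by simp
    hence "single nu a \<in> ?G" using submod_diff[OF BB.subr_K subG _ 2] 1 supG by auto
    thus ?case unfolding ae(1) single_add using e by (rule submod_add[OF subG])
  qed
  have BtG: "Bt s j \<subseteq> ?G"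
  proof
    fix b assume b: "b \<in> Bt s j"
    have "(\<Sum>nu\<in>keys b. single nu (coef b nu)) \<in> ?G"
      using Bt_keys[OF b] b by (intro submod_sum[OF subG] key) (auto simp: Bt_def)
    thus "b \<in> ?G" using monom_expand[of b] by simp
  qed
  have subL: "submod K1 L" by (rule BB.submod_K[OF submod_M])
  have "len K1 (Bt s j \<inter> L) (Bt s j) = len K1 L (msum (Bt s j) L)"
    by (rule len_inclusion[OF BB.subr_K submod_Bt subL])
  also have "\<dots> \<le> len K1 L ?G"
    using BtG supG by (intro len_mono msum_least[OF subG]) auto
  also have "\<dots> \<le> enat (card (E1 \<union> E2))"
    using E(1) by (intro BB.K.len_le_card subL) (auto simp: E1_def E2_def)
  also have "card (E1 \<union> E2) \<le> card E1 + card E2" by (rule card_Un_le)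
  also have "card E1 \<le> lam * h j"
    unfolding E1_def using card_image_le[of "Mon (Suc d) j \<times> E" "\<lambda>(nu, e). single nu e"] E
    by (simp add: card_cartesian_product mult.commute)
  also have "card E2 \<le> D s * h' j"
    unfolding E2_def using card_image_le[of "Mon d j \<times> Xlt s" "\<lambda>(nu, mu). bm nu mu"]
    by (simp add: card_cartesian_product card_Xlt mult.commute)
  finally show ?thesis by (simp add: Int_commute)
qed

subsection \<open>Lower bound\<close>

text \<open>Selects the terms whose bidegree satisfies \<open>Q\<close>, with the T-degree as first
  argument and the x-degree as second.\<close>

definition fl :: "(nat \<Rightarrow> nat \<Rightarrow> bool) \<Rightarrow> 'k bipoly \<Rightarrow> 'k bipoly" where
  "fl Q b = (\<Sum>nu\<in>keys b. single nu (filt (\<lambda>mu. Q (deg nu) (deg mu)) (coef b nu)))"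

lemma coef_fl: "coef (fl Q b) nu = filt (\<lambda>mu. Q (deg nu) (deg mu)) (coef b nu)"
proof -
  have "coef (fl Q b) nu = (\<Sum>ka\<in>keys b. if ka = nu then filt (\<lambda>mu. Q (deg nu) (deg mu)) (coef b nu) else 0)"
    unfolding fl_def lookup_sum by (rule sum.cong) (auto simp: lookup_single)
  thus ?thesis by (auto simp: in_keys_iff)
qed

lemma fl_add: "fl Q (b + c) = fl Q b + fl Q c"
  by (rule poly_mapping_eqI) (simp add: coef_fl lookup_add filt_add)

lemma fl_0 [simp]: "fl Q 0 = 0"
  by (rule poly_mapping_eqI) (simp add: coef_fl)

lemma fl_sum: "fl Q (sum g S) = (\<Sum>i\<in>S. fl Q (g i))"
  by (induction S rule: infinite_finite_induct) (auto simp: fl_add)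

lemma fl_single: "fl Q (single nu c) = single nu (filt (\<lambda>mu. Q (deg nu) (deg mu)) c)"
  by (rule poly_mapping_eqI) (auto simp: coef_fl lookup_single when_def)

lemma fl_B: "b \<in> B \<Longrightarrow> fl Q b \<in> B"
proof -
  assume b: "b \<in> B"
  show ?thesis
    unfolding B_def
  proof (rule mpolysI)
    show "coef (fl Q b) nu \<in> R" for nu
      unfolding coef_fl using b mpolys_coef[of b R "{..d}" nu] by (intro filt_mpolys) (auto simp: B_def)
    show "keys nu \<subseteq> {..d}" if "nu \<in> keys (fl Q b)" for nu
    proof -
      have "nu \<in> keys b" using that by (auto simp: in_keys_iff coef_fl)
      thus ?thesis using mpolys_keys[of b R "{..d}" nu] b by (simp add: B_def)
    qed
  qed
qed

abbreviation tr where "tr s j \<equiv> fl (\<lambda>i i'. i = j \<and> i' < s)"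

lemma tr_id: "b \<in> Bt s j \<Longrightarrow> tr s j b = b"
proof (rule poly_mapping_eqI)
  fix nu assume b: "b \<in> Bt s j"
  have "filt (\<lambda>mu. deg nu = j \<and> deg mu < s) (coef b nu) = coef b nu"
  proof (cases "deg nu = j")
    case True thus ?thesis using b Rlt_filt_id[of "coef b nu" s] by (simp add: Bt_def)
  next
    case False
    hence "coef b nu = 0" using b by (auto simp: Bt_def form_iff in_keys_iff)
    thus ?thesis by simp
  qed
  thus "coef (tr s j b) nu = coef b nu" by (simp add: coef_fl)
qed

lemma tr_Bt: "b \<in> B \<Longrightarrow> tr s j b \<in> Bt s j"
proof -
  assume b: "b \<in> B"
  have "coef (tr s j b) nu \<in> Rlt s" for nu
    using b mpolys_coef[of b R "{..d}"] by (auto simp: B_def Rlt_def coef_fl keys_filt intro: filt_mpolys)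
  moreover have "form j (tr s j b)"
    by (auto simp: form_iff in_keys_iff coef_fl filt_none split: if_splits intro: ccontr)
  ultimately show ?thesis using fl_B[OF b] by (simp add: Bt_def)
qed

text \<open>\<open>L\<close> is spanned by products of monomials and linear relations, and selecting
  bidegrees turns such a product into the same monomial times a truncated relation. The variable of
  the linear relation accounts for \<open>Suc (deg nu)\<close>. As an induction rule this serves
  both the homogeneity of \<open>L\<close> and the count of its elements in a window.\<close>

lemma fl_L_induct:
  assumes "x \<in> L" and Q0: "Q 0" and Qadd: "\<And>u v. Q u \<Longrightarrow> Q v \<Longrightarrow> Q (u + v)"
    and prod: "\<And>nu a. keys nu \<subseteq> {..d} \<Longrightarrow> syz (Suc d) a \<Longrightarrow>
      (\<And>l mu. mu \<in> keys (a l) \<Longrightarrow> F (Suc (deg nu)) (deg mu)) \<Longrightarrow> Q (single nu 1 * lin (Suc d) a)"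
  shows "Q (fl F x)"
  using assms(1) unfolding M_def
proof (induction rule: gen.induct)
  case zero show ?case using Q0 by simp
next
  case (step b x y)
  then obtain a where a: "x = lin (Suc d) a" "syz (Suc d) a" by auto
  have "Q (fl F (single nu c * lin (Suc d) a))" if nu: "keys nu \<subseteq> {..d}" and c: "c \<in> R" for nu c
  proof -
    let ?a = "\<lambda>l. filt (\<lambda>mu. F (Suc (deg nu)) (deg mu)) (c * a l)"
    have eq: "fl F (single nu c * lin (Suc d) a) = single nu 1 * lin (Suc d) ?a"
      by (simp add: lin_single sum_distrib_left mult_single fl_sum fl_single del: sum.lessThan_Suc)
    have "(\<Sum>l<Suc d. c * a l * f l) = c * (\<Sum>l<Suc d. a l * f l)"
      by (simp add: sum_distrib_left mult.assoc del: sum.lessThan_Suc)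
    hence 0: "(\<Sum>l<Suc d. c * a l * f l) = 0" using a(2) by (simp add: syz_def del: sum.lessThan_Suc)
    have "(\<Sum>l<Suc d. ?a l * f l) = filt (\<lambda>mu. n \<le> deg mu \<and> F (Suc (deg nu)) (deg mu - n)) (\<Sum>l<Suc d. c * a l * f l)"
      unfolding filt_sum
    proof (rule sum.cong)
      fix l assume "l \<in> {..<Suc d}"
      thus "?a l * f l = filt (\<lambda>mu. n \<le> deg mu \<and> F (Suc (deg nu)) (deg mu - n)) (c * a l * f l)"
        using filt_form_mult[OF f_form, of l "\<lambda>i. n \<le> i \<and> F (Suc (deg nu)) (i - n)" "c * a l"]
        by (simp add: mult.commute)
    qed simp
    hence "syz (Suc d) ?a"
      unfolding 0 using a(2) c RR.B.mult by (auto simp: syz_def intro!: filt_mpolys)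
    thus ?thesis unfolding eq using nu by (intro prod) (auto simp: keys_filt)
  qed
  hence each: "Q (fl F (single nu (coef b nu) * lin (Suc d) a))" if "nu \<in> keys b" for nu
    using step(1) that unfolding B_def by (auto dest: mpolys_keys mpolys_coef)
  have "Q (\<Sum>nu\<in>S. fl F (single nu (coef b nu) * lin (Suc d) a))" if "finite S" "S \<subseteq> keys b" for S
    using that by (induction S) (auto intro: Q0 Qadd each)
  hence "Q (\<Sum>nu\<in>keys b. fl F (single nu (coef b nu) * lin (Suc d) a))" by simp
  moreover have "b * lin (Suc d) a = (\<Sum>nu\<in>keys b. single nu (coef b nu) * lin (Suc d) a)"
    by (subst monom_expand[of b]) (simp_all add: sum_distrib_right)
  ultimately have "Q (fl F (b * x))" by (simp add: a(1) fl_sum)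
  thus ?case unfolding fl_add using step.IH by (rule Qadd)
qed

lemma fl_L: "x \<in> L \<Longrightarrow> fl F x \<in> L"
proof (rule fl_L_induct[of x "\<lambda>u. u \<in> L"])
  show "single nu 1 * lin (Suc d) a \<in> L" if "keys nu \<subseteq> {..d}" "syz (Suc d) a" for nu a
    using that by (intro submod_mult[OF submod_M] lin_in_M) (auto simp: B_def intro!: single_mpolys)
qed (auto intro: submod_zero[OF submod_M] submod_add[OF submod_M])

lemma lin_add: "lin r (\<lambda>l. a l + b l) = lin r a + lin r b"
  by (simp add: lin_def const_add distrib_right sum.distrib)

lemma lin_mult: "lin r (\<lambda>l. c * a l) = const c * lin r a"
  by (simp add: lin_def const_mult sum_distrib_left mult.assoc)

lemma lin_sum: "lin r (\<lambda>l. \<Sum>e\<in>S. g e l) = (\<Sum>e\<in>S. lin r (g e))"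
  unfolding lin_def const_sum sum_distrib_right by (rule sum.swap)

text \<open>Here \<open>r\<close> is the dimension of the part of \<open>J : a\<close> below degree
  \<open>s\<close>. Fixed lifts of a basis of this part match the last coefficient of any relation
  and contribute \<open>r * h j\<close>. There remain relations with last coefficient 0: if their
  monomial contains \<open>T d\<close>, they are rewritten with smaller powers of
  \<open>T d\<close>; otherwise they lie in the span of the \<open>D s * h' (Suc j)\<close>
  monomials free of \<open>T d\<close>.\<close>

lemma len_L_Bt_le:
  assumes s: "d * n \<le> s"
  obtains r where "r + lam = D s" "\<And>j. len K1 {0} (L \<inter> Bt s (Suc j)) \<le> enat (r * h j + D s * h' (Suc j))"
proof -
  have "len K0 {0} (Rlt s) = len K0 {0} (aa \<inter> Rlt s) + len K0 (aa \<inter> Rlt s) (Rlt s)"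
    using submod_zero[OF submod_aa_Rlt] by (intro len_add RR.subr_K submod_zero_set submod_aa_Rlt submod_Rlt) auto
  hence "enat (D s) = len K0 {0} (aa \<inter> Rlt s) + enat lam"
    unfolding len_aa_Rlt[OF s] len_aa len_Rlt D_def .
  then obtain r where r: "len K0 {0} (aa \<inter> Rlt s) = enat r" "r + lam = D s"
    by (cases "len K0 {0} (aa \<inter> Rlt s)") auto
  obtain Ea where Ea: "finite Ea" "Ea \<subseteq> aa \<inter> Rlt s" "card Ea = r" "aa \<inter> Rlt s = gen K0 ({0} \<union> Ea)"
    using RR.K.exists_basis[OF submod_zero_set submod_aa_Rlt _ r(1)] submod_zero[OF submod_aa_Rlt] by auto
  have "\<exists>b. syz (Suc d) b \<and> b d = e \<and> (\<forall>l\<le>d. b l \<in> Rlt s)" if "e \<in> Ea" for e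
    using aa_relation[of e s] Ea(2) that by blast
  then obtain sg where sg: "\<And>e. e \<in> Ea \<Longrightarrow> syz (Suc d) (sg e)" "\<And>e. e \<in> Ea \<Longrightarrow> sg e d = e"
    "\<And>e l. e \<in> Ea \<Longrightarrow> l \<le> d \<Longrightarrow> sg e l \<in> Rlt s" by metis
  have "len K1 {0} (L \<inter> Bt s (Suc j)) \<le> enat (r * h j + D s * h' (Suc j))" for j
  proof -
    define F1 where "F1 = (\<lambda>(nu, e). single nu 1 * lin (Suc d) (sg e)) ` (Mon (Suc d) j \<times> Ea)"
    define F2 where "F2 = (\<lambda>(nu, mu). bm nu mu) ` (Mon d (Suc j) \<times> Xlt s)"
    let ?G = "gen K1 ({0} \<union> (F1 \<union> F2))"
    have subG: "submod K1 ?G" by (rule submod_gen[OF BB.subr_K])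
    have supG: "{0} \<union> (F1 \<union> F2) \<subseteq> ?G" by (rule gen_superset[OF BB.subr_K])
    have key: "single nu 1 * lin (Suc d) a \<in> ?G"
      if "nu \<in> Mon (Suc d) j" "coef nu d = k" "syz (Suc d) a" "\<And>l. l \<le> d \<Longrightarrow> a l \<in> Rlt s" for nu a k
      using that
    proof (induction k arbitrary: nu a rule: less_induct)
      case (less k)
      have "a d * f d = (\<Sum>l<d. - a l * f l)"
        using less.prems(3) by (simp add: syz_def sum_negf eq_neg_iff_add_eq_0 add.commute)
      hence "a d * f d \<in> J d" unfolding J_iff using less.prems(4) RR.B.uminus
        by (intro exI[of _ "\<lambda>l. - a l"]) (auto simp: Rlt_def)
      hence "a d \<in> aa \<inter> Rlt s" using less.prems(4)[of d] by (auto simp: colon_def Rlt_def)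
      hence "a d \<in> gen K0 Ea" using Ea(4) gen_Un_submod[OF RR.subr_K submod_zero_set, of Ea] by (auto simp: msum_def)
      then obtain ka where ka: "\<And>e. e \<in> Ea \<Longrightarrow> ka e \<in> K0" "a d = (\<Sum>e\<in>Ea. ka e * e)"
        using gen_image_sum[OF RR.subr_K Ea(1), of "\<lambda>e. e"] by auto
      \<comment> \<open>Removing the lifts leaves last coefficient 0, hence a relation of the
        regular sequence \<open>f 0, \<dots>, f (d - 1)\<close>.\<close>
      define a' where "a' l = a l + - (\<Sum>e\<in>Ea. ka e * sg e l)" for l
      have a'd: "a' d = 0" using ka(2) sg(2) by (simp add: a'_def)
      have a'R: "a' l \<in> Rlt s" if "l \<le> d" for l
        unfolding a'_def using that less.prems(4) sg(3) ka(1) submod_Rlt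
        by (intro submod_add[OF submod_Rlt] submod_uminus[OF RR.subr_K submod_Rlt] submod_sum[OF submod_Rlt] submod_mult[OF submod_Rlt]) auto
      have "(\<Sum>l<Suc d. (\<Sum>e\<in>Ea. ka e * sg e l) * f l) = (\<Sum>e\<in>Ea. ka e * (\<Sum>l<Suc d. sg e l * f l))"
        unfolding sum_distrib_left sum_distrib_right mult.assoc by (rule sum.swap)
      also have "\<dots> = 0" using sg(1) by (simp add: syz_def del: sum.lessThan_Suc)
      finally have "(\<Sum>l<Suc d. a' l * f l) = 0"
        using less.prems(3) by (simp add: a'_def syz_def left_diff_distrib sum_subtractf del: sum.lessThan_Suc)
      hence syz': "syz d a'" using a'd a'R by (auto simp: syz_def Rlt_def)
      have lin_a: "lin (Suc d) a = lin d a' + (\<Sum>e\<in>Ea. const (ka e) * lin (Suc d) (sg e))"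
      proof -
        have "a = (\<lambda>l. a' l + (\<Sum>e\<in>Ea. ka e * sg e l))" by (simp add: a'_def fun_eq_iff)
        hence "lin (Suc d) a = lin (Suc d) a' + (\<Sum>e\<in>Ea. const (ka e) * lin (Suc d) (sg e))"
          using lin_add[of "Suc d" a' "\<lambda>l. \<Sum>e\<in>Ea. ka e * sg e l"] by (simp add: lin_sum lin_mult)
        moreover have "lin (Suc d) a' = lin d a'" using a'd by (simp add: lin_def)
        ultimately show ?thesis by simp
      qed
      have "const (ka e) * (single nu 1 * lin (Suc d) (sg e)) \<in> ?G" if e: "e \<in> Ea" for e
      proof (rule submod_mult[OF subG])
        show "const (ka e) \<in> K1" using ka(1)[OF e] by (simp add: K1_def)
        have "single nu 1 * lin (Suc d) (sg e) \<in> F1" using e less.prems(1) by (force simp: F1_def)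
        thus "single nu 1 * lin (Suc d) (sg e) \<in> ?G" using supG by blast
      qed
      hence 1: "(\<Sum>e\<in>Ea. const (ka e) * (single nu 1 * lin (Suc d) (sg e))) \<in> ?G"
        by (intro submod_sum[OF subG])
      have 2: "single nu 1 * lin d a' \<in> ?G"
      proof (cases k)
        case 0
        hence nu: "nu \<in> Mon d j" using Mon_Suc_0[OF less.prems(1)] less.prems(2) by simp
        have "single (nu + single l 1) (a' l) \<in> ?G" if l: "l < d" for l
        proof -
          have "single (nu + single l 1) (a' l) \<in> gen K1 F2"
          proof (rule in_gen_bm)
            fix nu' mu assume "nu' \<in> keys (single (nu + single l 1) (a' l))" "mu \<in> keys (coef (single (nu + single l 1) (a' l)) nu')"
            hence "nu' = nu + single l 1" "mu \<in> keys (a' l)" by (auto split: if_splits)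
            moreover from this have "nu' \<in> Mon d (Suc j)" "mu \<in> Xlt s"
              using nu l a'R[of l] by (auto simp: Mon_def keys_plus_nat Rlt_def Xlt_def R_iff)
            ultimately show "bm nu' mu \<in> F2" by (force simp: F2_def)
          qed
          thus ?thesis using gen_mono[OF BB.subr_K, of F2 "{0} \<union> (F1 \<union> F2)"] by auto
        qed
        hence "(\<Sum>l<d. single (nu + single l 1) (a' l)) \<in> ?G" by (intro submod_sum[OF subG]) auto
        thus ?thesis by (simp add: lin_single sum_distrib_left mult_single)
      next
        case (Suc k')
        define nu' where "nu' = nu - single d 1"
        have nu': "nu = nu' + single d 1"
          unfolding nu'_def using less.prems(2) Suc
          by (intro poly_mapping_eqI) (auto simp: lookup_add lookup_minus lookup_single when_def)
        have mnu': "keys nu' \<subseteq> {..<Suc d}" "Suc (deg nu') = j" "coef nu' d = k'"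
          using less.prems(1,2) Suc unfolding nu' by (auto simp: Mon_def keys_plus_nat lookup_add)
        obtain C0 where C0: "\<And>l k. l < d \<Longrightarrow> k < d \<Longrightarrow> C0 l k \<in> R" "\<And>l k. C0 k l = - C0 l k" "\<And>l. C0 l l = 0"
          "\<And>l. l < d \<Longrightarrow> a' l = (\<Sum>k<d. C0 l k * f k)"
          by (rule syz_koszul[OF order_refl syz']) (rule that)
        \<comment> \<open>Truncating the Koszul coefficients keeps the identity, since all
          \<open>f k\<close> have degree \<open>n\<close>, and makes their products with
          \<open>f d\<close> fit below degree \<open>s\<close>.\<close>
        define C where "C l k = filt (\<lambda>mu. n + deg mu < s) (C0 l k)" for l k
        have C1: "C l k \<in> R" if "l < d" "k < d" for l k unfolding C_def using C0(1)[OF that] by (intro filt_mpolys) auto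
        have C2: "C k l = - C l k" for l k
          unfolding C_def by (subst C0(2)) (rule poly_mapping_eqI, simp add: coef_filt)
        have C4: "a' l = (\<Sum>k<d. C l k * f k)" if l: "l < d" for l
        proof -
          have "a' l = filt (\<lambda>mu. deg mu < s) (\<Sum>k<d. C0 l k * f k)"
            using Rlt_filt_id[OF a'R[of l]] l C0(4)[OF l] by simp
          also have "\<dots> = (\<Sum>k<d. C l k * f k)"
            unfolding filt_sum
          proof (rule sum.cong)
            fix k assume "k \<in> {..<d}"
            thus "filt (\<lambda>mu. deg mu < s) (C0 l k * f k) = C l k * f k"
              using filt_form_mult[OF f_form, of k "\<lambda>i. i < s" "C0 l k"] by (simp add: C_def mult.commute)
          qed simp
          finally show ?thesis .
        qed
        \<comment> \<open>As \<open>a' l\<close> is a combination of the \<open>f i\<close>,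
          multiplication by \<open>f d\<close> gives a relation with last coefficient
          \<open>a' l\<close>.\<close>
        define u where "u l i = (if i = d then a' l else - (C l i * f d))" for l i
        have u: "syz (Suc d) (u l)" if l: "l < d" for l
        proof -
          have "(\<Sum>i<d. u l i * f i) = - (\<Sum>i<d. C l i * f i) * f d"
            unfolding sum_negf[symmetric] sum_distrib_right by (rule sum.cong) (auto simp: u_def)
          hence "(\<Sum>i<Suc d. u l i * f i) = 0" using C4[OF l] by (simp add: u_def)
          thus ?thesis using a'R[of l] l C1 f_in RR.B.uminus RR.B.mult
            by (auto simp: syz_def u_def Rlt_def less_Suc_eq)
        qed
        have uR: "u l i \<in> Rlt s" if l: "l < d" and i: "i \<le> d" for l i
        proof (cases "i = d")
          case True thus ?thesis using a'R[of l] l by (simp add: u_def)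
        next
          case False
          have "deg mu < s" if h: "mu \<in> keys (C l i * f d)" for mu
          proof -
            obtain mu1 mu2 where "mu1 \<in> keys (C l i)" "mu2 \<in> keys (f d)" "mu = mu1 + mu2" using keys_mult[of "C l i" "f d"] h by blast
            thus ?thesis using f_form[of d] by (auto simp: C_def keys_filt form_iff)
          qed
          moreover have "C l i * f d \<in> R" using C1[of l i] l i False f_in RR.B.mult by auto
          ultimately have "C l i * f d \<in> Rlt s" by (auto simp: Rlt_def)
          thus ?thesis using False submod_uminus[OF RR.subr_K submod_Rlt] by (simp add: u_def)
        qed
        have "single (nu' + single l 1) 1 * lin (Suc d) (u l) \<in> ?G" if l: "l < d" for l
        proof (rule less.IH)
          show "k' < k" using Suc by simp
          show "nu' + single l 1 \<in> Mon (Suc d) j" using mnu' l by (auto simp: Mon_def keys_plus_nat)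
          show "coef (nu' + single l 1) d = k'" using mnu'(3) l by (simp add: lookup_add lookup_single)
        qed (use u[OF l] uR[OF l] in auto)
        hence "(\<Sum>l<d. single (nu' + single l 1) 1 * lin (Suc d) (u l)) \<in> ?G" by (intro submod_sum[OF subG]) auto
        \<comment> \<open>The sum of \<open>T l\<close> times the \<open>l\<close>-th of these
          relations is \<open>T d\<close> times the given one, because the quadratic form of the
          alternating matrix \<open>C\<close> vanishes. The monomials in front have one factor
          \<open>T d\<close> less.\<close>
        moreover have "(\<Sum>l<d. var l * lin (Suc d) (u l)) = var d * lin d a'"
        proof -
          have "lin (Suc d) (u l) = const (a' l) * var d - const (f d) * (\<Sum>i<d. const (C l i) * var i)" for l
          proof -
            have "lin (Suc d) (u l) = (\<Sum>i<d. const (u l i) * var i) + const (a' l) * var d" by (simp add: lin_def u_def)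
            also have "(\<Sum>i<d. const (u l i) * var i) = (\<Sum>i<d. - (const (f d) * (const (C l i) * var i)))"
              by (rule sum.cong) (auto simp: u_def const_minus const_mult mult_ac)
            finally show ?thesis by (simp add: sum_negf sum_distrib_left)
          qed
          hence "(\<Sum>l<d. var l * lin (Suc d) (u l)) = var d * lin d a'
              - const (f d) * (\<Sum>l<d. \<Sum>i<d. const (C l i) * (var l * var i))"
            by (simp add: right_diff_distrib sum_subtractf lin_def sum_distrib_left mult_ac)
          moreover have "(\<Sum>l<d. \<Sum>i<d. const (C l i) * (var l * var i)) = (0 :: 'k bipoly)"
          proof -
            have "(\<Sum>l<e. \<Sum>i<e. const (C l i) * (var l * var i)) = (0 :: 'k bipoly)" for e
            proof (induction e)
              case (Suc e)
              have "C e e = 0" unfolding C_def C0(3) by simp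
              have "(\<Sum>l<e. const (C l e) * (var l * var e)) = - (\<Sum>i<e. const (C e i) * (var e * var i) :: 'k bipoly)"
                unfolding sum_negf[symmetric]
              proof (rule sum.cong)
                fix i show "const (C i e) * (var i * var e) = - (const (C e i) * (var e * var i) :: 'k bipoly)"
                  by (subst C2) (simp add: const_minus mult_ac)
              qed simp
              thus ?case using Suc `C e e = 0` by (simp add: sum.distrib)
            qed simp
            thus ?thesis .
          qed
          ultimately show ?thesis by simp
        qed
        moreover have "(\<Sum>l<d. single (nu' + single l 1) 1 * lin (Suc d) (u l)) = single nu' 1 * (\<Sum>l<d. var l * lin (Suc d) (u l))"
          unfolding sum_distrib_left by (rule sum.cong) (auto simp: var_def mult_single mult.assoc[symmetric])
        ultimately have "single nu' 1 * (var d * lin d a') \<in> ?G" by simp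
        moreover have "single nu 1 * lin d a' = single nu' 1 * (var d * lin d a')"
          by (simp add: nu' var_def mult_single mult.assoc[symmetric])
        ultimately show ?thesis by (rule back_subst[of "\<lambda>u. u \<in> ?G", OF _ sym])
      qed
      have "single nu 1 * lin (Suc d) a = single nu 1 * lin d a' + (\<Sum>e\<in>Ea. const (ka e) * (single nu 1 * lin (Suc d) (sg e)))"
        unfolding lin_a by (simp add: distrib_left sum_distrib_left mult.left_commute)
      thus ?case using submod_add[OF subG 2 1] by simp
    qed
    have "L \<inter> Bt s (Suc j) \<subseteq> ?G"
    proof
      fix x assume x: "x \<in> L \<inter> Bt s (Suc j)"
      have "tr s (Suc j) x \<in> ?G"
      proof (rule fl_L_induct[of x "\<lambda>u. u \<in> ?G"])
        fix nu a assume nu: "keys nu \<subseteq> {..d}" and a: "syz (Suc d) a"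
          "\<And>l mu. mu \<in> keys (a l) \<Longrightarrow> Suc (deg nu) = Suc j \<and> deg mu < s"
        show "single nu 1 * lin (Suc d) a \<in> ?G"
        proof (cases "deg nu = j")
          case True
          thus ?thesis using nu a by (intro key[OF _ refl]) (auto simp: Mon_def lessThan_Suc_atMost syz_def Rlt_def)
        next
          case False
          hence "keys (a l) = {}" for l using a(2)[of _ l] by blast
          thus ?thesis using submod_zero[OF subG] by (simp add: lin_def)
        qed
      qed (use x submod_zero[OF subG] submod_add[OF subG] in auto)
      thus "x \<in> ?G" using x tr_id by auto
    qed
    hence "len K1 {0} (L \<inter> Bt s (Suc j)) \<le> enat (card (F1 \<union> F2))"
      using Ea(1) by (intro BB.K.len_le_card submod_zero_set) (auto simp: F1_def F2_def)
    also have "card (F1 \<union> F2) \<le> card F1 + card F2" by (rule card_Un_le)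
    also have "card F1 \<le> r * h j"
      unfolding F1_def using card_image_le[of "Mon (Suc d) j \<times> Ea" "\<lambda>(nu, e). single nu 1 * lin (Suc d) (sg e)"] Ea(1,3)
      by (simp add: card_cartesian_product mult.commute)
    also have "card F2 \<le> D s * h' (Suc j)"
      unfolding F2_def using card_image_le[of "Mon d (Suc j) \<times> Xlt s" "\<lambda>(nu, mu). bm nu mu"]
      by (simp add: card_cartesian_product card_Xlt mult.commute)
    finally show ?thesis by simp
  qed
  thus thesis using that r(2) by blast
qed

end

context aci
begin

section \<open>The module of nonlinear relations\<close>

text \<open>The presentation of the Rees algebra, with \<open>T l\<close> sent to \<open>f l\<close>
  times the Rees variable.\<close>

definition ev :: "'k bipoly \<Rightarrow> (nat, 'k) mpoly poly" where
  "ev = mpoly_eval (\<lambda>r. [:r:]) (\<lambda>l. monom (f l) 1)"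

definition P :: "'k bipoly set" where "P = {b \<in> B. ev b = 0}"

lemma rhom_ev: "rhom ev"
  unfolding ev_def by (rule hpCons.rhom_eval)

sublocale hev: rhom ev by (rule rhom_ev)

lemma ev_single: "ev (single nu c) = monom (c * mev f nu) (deg nu)"
proof -
  have "(\<Prod>l\<in>S. monom (f l) 1 ^ coef nu l) = monom (\<Prod>l\<in>S. f l ^ coef nu l) (\<Sum>l\<in>S. coef nu l)" for S
    by (induction S rule: infinite_finite_induct) (auto simp: mult_monom monom_power)
  hence "mev (\<lambda>l. monom (f l) 1) nu = monom (mev f nu) (deg nu)"
    by (simp add: mev_def mev_def deg_def)
  thus ?thesis
    unfolding ev_def hpCons.eval_single by (simp add: smult_monom)
qed

lemma ev_sum: "ev (sum g S) = (\<Sum>i\<in>S. ev (g i))"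
  by (rule hev.h_sum)

lemma coeff_ev: "coeff (ev b) j = evf (filt (dg j) b)"
proof -
  have "coeff (ev (\<Sum>nu\<in>keys b. single nu (coef b nu))) j
      = (\<Sum>nu\<in>keys b. if deg nu = j then coef b nu * mev f nu else 0)"
    by (simp add: ev_sum ev_single coeff_sum)
  also have "\<dots> = (\<Sum>nu\<in>{nu\<in>keys b. deg nu = j}. coef b nu * mev f nu)"
    by (simp add: sum.If_cases Int_def)
  also have "\<dots> = evf (filt (dg j) b)"
    by (simp add: filt_def ev_simps hid.eval_single)
  finally show ?thesis using monom_expand[of b] by simp
qed

lemma submod_P: "submod B P"
  unfolding P_def by (rule submodI)
    (auto simp: hev.h_zero hev.h_add hev.h_mult
      sB.zero intro: sB.add sB.mult)

lemma P_subset_B: "P \<subseteq> B"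
  by (auto simp: P_def)

lemma P_iff: "b \<in> P \<longleftrightarrow> b \<in> B \<and> (\<forall>j. evf (filt (dg j) b) = 0)"
  by (auto simp: P_def coeff_ev[symmetric] poly_eq_iff)

lemma L_subset_P: "L \<subseteq> P"
proof -
  have "lin (Suc d) a \<in> P" if "syz (Suc d) a" for a
  proof -
    have "ev (lin (Suc d) a) = (\<Sum>l<Suc d. monom (a l * f l) 1)"
      unfolding lin_single ev_sum by (simp add: ev_single mev_single del: sum.lessThan_Suc)
    also have "\<dots> = monom (\<Sum>l<Suc d. a l * f l) 1"
      by (rule monom_sum[symmetric])
    finally have "ev (lin (Suc d) a) = 0" using that by (simp add: syz_def del: sum.lessThan_Suc)
    thus ?thesis using lin_in_M[OF that] M_subset_B[of "Suc d"] by (auto simp: P_def)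
  qed
  thus ?thesis unfolding M_def by (intro gen_least submod_P) auto
qed

lemma subK_P: "submod K1 P" and subK_L: "submod K1 L"
  by (rule BB.submod_K[OF submod_P], rule BB.submod_K[OF submod_M])

subsection \<open>Bihomogeneous components\<close>

lemma fl_T: "fl (\<lambda>i _. Q i) b = filt (\<lambda>nu. Q (deg nu)) b"
  by (rule poly_mapping_eqI, rule poly_mapping_eqI) (auto simp: coef_fl coef_filt)

lemma fl_split: "b = fl Q b + fl (\<lambda>i j. \<not> Q i j) b"
  by (rule poly_mapping_eqI, rule poly_mapping_eqI) (auto simp: coef_fl coef_filt lookup_add)

lemma mev_f_form: "keys nu \<subseteq> {..d} \<Longrightarrow> form (n * deg nu) (mev f nu)"
proof -
  assume nu: "keys nu \<subseteq> {..d}"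
  have "form (n * (\<Sum>l\<in>S. coef nu l)) (\<Prod>l\<in>S. f l ^ coef nu l)" if "S \<subseteq> {..d}" for S
    using that
  proof (induction S rule: infinite_finite_induct)
    case (insert l S)
    thus ?case using form_mult[OF form_power[OF f_form[of l], of "coef nu l"], of "n * sum (coef nu) S"]
      by (simp add: distrib_left)
  qed (auto simp: form_const[of 1, simplified])
  thus ?thesis using nu by (simp add: mev_def deg_def)
qed

lemma evf_expand: "evf b = (\<Sum>nu\<in>keys b. coef b nu * mev f nu)"
  by (rule hid.eval_superset) auto

text \<open>Within one T-degree \<open>j\<close>, evaluation at \<open>f\<close> raises all
  x-degrees by \<open>n * j\<close>, so \<open>P\<close> is homogeneous for both degrees.\<close>

lemma fl_P: "b \<in> P \<Longrightarrow> fl Q b \<in> P"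
proof -
  assume b: "b \<in> P"
  hence bB: "b \<in> B" by (simp add: P_def)
  have "evf (filt (dg j) (fl Q b)) = 0" for j
  proof -
    let ?S = "{nu\<in>keys b. deg nu = j}"
    have "filt (dg j) (fl Q b) = (\<Sum>nu\<in>?S. single nu (filt (\<lambda>mu. Q j (deg mu)) (coef b nu)))"
    proof -
      have "filt (dg j) (fl Q b) = (\<Sum>nu\<in>keys b. if deg nu = j then single nu (filt (\<lambda>mu. Q j (deg mu)) (coef b nu)) else 0)"
        unfolding fl_def filt_sum by (rule sum.cong) (auto simp: filt_single)
      thus ?thesis by (simp add: sum.If_cases Int_def)
    qed
    hence "evf (filt (dg j) (fl Q b)) = (\<Sum>nu\<in>?S. filt (\<lambda>mu. Q j (deg mu)) (coef b nu) * mev f nu)"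
      by (simp add: ev_simps hid.eval_single)
    also have "\<dots> = (\<Sum>nu\<in>?S. filt (\<lambda>mu. n * j \<le> deg mu \<and> Q j (deg mu - n * j)) (coef b nu * mev f nu))"
    proof (rule sum.cong)
      fix nu assume "nu \<in> ?S"
      hence "form (n * j) (mev f nu)" using mev_f_form[of nu] mpolys_keys[of b R "{..d}" nu] bB by (auto simp: B_def)
      from filt_form_mult[OF this, of "\<lambda>i. n * j \<le> i \<and> Q j (i - n * j)" "coef b nu"]
      show "filt (\<lambda>mu. Q j (deg mu)) (coef b nu) * mev f nu
          = filt (\<lambda>mu. n * j \<le> deg mu \<and> Q j (deg mu - n * j)) (coef b nu * mev f nu)" by (simp add: mult.commute)
    qed simp
    also have "\<dots> = filt (\<lambda>mu. n * j \<le> deg mu \<and> Q j (deg mu - n * j)) (evf (filt (dg j) b))"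
      by (simp add: filt_sum[symmetric] filt_def[of "dg j"] ev_simps hid.eval_single)
    finally show ?thesis using b by (simp add: P_iff)
  qed
  thus ?thesis using fl_B[OF bB] by (simp add: P_iff)
qed

lemma filt_P: "b \<in> P \<Longrightarrow> filt (\<lambda>nu. Q (deg nu)) b \<in> P"
  and filt_L: "b \<in> L \<Longrightarrow> filt (\<lambda>nu. Q (deg nu)) b \<in> L"
  using fl_P[of b "\<lambda>i _. Q i"] fl_L[of b "\<lambda>i _. Q i"] by (simp_all add: fl_T)

subsection \<open>Nonlinear relations are torsion\<close>

lemma koszul_L: "l \<le> d \<Longrightarrow> k \<le> d \<Longrightarrow> const (f l) * var k - const (f k) * var l \<in> L"
proof (cases l k rule: linorder_cases)
  case less
  assume "l \<le> d" "k \<le> d"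
  thus ?thesis using koszul_relation[OF less] M_mono[of "Suc k" "Suc d"] by auto
next
  case equal thus ?thesis by (simp add: submod_zero[OF submod_M])
next
  case greater
  assume "l \<le> d" "k \<le> d"
  hence "const (f k) * var l - const (f l) * var k \<in> L"
    using koszul_relation[OF greater] M_mono[of "Suc l" "Suc d"] by auto
  thus ?thesis using submod_uminus[OF subr_B submod_M] by fastforce
qed

lemma mev_scale: "mev (\<lambda>k. c * g k) nu = c ^ deg nu * mev g nu"
  by (simp add: mev_def power_mult_distrib prod.distrib deg_def power_sum)

text \<open>The homomorphisms \<open>T k \<mapsto> f l * T k\<close> and \<open>T k \<mapsto> T l * f k\<close> agree modulo \<open>L\<close>.\<close>

lemma form_congruence:
  assumes l: "l \<le> d" and p: "p \<in> B" "form j p" shows "const (f l) ^ j * p - var l ^ j * const (evf p) \<in> L"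
proof -
  have eval: "mpoly_eval const (\<lambda>k. c * g k) p = c ^ j * (\<Sum>nu\<in>keys p. const (coef p nu) * mev g nu)" for c g
    using p(2) by (auto simp: hconst.eval_superset[of "keys p"] mev_scale form_iff sum_distrib_left mult.left_commute intro!: sum.cong)
  have "mpoly_eval const (\<lambda>k. const (f l) * var k) p - mpoly_eval const (\<lambda>k. var l * const (f k)) p \<in> L"
    using p(1) unfolding B_def
  proof (rule rhom_congruent[OF subr_R subr_B submod_M hconst.rhom_eval hconst.rhom_eval, rotated -1])
    show "mpoly_eval const (\<lambda>k. const (f l) * var k) (const r) \<in> B \<and> mpoly_eval const (\<lambda>k. var l * const (f k)) (const r) \<in> B \<and>
      mpoly_eval const (\<lambda>k. const (f l) * var k) (const r) - mpoly_eval const (\<lambda>k. var l * const (f k)) (const r) \<in> L" if "r \<in> R" for r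
      using const_B[OF that] submod_zero[OF submod_M] by (simp add: hconst.eval_const)
    show "mpoly_eval const (\<lambda>k. const (f l) * var k) (var v) \<in> B \<and> mpoly_eval const (\<lambda>k. var l * const (f k)) (var v) \<in> B \<and>
      mpoly_eval const (\<lambda>k. const (f l) * var k) (var v) - mpoly_eval const (\<lambda>k. var l * const (f k)) (var v) \<in> L" if "v \<in> {..d}" for v
      using that l const_B f_in var_B koszul_L[OF l, of v] sB.mult by (simp add: hconst.eval_var mult.commute[of "var l"])
  qed
  moreover have "mev (\<lambda>k. const (f k)) nu = (const (mev f nu) :: 'k bipoly)" for nu
    by (simp add: mev_def const_prod hconst.h_power)
  ultimately show ?thesis
    unfolding eval using monom_expand[of p] by (simp add: mev_var const_single evf_expand const_sum const_mult)
qed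

text \<open>On a form in \<open>P\<close> the second term of \<open>form_congruence\<close>
  vanishes, so a power of \<open>f l\<close> sends it into \<open>L\<close>; the components of
  \<open>p\<close> have bounded degree.\<close>

lemma P_torsion:
  assumes "p \<in> P" obtains N where "\<And>l. l < d \<Longrightarrow> const (f l) ^ N * p \<in> L"
proof -
  obtain N where N: "\<And>nu. nu \<in> keys p \<Longrightarrow> deg nu < N" using deg_bounded by blast
  have "const (f l) ^ N * p \<in> L" if l: "l < d" for l
  proof -
    have "const (f l) ^ N * filt (dg j) p \<in> L" if j: "j < N" for j
    proof -
      let ?p = "filt (dg j) p"
      have pP: "?p \<in> P" using filt_P[OF assms, of "\<lambda>i. i = j"] .
      have "evf ?p = 0" using assms by (simp add: P_iff)
      hence "const (f l) ^ j * ?p \<in> L"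
        using form_congruence[of l ?p j] l pP P_subset_B form_filt by auto
      moreover have "const (f l) ^ (N - j) \<in> B" using f_in l by (intro sB.power const_B) auto
      ultimately have "const (f l) ^ (N - j) * (const (f l) ^ j * ?p) \<in> L" by (rule submod_mult[OF submod_M, rotated])
      thus ?thesis using j by (simp add: mult.assoc[symmetric] power_add[symmetric])
    qed
    hence "(\<Sum>j<N. const (f l) ^ N * filt (dg j) p) \<in> L" by (intro submod_sum[OF submod_M]) auto
    thus ?thesis using sum_filt_deg[of p N] N by (simp add: sum_distrib_left[symmetric])
  qed
  thus thesis by (rule that)
qed

text \<open>A coefficient of high degree lies in \<open>J d\<close>, so one factor
  \<open>f l\<close> can be split off and absorbed by lowering \<open>N l\<close>. Repeating this
  exhausts the exponents after at most \<open>k\<close> rounds.\<close>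

lemma torsion_high:
  assumes "g \<in> B" "\<And>l. l < d \<Longrightarrow> const (f l) ^ N l * g \<in> L" "(\<Sum>l<d. N l) = k"
    and "c \<in> R" "\<And>mu. mu \<in> keys c \<Longrightarrow> k * (d * n) \<le> deg mu"
  shows "const c * g \<in> L"
  using assms
proof (induction k arbitrary: N g c)
  case 0
  hence "g \<in> L" using d_ge 0(2)[of 0] by auto
  thus ?case using const_B[OF 0(4)] by (intro submod_mult[OF submod_M])
next
  case (Suc k)
  have "d * n \<le> deg mu" if "mu \<in> keys c" for mu
    using Suc.prems(5)[OF that] by simp
  hence "c \<in> J d" using Suc.prems(4) by (intro high_in_J)
  then obtain a where a: "\<forall>l<d. a l \<in> R" "c = (\<Sum>l<d. a l * f l)" unfolding J_iff by auto
  let ?a = "\<lambda>l. filt (\<lambda>mu. Suc k * (d * n) \<le> n + deg mu) (a l)"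
  have "c = filt (\<lambda>mu. Suc k * (d * n) \<le> deg mu) c" using Suc.prems(5) by (intro filt_id[symmetric])
  also have "\<dots> = (\<Sum>l<d. ?a l * f l)"
    unfolding a(2) filt_sum
  proof (rule sum.cong)
    fix l assume "l \<in> {..<d}"
    thus "filt (\<lambda>mu. Suc k * (d * n) \<le> deg mu) (a l * f l) = ?a l * f l"
      using filt_form_mult[OF f_form, of l "\<lambda>i. Suc k * (d * n) \<le> i" "a l"] by (simp add: mult.commute)
  qed simp
  finally have c: "c = (\<Sum>l<d. ?a l * f l)" .
  have "const (?a l) * (const (f l) * g) \<in> L" if l: "l < d" for l
  proof (cases "N l")
    case 0
    hence "g \<in> L" using Suc.prems(2)[OF l] by simp
    thus ?thesis using a(1) l f_in
      by (intro submod_mult[OF submod_M] const_B) (auto intro!: filt_mpolys)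
  next
    case (Suc i)
    show ?thesis
    proof (rule Suc.IH[of "const (f l) * g" "N(l := i)"])
      show fg: "const (f l) * g \<in> B" using Suc.prems(1) f_in l by (intro sB.mult const_B) auto
      show "const (f l') ^ (N(l := i)) l' * (const (f l) * g) \<in> L" if "l' < d" for l'
      proof (cases "l' = l")
        case True
        thus ?thesis using Suc.prems(2)[OF l] Suc by (simp add: mult_ac)
      next
        case False
        have "const (f l) * (const (f l') ^ N l' * g) \<in> L"
          using f_in l by (intro submod_mult[OF submod_M _ Suc.prems(2)[OF that]] const_B) auto
        thus ?thesis using False by (simp add: mult_ac)
      qed
      have "(\<Sum>l'<d. (N(l := i)) l') = i + (\<Sum>l'\<in>{..<d} - {l}. N l')"
        using l by (subst sum.remove[of _ l]) (auto intro!: sum.cong)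
      moreover have "(\<Sum>l'<d. N l') = N l + (\<Sum>l'\<in>{..<d} - {l}. N l')" using l by (subst sum.remove[of _ l]) auto
      ultimately show "(\<Sum>l'<d. (N(l := i)) l') = k" using Suc.prems(3) Suc by simp
      show "?a l \<in> R" using a(1) l by (auto intro: filt_mpolys)
      show "k * (d * n) \<le> deg mu" if "mu \<in> keys (?a l)" for mu
      proof -
        \<comment> \<open>A round consumes only \<open>n\<close> of the \<open>d * n\<close> degrees
          provided for it.\<close>
        have "1 * n \<le> d * n" using d_ge by (intro mult_le_mono1)
        moreover have "Suc k * (d * n) \<le> n + deg mu" using that by (simp add: keys_filt)
        ultimately show ?thesis unfolding mult_Suc by linarith
      qed
    qed
  qed
  hence "(\<Sum>l<d. const (?a l) * (const (f l) * g)) \<in> L" by (intro submod_sum[OF submod_M]) auto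
  also have "(\<Sum>l<d. const (?a l) * (const (f l) * g)) = const (\<Sum>l<d. ?a l * f l) * g"
    by (simp add: const_sum const_mult sum_distrib_right mult.assoc)
  finally show ?case using c by simp
qed

definition xhigh :: "nat \<Rightarrow> 'k bipoly \<Rightarrow> bool" where
  "xhigh e b \<longleftrightarrow> (\<forall>nu. \<forall>mu\<in>keys (coef b nu). e \<le> deg mu)"

lemma xhigh_mult:
  assumes "b \<in> B" "xhigh e b" "\<And>c. c \<in> R \<Longrightarrow> (\<And>mu. mu \<in> keys c \<Longrightarrow> e \<le> deg mu) \<Longrightarrow> const c * g \<in> L"
  shows "b * g \<in> L"
proof -
  have "(\<Sum>nu\<in>keys b. single nu 1 * (const (coef b nu) * g)) \<in> L"
    using assms by (intro submod_sum[OF submod_M] submod_mult[OF submod_M] assms(3))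
      (auto simp: B_def xhigh_def dest: mpolys_coef mpolys_keys intro!: single_mpolys)
  also have "(\<Sum>nu\<in>keys b. single nu 1 * (const (coef b nu) * g)) = (\<Sum>nu\<in>keys b. single nu (coef b nu) * g)"
    by (rule sum.cong) (auto simp: const_def mult_single mult.assoc[symmetric])
  also have "\<dots> = b * g"
    unfolding sum_distrib_right[symmetric] using monom_expand[of b] by simp
  finally show ?thesis .
qed

text \<open>By the basis theorem finitely many generators suffice, which yields one exponent
  \<open>e\<close> for all of them.\<close>

lemma P_generators:
  obtains G e where "finite G" "G \<subseteq> P" "P = gen B G"
    "\<forall>g\<in>G. \<forall>c\<in>R. (\<forall>mu\<in>keys c. e \<le> deg mu) \<longrightarrow> const c * g \<in> L"
proof -
  obtain G where G: "finite G" "G \<subseteq> P" "P = gen B G" using BB.hilbert_basis[OF submod_P P_subset_B] by blast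
  have "\<exists>k. \<forall>c\<in>R. (\<forall>mu\<in>keys c. k * (d * n) \<le> deg mu) \<longrightarrow> const c * g \<in> L" if g: "g \<in> G" for g
  proof -
    obtain N where N: "\<And>l. l < d \<Longrightarrow> const (f l) ^ N * g \<in> L" using P_torsion[of g] g G(2) by blast
    have "g \<in> B" using g G(2) P_subset_B by auto
    thus ?thesis using torsion_high[of g "\<lambda>_. N" "\<Sum>l<d. N"] N by blast
  qed
  then obtain k where k: "\<And>g c. g \<in> G \<Longrightarrow> c \<in> R \<Longrightarrow> (\<forall>mu\<in>keys c. k g * (d * n) \<le> deg mu) \<Longrightarrow> const c * g \<in> L"
    by metis
  have "const c * g \<in> L"
    if "g \<in> G" "c \<in> R" "\<And>mu. mu \<in> keys c \<Longrightarrow> (\<Sum>g\<in>G. k g * (d * n)) \<le> deg mu" for g c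
  proof (rule k[OF that(1,2)], rule ballI)
    fix mu assume "mu \<in> keys c"
    have "k g * (d * n) \<le> (\<Sum>g\<in>G. k g * (d * n))" using member_le_sum[OF that(1), of "\<lambda>g. k g * (d * n)"] G(1) by simp
    thus "k g * (d * n) \<le> deg mu" using that(3)[OF `mu \<in> keys c`] by linarith
  qed
  thus thesis using that[OF G] by blast
qed

lemma fl_mult_low:
  assumes "\<And>nu mu. mu \<in> keys (coef a nu) \<Longrightarrow> deg mu < e" "\<And>nu mu. mu \<in> keys (coef g nu) \<Longrightarrow> deg mu < D1"
  shows "fl (\<lambda>_ i. e + D1 \<le> i) (a * g) = 0"
proof -
  have "a * g = (\<Sum>nu\<in>keys a. \<Sum>ka\<in>keys g. single (nu + ka) (coef a nu * coef g ka))"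
    by (subst monom_expand[of a],
        subst monom_expand[of g]) (simp add: sum_product mult_single)
  moreover have "fl (\<lambda>_ i. e + D1 \<le> i) (single (nu + ka) (coef a nu * coef g ka)) = 0" for nu ka
  proof -
    have "filt (\<lambda>mu. e + D1 \<le> deg mu) (coef a nu * coef g ka) = 0"
    proof (rule filt_none)
      fix mu assume "mu \<in> keys (coef a nu * coef g ka)"
      then obtain mu1 mu2 where "mu1 \<in> keys (coef a nu)" "mu2 \<in> keys (coef g ka)" "mu = mu1 + mu2"
        using keys_mult[of "coef a nu" "coef g ka"] by blast
      thus "\<not> e + D1 \<le> deg mu" using assms(1)[of mu1 nu] assms(2)[of mu2 ka] by simp
    qed
    thus ?thesis by (simp add: fl_single)
  qed
  ultimately show ?thesis by (simp add: fl_sum)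
qed

text \<open>In a combination of the generators, the coefficients are split at x-degree
  \<open>e\<close>. The high parts send the generators into \<open>L\<close>, and the low parts
  produce terms of bounded x-degree only, so nothing outside \<open>L\<close> remains from
  \<open>e + D0\<close> on.\<close>

lemma P_high_in_L:
  obtains s where "d * n \<le> s" "\<And>p. p \<in> P \<Longrightarrow> fl (\<lambda>_ i. s \<le> i) p \<in> L"
proof -
  obtain G e where G: "finite G" "G \<subseteq> P" "P = gen B G"
    "\<forall>g\<in>G. \<forall>c\<in>R. (\<forall>mu\<in>keys c. e \<le> deg mu) \<longrightarrow> const c * g \<in> L"
    by (rule P_generators)
  have "\<exists>D. \<forall>nu. \<forall>mu\<in>keys (coef g nu). deg mu < D" for g :: "'k bipoly"
  proof -
    let ?S = "\<Union>nu\<in>keys g. keys (coef g nu)"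
    have fin: "finite (deg ` ?S)" by simp
    have "\<forall>nu. \<forall>mu\<in>keys (coef g nu). deg mu < Suc (Max (deg ` ?S))"
    proof (intro allI ballI)
      fix nu mu assume "mu \<in> keys (coef g nu)"
      moreover from this have "nu \<in> keys g" by (auto simp: in_keys_iff)
      ultimately have "mu \<in> ?S" by blast
      thus "deg mu < Suc (Max (deg ` ?S))" using Max_ge[OF fin, of "deg mu"] by (simp add: less_Suc_eq_le)
    qed
    thus ?thesis by blast
  qed
  hence "\<exists>D'. \<forall>g :: 'k bipoly. \<forall>nu. \<forall>mu\<in>keys (coef g nu). deg mu < D' g" by (intro choice) blast
  then obtain D' where D': "\<And>g nu mu. mu \<in> keys (coef (g :: 'k bipoly) nu) \<Longrightarrow> deg mu < D' g" by blast
  define D0 where "D0 = (\<Sum>g\<in>G. D' g)"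
  have D0: "deg mu < D0" if "g \<in> G" "mu \<in> keys (coef g nu)" for g nu mu
    using D'[OF that(2)] member_le_sum[OF that(1) _ G(1), of D'] unfolding D0_def by simp
  have high: "fl (\<lambda>_ i. e + D0 \<le> i) p \<in> L" if p: "p \<in> P" for p
  proof -
    obtain b where b: "\<forall>g\<in>G. b g \<in> B" "p = (\<Sum>g\<in>G. b g * g)"
      using p G(3) gen_image_sum[OF subr_B G(1), of "\<lambda>g. g"] by auto
    let ?hi = "\<lambda>g. fl (\<lambda>_ i. e \<le> i) (b g)" and ?lo = "\<lambda>g. fl (\<lambda>_ i. \<not> e \<le> i) (b g)"
    have "p = (\<Sum>g\<in>G. ?hi g * g) + (\<Sum>g\<in>G. ?lo g * g)"
      unfolding b(2) sum.distrib[symmetric] distrib_right[symmetric]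
      using fl_split[of _ "\<lambda>_ i. e \<le> i"] by (intro sum.cong) auto
    moreover have "(\<Sum>g\<in>G. ?hi g * g) \<in> L"
    proof (rule submod_sum[OF submod_M])
      fix g assume g: "g \<in> G"
      show "?hi g * g \<in> L"
      proof (rule xhigh_mult[of _ e])
        show "?hi g \<in> B" using b(1) g by (intro fl_B) auto
        show "xhigh e (?hi g)" by (auto simp: xhigh_def coef_fl keys_filt)
      qed (use G(4) g in auto)
    qed
    moreover have "fl (\<lambda>_ i. e + D0 \<le> i) (\<Sum>g\<in>G. ?lo g * g) = 0"
      unfolding fl_sum
    proof (rule sum.neutral, rule ballI, rule fl_mult_low)
      show "deg mu < e" if "mu \<in> keys (coef (?lo g) nu)" for g nu mu using that by (simp add: coef_fl keys_filt)
    qed (rule D0)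
    ultimately show ?thesis using fl_L by (simp add: fl_add)
  qed
  \<comment> \<open>The bound is enlarged to at least \<open>d * n\<close>, as the counting lemmas
    require.\<close>
  have "fl (\<lambda>_ i. max (d * n) (e + D0) \<le> i) p \<in> L" if "p \<in> P" for p
  proof -
    have "fl (\<lambda>_ i. max (d * n) (e + D0) \<le> i) p = fl (\<lambda>_ i. max (d * n) (e + D0) \<le> i) (fl (\<lambda>_ i. e + D0 \<le> i) p)"
      by (rule poly_mapping_eqI, rule poly_mapping_eqI) (auto simp: coef_fl coef_filt)
    thus ?thesis using fl_L[OF high[OF that]] by simp
  qed
  thus thesis by (intro that[of "max (d * n) (e + D0)"]) auto
qed

subsection \<open>Generators over the ring of polynomials in the \<open>T\<close>-variables\<close>

definition KT :: "'k bipoly set" where "KT = mpolys K0 {..d}"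

lemma subr_KT: "subr KT"
  unfolding KT_def by (rule subr_mpolys[OF RR.subr_K])

lemma KT_B: "KT \<subseteq> B"
  unfolding KT_def B_def by (rule mpolys_mono[OF RR.K_B]) simp

lemma submod_KT: "submod B Q \<Longrightarrow> submod KT Q"
  using submod_subset KT_B by blast

text \<open>x-monomials of degree at least \<open>e\<close> send the generators into
  \<open>L\<close>, so modulo \<open>L\<close> the products of the generators with the finitely many
  other x-monomials generate over \<open>k[T]\<close>. Splitting these products by T-degree makes
  them homogeneous.\<close>

lemma P_homogeneous_generators:
  obtains G where "finite G" "G \<subseteq> P" "\<And>g. g \<in> G \<Longrightarrow> \<exists>j. form j g" "P = gen KT (G \<union> L)"
proof -
  obtain G e where G: "finite G" "G \<subseteq> P" "P = gen B G"
    "\<forall>g\<in>G. \<forall>c\<in>R. (\<forall>mu\<in>keys c. e \<le> deg mu) \<longrightarrow> const c * g \<in> L"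
    by (rule P_generators)
  define G1 where "G1 = (\<lambda>(mu, g). const (single mu 1) * g) ` (Xlt e \<times> G)"
  have G1P: "G1 \<subseteq> P"
  proof
    fix x assume "x \<in> G1"
    then obtain mu g where x: "x = const (single mu 1) * g" "mu \<in> Xlt e" "g \<in> G" by (auto simp: G1_def)
    have "single mu 1 \<in> R" using x(2) by (intro single_mpolys) (auto simp: Xlt_def)
    thus "x \<in> P" unfolding x(1) using x(3) G(2) by (intro submod_mult[OF submod_P] const_B) auto
  qed
  have "finite G1" using G(1) by (simp add: G1_def)
  have "\<exists>N. \<forall>nu\<in>keys g. deg nu < N" for g :: "'k bipoly" using deg_bounded[of g] by metis
  then obtain N where N: "\<And>g nu. nu \<in> keys g \<Longrightarrow> deg nu < N (g :: 'k bipoly)" by metis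
  define G2 where "G2 = (\<Union>g\<in>G1. (\<lambda>j. filt (dg j) g) ` {..<N g})"
  have "finite G2" using `finite G1` by (simp add: G2_def)
  moreover have G2P: "G2 \<subseteq> P" unfolding G2_def using G1P filt_P[of _ "\<lambda>i. i = _"] by blast
  moreover have "\<exists>j. form j g" if "g \<in> G2" for g using that form_filt by (auto simp: G2_def)
  moreover have "P = gen KT (G2 \<union> L)"
  proof (rule antisym)
    let ?H = "gen KT (G2 \<union> L)"
    have sub: "submod KT ?H" by (rule submod_gen[OF subr_KT])
    have sup: "G2 \<union> L \<subseteq> ?H" by (rule gen_superset[OF subr_KT])
    have G1H: "G1 \<subseteq> ?H"
    proof
      fix g assume g: "g \<in> G1"
      have "(\<Sum>j<N g. filt (dg j) g) \<in> ?H"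
        using g sup by (intro submod_sum[OF sub]) (auto simp: G2_def)
      thus "g \<in> ?H" using sum_filt_deg[of g "N g"] N by simp
    qed
    show "P \<subseteq> ?H"
    proof
      fix p assume "p \<in> P"
      then obtain b where b: "\<forall>g\<in>G. b g \<in> B" "p = (\<Sum>g\<in>G. b g * g)"
        using G(3) gen_image_sum[OF subr_B G(1), of "\<lambda>g. g"] by auto
      have "b g * g \<in> ?H" if g: "g \<in> G" for g
      proof -
        have bg: "b g \<in> B" using b(1) g by simp
        let ?lo = "fl (\<lambda>_ i. \<not> e \<le> i) (b g)" and ?hi = "fl (\<lambda>_ i. e \<le> i) (b g)"
        have "?hi * g \<in> L"
        proof (rule xhigh_mult[of _ e])
          show "?hi \<in> B" using bg by (rule fl_B)
          show "xhigh e ?hi" by (auto simp: xhigh_def coef_fl keys_filt)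
        qed (use G(4) g in auto)
        moreover have "?lo * g \<in> ?H"
        proof -
          have "?lo * g = (\<Sum>nu\<in>keys ?lo. \<Sum>mu\<in>keys (coef ?lo nu). const (const (coef (coef ?lo nu) mu)) * bm nu mu) * g"
            using B_expand[of ?lo] by simp
          also have "\<dots> = (\<Sum>nu\<in>keys ?lo. \<Sum>mu\<in>keys (coef ?lo nu).
              (const (const (coef (coef ?lo nu) mu)) * single nu 1) * (const (single mu 1) * g))"
            unfolding sum_distrib_right by (intro sum.cong refl) (simp add: const_def mult_single mult.assoc[symmetric])
          also have "\<dots> \<in> ?H"
          proof (rule submod_sum[OF sub], rule submod_sum[OF sub], rule submod_mult[OF sub])
            fix nu mu assume nu: "nu \<in> keys ?lo" and mu: "mu \<in> keys (coef ?lo nu)"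
            have loB: "?lo \<in> B" using bg by (rule fl_B)
            have "keys nu \<subseteq> {..d}" using loB nu by (auto simp: B_def dest: mpolys_keys)
            thus "const (const (coef (coef ?lo nu) mu)) * single nu 1 \<in> KT"
              unfolding const_single KT_def using RR.K.zero by (intro single_mpolys) (auto simp: K0_def)
            have "coef ?lo nu \<in> R" using loB by (auto simp: B_def dest: mpolys_coef)
            hence "mu \<in> Xlt e" using mu by (auto simp: coef_fl keys_filt Xlt_def dest: mpolys_keys)
            hence "const (single mu 1) * g \<in> G1" using g by (force simp: G1_def)
            thus "const (single mu 1) * g \<in> ?H" using G1H by auto
          qed
          finally show ?thesis .
        qed
        ultimately have "?hi * g + ?lo * g \<in> ?H" using sup by (intro submod_add[OF sub]) auto
        thus ?thesis using fl_split[of "b g" "\<lambda>_ i. e \<le> i"] by (simp add: distrib_right[symmetric])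
      qed
      thus "p \<in> ?H" unfolding b(2) by (intro submod_sum[OF sub])
    qed
    show "?H \<subseteq> P" using G2P L_subset_P by (intro gen_least submod_KT submod_P) auto
  qed
  ultimately show thesis using that by blast
qed

end

section \<open>Growth of binomial coefficients and polynomials\<close>

lemma choose_lim:
  assumes u: "(\<lambda>N. real (u N) / real N) \<longlonglongrightarrow> a"
  shows "(\<lambda>N. real (u N choose k) / real N ^ k) \<longlonglongrightarrow> a ^ k / fact k"
proof -
  have "real (u N choose k) / real N ^ k = (\<Prod>i = 0..<k. real (u N) / real N - real i / real N) / fact k" for N
    unfolding binomial_gbinomial gbinomial_prod_rev
    by (simp add: prod_dividef diff_divide_distrib[symmetric] field_simps)
  moreover have "(\<lambda>N. (\<Prod>i = 0..<k. real (u N) / real N - real i / real N) / fact k) \<longlonglongrightarrow> (\<Prod>i = 0..<k. a - 0) / fact k"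
    by (intro tendsto_divide tendsto_prod tendsto_diff u lim_const_over_n tendsto_const) auto
  ultimately show ?thesis by simp
qed

lemma poly_lim_coeff:
  fixes p :: "real poly"
  assumes "degree p \<le> k"
  shows "(\<lambda>N. poly p (real N) / real N ^ k) \<longlonglongrightarrow> coeff p k"
proof -
  have "(\<lambda>N. coeff p i * real N ^ i / real N ^ k) \<longlonglongrightarrow> (if i = k then coeff p k else 0)" if "i \<le> k" for i
  proof (cases "i = k")
    case True
    have "\<forall>\<^sub>F N in sequentially. coeff p i * real N ^ i / real N ^ k = coeff p k"
      using eventually_gt_at_top[of 0] by eventually_elim (simp add: True)
    thus ?thesis using True by (simp add: tendsto_eventually)
  next
    case False
    hence ik: "0 < k - i" using that by simp
    have "(\<lambda>N. coeff p i * (1 / real N) ^ (k - i)) \<longlonglongrightarrow> coeff p i * 0 ^ (k - i)"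
      by (intro tendsto_intros lim_1_over_n)
    moreover have "\<forall>\<^sub>F N in sequentially. coeff p i * (1 / real N) ^ (k - i) = coeff p i * real N ^ i / real N ^ k"
      using eventually_gt_at_top[of 0] by eventually_elim (use that in \<open>simp add: power_one_over power_diff field_simps\<close>)
    ultimately have "(\<lambda>N. coeff p i * real N ^ i / real N ^ k) \<longlonglongrightarrow> coeff p i * 0 ^ (k - i)"
      by (rule Lim_transform_eventually)
    thus ?thesis using False ik by (simp add: power_0_left)
  qed
  hence "(\<lambda>N. \<Sum>i\<le>k. coeff p i * real N ^ i / real N ^ k) \<longlonglongrightarrow> (\<Sum>i\<le>k. if i = k then coeff p k else 0)"
    by (intro tendsto_sum) auto
  moreover have "poly p x = (\<Sum>i\<le>k. coeff p i * x ^ i)" for x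
    unfolding poly_altdef using assms by (intro sum.mono_neutral_left) (auto simp: coeff_eq_0)
  ultimately show ?thesis by (simp add: sum_divide_distrib)
qed

text \<open>If the degree exceeded \<open>k\<close>, dividing by the larger power would exhibit the
  leading coefficient as a limit equal to 0.\<close>

lemma degree_lead_coeff_of_lim:
  fixes p :: "real poly"
  assumes lim: "(\<lambda>N. poly p (real N) / real N ^ k) \<longlonglongrightarrow> c" and c: "c \<noteq> 0"
  shows "degree p = k" "lead_coeff p = c"
proof -
  have le: "degree p \<le> k"
  proof (rule ccontr)
    assume "\<not> degree p \<le> k"
    hence k: "0 < degree p - k" "k \<le> degree p" by auto
    have "(\<lambda>N. poly p (real N) / real N ^ k * (1 / real N) ^ (degree p - k)) \<longlonglongrightarrow> c * 0 ^ (degree p - k)"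
      by (intro tendsto_mult lim tendsto_power lim_1_over_n)
    moreover have "\<forall>\<^sub>F N in sequentially. poly p (real N) / real N ^ k * (1 / real N) ^ (degree p - k) = poly p (real N) / real N ^ degree p"
      using eventually_gt_at_top[of 0] by eventually_elim (use k in \<open>simp add: power_one_over power_diff field_simps\<close>)
    ultimately have "(\<lambda>N. poly p (real N) / real N ^ degree p) \<longlonglongrightarrow> 0"
      using k(1) by (auto elim: Lim_transform_eventually simp: power_0_left)
    from LIMSEQ_unique[OF this poly_lim_coeff[OF order_refl]] have "p = 0" by simp
    thus False using k by simp
  qed
  have "coeff p k = c" using LIMSEQ_unique[OF poly_lim_coeff[OF le] lim] .
  moreover from this have "degree p = k" using le c le_degree[of p k] by auto
  ultimately show "degree p = k" "lead_coeff p = c" by simp_all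
qed

lemma card_Mon_sum: "(\<Sum>j\<le>N. card (Mon m j)) = card (Mon (Suc m) N)"
  by (induction N) (simp_all add: Mon_0 card_Mon_Suc)

lemma card_Mon_mono: "i \<le> j \<Longrightarrow> card (Mon (Suc m) i) \<le> card (Mon (Suc m) j)"
  by (rule lift_Suc_mono_le[of "\<lambda>i. card (Mon (Suc m) i)"]) (auto simp: card_Mon_Suc)

lemma card_Mon_lim:
  assumes "(\<lambda>N. real (u N) / real N) \<longlonglongrightarrow> a"
  shows "(\<lambda>N. real (card (Mon (Suc k) (u N))) / real N ^ k) \<longlonglongrightarrow> a ^ k / fact k"
proof -
  have "(\<lambda>N. real (u N) / real N + real k / real N) \<longlonglongrightarrow> a + 0"
    by (intro tendsto_add assms lim_const_over_n)
  thus ?thesis unfolding card_Mon by (intro choose_lim) (simp add: add_divide_distrib)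
qed

lemma linear_lim: "(\<lambda>N. real (a * N + b) / real N) \<longlonglongrightarrow> real a"
proof -
  have "(\<lambda>N. real a + real b / real N) \<longlonglongrightarrow> real a + 0"
    by (intro tendsto_add tendsto_const lim_const_over_n)
  moreover have "\<forall>\<^sub>F N in sequentially. real a + real b / real N = real (a * N + b) / real N"
    using eventually_gt_at_top[of 0] by eventually_elim (simp add: field_simps)
  ultimately show ?thesis using Lim_transform_eventually by fastforce
qed

lemma shift_lim: "(\<lambda>N. real (N - b) / real N) \<longlonglongrightarrow> 1"
proof -
  have "(\<lambda>N. 1 - real b / real N) \<longlonglongrightarrow> 1 - 0"
    by (intro tendsto_diff tendsto_const lim_const_over_n)
  moreover have "\<forall>\<^sub>F N in sequentially. 1 - real b / real N = real (N - b) / real N"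
    using eventually_gt_at_top[of b] by eventually_elim (simp add: field_simps of_nat_diff)
  ultimately show ?thesis using Lim_transform_eventually by fastforce
qed

context aci
begin

section \<open>The multiplicity\<close>

text \<open>The dimension of the part of \<open>P / L\<close> in T-degree \<open>j\<close> and
  x-degree below \<open>s\<close>. With \<open>s\<close> from \<open>P_high_in_L\<close> this is the
  whole part of T-degree \<open>j\<close>.\<close>

definition tau :: "nat \<Rightarrow> nat \<Rightarrow> nat" where "tau s j = the_enat (len K1 (L \<inter> Bt s j) (P \<inter> Bt s j))"

lemma len_tau: "d * n \<le> s \<Longrightarrow> len K1 (L \<inter> Bt s j) (P \<inter> Bt s j) = enat (tau s j)"
  and tau_le: "d * n \<le> s \<Longrightarrow> tau s j \<le> lam * h j + D s * h' j"
proof -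
  assume s: "d * n \<le> s"
  have le: "len K1 (L \<inter> Bt s j) (P \<inter> Bt s j) \<le> enat (lam * h j + D s * h' j)"
    by (rule order_trans[OF len_mono len_L_Bt[OF s]]) auto
  then obtain t where t: "len K1 (L \<inter> Bt s j) (P \<inter> Bt s j) = enat t" by (auto dest!: enat_ile)
  thus "len K1 (L \<inter> Bt s j) (P \<inter> Bt s j) = enat (tau s j)" by (simp add: tau_def)
  show "tau s j \<le> lam * h j + D s * h' j" using le t by (simp add: tau_def)
qed

text \<open>Evaluation at \<open>f\<close> embeds the window modulo \<open>P\<close> into the
  degrees \<open>n * j, \<dots>, n * j + s - 1\<close> of \<open>R\<close>. For fixed
  \<open>s\<close> their dimensions are of order \<open>j ^ (d - 1)\<close>.\<close>

lemma len_P_Bt: "len K1 (P \<inter> Bt s j) (Bt s j) \<le> enat (\<Sum>i<s. h' (n * j + i))"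
proof -
  let ?h = "\<lambda>a :: 'k bipoly. coef a 0"
  have "len K1 {x \<in> Bt s j. evf x \<in> {0}} (Bt s j) = len K0 {0} (msum (evf ` Bt s j) {0})"
  proof (rule len_iso[where h = ?h])
    show "?h ` K1 = K0" unfolding K1_def image_image by (simp add: coef_const)
    show "evf (a * x) = ?h a * evf x" if "a \<in> K1" "x \<in> Bt s j" for a x
      using that by (auto simp: K1_def ev_simps coef_const)
  qed (auto simp: BB.subr_K RR.subr_K submod_Bt submod_zero_set ev_simps)
  also have "{x \<in> Bt s j. evf x \<in> {0}} = P \<inter> Bt s j"
  proof -
    have "evf (filt (dg i) x) = (if i = j then evf x else 0)" if "x \<in> Bt s j" for x i
      using that filt_deg_form[of j x i] by (simp add: Bt_def ev_simps hid.eval_0)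
    hence "x \<in> P \<longleftrightarrow> evf x = 0" if "x \<in> Bt s j" for x
      unfolding P_iff using that by (auto simp: Bt_def split: if_splits)
    thus ?thesis by auto
  qed
  also have "msum (evf ` Bt s j) {0} = evf ` Bt s j" by (auto simp: msum_def)
  also have "len K0 {0} (evf ` Bt s j) \<le> enat (card ((\<lambda>mu. single mu (1 :: 'k)) ` (\<Union>i<s. Mon d (n * j + i))))"
  proof (rule RR.K.len_le_card[OF submod_zero_set])
    show "evf ` Bt s j \<subseteq> gen K0 ({0} \<union> (\<lambda>mu. single mu 1) ` (\<Union>i<s. Mon d (n * j + i)))"
    proof clarify
      fix b assume b: "b \<in> Bt s j"
      have keys: "mu \<in> (\<Union>i<s. Mon d (n * j + i))" if mu: "mu \<in> keys (evf b)" for mu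
      proof -
        obtain nu where nu: "nu \<in> keys b" "mu \<in> keys (coef b nu * mev f nu)"
        proof -
          have "(\<Sum>nu\<in>keys b. coef (coef b nu * mev f nu) mu) \<noteq> 0"
            using mu by (simp add: evf_expand in_keys_iff lookup_sum)
          thus thesis using that by (meson in_keys_iff sum.neutral)
        qed
        obtain mu1 mu2 where mu12: "mu = mu1 + mu2" "mu1 \<in> keys (coef b nu)" "mu2 \<in> keys (mev f nu)"
          using keys_mult[of "coef b nu" "mev f nu"] nu(2) by blast
        have "nu \<in> Mon (Suc d) j" using Bt_keys[OF b nu(1)] .
        hence nud: "keys nu \<subseteq> {..d}" "deg nu = j" by (auto simp: Mon_def lessThan_Suc_atMost)
        hence "deg mu2 = n * j" using mev_f_form[of nu] mu12(3) by (auto simp: form_iff)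
        moreover have "deg mu1 < s" "keys mu1 \<subseteq> {..<d}" using Bt_keys'[OF b mu12(2)] by (auto simp: Xlt_def)
        moreover have "mev f nu \<in> R" unfolding mev_def using nud(1) f_in
          by (intro RR.B.prod RR.B.power) auto
        hence "keys mu2 \<subseteq> {..<d}" using mu12(3) by (auto simp: R_iff)
        ultimately show ?thesis unfolding mu12(1)
          by (intro UN_I[of "deg mu1"]) (auto simp: Mon_def keys_plus_nat)
      qed
      hence "evf b \<in> R" by (auto simp: R_iff Mon_def)
      moreover have "(\<lambda>mu. single mu 1) ` keys (evf b) \<subseteq> {0} \<union> (\<lambda>mu. single mu (1 :: 'k)) ` (\<Union>i<s. Mon d (n * j + i))"
        using keys by auto
      ultimately show "evf b \<in> gen K0 ({0} \<union> (\<lambda>mu. single mu 1) ` (\<Union>i<s. Mon d (n * j + i)))"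
        using subsetD[OF gen_mono[OF RR.subr_K] R_expand] by blast
    qed
  qed auto
  also have "card ((\<lambda>mu. single mu (1 :: 'k)) ` (\<Union>i<s. Mon d (n * j + i))) \<le> card (\<Union>i<s. Mon d (n * j + i))"
    by (rule card_image_le) auto
  also have "\<dots> \<le> (\<Sum>i<s. h' (n * j + i))" by (rule card_UN_le) auto
  finally show ?thesis by simp
qed

lemma h'_mono: "i \<le> j \<Longrightarrow> h' i \<le> h' j"
  using card_Mon_mono[of i j "d - 1"] d_ge by simp

text \<open>The window splits into its parts in \<open>L\<close>, \<open>P / L\<close> and
  \<open>B / P\<close>, of which the first and the last are bounded from above. The shift of
  \<open>j\<close> comes from the T-degree 1 of the linear relations and is absorbed by
  \<open>h j \<le> h (Suc j)\<close>.\<close>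

lemma tau_ge:
  assumes s: "d * n \<le> s"
  shows "lam * h j \<le> tau s (Suc j) + D s * h' (Suc j) + s * h' (n * Suc j + s)"
proof -
  obtain r where r: "r + lam = D s" "\<And>j. len K1 {0} (L \<inter> Bt s (Suc j)) \<le> enat (r * h j + D s * h' (Suc j))"
    using len_L_Bt_le[OF s] by blast
  have sub: "submod K1 (L \<inter> Bt s (Suc j))" "submod K1 (P \<inter> Bt s (Suc j))"
    by (intro submod_Int subK_L subK_P submod_Bt)+
  have z: "{0} \<subseteq> L \<inter> Bt s (Suc j)" using submod_zero[OF sub(1)] by auto
  have LP: "L \<inter> Bt s (Suc j) \<subseteq> P \<inter> Bt s (Suc j)" using L_subset_P by auto
  have "enat (D s * h (Suc j)) = len K1 {0} (L \<inter> Bt s (Suc j)) + len K1 (L \<inter> Bt s (Suc j)) (Bt s (Suc j))"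
    unfolding len_Bt[symmetric] using z by (intro len_add BB.subr_K submod_zero_set sub submod_Bt) auto
  also have "len K1 (L \<inter> Bt s (Suc j)) (Bt s (Suc j)) = enat (tau s (Suc j)) + len K1 (P \<inter> Bt s (Suc j)) (Bt s (Suc j))"
    unfolding len_tau[OF s, symmetric] using LP by (intro len_add BB.subr_K sub submod_Bt) auto
  also have "len K1 {0} (L \<inter> Bt s (Suc j)) + (enat (tau s (Suc j)) + len K1 (P \<inter> Bt s (Suc j)) (Bt s (Suc j)))
      \<le> enat (r * h j + D s * h' (Suc j)) + (enat (tau s (Suc j)) + enat (\<Sum>i<s. h' (n * Suc j + i)))"
    by (intro add_mono r(2) len_P_Bt order_refl)
  finally have "D s * h (Suc j) \<le> r * h j + D s * h' (Suc j) + tau s (Suc j) + (\<Sum>i<s. h' (n * Suc j + i))" by simp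
  moreover have "(\<Sum>i<s. h' (n * Suc j + i)) \<le> s * h' (n * Suc j + s)"
    using sum_bounded_above[of "{..<s}" "\<lambda>i. h' (n * Suc j + i)" "h' (n * Suc j + s)"] h'_mono by simp
  moreover have "D s * h j \<le> D s * h (Suc j)" by (intro mult_le_mono2 card_Mon_mono) simp
  moreover have "D s * h j = r * h j + lam * h j" unfolding r(1)[symmetric] by (simp add: distrib_right)
  ultimately show ?thesis by linarith
qed

lemma sum_tau_le: "d * n \<le> s \<Longrightarrow> (\<Sum>j\<le>N. tau s j) \<le> lam * card (Mon (Suc (Suc d)) N) + D s * h N"
  using sum_mono[of "{..N}" "tau s" "\<lambda>j. lam * h j + D s * h' j"] tau_le[of s]
  by (simp add: sum.distrib sum_distrib_left[symmetric] card_Mon_sum)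

lemma sum_tau_ge:
  assumes s: "d * n \<le> s"
  shows "lam * card (Mon (Suc (Suc d)) N) \<le> (\<Sum>j\<le>Suc N. tau s j) + D s * h (Suc N) + Suc N * (s * h' (n * Suc N + s))"
proof -
  have shift: "(\<Sum>j\<le>N. g (Suc j)) \<le> (\<Sum>j\<le>Suc N. g j)" for g :: "nat \<Rightarrow> nat" unfolding sum.atMost_Suc_shift by simp
  have "lam * card (Mon (Suc (Suc d)) N) = (\<Sum>j\<le>N. lam * h j)" by (simp add: card_Mon_sum sum_distrib_left[symmetric])
  also have "\<dots> \<le> (\<Sum>j\<le>N. tau s (Suc j) + D s * h' (Suc j) + s * h' (n * Suc N + s))"
  proof (rule sum_mono)
    fix j assume "j \<in> {..N}"
    hence "s * h' (n * Suc j + s) \<le> s * h' (n * Suc N + s)" by (intro mult_le_mono2 h'_mono add_mono) auto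
    thus "lam * h j \<le> tau s (Suc j) + D s * h' (Suc j) + s * h' (n * Suc N + s)" using tau_ge[OF s, of j] by linarith
  qed
  also have "\<dots> = (\<Sum>j\<le>N. tau s (Suc j)) + D s * (\<Sum>j\<le>N. h' (Suc j)) + Suc N * (s * h' (n * Suc N + s))"
    by (simp only: sum.distrib sum_distrib_left[symmetric]) (simp add: algebra_simps)
  also have "\<dots> \<le> (\<Sum>j\<le>Suc N. tau s j) + D s * h (Suc N) + Suc N * (s * h' (n * Suc N + s))"
    using shift[of "tau s"] shift[of h'] unfolding card_Mon_sum by (intro add_mono mult_le_mono2) auto
  finally show ?thesis .
qed

text \<open>The filtration of \<open>P\<close> by T-degree, taken modulo \<open>L\<close>. For large
  \<open>s\<close> its layers have the dimensions \<open>tau s N\<close>, and up to shifts it agrees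
  with the filtration by powers of the maximal ideal.\<close>

definition U :: "nat \<Rightarrow> 'k bipoly set" where
  "U N = msum {p \<in> P. \<forall>nu\<in>keys p. N \<le> deg nu} L"

lemma submod_U: "submod B (U N)"
  unfolding U_def
proof (rule submod_msum[OF _ submod_M], rule submodI)
  fix b p assume b: "b \<in> B" and p: "p \<in> {p \<in> P. \<forall>nu\<in>keys p. N \<le> deg nu}"
  have "N \<le> deg nu" if "nu \<in> keys (b * p)" for nu
    using keys_mult[of b p] that p by fastforce
  thus "b * p \<in> {p \<in> P. \<forall>nu\<in>keys p. N \<le> deg nu}" using submod_mult[OF submod_P b] p by auto
next
  fix x y assume "x \<in> {p \<in> P. \<forall>nu\<in>keys p. N \<le> deg nu}" "y \<in> {p \<in> P. \<forall>nu\<in>keys p. N \<le> deg nu}"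
  thus "x + y \<in> {p \<in> P. \<forall>nu\<in>keys p. N \<le> deg nu}"
    using Poly_Mapping.keys_add[of x y] submod_add[OF submod_P] by fastforce
qed (simp add: submod_zero[OF submod_P])

lemma P_U: "p \<in> P \<Longrightarrow> (\<And>nu. nu \<in> keys p \<Longrightarrow> N \<le> deg nu) \<Longrightarrow> p \<in> U N"
  unfolding U_def using msumI[of p _ 0 L] submod_zero[OF submod_M] by auto

lemma L_U: "L \<subseteq> U N"
  unfolding U_def using msumI[of 0 _ _ L] submod_zero[OF submod_P] by auto

lemma U_P: "U N \<subseteq> P"
  unfolding U_def using L_subset_P by (intro msum_least[OF submod_P]) auto

lemma U_mono: "N \<le> N' \<Longrightarrow> U N' \<subseteq> U N"
  unfolding U_def msum_def by fastforce

lemma len_U_Suc: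
  assumes s: "d * n \<le> s" and high: "\<And>p. p \<in> P \<Longrightarrow> fl (\<lambda>_ i. s \<le> i) p \<in> L"
  shows "len K1 (U (Suc N)) (U N) = enat (tau s N)"
proof -
  have subP: "submod K1 (P \<inter> Bt s N)" by (intro submod_Int subK_P submod_Bt)
  have subU: "submod K1 (U N)" for N by (rule BB.submod_K[OF submod_U])
  have "(P \<inter> Bt s N) \<inter> U (Suc N) = L \<inter> Bt s N"
  proof (intro subset_antisym subsetI)
    fix x assume x: "x \<in> (P \<inter> Bt s N) \<inter> U (Suc N)"
    then obtain p l where pl: "x = p + l" "l \<in> L" "\<forall>nu\<in>keys p. Suc N \<le> deg nu" by (auto simp: U_def msum_def)
    have "x = filt (dg N) x" using x filt_deg_form[of N x N] by (simp add: Bt_def)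
    also have "\<dots> = filt (dg N) p + filt (dg N) l" by (simp add: pl(1) filt_add)
    also have "filt (dg N) p = 0" using pl(3) by (intro filt_none) auto
    finally have "x \<in> L" using filt_L[OF pl(2), of "\<lambda>i. i = N"] by simp
    thus "x \<in> L \<inter> Bt s N" using x by simp
  qed (use L_U L_subset_P in auto)
  moreover have "msum (P \<inter> Bt s N) (U (Suc N)) = U N"
  proof (rule antisym)
    have "P \<inter> Bt s N \<subseteq> U N" by (auto intro!: P_U simp: Bt_def form_iff)
    thus "msum (P \<inter> Bt s N) (U (Suc N)) \<subseteq> U N" using U_mono by (intro msum_least[OF submod_U]) auto
    show "U N \<subseteq> msum (P \<inter> Bt s N) (U (Suc N))"
    proof
      fix x assume "x \<in> U N"
      then obtain p l where pl: "x = p + l" "l \<in> L" "p \<in> P" "\<forall>nu\<in>keys p. N \<le> deg nu" by (auto simp: U_def msum_def)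
      let ?q = "fl (\<lambda>i i'. i = N \<and> i' < s) p"
      have q: "?q \<in> P \<inter> Bt s N"
      proof -
        show ?thesis using tr_Bt[of p N s] fl_P[OF pl(3), of "\<lambda>i i'. i = N \<and> i' < s"] pl(3) P_subset_B by auto
      qed
      have hi: "fl (\<lambda>i i'. i = N \<and> s \<le> i') p \<in> U (Suc N)"
      proof -
        have "fl (\<lambda>i i'. i = N \<and> s \<le> i') p = filt (dg N) (fl (\<lambda>_ i. s \<le> i) p)"
          by (rule poly_mapping_eqI, rule poly_mapping_eqI) (auto simp: coef_fl coef_filt)
        thus ?thesis using filt_L[OF high[OF pl(3)], of "\<lambda>i. i = N"] L_U by auto
      qed
      have rest: "filt (\<lambda>nu. deg nu \<noteq> N) p \<in> U (Suc N)"
      proof (rule P_U[OF filt_P[OF pl(3), of "\<lambda>i. i \<noteq> N"]])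
        fix nu assume "nu \<in> keys (filt (\<lambda>nu. deg nu \<noteq> N) p)"
        thus "Suc N \<le> deg nu" using pl(4) by (auto simp: keys_filt Suc_le_eq le_neq_implies_less)
      qed
      have "p = ?q + (fl (\<lambda>i i'. i = N \<and> s \<le> i') p + filt (\<lambda>nu. deg nu \<noteq> N) p)"
        by (rule poly_mapping_eqI, rule poly_mapping_eqI) (auto simp: coef_fl coef_filt lookup_add)
      hence eq: "x = (?q + (fl (\<lambda>i i'. i = N \<and> s \<le> i') p + filt (\<lambda>nu. deg nu \<noteq> N) p)) + l"
        unfolding pl(1) by (rule arg_cong[where f = "\<lambda>p. p + l"])
      have "l \<in> U (Suc N)" using pl(2) L_U by auto
      hence "fl (\<lambda>i i'. i = N \<and> s \<le> i') p + filt (\<lambda>nu. deg nu \<noteq> N) p + l \<in> U (Suc N)"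
        using hi rest submod_add[OF submod_U] by blast
      from msumI[OF q this] show "x \<in> msum (P \<inter> Bt s N) (U (Suc N))"
        unfolding eq by (simp only: add.assoc)
    qed
  qed
  ultimately have "len K1 (U (Suc N)) (U N) = len K1 (L \<inter> Bt s N) (P \<inter> Bt s N)"
    using len_inclusion[OF BB.subr_K subP subU, of "Suc N"] by simp
  thus ?thesis using len_tau[OF s] by simp
qed

lemma len_U:
  assumes s: "d * n \<le> s" and high: "\<And>p. p \<in> P \<Longrightarrow> fl (\<lambda>_ i. s \<le> i) p \<in> L"
  shows "len K1 (U N) P = enat (\<Sum>j<N. tau s j)"
proof (induction N)
  case 0
  have "U 0 = P" using U_P P_U[of _ 0] by blast
  thus ?case by (simp add: zero_enat_def)
next
  case (Suc N)
  have subU: "submod K1 (U N)" for N by (rule BB.submod_K[OF submod_U])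
  have "len K1 (U (Suc N)) P = len K1 (U (Suc N)) (U N) + len K1 (U N) P"
    by (intro len_add BB.subr_K subU subK_P U_P U_mono) simp
  moreover have "len K1 (U (Suc N)) (U N) = enat (tau s N)" using s high by (rule len_U_Suc)
  ultimately show ?case using Suc by (simp add: add.commute)
qed

section \<open>Comparison of the filtration by T-degree with powers of the maximal ideal\<close>

lemma y_power_bm: "v < m \<Longrightarrow> \<exists>nu mu. y v ^ i = bm nu mu \<and> deg nu + deg mu = i"
proof (induction i)
  case 0 show ?case by (intro exI[of _ 0]) (simp add: single_one)
next
  case (Suc i)
  then obtain nu mu where nu: "y v ^ i = bm nu mu" "deg nu + deg mu = i" by auto
  show ?case
  proof (cases "v \<le> d")
    case True
    hence "y v ^ Suc i = bm (single v 1 + nu) mu" using nu(1) by (simp add: y_def var_def mult_single)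
    thus ?thesis using nu(2) by (intro exI[of _ "single v 1 + nu"] exI[of _ mu]) simp
  next
    case False
    hence "y v ^ Suc i = bm nu (single (v - Suc d) 1 + mu)" using nu(1) by (simp add: y_def var_def const_def mult_single)
    thus ?thesis using nu(2) by (intro exI[of _ nu] exI[of _ "single (v - Suc d) 1 + mu"]) simp
  qed
qed

lemma mnm_bm:
  assumes "keys ka \<subseteq> {..<m}"
  obtains nu mu where "BB.mnm ka = bm nu mu" "deg nu + deg mu = deg ka"
proof -
  have "\<exists>nu mu. (\<Prod>v\<in>S. y v ^ coef ka v) = bm nu mu \<and> deg nu + deg mu = (\<Sum>v\<in>S. coef ka v)" if "finite S" "S \<subseteq> {..<m}" for S
    using that
  proof (induction S)
    case empty show ?case by (intro exI[of _ 0]) (simp add: single_one)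
  next
    case (insert v S)
    then obtain nu mu nu' mu' where "(\<Prod>v\<in>S. y v ^ coef ka v) = bm nu mu" "deg nu + deg mu = (\<Sum>v\<in>S. coef ka v)"
      "y v ^ coef ka v = bm nu' mu'" "deg nu' + deg mu' = coef ka v" using y_power_bm[of v "coef ka v"] by auto
    thus ?case using insert.hyps by (intro exI[of _ "nu' + nu"] exI[of _ "mu' + mu"]) (simp add: mult_single)
  qed
  from this[of "keys ka"] show thesis using that assms by (auto simp: mev_def deg_def)
qed

lemma high_mult:
  assumes high: "\<And>p. p \<in> P \<Longrightarrow> fl (\<lambda>_ i. s \<le> i) p \<in> L" and qP: "bm nu mu * p \<in> P" and True: "s \<le> deg mu" and p: "p \<in> P"
  shows "bm nu mu * p \<in> L"
proof -
  have "bm nu mu * p = (\<Sum>ka\<in>keys p. single (nu + ka) (single mu 1 * coef p ka))"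
    by (subst monom_expand[of p]) (simp_all add: sum_distrib_left mult_single)
  moreover have "fl (\<lambda>_ i. s \<le> i) (single (nu + ka) (single mu 1 * coef p ka)) = single (nu + ka) (single mu 1 * coef p ka)" for ka
  proof -
    have "filt (\<lambda>mu. s \<le> deg mu) (single mu 1 * coef p ka) = single mu 1 * coef p ka"
    proof (rule filt_id)
      fix mu' assume "mu' \<in> keys (single mu 1 * coef p ka)"
      then obtain mu1 mu2 where "mu' = mu1 + mu2" "mu1 \<in> keys (single mu (1::'k))" using keys_mult by blast
      thus "s \<le> deg mu'" using True by simp
    qed
    thus ?thesis by (simp add: fl_single)
  qed
  ultimately have "fl (\<lambda>_ i. s \<le> i) (bm nu mu * p) = bm nu mu * p" by (simp add: fl_sum)
  thus ?thesis using high[OF qP] by simp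
qed

text \<open>A monomial of total degree \<open>N\<close> either has x-degree at least
  \<open>s\<close>, and then sends \<open>P\<close> into \<open>L\<close>, or has T-degree at least
  \<open>N - s\<close>.\<close>

lemma Npow_U:
  assumes high: "\<And>p. p \<in> P \<Longrightarrow> fl (\<lambda>_ i. s \<le> i) p \<in> L"
  shows "BB.Npow N P L \<subseteq> U (N - s)"
  unfolding BB.Npow_def
proof (rule gen_least[OF submod_U], rule Un_least[OF _ L_U], clarify)
  fix ka p assume ka: "ka \<in> Mon m N" and p: "p \<in> P"
  then obtain nu mu where nu: "BB.mnm ka = bm nu mu" "deg nu + deg mu = N" using mnm_bm[of ka] by (auto simp: Mon_def)
  have qP: "BB.mnm ka * p \<in> P" using ka p by (intro submod_mult[OF submod_P] BB.mnm_B) (auto simp: Mon_def)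
  show "BB.mnm ka * p \<in> U (N - s)"
  proof (cases "s \<le> deg mu")
    case True
    show ?thesis using high_mult[OF high _ True p] qP nu(1) L_U by auto
  next
    case False
    show ?thesis
    proof (rule P_U[OF qP])
      fix nu' assume "nu' \<in> keys (BB.mnm ka * p)"
      then obtain nu1 nu2 where "nu' = nu1 + nu2" "nu1 \<in> keys (bm nu mu)" unfolding nu(1) using keys_mult by blast
      hence "deg nu \<le> deg nu'" by (simp split: if_splits)
      thus "N - s \<le> deg nu'" using False nu(2) by simp
    qed
  qed
qed

lemma mnm_T: "keys nu \<subseteq> {..d} \<Longrightarrow> BB.mnm nu = single nu 1"
proof -
  assume "keys nu \<subseteq> {..d}"
  hence "BB.mnm nu = mev var nu" unfolding mev_def by (intro prod.cong) (auto simp: y_def)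
  thus ?thesis by (simp add: mev_var)
qed

text \<open>The constant \<open>c\<close> bounds the T-degrees of homogeneous generators over
  \<open>k[T]\<close>: only coefficients of degree at least \<open>N\<close> can reach T-degree
  \<open>N + c\<close>.\<close>

lemma U_Npow:
  obtains c where "\<And>N. U (N + c) \<subseteq> BB.Npow N P L"
proof -
  obtain G where G: "finite G" "G \<subseteq> P" "\<And>g. g \<in> G \<Longrightarrow> \<exists>j. form j g" "P = gen KT (G \<union> L)"
    using P_homogeneous_generators by blast
  then obtain e where e: "\<And>g. g \<in> G \<Longrightarrow> form (e g) g" by metis
  define c where "c = (\<Sum>g\<in>G. e g)"
  have c: "e g \<le> c" if "g \<in> G" for g unfolding c_def using member_le_sum[OF that, of e] G(1) by simp
  have "p \<in> BB.Npow N P L" if p: "p \<in> P" "\<And>nu. nu \<in> keys p \<Longrightarrow> N + c \<le> deg nu" for p N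
  proof -
    obtain a l where a: "\<forall>g\<in>G. a g \<in> KT" "l \<in> L" "p = l + (\<Sum>g\<in>G. a g * g)"
    proof -
      have "p \<in> msum L (gen KT ((\<lambda>g. g) ` G))"
        using p(1) G(4) gen_Un_submod[OF subr_KT submod_KT[OF submod_M], of "Suc d" G] by (simp add: Un_commute)
      thus thesis using that unfolding gen_image_sum[OF subr_KT G(1)] msum_def by auto
    qed
    have "p = filt (\<lambda>nu. N + c \<le> deg nu) p" using p(2) by (intro filt_id[symmetric])
    also have "\<dots> = filt (\<lambda>nu. N + c \<le> deg nu) l + (\<Sum>g\<in>G. filt (\<lambda>nu. N + c \<le> e g + deg nu) (a g) * g)"
      unfolding a(3) filt_add filt_sum
    proof (intro arg_cong2[where f = "(+)"] sum.cong refl)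
      fix g assume "g \<in> G"
      thus "filt (\<lambda>nu. N + c \<le> deg nu) (a g * g) = filt (\<lambda>nu. N + c \<le> e g + deg nu) (a g) * g"
        using filt_form_mult[OF e, of g "\<lambda>i. N + c \<le> i" "a g"] by (simp add: mult.commute)
    qed
    also have "\<dots> \<in> BB.Npow N P L"
    proof (rule submod_add[OF BB.submod_Npow _ submod_sum[OF BB.submod_Npow]])
      show "filt (\<lambda>nu. N + c \<le> deg nu) l \<in> BB.Npow N P L" using filt_L[OF a(2), of "\<lambda>i. N + c \<le> i"] BB.L_Npow by blast
      fix g assume g: "g \<in> G"
      let ?a = "filt (\<lambda>nu. N + c \<le> e g + deg nu) (a g)"
      have aKT: "?a \<in> KT" using a(1) g RR.K.zero unfolding KT_def by (intro filt_mpolys) auto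
      have "const (coef ?a nu) * (single nu 1 * g) \<in> BB.Npow N P L" if nu: "nu \<in> keys ?a" for nu
      proof (rule submod_mult[OF BB.submod_Npow])
        have "coef ?a nu \<in> K0" "keys nu \<subseteq> {..d}" using aKT nu mpolys_keys[of ?a K0 "{..d}" nu] by (auto simp: KT_def mpolys_coef)
        thus "const (coef ?a nu) \<in> B" using RR.K_B by (intro const_B) auto
        have "{..d} \<subseteq> {..<m}" by auto
        hence "keys nu \<subseteq> {..<m}" using `keys nu \<subseteq> {..d}` by blast
        moreover have "N \<le> deg nu" using nu c[OF g] by (simp add: keys_filt)
        ultimately show "single nu 1 * g \<in> BB.Npow N P L"
          using BB.mnm_Npow[OF submod_P, of nu N g L] mnm_T[OF `keys nu \<subseteq> {..d}`] g G(2) by auto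
      qed
      hence "(\<Sum>nu\<in>keys ?a. const (coef ?a nu) * (single nu 1 * g)) \<in> BB.Npow N P L"
        by (intro submod_sum[OF BB.submod_Npow])
      also have "(\<Sum>nu\<in>keys ?a. const (coef ?a nu) * (single nu 1 * g)) = ?a * g"
        unfolding mult.assoc[symmetric] sum_distrib_right[symmetric] const_single
        using monom_expand[of ?a] by simp
      finally show "?a * g \<in> BB.Npow N P L" .
    qed
    finally show ?thesis .
  qed
  hence "U (N + c) \<subseteq> BB.Npow N P L" for N
    unfolding U_def using BB.L_Npow by (intro msum_least[OF BB.submod_Npow]) auto
  thus thesis by (rule that)
qed

text \<open>Both bounds for the length have the same leading term, which determines the Hilbert-Samuel polynomial.\<close>

lemma multiplicity:
  obtains l p where "\<And>N. len B (BB.Npow N P L) P = enat (l N)" "\<forall>\<^sub>F N in sequentially. real (l N) = poly p (real N)"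
    "\<And>q. \<forall>\<^sub>F N in sequentially. real (l N) = poly q (real N) \<Longrightarrow> fact (degree q) * lead_coeff q = real lam"
proof -
  obtain s where s: "d * n \<le> s" "\<And>p. p \<in> P \<Longrightarrow> fl (\<lambda>_ i. s \<le> i) p \<in> L" using P_high_in_L by blast
  obtain c where c: "\<And>N. U (N + c) \<subseteq> BB.Npow N P L" using U_Npow by blast
  obtain G where G: "finite G" "G \<subseteq> P" "P = gen B G" by (rule P_generators)
  have "P = gen B (G \<union> L)"
  proof (rule antisym)
    show "P \<subseteq> gen B (G \<union> L)" using gen_mono[OF subr_B, of G "G \<union> L"] G(3) by blast
    show "gen B (G \<union> L) \<subseteq> P" using G(2) L_subset_P by (intro gen_least submod_P) auto
  qed
  then obtain l where l: "evpoly l" "\<And>N. len K1 (BB.Npow N P L) P = enat (l N)"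
    using BB.Npow_evpoly[OF submod_P submod_M L_subset_P G(1)] by blast
  have upper: "l N \<le> (\<Sum>j\<le>N + c. tau s j)" for N
  proof -
    have "enat (l N) \<le> len K1 (U (N + c)) P" unfolding l(2)[symmetric] using c by (intro len_mono) auto
    hence "l N \<le> (\<Sum>j<N + c. tau s j)" by (simp add: len_U[OF s])
    also have "\<dots> \<le> (\<Sum>j\<le>N + c. tau s j)" by (rule sum_mono2) auto
    finally show ?thesis .
  qed
  have lower: "(\<Sum>j<N - s. tau s j) \<le> l N" for N
  proof -
    have "len K1 (U (N - s)) P \<le> enat (l N)" unfolding l(2)[symmetric] using Npow_U[OF s(2)] by (intro len_mono) auto
    thus ?thesis by (simp add: len_U[OF s])
  qed
  \<comment> \<open>The two bounds agree in the term of order \<open>Suc d\<close>, which comes from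
    summing \<open>lam * h j\<close>; all other terms have order at most \<open>d\<close>.\<close>
  have lim: "(\<lambda>N. real (l N) / real N ^ Suc d) \<longlonglongrightarrow> real lam / fact (Suc d)"
  proof -
    have add: "(\<lambda>N. real (N + b) / real N) \<longlonglongrightarrow> 1" for b using linear_lim[of 1 b] by simp
    let ?up = "\<lambda>N. real lam * (real (card (Mon (Suc (Suc d)) (N + c))) / real N ^ Suc d)
      + real (D s) * (real (h (N + c)) / real N ^ d) * (1 / real N)"
    have "?up \<longlonglongrightarrow> real lam * (1 ^ Suc d / fact (Suc d)) + real (D s) * (1 ^ d / fact d) * 0"
      by (intro tendsto_add tendsto_mult tendsto_const card_Mon_lim add lim_1_over_n)
    hence up_lim: "?up \<longlonglongrightarrow> real lam / fact (Suc d)" by simp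
    have le_up: "\<forall>\<^sub>F N in sequentially. real (l N) / real N ^ Suc d \<le> ?up N"
      using eventually_gt_at_top[of 0]
    proof eventually_elim
      case (elim N)
      have "real (l N) \<le> real (lam * card (Mon (Suc (Suc d)) (N + c)) + D s * h (N + c))"
        using order_trans[OF upper sum_tau_le[OF s(1)]] by (simp only: of_nat_le_iff)
      hence "real (l N) / real N ^ Suc d \<le> real (lam * card (Mon (Suc (Suc d)) (N + c)) + D s * h (N + c)) / real N ^ Suc d"
        by (intro divide_right_mono) auto
      also have "\<dots> = ?up N" using elim by (simp add: add_divide_distrib)
      finally show ?case .
    qed
    \<comment> \<open>Chosen so that \<open>Suc (u N)\<close>, where the sum in
      \<open>sum_tau_ge\<close> stops, is the last index of the sum over
      \<open>j < N - s\<close>.\<close>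
    define u where "u N = N - (s + 2)" for N
    let ?lo = "\<lambda>N. real lam * (real (card (Mon (Suc (Suc d)) (u N))) / real N ^ Suc d)
      - real (D s) * (real (h (N - (s + 1))) / real N ^ d) * (1 / real N)
      - real s * (real (N - (s + 1)) / real N) * (real (card (Mon (Suc (d - 1)) (n * N + s))) / real N ^ (d - 1)) * (1 / real N)"
    have u_lim: "(\<lambda>N. real (u N) / real N) \<longlonglongrightarrow> 1" unfolding u_def by (rule shift_lim)
    have "?lo \<longlonglongrightarrow> real lam * (1 ^ Suc d / fact (Suc d)) - real (D s) * (1 ^ d / fact d) * 0
      - real s * 1 * (real n ^ (d - 1) / fact (d - 1)) * 0"
      by (intro tendsto_diff tendsto_mult tendsto_const card_Mon_lim u_lim shift_lim linear_lim lim_1_over_n)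
    hence lo_lim: "?lo \<longlonglongrightarrow> real lam / fact (Suc d)" by simp
    have lo_le: "\<forall>\<^sub>F N in sequentially. ?lo N \<le> real (l N) / real N ^ Suc d"
      using eventually_gt_at_top[of "s + 2"]
    proof eventually_elim
      case (elim N)
      have u: "Suc (Suc (u N)) = N - s" "Suc (u N) = N - (s + 1)" "N > 0" using elim by (auto simp: u_def)
      have "{..Suc (u N)} = {..<N - s}" using u(1) by auto
      hence "lam * card (Mon (Suc (Suc d)) (u N))
          \<le> (\<Sum>j<N - s. tau s j) + D s * h (N - (s + 1)) + (N - (s + 1)) * (s * h' (n * (N - (s + 1)) + s))"
        using sum_tau_ge[OF s(1), of "u N"] unfolding u(2) by simp
      also have "h' (n * (N - (s + 1)) + s) \<le> h' (n * N + s)" by (intro h'_mono add_mono mult_le_mono) auto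
      finally have "lam * card (Mon (Suc (Suc d)) (u N)) \<le> l N + D s * h (N - (s + 1)) + (N - (s + 1)) * (s * h' (n * N + s))"
        using lower[of N] by (simp add: mult_le_mono)
      hence "real (lam * card (Mon (Suc (Suc d)) (u N)))
          \<le> real (l N + D s * h (N - (s + 1)) + (N - (s + 1)) * (s * h' (n * N + s)))"
        by (simp only: of_nat_le_iff)
      hence "(real (lam * card (Mon (Suc (Suc d)) (u N))) - real (D s * h (N - (s + 1))) - real ((N - (s + 1)) * (s * h' (n * N + s)))) / real N ^ Suc d
          \<le> real (l N) / real N ^ Suc d"
        by (intro divide_right_mono) (simp_all del: of_nat_mult)
      also have "(real (lam * card (Mon (Suc (Suc d)) (u N))) - real (D s * h (N - (s + 1))) - real ((N - (s + 1)) * (s * h' (n * N + s)))) / real N ^ Suc d = ?lo N"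
      proof -
        have "Suc (d - 1) = d" using d_ge by simp
        hence "real N ^ d = real N * real N ^ (d - 1)" by (metis power_Suc)
        thus ?thesis using u(3) `Suc (d - 1) = d` by (simp add: diff_divide_distrib mult_ac)
      qed
      finally show ?case .
    qed
    show ?thesis by (rule tendsto_sandwich[OF lo_le le_up lo_lim up_lim])
  qed
  have key: "fact (degree q) * lead_coeff q = real lam" if q: "\<forall>\<^sub>F N in sequentially. real (l N) = poly q (real N)" for q
  proof -
    have "\<forall>\<^sub>F N in sequentially. real (l N) / real N ^ Suc d = poly q (real N) / real N ^ Suc d"
      using q by eventually_elim simp
    from Lim_transform_eventually[OF lim this]
    have "degree q = Suc d" "lead_coeff q = real lam / fact (Suc d)"
      using degree_lead_coeff_of_lim[of q "Suc d" "real lam / fact (Suc d)"] lam_pos by auto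
    thus ?thesis by simp
  qed
  obtain p where p: "\<forall>\<^sub>F N in sequentially. real (l N) = poly p (real N)" using l(1) by (auto simp: evpoly_def)
  show thesis
    by (rule that[OF _ p key]) (simp_all add: BB.len_Npow[OF submod_P submod_M L_subset_P] l(2))
qed

end

context aci
begin

section \<open>The number of generators\<close>

subsection \<open>Vanishing of Koszul homology of the module of nonlinear relations\<close>

text \<open>Vanishing is vacuous in degree \<open>Suc m = 2 * d + 2\<close>, and each of the
  \<open>d\<close> elements regular on \<open>B / P\<close> lowers the degree by one.\<close>

lemma van_rees:
  assumes a: "\<And>i. i < d \<Longrightarrow> a i \<in> gen B (y ` {..<m})"
    and reg: "\<And>i x. i < d \<Longrightarrow> x \<in> B \<Longrightarrow> a i * x \<in> gen B (P \<union> a ` {..<i}) \<Longrightarrow> x \<in> gen B (P \<union> a ` {..<i})"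
  shows "van y m (d + 2) B P"
proof -
  let ?Y = "\<lambda>i. gen B (P \<union> a ` {..<i})"
  have aB: "a i \<in> B" if "i < d" for i
    using a[OF that] gen_least[OF submod_self[OF subr_B], of "y ` {..<m}"] K.y by auto
  have sub: "submod B (?Y i)" for i by (rule submod_gen[OF subr_B])
  have YB: "?Y i \<subseteq> B" if "i \<le> d" for i
    using that aB P_subset_B by (intro gen_least submod_self subr_B) auto
  have "van y m (Suc m - k) B (?Y (d - k))" if "k \<le> d" for k
    using that
  proof (induction k)
    case 0 show ?case by (intro K.van_vacuous submod_self subr_B) simp
  next
    case (Suc k)
    let ?i = "d - Suc k"
    have i: "?i < d" "Suc ?i = d - k" using Suc.prems by auto
    have step: "?Y (Suc ?i) = msum (?Y ?i) ((*) (a ?i) ` B)"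
    proof -
      have "?Y (Suc ?i) = msum (?Y ?i) (gen B {a ?i})"
        using gen_Un[OF subr_B, of "P \<union> a ` {..<?i}" "{a ?i}"] by (simp add: lessThan_Suc Un_insert_right insert_commute)
      also have "gen B {a ?i} = (*) (a ?i) ` B" unfolding gen_singleton[OF subr_B] by (auto simp: mult.commute)
      finally show ?thesis .
    qed
    have "van y m (Suc (Suc m - Suc k)) B (?Y (Suc ?i))" using Suc i by (simp add: Suc_diff_le)
    thus ?case unfolding step using i YB[of ?i] reg[OF i(1)]
      by (intro K.van_regular[OF submod_self[OF subr_B] sub _ a[OF i(1)]]) auto
  qed
  from this[of d] show ?thesis using gen_submod[OF subr_B submod_P] by (simp add: mult_2)
qed

lemma const_var_power_P:
  assumes high: "\<And>p. p \<in> P \<Longrightarrow> fl (\<lambda>_ i. s \<le> i) p \<in> L" and p: "p \<in> P" and u: "u < d"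
  shows "const (var u) ^ s * p \<in> L"
proof -
  have eq: "const (var u) ^ k = bm 0 (single u k)" for k
    by (induction k) (auto simp: const_def var_def mult_single single_one single_add[symmetric])
  have "const (var u) ^ s * p \<in> P"
    using u by (intro submod_mult[OF submod_P _ p] sB.power const_B RR.z_B)
  thus ?thesis using high_mult[OF high _ _ p, of 0 "single u s"] by (simp add: eq)
qed

text \<open>Vanishing for \<open>B / P\<close> in degree \<open>d + 2\<close> and for
  \<open>B / L\<close> in degree \<open>d + 1\<close> gives vanishing for \<open>P / L\<close> in
  degree \<open>d + 1\<close>. Powers of the variables \<open>x\<close> send \<open>P\<close> into
  \<open>L\<close>, so dropping these \<open>d\<close> variables lowers the degree to 1.\<close>

lemma van_T:
  assumes van: "van y m (d + 2) B P" shows "van y (Suc d) 1 P L"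
proof -
  obtain s where high: "\<And>p. p \<in> P \<Longrightarrow> fl (\<lambda>_ i. s \<le> i) p \<in> L" using P_high_in_L by blast
  have "van y m (Suc d) B L" by (rule van_M) auto
  hence "van y m (Suc d) P L"
    using van by (intro K.van_sub[OF submod_self[OF subr_B] submod_P submod_M L_subset_P P_subset_B]) auto
  hence "van y (m - k) (Suc d - k) P L" if "k \<le> d" for k
    using that
  proof (induction k)
    case (Suc k)
    interpret Kk: koszul B y "m - k" using K.y by unfold_locales auto
    have v: "m - Suc k = Suc d + (d - Suc k)" "d - Suc k < d" using Suc.prems by auto
    have "y (m - Suc k) = const (var (d - Suc k))" unfolding v(1) by (simp add: y_def)
    hence nil: "y (m - Suc k) ^ s * x \<in> L" if "x \<in> P" for x
      using const_var_power_P[OF high that v(2)] by simp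
    have eq: "m - k = Suc (m - Suc k)" using Suc.prems by simp
    have "van y (m - k) (Suc (Suc d - Suc k)) P L" using Suc by (simp add: Suc_diff_le)
    thus ?case by (rule Kk.van_drop[OF submod_P submod_M L_subset_P eq, rotated]) (rule nil)
  qed simp
  moreover have "m - d = Suc d" "Suc d - d = 1" by simp_all
  ultimately show ?thesis by (metis order_refl)
qed

lemma kd_y_T: "kd y (Suc d) c A = kd var (Suc d) c A"
  unfolding kd_def by (rule sum.cong) (auto simp: y_def)

subsection \<open>Freeness over the ring of polynomials in the \<open>T\<close>-variables\<close>

definition gens :: "'k bipoly set \<Rightarrow> bool" where
  "gens G \<longleftrightarrow> finite G \<and> G \<subseteq> P \<and> (\<forall>g\<in>G. \<exists>j. form j g) \<and> P = gen KT (G \<union> L)"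

definition min_gens :: "'k bipoly set \<Rightarrow> bool" where
  "min_gens G \<longleftrightarrow> gens G \<and> (\<forall>G'. gens G' \<longrightarrow> card G \<le> card G')"

lemma exists_min_gens: obtains G where "min_gens G"
proof -
  have "\<exists>G. gens G" using P_homogeneous_generators unfolding gens_def by metis
  then obtain G where "is_arg_min card gens G" using ex_has_least_nat[of gens _ card] by (auto simp: is_arg_min_linorder)
  thus thesis using that by (auto simp: min_gens_def is_arg_min_linorder)
qed

lemma gens_expand:
  assumes "gens G" "p \<in> P"
  obtains a where "\<And>g. g \<in> G \<Longrightarrow> a g \<in> KT" "p - (\<Sum>g\<in>G. a g * g) \<in> L"
proof -
  have "p \<in> msum L (gen KT ((\<lambda>g. g) ` G))"
    using assms gen_Un_submod[OF subr_KT submod_KT[OF submod_M], of "Suc d" G] by (simp add: gens_def Un_commute)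
  moreover have "finite G" using assms(1) by (simp add: gens_def)
  ultimately obtain l a where "l \<in> L" "\<forall>g\<in>G. a g \<in> KT" "p = l + (\<Sum>g\<in>G. a g * g)"
    unfolding gen_image_sum[OF subr_KT `finite G`] msum_def by auto
  thus thesis by (intro that[of a]) auto
qed

text \<open>Graded Nakayama: homogeneity makes a coefficient with nonzero constant term a scalar,
  and inverting it would allow its generator to be discarded.\<close>

lemma min_gens_no_const:
  assumes G: "min_gens G" and e: "\<And>g. g \<in> G \<Longrightarrow> form (e g) g"
    and a: "\<And>g. g \<in> G \<Longrightarrow> a g \<in> KT" "(\<Sum>g\<in>G. a g * g) \<in> L"
    and homog: "\<And>g nu. g \<in> G \<Longrightarrow> nu \<in> keys (a g) \<Longrightarrow> e g + deg nu = j"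
    and g0: "g0 \<in> G"
  shows "coef (a g0) 0 = 0"
proof (rule ccontr)
  assume nz: "coef (a g0) 0 \<noteq> 0"
  have gG: "gens G" using G by (simp add: min_gens_def)
  hence fin: "finite G" by (simp add: gens_def)
  let ?H = "gen KT ((G - {g0}) \<union> L)"
  have subH: "submod KT ?H" by (rule submod_gen[OF subr_KT])
  have supH: "(G - {g0}) \<union> L \<subseteq> ?H" by (rule gen_superset[OF subr_KT])
  have "e g0 = j" using homog[OF g0, of 0] nz by (simp add: in_keys_iff)
  hence "form 0 (a g0)" using homog[OF g0] by (fastforce simp: form_iff)
  hence ac: "a g0 = const (coef (a g0) 0)" by (rule form_0_const)
  have "coef (a g0) 0 \<in> K0" using a(1)[OF g0] by (auto simp: KT_def mpolys_coef)
  then obtain b where b: "b \<in> K0" "b * coef (a g0) 0 = 1" using RR.K.inv nz by blast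
  have bK: "const b \<in> KT" unfolding KT_def using b(1) RR.K.zero by (intro const_mpolys) auto
  have "const b * a g0 = const b * const (coef (a g0) 0)" by (rule arg_cong[OF ac])
  hence "const b * a g0 = 1" using b(2) by (simp flip: const_mult)
  hence g0_eq: "g0 = const b * (a g0 * g0)" by (simp add: mult.assoc[symmetric])
  have "a g0 * g0 = (\<Sum>g\<in>G. a g * g) - (\<Sum>g\<in>G - {g0}. a g * g)" using sum.remove[OF fin g0, of "\<lambda>g. a g * g"] by simp
  moreover have "(\<Sum>g\<in>G - {g0}. a g * g) \<in> ?H"
  proof (rule submod_sum[OF subH])
    fix g assume "g \<in> G - {g0}"
    thus "a g * g \<in> ?H" using a(1) supH by (intro submod_mult[OF subH]) auto
  qed
  moreover have "(\<Sum>g\<in>G. a g * g) \<in> ?H" using a(2) supH by auto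
  ultimately have "a g0 * g0 \<in> ?H" using submod_diff[OF subr_KT subH] by simp
  hence "g0 \<in> ?H" using submod_mult[OF subH bK] g0_eq by metis
  hence "G \<union> L \<subseteq> ?H" using supH by auto
  hence "gen KT (G \<union> L) \<subseteq> ?H" by (rule gen_least[OF subH])
  moreover have "?H \<subseteq> gen KT (G \<union> L)" by (intro gen_mono subr_KT) auto
  ultimately have "gens (G - {g0})" using gG by (auto simp: gens_def)
  hence "card G \<le> card (G - {g0})" using G by (simp add: min_gens_def)
  thus False using fin g0 by (metis card_Diff1_less not_le)
qed

text \<open>Vanishing first Koszul homology makes minimal generators free. The coefficients of a
  relation lie in the ideal of the variables, and dividing by the variables gives a Koszul 1-cycle
  of \<open>P / L\<close>. It is a boundary, so the quotients are themselves differentials up to a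
  relation of smaller degree, which is zero by induction; applying the differential twice gives
  0.\<close>

lemma min_gens_independent_homogeneous:
  assumes van: "van y (Suc d) 1 P L" and G: "min_gens G" and e: "\<And>g. g \<in> G \<Longrightarrow> form (e g) g"
    and "\<And>g. g \<in> G \<Longrightarrow> a g \<in> KT" "(\<Sum>g\<in>G. a g * g) \<in> L"
    and "\<And>g nu. g \<in> G \<Longrightarrow> nu \<in> keys (a g) \<Longrightarrow> e g + deg nu = j" and "g \<in> G"
  shows "a g = 0"
  using assms(4-7)
proof (induction j arbitrary: a g)
  case 0
  have c: "coef (a g) 0 = 0" if "g \<in> G" for g by (rule min_gens_no_const[OF G e 0(1-3) that])
  have "nu \<notin> keys (a g)" for nu
  proof
    assume "nu \<in> keys (a g)"
    thus False using c[of g] 0(3)[of g nu] 0(4) by (auto simp: in_keys_iff)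
  qed
  thus ?case by (intro poly_mapping_eqI) (simp add: in_keys_iff)
next
  case (Suc j)
  have c: "coef (a g) 0 = 0" if "g \<in> G" for g by (rule min_gens_no_const[OF G e Suc.prems(1-3) that])
  have gG: "gens G" using G by (simp add: min_gens_def)
  have GP: "G \<subseteq> P" using gG unfolding gens_def by blast
  have "\<exists>q. a g = (\<Sum>l<Suc d. var l * q l) \<and> (\<forall>l<Suc d. q l \<in> KT \<and> (\<forall>nu\<in>keys (q l). e g + deg nu = j))" if g: "g \<in> G" for g
  proof (cases "a g = 0")
    case True thus ?thesis using subr.zero[OF subr_KT] by (intro exI[of _ "\<lambda>_. 0"]) auto
  next
    case False
    then obtain nu where nu: "nu \<in> keys (a g)" by fastforce
    hence "deg nu \<noteq> 0" using c[OF g] by (auto simp: in_keys_iff)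
    hence ej: "e g \<le> j" using Suc.prems(3)[OF g nu] by linarith
    have fm: "form (Suc (j - e g)) (a g)" unfolding form_iff using Suc.prems(3)[OF g] ej by (metis Suc_diff_le diff_add_inverse)
    have aKT: "a g \<in> mpolys K0 {..<Suc d}" using Suc.prems(1)[OF g] by (simp add: KT_def lessThan_Suc_atMost)
    obtain q where "a g = (\<Sum>l<Suc d. var l * q l)" "\<And>l. l < Suc d \<Longrightarrow> q l \<in> mpolys K0 {..<Suc d}"
      "\<And>l. l < Suc d \<Longrightarrow> form (j - e g) (q l)"
      using split_vars[OF aKT RR.subr_K fm] by blast
    thus ?thesis using ej unfolding KT_def by (intro exI[of _ q]) (auto simp: lessThan_Suc_atMost form_iff)
  qed
  hence "\<forall>g\<in>G. \<exists>q. a g = (\<Sum>l<Suc d. var l * q l) \<and> (\<forall>l<Suc d. q l \<in> KT \<and> (\<forall>nu\<in>keys (q l). e g + deg nu = j))"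
    by blast
  from bchoice[OF this] obtain q where q: "\<And>g. g \<in> G \<Longrightarrow> a g = (\<Sum>l<Suc d. var l * q g l)" "\<And>g l. g \<in> G \<Longrightarrow> l < Suc d \<Longrightarrow> q g l \<in> KT"
    "\<And>g l nu. g \<in> G \<Longrightarrow> l < Suc d \<Longrightarrow> nu \<in> keys (q g l) \<Longrightarrow> e g + deg nu = j"
    by blast
  \<comment> \<open>The 1-chain with components given by the quotients \<open>q\<close>. Its
    differential is the given relation, so it is a cycle of \<open>P / L\<close>.\<close>
  define z where "z A = (if \<exists>l<Suc d. A = {l} then \<Sum>g\<in>G. q g (the_elem A) * g else 0)" for A
  have z_single: "z {l} = (\<Sum>g\<in>G. q g l * g)" if "l < Suc d" for l using that by (simp add: z_def)
  have zP: "z A \<in> P" for A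
  proof (cases "\<exists>l<Suc d. A = {l}")
    case True
    then obtain l where l: "l < Suc d" "A = {l}" by auto
    have "q g l * g \<in> P" if "g \<in> G" for g using that q(2) l(1) GP KT_B by (intro submod_mult[OF submod_P]) auto
    thus ?thesis unfolding l(2) z_single[OF l(1)] by (intro submod_sum[OF submod_P])
  next
    case False
    thus ?thesis unfolding z_def by (simp only: if_False submod_zero[OF submod_P])
  qed
  have kd_single: "kd var (Suc d) w {} = (\<Sum>l<Suc d. var l * w {l})" for w :: "nat set \<Rightarrow> 'k bipoly"
    unfolding kd_def kcon_def ksgn_def by simp
  have "kd y (Suc d) z A \<in> L" if "A \<subseteq> {..<Suc d}" "Suc (card A) = 1" for A
  proof -
    have "A = {}" using that finite_subset[of A] by auto
    hence "kd y (Suc d) z A = (\<Sum>l<Suc d. \<Sum>g\<in>G. var l * q g l * g)"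
      unfolding kd_y_T kd_single `A = {}` by (intro sum.cong refl) (simp add: z_single sum_distrib_left mult.assoc)
    also have "\<dots> = (\<Sum>g\<in>G. a g * g)"
      by (subst sum.swap) (simp add: q(1) sum_distrib_right del: sum.lessThan_Suc)
    finally show ?thesis using Suc.prems(2) by simp
  qed
  then obtain w where w: "\<And>A. w A \<in> P" "\<And>A. A \<subseteq> {..<Suc d} \<Longrightarrow> card A = 1 \<Longrightarrow> z A - kd y (Suc d) w A \<in> L"
    using vanE[OF van, of z] zP by blast
  have "\<exists>b. (\<forall>g\<in>G. b g \<in> KT) \<and> w A - (\<Sum>g\<in>G. b g * g) \<in> L" for A
  proof -
    obtain b where "\<And>g. g \<in> G \<Longrightarrow> b g \<in> KT" "w A - (\<Sum>g\<in>G. b g * g) \<in> L"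
      using gens_expand[OF gG w(1)[of A]] by blast
    thus ?thesis by (intro exI[of _ b]) simp
  qed
  hence "\<forall>A. \<exists>b. (\<forall>g\<in>G. b g \<in> KT) \<and> w A - (\<Sum>g\<in>G. b g * g) \<in> L" by (rule allI)
  from choice[OF this] obtain b where b: "\<And>A g. g \<in> G \<Longrightarrow> b A g \<in> KT" "\<And>A. w A - (\<Sum>g\<in>G. b A g * g) \<in> L" by blast
  let ?k = "\<lambda>g l. kd var (Suc d) (\<lambda>A. b A g) {l}"
  have kKT: "?k g l \<in> KT" if "g \<in> G" for g l
    using b(1)[OF that] RR.K.zero RR.K.one
    by (intro kd_in[OF subr_KT submod_self[OF subr_KT]]) (auto simp: KT_def intro!: var_mpolys)
  \<comment> \<open>The discrepancy between \<open>q\<close> and the differential of the coordinates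
    \<open>b\<close>, cut to the degree that makes it a homogeneous relation of T-degree
    \<open>j\<close>.\<close>
  define r where "r l g = filt (\<lambda>nu. e g + deg nu = j) (q g l - ?k g l)" for l g
  have rL: "(\<Sum>g\<in>G. r l g * g) \<in> L" if l: "l < Suc d" for l
  proof -
    have "kd var (Suc d) (\<lambda>A. w A - (\<Sum>g\<in>G. b A g * g)) {l} \<in> L"
      using b(2) var_B by (intro kd_in[OF subr_B submod_M]) auto
    moreover have "kd var (Suc d) (\<lambda>A. w A - (\<Sum>g\<in>G. b A g * g)) {l} = kd var (Suc d) w {l} - (\<Sum>g\<in>G. ?k g l * g)"
    proof -
      have "kd var (Suc d) (\<lambda>A. \<Sum>g\<in>G. b A g * g) {l} = (\<Sum>g\<in>G. ?k g l * g)"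
        unfolding kd_sum by (intro sum.cong refl) (simp add: mult.commute[of _ "_ :: 'k bipoly"] kd_mult)
      thus ?thesis by (simp add: kd_diff)
    qed
    moreover have "z {l} - kd var (Suc d) w {l} \<in> L" using w(2)[of "{l}"] l by (simp add: kd_y_T)
    ultimately have "(z {l} - kd var (Suc d) w {l}) + (kd var (Suc d) w {l} - (\<Sum>g\<in>G. ?k g l * g)) \<in> L"
      by (simp only: submod_add[OF submod_M])
    hence "(\<Sum>g\<in>G. (q g l - ?k g l) * g) \<in> L"
      by (simp add: z_single[OF l] left_diff_distrib sum_subtractf)
    hence "filt (dg j) (\<Sum>g\<in>G. (q g l - ?k g l) * g) \<in> L" using filt_L[of _ "\<lambda>i. i = j"] by blast
    also have "filt (dg j) (\<Sum>g\<in>G. (q g l - ?k g l) * g) = (\<Sum>g\<in>G. r l g * g)"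
      unfolding filt_sum r_def
    proof (rule sum.cong)
      fix g assume "g \<in> G"
      thus "filt (dg j) ((q g l - ?k g l) * g) = filt (\<lambda>nu. e g + deg nu = j) (q g l - ?k g l) * g"
        using filt_form_mult[OF e, of g "\<lambda>i. i = j"] by (simp add: mult.commute[of _ g])
    qed simp
    finally show ?thesis .
  qed
  have r0: "r l g = 0" if "l < Suc d" "g \<in> G" for l g
  proof (rule Suc.IH[OF _ rL[OF that(1)] _ that(2)])
    show "r l g \<in> KT" if "g \<in> G" for g
      unfolding r_def using subr.diff[OF subr_KT q(2)[OF that `l < Suc d`] kKT[OF that]] RR.K.zero
      unfolding KT_def by (intro filt_mpolys)
    show "e g + deg nu = j" if "g \<in> G" "nu \<in> keys (r l g)" for g nu using that(2) by (simp add: r_def keys_filt)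
  qed
  have q_eq: "q g l = filt (\<lambda>nu. e g + deg nu = j) (?k g l)" if l: "l < Suc d" for l
  proof -
    have "q g l = filt (\<lambda>nu. e g + deg nu = j) (q g l)" using q(3)[OF Suc.prems(4) l] by (intro filt_id[symmetric])
    thus ?thesis using r0[OF l Suc.prems(4)] by (simp add: r_def filt_diff)
  qed
  have "a g = (\<Sum>l<Suc d. var l * filt (\<lambda>nu. e g + deg nu = j) (?k g l))"
    unfolding q(1)[OF Suc.prems(4)] using q_eq by (intro sum.cong) auto
  also have "\<dots> = filt (\<lambda>nu. e g + deg nu = Suc j) (\<Sum>l<Suc d. var l * ?k g l)"
    unfolding filt_sum
  proof (rule sum.cong)
    fix l
    show "var l * filt (\<lambda>nu. e g + deg nu = j) (?k g l) = filt (\<lambda>nu. e g + deg nu = Suc j) (var l * ?k g l)"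
      using filt_form_mult[OF form_var, of "\<lambda>i. e g + i = Suc j" l "?k g l"] by simp
  qed simp
  \<comment> \<open>With the quotients replaced by differentials, \<open>a g\<close> is the selected
    part of \<open>kd\<close> applied twice.\<close>
  also have "(\<Sum>l<Suc d. var l * ?k g l) = kd var (Suc d) (kd var (Suc d) (\<lambda>A. b A g)) {}" by (rule kd_single[symmetric])
  also have "\<dots> = 0" by (rule kd_kd)
  finally show ?case by simp
qed

lemma min_gens_independent:
  assumes van: "van y (Suc d) 1 P L" and G: "min_gens G"
    and a: "\<And>g. g \<in> G \<Longrightarrow> a g \<in> KT" "(\<Sum>g\<in>G. a g * g) \<in> L" and g: "g \<in> G"
  shows "a g = 0"
proof -
  obtain e where e: "\<And>g. g \<in> G \<Longrightarrow> form (e g) g" using G unfolding min_gens_def gens_def by metis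
  have "filt (\<lambda>nu. e g + deg nu = j) (a g) = 0" for j
  proof (rule min_gens_independent_homogeneous[OF van G e, where a = "\<lambda>g. filt (\<lambda>nu. e g + deg nu = j) (a g)"])
    have "filt (dg j) (\<Sum>g\<in>G. a g * g) \<in> L" using filt_L[OF a(2), of "\<lambda>i. i = j"] .
    also have "filt (dg j) (\<Sum>g\<in>G. a g * g) = (\<Sum>g\<in>G. filt (\<lambda>nu. e g + deg nu = j) (a g) * g)"
      unfolding filt_sum
    proof (rule sum.cong)
      fix g assume "g \<in> G"
      thus "filt (dg j) (a g * g) = filt (\<lambda>nu. e g + deg nu = j) (a g) * g"
        using filt_form_mult[OF e, of g "\<lambda>i. i = j"] by (simp add: mult.commute[of _ g])
    qed simp
    finally show "(\<Sum>g\<in>G. filt (\<lambda>nu. e g + deg nu = j) (a g) * g) \<in> L" .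
    show "filt (\<lambda>nu. e g + deg nu = j) (a g) \<in> KT" if "g \<in> G" for g
      using a(1)[OF that] RR.K.zero unfolding KT_def by (intro filt_mpolys)
  qed (use g in \<open>auto simp: keys_filt\<close>)
  hence "coef (filt (\<lambda>nu. e g + deg nu = j) (a g)) ka = 0" for j ka by (simp only: lookup_zero)
  hence "coef (a g) ka = 0" for ka unfolding coef_filt by (metis (full_types))
  thus ?thesis by (rule poly_mapping_eqI[OF trans[OF _ lookup_zero[symmetric]]])
qed

text \<open>Products of T-monomials with minimal generators are independent modulo \<open>L\<close>,
  so each generator contributes at least \<open>h j\<close> to the component of T-degree
  \<open>j + c\<close>. Comparison with the upper bound for \<open>tau\<close> as \<open>j\<close>
  grows gives the claim.\<close>

lemma card_min_gens:
  assumes van: "van y (Suc d) 1 P L" and G: "min_gens G"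
  shows "card G \<le> lam"
proof -
  have fin: "finite G" and GP: "G \<subseteq> P" using G by (auto simp: min_gens_def gens_def)
  obtain e where e: "\<And>g. g \<in> G \<Longrightarrow> form (e g) g" using G unfolding min_gens_def gens_def by metis
  obtain s where s: "d * n \<le> s" "\<And>p. p \<in> P \<Longrightarrow> fl (\<lambda>_ i. s \<le> i) p \<in> L" using P_high_in_L by blast
  \<comment> \<open>A shift that dominates the degrees of all generators, so that each of them
    reaches T-degree \<open>j + c\<close>.\<close>
  define c where "c = (\<Sum>g\<in>G. e g)"
  have c: "e g \<le> c" if "g \<in> G" for g unfolding c_def using member_le_sum[OF that, of e] fin by simp
  have bound: "card G * h j \<le> lam * h (j + c) + D s * h' (j + c)" for j
  proof -
    define S where "S = (SIGMA g:G. Mon (Suc d) (j + c - e g))"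
    have finS: "finite S" using fin by (simp add: S_def)
    have "enat (card S) \<le> len K1 (U (Suc (j + c))) (U (j + c))"
    proof (rule BB.K.len_ge_family[where e = "\<lambda>(g, nu). single nu 1 * g"])
      show "(\<lambda>(g, nu). single nu 1 * g) ` S \<subseteq> U (j + c)"
      proof clarify
        fix g nu assume "(g, nu) \<in> S"
        hence g: "g \<in> G" "keys nu \<subseteq> {..d}" "deg nu = j + c - e g" by (auto simp: S_def Mon_def lessThan_Suc_atMost)
        show "single nu 1 * g \<in> U (j + c)"
        proof (rule P_U)
          show "single nu 1 * g \<in> P" using g GP RR.B.zero RR.B.one
            by (intro submod_mult[OF submod_P]) (auto simp: B_def intro!: single_mpolys)
          have "form (j + c) (single nu 1 * g)"
            using form_mult[OF form_single[OF g(3)] e[OF g(1)]] c[OF g(1)] by simp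
          thus "j + c \<le> deg ka" if "ka \<in> keys (single nu 1 * g)" for ka using that by (simp add: form_iff)
        qed
      qed
      fix a t
      assume a: "\<And>s. s \<in> S \<Longrightarrow> a s \<in> K1" "(\<Sum>s\<in>S. a s * (case s of (g, nu) \<Rightarrow> single nu 1 * g)) \<in> U (Suc (j + c))" and t: "t \<in> S"
      obtain g0 nu0 where t0: "t = (g0, nu0)" by (cases t)
      define b where "b g = (\<Sum>nu\<in>Mon (Suc d) (j + c - e g). single nu (coef (a (g, nu)) 0))" for g
      have a_const: "a (g, nu) = const (coef (a (g, nu)) 0)" "coef (a (g, nu)) 0 \<in> K0" if "g \<in> G" "nu \<in> Mon (Suc d) (j + c - e g)" for g nu
        using a(1)[of "(g, nu)"] that by (auto simp: S_def K1_def coef_const)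
      have "(\<Sum>s\<in>S. a s * (case s of (g, nu) \<Rightarrow> single nu 1 * g)) = (\<Sum>g\<in>G. \<Sum>nu\<in>Mon (Suc d) (j + c - e g). a (g, nu) * (single nu 1 * g))"
        unfolding S_def using fin by (subst sum.Sigma) (auto intro!: sum.cong)
      also have "\<dots> = (\<Sum>g\<in>G. b g * g)"
        unfolding b_def sum_distrib_right
      proof (intro sum.cong refl)
        fix g nu assume g: "g \<in> G" "nu \<in> Mon (Suc d) (j + c - e g)"
        have "a (g, nu) * (single nu 1 * g) = const (coef (a (g, nu)) 0) * single nu 1 * g"
          using a_const(1)[OF g] by (simp add: mult.assoc)
        thus "a (g, nu) * (single nu 1 * g) = single nu (coef (a (g, nu)) 0) * g" by (simp add: const_single)
      qed
      finally have "(\<Sum>g\<in>G. b g * g) \<in> U (Suc (j + c))" using a(2) by simp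
      then obtain p l where pl: "(\<Sum>g\<in>G. b g * g) = p + l" "l \<in> L" "\<forall>nu\<in>keys p. Suc (j + c) \<le> deg nu" by (auto simp: U_def msum_def)
      have "form (j + c) (\<Sum>g\<in>G. b g * g)"
      proof (rule form_sum)
        fix g assume g: "g \<in> G"
        have "form (j + c - e g) (b g)" unfolding b_def by (intro form_sum form_single) (auto simp: Mon_def)
        from form_mult[OF this e[OF g]] show "form (j + c) (b g * g)" using c[OF g] by simp
      qed
      hence "(\<Sum>g\<in>G. b g * g) = filt (\<lambda>nu. deg nu = j + c) (p + l)" using pl(1) filt_deg_form[of "j + c" _ "j + c"] by metis
      also have "filt (\<lambda>nu. deg nu = j + c) (p + l) = filt (\<lambda>nu. deg nu = j + c) l"
        unfolding filt_add using filt_none[of p "\<lambda>nu. deg nu = j + c"] pl(3) by fastforce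
      also have "\<dots> \<in> L" using filt_L[OF pl(2), of "\<lambda>i. i = j + c"] .
      finally have bL: "(\<Sum>g\<in>G. b g * g) \<in> L" .
      have bKT: "b g \<in> KT" if "g \<in> G" for g
        unfolding b_def KT_def using a_const(2)[OF that] RR.K.zero
        by (intro subr.sum[OF subr_mpolys[OF RR.subr_K]] single_mpolys) (auto simp: Mon_def lessThan_Suc_atMost)
      have g0: "g0 \<in> G" "nu0 \<in> Mon (Suc d) (j + c - e g0)" using t t0 by (auto simp: S_def)
      have "b g0 = 0" by (rule min_gens_independent[OF van G bKT bL g0(1)])
      hence "0 = coef (b g0) nu0" by simp
      also have "\<dots> = coef (a (g0, nu0)) 0"
        unfolding b_def lookup_sum using g0(2) by (simp add: lookup_single when_def)
      finally show "a t = 0" using a_const(1)[OF g0] t0 by simp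
    qed (use finS BB.submod_K[OF submod_U] U_mono in auto)
    also have "\<dots> = enat (tau s (j + c))" using s by (rule len_U_Suc)
    finally have "card S \<le> tau s (j + c)" by simp
    also have "card S = (\<Sum>g\<in>G. h (j + c - e g))" unfolding S_def using fin by (simp add: card_SigmaI)
    finally have "(\<Sum>g\<in>G. h (j + c - e g)) \<le> tau s (j + c)" .
    moreover have "(\<Sum>g\<in>G. h j) \<le> (\<Sum>g\<in>G. h (j + c - e g))" by (intro sum_mono card_Mon_mono) (use c in force)
    ultimately show ?thesis using tau_le[OF s(1), of "j + c"] by simp
  qed
  have add: "(\<lambda>N. real (N + b) / real N) \<longlonglongrightarrow> 1" for b using linear_lim[of 1 b] by simp
  have d1: "Suc (d - 1) = d" using d_ge by simp
  have "(\<lambda>N. real (card G) * (real (h (N + 0)) / real N ^ d)) \<longlonglongrightarrow> real (card G) * (1 ^ d / fact d)"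
    by (intro tendsto_mult tendsto_const card_Mon_lim add)
  moreover have "(\<lambda>N. real lam * (real (h (N + c)) / real N ^ d) + real (D s) * (real (card (Mon (Suc (d - 1)) (N + c))) / real N ^ (d - 1)) * (1 / real N))
      \<longlonglongrightarrow> real lam * (1 ^ d / fact d) + real (D s) * (1 ^ (d - 1) / fact (d - 1)) * 0"
    by (intro tendsto_add tendsto_mult tendsto_const card_Mon_lim add lim_1_over_n)
  moreover have "real (card G) * (real (h (N + 0)) / real N ^ d)
      \<le> real lam * (real (h (N + c)) / real N ^ d) + real (D s) * (real (card (Mon (Suc (d - 1)) (N + c))) / real N ^ (d - 1)) * (1 / real N)"
    if "N > 0" for N
  proof -
    have "real (card G * h N) \<le> real (lam * h (N + c) + D s * h' (N + c))" using bound[of N] by (simp only: of_nat_le_iff)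
    hence "real (card G * h N) / real N ^ d \<le> real (lam * h (N + c) + D s * h' (N + c)) / real N ^ d"
      by (intro divide_right_mono) auto
    moreover have "real N ^ d = real N * real N ^ (d - 1)" using d1 by (metis power_Suc)
    ultimately show ?thesis using d1 that by (simp add: add_divide_distrib mult_ac)
  qed
  ultimately have "real (card G) * (1 ^ d / fact d) \<le> real lam * (1 ^ d / fact d) + real (D s) * (1 ^ (d - 1) / fact (d - 1)) * 0"
    by (intro LIMSEQ_le) (auto intro!: exI[of _ 1])
  thus ?thesis by (simp add: divide_le_cancel)
qed

lemma few_generators:
  assumes a: "\<And>i. i < d \<Longrightarrow> a i \<in> gen B (y ` {..<m})"
    and reg: "\<And>i x. i < d \<Longrightarrow> x \<in> B \<Longrightarrow> a i * x \<in> gen B (P \<union> a ` {..<i}) \<Longrightarrow> x \<in> gen B (P \<union> a ` {..<i})"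
  obtains gs where "length gs = lam" "set gs \<subseteq> P" "gen B (set gs \<union> L) = P"
proof -
  have van: "van y (Suc d) 1 P L" using van_rees[OF a reg] by (intro van_T) auto
  obtain G where G: "min_gens G" by (rule exists_min_gens)
  hence GP: "finite G" "G \<subseteq> P" "P = gen KT (G \<union> L)" by (auto simp: min_gens_def gens_def)
  obtain xs where xs: "set xs = G" "distinct xs" using finite_distinct_list[OF GP(1)] by blast
  \<comment> \<open>Zeros fill the list up to exactly \<open>lam\<close> entries.\<close>
  let ?gs = "xs @ replicate (lam - card G) 0"
  have "length ?gs = lam" using card_min_gens[OF van G] xs distinct_card[of xs] by simp
  moreover have gsP: "set ?gs \<subseteq> P" using xs GP(2) submod_zero[OF submod_P] by auto
  moreover have "gen B (set ?gs \<union> L) = P"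
  proof (rule antisym)
    show "gen B (set ?gs \<union> L) \<subseteq> P" using gsP L_subset_P by (intro gen_least submod_P) auto
    have "G \<union> L \<subseteq> gen B (set ?gs \<union> L)" using gen_superset[OF subr_B, of "set ?gs \<union> L"] xs by auto
    hence "gen KT (G \<union> L) \<subseteq> gen B (set ?gs \<union> L)" by (rule gen_least[OF submod_KT[OF submod_gen[OF subr_B]]])
    thus "P \<subseteq> gen B (set ?gs \<union> L)" by (rule ord_eq_le_trans[OF GP(3)])
  qed
  ultimately show thesis by (rule that)
qed

end

section \<open>The algebraic structures of HOL-Algebra\<close>

lemma ring_on_simps [simp]:
  "carrier (ring_on A) = A" "mult (ring_on A) = (*)" "one (ring_on A) = 1"
  "ring.zero (ring_on A) = 0" "add (ring_on A) = (+)"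
  by (simp_all add: ring_on_def)

lemma cring_ring_on: assumes "subr A" shows "cring (ring_on A)"
proof (rule cringI)
  show "abelian_group (ring_on A)"
  proof (rule abelian_groupI)
    show "\<exists>y\<in>carrier (ring_on A). y \<oplus>\<^bsub>ring_on A\<^esub> x = \<zero>\<^bsub>ring_on A\<^esub>" if "x \<in> carrier (ring_on A)" for x
      using that subr.uminus[OF assms] by (intro bexI[of _ "- x"]) auto
  qed (auto simp: subr.add[OF assms] subr.zero[OF assms] add.assoc add.commute)
  show "comm_monoid (ring_on A)"
    by (rule comm_monoidI) (auto simp: subr.mult[OF assms] subr.one[OF assms] mult.assoc mult.commute)
qed (auto simp: distrib_right)

lemma ideal_ring_on:
  fixes A :: "'a::comm_ring_1 set"
  assumes "subr A" shows "ideal Q (ring_on A) \<longleftrightarrow> submod A Q \<and> Q \<subseteq> A"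
proof
  interpret cring "ring_on A" by (rule cring_ring_on[OF assms])
  assume "ideal Q (ring_on A)"
  then interpret ideal Q "ring_on A" .
  show "submod A Q \<and> Q \<subseteq> A"
    using a_subset zero_closed a_closed I_l_closed unfolding submod_def ring_on_simps by blast
next
  interpret cring "ring_on A" by (rule cring_ring_on[OF assms])
  assume Q: "submod A Q \<and> Q \<subseteq> A"
  show "ideal Q (ring_on A)"
  proof (rule idealI)
    have inv: "\<ominus>\<^bsub>ring_on A\<^esub> x = - x" if "x \<in> Q" for x
      using minus_equality[of "- x" x] that Q subr.uminus[OF assms] by auto
    show "subgroup Q (add_monoid (ring_on A))"
    proof
      show "inv\<^bsub>add_monoid (ring_on A)\<^esub> x \<in> Q" if "x \<in> Q" for x
        using inv[OF that] submod_uminus[OF assms _ that] Q by (simp add: a_inv_def)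
    qed (use Q in \<open>auto simp: submod_zero submod_add\<close>)
    show "x \<otimes>\<^bsub>ring_on A\<^esub> a \<in> Q" "a \<otimes>\<^bsub>ring_on A\<^esub> x \<in> Q" if "a \<in> Q" "x \<in> carrier (ring_on A)" for a x
      using submod_mult[of A Q x a] Q that by (simp_all add: mult.commute)
  qed (rule ring_axioms)
qed

lemma genideal_ring_on:
  assumes "subr A" "X \<subseteq> A" shows "Idl\<^bsub>ring_on A\<^esub> X = gen A X"
  unfolding genideal_def
proof (rule antisym)
  have "gen A X \<subseteq> A" using assms by (intro gen_least submod_self)
  thus "\<Inter>{I. ideal I (ring_on A) \<and> X \<subseteq> I} \<subseteq> gen A X"
    using submod_gen[OF assms(1)] gen_superset[OF assms(1)] by (intro Inter_lower) (simp add: ideal_ring_on[OF assms(1)])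
  show "gen A X \<subseteq> \<Inter>{I. ideal I (ring_on A) \<and> X \<subseteq> I}"
    by (rule Inter_greatest) (auto simp: ideal_ring_on[OF assms(1)] dest: gen_least)
qed

section \<open>Products and powers of ideals\<close>

lemma ideal_prod_ring_on:
  assumes "subr A" "X \<subseteq> A" "Y \<subseteq> A"
  shows "ideal_prod (ring_on A) (gen A X) (gen A Y) = gen A {x * y |x y. x \<in> X \<and> y \<in> Y}"
proof
  let ?Z = "gen A {x * y |x y. x \<in> X \<and> y \<in> Y}"
  interpret cring "ring_on A" by (rule cring_ring_on[OF assms(1)])
  have gA: "gen A X \<subseteq> A" "gen A Y \<subseteq> A" using gen_least[OF submod_self[OF assms(1)]] assms by auto
  have sub: "submod A ?Z" by (rule submod_gen[OF assms(1)])
  have 1: "x * b \<in> ?Z" if "x \<in> X" "b \<in> gen A Y" for x b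
    using that(2)
  proof (induction rule: gen.induct)
    case (step a u v)
    have "x * u \<in> ?Z" using gen_superset[OF assms(1), of "{x * y |x y. x \<in> X \<and> y \<in> Y}"] that(1) step(2) by blast
    hence "a * (x * u) + x * v \<in> ?Z" using submod_add[OF sub submod_mult[OF sub step(1)] step.IH] by simp
    thus ?case by (simp add: algebra_simps)
  qed (simp add: gen.zero)
  have 2: "a * b \<in> ?Z" if "a \<in> gen A X" "b \<in> gen A Y" for a b
    using that(1)
  proof (induction rule: gen.induct)
    case (step c u v)
    have "c * (u * b) + v * b \<in> ?Z" using submod_add[OF sub submod_mult[OF sub step(1) 1] step.IH] step(2) that(2) by simp
    thus ?case by (simp add: algebra_simps)
  qed (simp add: gen.zero)
  show "ideal_prod (ring_on A) (gen A X) (gen A Y) \<subseteq> ?Z"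
  proof
    fix s assume "s \<in> ideal_prod (ring_on A) (gen A X) (gen A Y)"
    thus "s \<in> ?Z" by (induction rule: ideal_prod.induct) (auto simp: 2 submod_add[OF sub])
  qed
  have "ideal (ideal_prod (ring_on A) (gen A X) (gen A Y)) (ring_on A)"
    using gA submod_gen[OF assms(1)] by (intro ideal_prod_is_ideal) (auto simp: ideal_ring_on[OF assms(1)])
  moreover have "x * y \<in> ideal_prod (ring_on A) (gen A X) (gen A Y)" if "x \<in> X" "y \<in> Y" for x y
    using ideal_prod.prod[of x "gen A X" y "gen A Y" "ring_on A"] gen_superset[OF assms(1)] that by auto
  ultimately show "?Z \<subseteq> ideal_prod (ring_on A) (gen A X) (gen A Y)"
    by (intro gen_least) (auto simp: ideal_ring_on[OF assms(1)])
qed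

lemma ideal_pow_ring_on:
  assumes A: "subr A" and z: "\<And>v. v < m \<Longrightarrow> z v \<in> A"
  shows "ideal_pow (ring_on A) (gen A (z ` {..<m})) k = gen A (mev z ` Mon m k)"
proof (induction k)
  case 0
  have "A = gen A {1}" unfolding gen_singleton[OF A] by auto
  thus ?case by (simp add: ideal_pow_def ideals_set_def Mon_0 mev_0)
next
  case (Suc k)
  have mevA: "mev z ` Mon m k \<subseteq> A"
    unfolding mev_def using z by (auto simp: Mon_def intro!: subr.prod[OF A] subr.power[OF A])
  have "ideal_pow (ring_on A) (gen A (z ` {..<m})) (Suc k)
      = ideal_prod (ring_on A) (gen A (mev z ` Mon m k)) (gen A (z ` {..<m}))"
    using Suc by (simp add: ideal_pow_def nat_pow_def ideals_set_def)
  also have "\<dots> = gen A {x * y |x y. x \<in> mev z ` Mon m k \<and> y \<in> z ` {..<m}}"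
    using z by (intro ideal_prod_ring_on[OF A mevA]) auto
  also have "{x * y |x y. x \<in> mev z ` Mon m k \<and> y \<in> z ` {..<m}} = mev z ` Mon m (Suc k)"
  proof (intro subset_antisym subsetI)
    fix t assume "t \<in> {x * y |x y. x \<in> mev z ` Mon m k \<and> y \<in> z ` {..<m}}"
    then obtain mu v where mu: "mu \<in> Mon m k" "v < m" "t = mev z mu * z v" by auto
    hence "t = mev z (mu + single v 1)" by (simp add: mev_add mev_single)
    thus "t \<in> mev z ` Mon m (Suc k)" using mu by (intro image_eqI) (auto simp: Mon_def keys_plus_nat)
  next
    fix t assume "t \<in> mev z ` Mon m (Suc k)"
    then obtain mu where mu: "keys mu \<subseteq> {..<m}" "deg mu = Suc k" "t = mev z mu" by (auto simp: Mon_def)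
    obtain mu1 mu2 where s: "mu = mu1 + mu2" "keys mu1 \<subseteq> {..<m}" "keys mu2 \<subseteq> {..<m}" "deg mu1 = k"
      using Mon_split[of mu m k] mu by auto
    hence "deg mu2 = 1" using mu(2) by simp
    then obtain v where v: "mu2 = single v 1" by (rule deg_1_single)
    hence "t = mev z mu1 * z v" using mu(3) s(1) by (simp add: mev_add mev_single)
    moreover have "v < m" using s(3) v by simp
    ultimately show "t \<in> {x * y |x y. x \<in> mev z ` Mon m k \<and> y \<in> z ` {..<m}}" using s by (auto simp: Mon_def)
  qed
  finally show ?case .
qed

text \<open>A module \<open>M\<close> in the sense of HOL-Algebra is presented as the image of \<open>V\<close> under an additive map
  that is constant on the cosets of \<open>W\<close>.\<close>

locale presented = subr A for A :: "'a::comm_ring_1 set" +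
  fixes V W :: "'a set" and pr :: "'a \<Rightarrow> 'b" and M :: "('a, 'b, 'c) module_scheme"
  assumes V: "submod A V" and W: "submod A W" and WV: "W \<subseteq> V"
    and surj: "pr ` V = carrier M" and pr_zero: "pr 0 = \<zero>\<^bsub>M\<^esub>"
    and pr_add: "\<And>x y. x \<in> V \<Longrightarrow> y \<in> V \<Longrightarrow> pr (x + y) = pr x \<oplus>\<^bsub>M\<^esub> pr y"
    and pr_smult: "\<And>a x. a \<in> A \<Longrightarrow> x \<in> V \<Longrightarrow> pr (a * x) = a \<odot>\<^bsub>M\<^esub> pr x"
    and pr_eq: "\<And>x y. x \<in> V \<Longrightarrow> y \<in> V \<Longrightarrow> pr x = pr y \<longleftrightarrow> x - y \<in> W"
begin

lemma sA: "subr A" by (rule subr_axioms)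

text \<open>\<open>M\<close> is given only by its presentation, so the description behind the
  inverse is evaluated directly; uniqueness comes from the kernel \<open>W\<close>.\<close>

lemma inv_pr: assumes u: "u \<in> V" shows "inv\<^bsub>add_monoid M\<^esub> (pr u) = pr (- u)"
  unfolding m_inv_def
proof (rule the_equality)
  have u': "- u \<in> V" by (rule submod_uminus[OF sA V u])
  show "pr (- u) \<in> carrier (add_monoid M) \<and> pr u \<otimes>\<^bsub>add_monoid M\<^esub> pr (- u) = \<one>\<^bsub>add_monoid M\<^esub> \<and> pr (- u) \<otimes>\<^bsub>add_monoid M\<^esub> pr u = \<one>\<^bsub>add_monoid M\<^esub>"
    using pr_add[OF u u'] pr_add[OF u' u] u' surj pr_zero by auto
  fix y assume y: "y \<in> carrier (add_monoid M) \<and> pr u \<otimes>\<^bsub>add_monoid M\<^esub> y = \<one>\<^bsub>add_monoid M\<^esub> \<and> y \<otimes>\<^bsub>add_monoid M\<^esub> pr u = \<one>\<^bsub>add_monoid M\<^esub>"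
  then obtain v where v: "v \<in> V" "y = pr v" using surj by auto
  hence "pr (v + u) = pr 0" using y pr_add[OF v(1) u] pr_zero by simp
  hence "v + u \<in> W" using pr_eq[OF submod_add[OF V v(1) u] submod_zero[OF V]] by simp
  thus "y = pr (- u)" unfolding v(2) using pr_eq[OF v(1) u'] by simp
qed

lemma submodule_iff: "submodule C (ring_on A) M \<longleftrightarrow> C \<subseteq> carrier M \<and> submod A {x \<in> V. pr x \<in> C}"
proof
  assume C: "submodule C (ring_on A) M"
  then interpret C: subgroup C "add_monoid M" by (rule submodule.axioms)
  have "pr (a * x) \<in> C" if "a \<in> A" "x \<in> V" "pr x \<in> C" for a x
    using submodule.smult_closed[OF C, of a "pr x"] that by (simp add: pr_smult)
  thus "C \<subseteq> carrier M \<and> submod A {x \<in> V. pr x \<in> C}"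
    using C.subset C.one_closed C.m_closed pr_add pr_zero V by (auto simp: submod_def)
next
  assume C: "C \<subseteq> carrier M \<and> submod A {x \<in> V. pr x \<in> C}"
  have repr: "\<exists>u\<in>V. x = pr u" if "x \<in> C" for x using that C surj by auto
  have sub: "submod A {x \<in> V. pr x \<in> C}" using C by simp
  show "submodule C (ring_on A) M"
  proof
    show "C \<subseteq> carrier (add_monoid M)" using C by simp
    show "\<one>\<^bsub>add_monoid M\<^esub> \<in> C" using submod_zero[OF sub] pr_zero by simp
    show "x \<otimes>\<^bsub>add_monoid M\<^esub> y \<in> C" if xy: "x \<in> C" "y \<in> C" for x y
    proof -
      obtain u v where "u \<in> V" "x = pr u" "v \<in> V" "y = pr v" using repr xy by blast
      thus ?thesis using submod_add[OF sub, of u v] xy pr_add[of u v] by simp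
    qed
    show "inv\<^bsub>add_monoid M\<^esub> x \<in> C" if x: "x \<in> C" for x
    proof -
      obtain u where "u \<in> V" "x = pr u" using repr x by blast
      thus ?thesis using submod_uminus[OF sA sub, of u] x inv_pr[of u] by simp
    qed
    show "a \<odot>\<^bsub>M\<^esub> x \<in> C" if a: "a \<in> carrier (ring_on A)" "x \<in> C" for a x
    proof -
      obtain u where "u \<in> V" "x = pr u" using repr a by blast
      thus ?thesis using submod_mult[OF sub, of a u] a pr_smult[of a u] by simp
    qed
  qed
qed

lemma pr_image_iff: "submod A Q \<Longrightarrow> W \<subseteq> Q \<Longrightarrow> Q \<subseteq> V \<Longrightarrow> x \<in> V \<Longrightarrow> pr x \<in> pr ` Q \<longleftrightarrow> x \<in> Q"
proof
  assume Q: "submod A Q" "W \<subseteq> Q" "Q \<subseteq> V" "x \<in> V" "pr x \<in> pr ` Q"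
  then obtain q where q: "q \<in> Q" "pr x = pr q" by auto
  hence "x - q \<in> Q" using pr_eq[of x q] Q by auto
  thus "x \<in> Q" using submod_diff_iff[OF sA Q(1)] q(1) by blast
qed auto

lemma submodule_image: "submod A Q \<Longrightarrow> W \<subseteq> Q \<Longrightarrow> Q \<subseteq> V \<Longrightarrow> submodule (pr ` Q) (ring_on A) M"
proof -
  assume Q: "submod A Q" "W \<subseteq> Q" "Q \<subseteq> V"
  have "{x \<in> V. pr x \<in> pr ` Q} = Q" using pr_image_iff[OF Q] Q(3) by auto
  moreover have "pr ` Q \<subseteq> carrier M" unfolding surj[symmetric] using Q(3) by (rule image_mono)
  ultimately show ?thesis unfolding submodule_iff using Q by simp
qed

text \<open>Preimages and images under \<open>pr\<close> turn chains of submodules of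
  \<open>M\<close> into chains between \<open>W\<close> and \<open>V\<close>, and
  conversely.\<close>

lemma mod_length_eq: "mod_length (ring_on A) M = len A W V"
proof -
  have "(\<exists>c. (\<forall>i\<le>n. submodule (c i) (ring_on A) M) \<and> (\<forall>i<n. c i \<subset> c (Suc i))) \<longleftrightarrow> (\<exists>c. chain A W V c n)" for n
  proof
    assume "\<exists>c. (\<forall>i\<le>n. submodule (c i) (ring_on A) M) \<and> (\<forall>i<n. c i \<subset> c (Suc i))"
    then obtain c where c: "\<And>i. i \<le> n \<Longrightarrow> submodule (c i) (ring_on A) M" "\<And>i. i < n \<Longrightarrow> c i \<subset> c (Suc i)" by blast
    have "chain A W V (\<lambda>i. {x \<in> V. pr x \<in> c i}) n"
      unfolding chain_def
    proof (intro conjI allI impI)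
      fix i assume i: "i \<le> n"
      show sub: "submod A {x \<in> V. pr x \<in> c i}" using c(1)[OF i] by (simp add: submodule_iff)
      show "W \<subseteq> {x \<in> V. pr x \<in> c i}"
      proof
        fix w assume w: "w \<in> W"
        hence "pr w = pr 0" using pr_eq[of w 0] WV submod_zero[OF V] by auto
        thus "w \<in> {x \<in> V. pr x \<in> c i}" using submod_zero[OF sub] w WV by auto
      qed
    next
      fix i assume i: "i < n"
      then obtain y where y: "y \<in> c (Suc i)" "y \<notin> c i" using c(2) by blast
      then obtain u where "u \<in> V" "y = pr u" using c(1)[of "Suc i"] i surj by (auto simp: submodule_iff)
      thus "{x \<in> V. pr x \<in> c i} \<subset> {x \<in> V. pr x \<in> c (Suc i)}" using y c(2)[OF i] by blast
    qed auto
    thus "\<exists>c. chain A W V c n" by blast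
  next
    assume "\<exists>c. chain A W V c n"
    then obtain c where c: "chain A W V c n" by blast
    have s: "submod A (c i)" "W \<subseteq> c i" "c i \<subseteq> V" if "i \<le> n" for i using c that by (auto simp: chain_def)
    have "pr ` c i \<subset> pr ` c (Suc i)" if i: "i < n" for i
    proof -
      have "c i \<subset> c (Suc i)" using c i by (simp add: chain_def)
      then obtain x where x: "x \<in> c (Suc i)" "x \<notin> c i" "c i \<subseteq> c (Suc i)" by blast
      hence "pr x \<notin> pr ` c i" using pr_image_iff[OF s, of i x] s(3)[of "Suc i"] i by auto
      thus ?thesis using x by blast
    qed
    thus "\<exists>c. (\<forall>i\<le>n. submodule (c i) (ring_on A) M) \<and> (\<forall>i<n. c i \<subset> c (Suc i))"
      using submodule_image[OF s] by (intro exI[of _ "\<lambda>i. pr ` c i"]) auto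
  qed
  thus ?thesis unfolding mod_length_def len_def by simp
qed

text \<open>Presentations pass to quotients with the same \<open>V\<close> and the larger kernel
  \<open>Q\<close>, so that lengths of quotients are computed by \<open>mod_length_eq\<close>
  again.\<close>

lemma quotient:
  assumes Q: "submod A Q" "W \<subseteq> Q" "Q \<subseteq> V"
  shows "presented A V Q (\<lambda>x. pr ` Q +>\<^bsub>M\<^esub> pr x) (quot_module M (pr ` Q))"
proof -
  have coset: "pr ` Q +>\<^bsub>M\<^esub> pr x = (\<lambda>q. pr (q + x)) ` Q" if x: "x \<in> V" for x
  proof -
    have "pr ` Q +>\<^bsub>M\<^esub> pr x = (\<lambda>q. pr q \<oplus>\<^bsub>M\<^esub> pr x) ` Q" unfolding a_r_coset_def r_coset_def by auto
    also have "\<dots> = (\<lambda>q. pr (q + x)) ` Q" using x Q(3) by (intro image_cong refl pr_add[symmetric]) auto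
    finally show ?thesis .
  qed
  have coset_le: "(\<lambda>q. pr (q + x)) ` Q \<subseteq> (\<lambda>q. pr (q + y)) ` Q" if "x - y \<in> Q" for x y
  proof (rule image_subsetI)
    fix q assume "q \<in> Q"
    thus "pr (q + x) \<in> (\<lambda>q. pr (q + y)) ` Q"
      using submod_add[OF Q(1) _ that] by (intro image_eqI[of _ _ "q + (x - y)"]) auto
  qed
  have coset_eq: "(\<lambda>q. pr (q + x)) ` Q = (\<lambda>q. pr (q + y)) ` Q \<longleftrightarrow> x - y \<in> Q" if xy: "x \<in> V" "y \<in> V" for x y
  proof
    assume "(\<lambda>q. pr (q + x)) ` Q = (\<lambda>q. pr (q + y)) ` Q"
    moreover have "pr (0 + x) \<in> (\<lambda>q. pr (q + x)) ` Q" using submod_zero[OF Q(1)] by (rule imageI)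
    ultimately obtain q where q: "q \<in> Q" "pr x = pr (q + y)" by auto
    hence "x - (q + y) \<in> Q" using pr_eq[of x "q + y"] xy Q submod_add[OF V, of q y] by auto
    thus "x - y \<in> Q" using submod_add[OF Q(1) _ q(1), of "x - (q + y)"] by (simp add: algebra_simps)
  next
    assume "x - y \<in> Q"
    moreover from this have "y - x \<in> Q" using submod_uminus[OF sA Q(1)] by fastforce
    ultimately show "(\<lambda>q. pr (q + x)) ` Q = (\<lambda>q. pr (q + y)) ` Q" using coset_le by (intro subset_antisym)
  qed
  show ?thesis
  proof (intro presented.intro presented_axioms.intro sA V Q)
    show "(\<lambda>x. pr ` Q +>\<^bsub>M\<^esub> pr x) ` V = carrier (quot_module M (pr ` Q))"
      unfolding quot_module_def A_RCOSETS_def' surj[symmetric] by auto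
    show "pr ` Q +>\<^bsub>M\<^esub> pr 0 = \<zero>\<^bsub>quot_module M (pr ` Q)\<^esub>"
      using coset[OF submod_zero[OF V]] by (simp add: quot_module_def)
    show "pr ` Q +>\<^bsub>M\<^esub> pr x = pr ` Q +>\<^bsub>M\<^esub> pr y \<longleftrightarrow> x - y \<in> Q" if "x \<in> V" "y \<in> V" for x y
      unfolding coset[OF that(1)] coset[OF that(2)] by (rule coset_eq[OF that])
    show "pr ` Q +>\<^bsub>M\<^esub> pr (x + y) = (pr ` Q +>\<^bsub>M\<^esub> pr x) \<oplus>\<^bsub>quot_module M (pr ` Q)\<^esub> (pr ` Q +>\<^bsub>M\<^esub> pr y)"
      if xy: "x \<in> V" "y \<in> V" for x y
    proof -
      have "(pr ` Q +>\<^bsub>M\<^esub> pr x) \<oplus>\<^bsub>quot_module M (pr ` Q)\<^esub> (pr ` Q +>\<^bsub>M\<^esub> pr y)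
          = (\<lambda>(q, q'). pr (q + x) \<oplus>\<^bsub>M\<^esub> pr (q' + y)) ` (Q \<times> Q)"
        unfolding quot_module_def set_add_def set_mult_def coset[OF xy(1)] coset[OF xy(2)] by auto
      also have "\<dots> = (\<lambda>q. pr (q + (x + y))) ` (\<lambda>(q, q'). q + q') ` (Q \<times> Q)"
        unfolding image_image
      proof (rule image_cong[OF refl], clarify)
        fix q q' assume "q \<in> Q" "q' \<in> Q"
        hence "q + x \<in> V" "q' + y \<in> V" using Q(3) xy submod_add[OF V] by auto
        moreover have "q + q' + (x + y) = (q + x) + (q' + y)" by (simp add: algebra_simps)
        ultimately show "pr (q + x) \<oplus>\<^bsub>M\<^esub> pr (q' + y) = pr (q + q' + (x + y))" by (simp only: pr_add)
      qed
      also have "(\<lambda>(q, q'). q + q') ` (Q \<times> Q) = Q"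
      proof (intro subset_antisym subsetI)
        fix q assume "q \<in> Q"
        hence "(0, q) \<in> Q \<times> Q" "q = (case (0, q) of (q, q') \<Rightarrow> q + q')" using submod_zero[OF Q(1)] by auto
        thus "q \<in> (\<lambda>(q, q'). q + q') ` (Q \<times> Q)" by (rule rev_image_eqI)
      qed (use submod_add[OF Q(1)] in auto)
      finally show ?thesis using coset[OF submod_add[OF V xy]] by simp
    qed
    show "pr ` Q +>\<^bsub>M\<^esub> pr (a * x) = a \<odot>\<^bsub>quot_module M (pr ` Q)\<^esub> (pr ` Q +>\<^bsub>M\<^esub> pr x)" if ax: "a \<in> A" "x \<in> V" for a x
    proof -
      \<comment> \<open>Scalar multiplication of a coset is a union over its representatives; all
        members of this union coincide because \<open>Q\<close> is a submodule.\<close>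
      have "pr ` Q +>\<^bsub>M\<^esub> (a \<odot>\<^bsub>M\<^esub> pr (q + x)) = pr ` Q +>\<^bsub>M\<^esub> pr (a * x)" if q: "q \<in> Q" for q
      proof -
        have qx: "q + x \<in> V" using submod_add[OF V] q Q(3) ax by auto
        have "a * (q + x) \<in> V" "a * x \<in> V" using submod_mult[OF V ax(1)] qx ax(2) by auto
        moreover have "a * (q + x) - a * x \<in> Q" using submod_mult[OF Q(1) ax(1) q] by (simp add: algebra_simps)
        ultimately show ?thesis unfolding pr_smult[OF ax(1) qx, symmetric] using coset coset_eq by simp
      qed
      hence "(\<Union>q\<in>Q. pr ` Q +>\<^bsub>M\<^esub> (a \<odot>\<^bsub>M\<^esub> pr (q + x))) = pr ` Q +>\<^bsub>M\<^esub> pr (a * x)"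
        using submod_zero[OF Q(1)] by auto
      thus ?thesis by (simp add: quot_module_def coset[OF ax(2)])
    qed
  qed
qed

lemma ideal_smult_eq:
  assumes Q: "submod A Q" "W \<subseteq> Q" "Q \<subseteq> V" and QI: "\<And>a x. a \<in> I \<Longrightarrow> x \<in> V \<Longrightarrow> a * x \<in> Q" and I: "I \<subseteq> A"
    and least: "\<And>N. submod A N \<Longrightarrow> W \<subseteq> N \<Longrightarrow> (\<And>a x. a \<in> I \<Longrightarrow> x \<in> V \<Longrightarrow> a * x \<in> N) \<Longrightarrow> Q \<subseteq> N"
  shows "ideal_smult (ring_on A) I M = pr ` Q"
  unfolding ideal_smult_def
proof (rule antisym)
  show "\<Inter>{N. submodule N (ring_on A) M \<and> (\<forall>a\<in>I. \<forall>x\<in>carrier M. a \<odot>\<^bsub>M\<^esub> x \<in> N)} \<subseteq> pr ` Q"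
  proof (rule Inter_lower, rule CollectI, intro conjI ballI submodule_image Q)
    fix a x assume a: "a \<in> I" "x \<in> carrier M"
    then obtain u where "u \<in> V" "x = pr u" using surj by auto
    moreover from this have "a * u \<in> Q" "pr (a * u) = a \<odot>\<^bsub>M\<^esub> pr u" using QI[OF a(1)] pr_smult[of a u] a(1) I by auto
    ultimately show "a \<odot>\<^bsub>M\<^esub> x \<in> pr ` Q" by (metis imageI)
  qed
  show "pr ` Q \<subseteq> \<Inter>{N. submodule N (ring_on A) M \<and> (\<forall>a\<in>I. \<forall>x\<in>carrier M. a \<odot>\<^bsub>M\<^esub> x \<in> N)}"
  proof (rule Inter_greatest, clarify)
    fix N q assume N: "submodule N (ring_on A) M" "\<forall>a\<in>I. \<forall>x\<in>carrier M. a \<odot>\<^bsub>M\<^esub> x \<in> N" and q: "q \<in> Q"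
    have sub: "submod A {x \<in> V. pr x \<in> N}" using N(1) by (simp add: submodule_iff)
    have "Q \<subseteq> {x \<in> V. pr x \<in> N}"
    proof (rule least[OF sub])
      show "W \<subseteq> {x \<in> V. pr x \<in> N}"
      proof
        fix w assume w: "w \<in> W"
        hence "pr w = pr 0" using pr_eq[of w 0] WV submod_zero[OF V] by auto
        thus "w \<in> {x \<in> V. pr x \<in> N}" using submod_zero[OF sub] w WV by auto
      qed
      show "a * x \<in> {x \<in> V. pr x \<in> N}" if "a \<in> I" "x \<in> V" for a x
      proof -
        have "a \<odot>\<^bsub>M\<^esub> pr x \<in> N" using that N(2) surj by blast
        thus ?thesis using that I submod_mult[OF V, of a x] pr_smult[of a x] by auto
      qed
    qed
    thus "pr q \<in> N" using q by auto
  qed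
qed

end

lemma presented_ideal_module:
  assumes "subr A" "submod A V" shows "presented A V {0} (\<lambda>x. x) (ideal_module (ring_on A) V)"
  using assms by (intro presented.intro presented_axioms.intro)
    (auto simp: restrict_scalars_def submod_zero submod_zero_set)

lemma coset_ring_on: "Q +>\<^bsub>ring_on A\<^esub> x = (\<lambda>q. q + x) ` Q"
  unfolding a_r_coset_def r_coset_def by auto

lemma coset_eq_iff:
  assumes "subr A" "submod A Q" "Q \<subseteq> A" "x \<in> A" "y \<in> A"
  shows "Q +>\<^bsub>ring_on A\<^esub> x = Q +>\<^bsub>ring_on A\<^esub> y \<longleftrightarrow> x - y \<in> Q"
proof -
  interpret presented A A "{0}" "\<lambda>x. x" "ideal_module (ring_on A) A"
    by (rule presented_ideal_module[OF assms(1) submod_self[OF assms(1)]])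
  interpret q: presented A A Q "\<lambda>x. (\<lambda>x. x) ` Q +>\<^bsub>ideal_module (ring_on A) A\<^esub> x" "quot_module (ideal_module (ring_on A) A) ((\<lambda>x. x) ` Q)"
    using assms submod_zero[OF assms(2)] by (intro quotient) auto
  have "Q +>\<^bsub>ideal_module (ring_on A) A\<^esub> x = Q +>\<^bsub>ring_on A\<^esub> x" for x
    unfolding a_r_coset_def r_coset_def by (simp add: restrict_scalars_def)
  thus ?thesis using q.pr_eq[OF assms(4,5)] by simp
qed

context aci
begin

section \<open>The symmetric algebra\<close>

abbreviation I where "I \<equiv> J (Suc d)"
abbreviation SA where "SA \<equiv> mpolys R I"
abbreviation SR where "SR \<equiv> sym_relations R I"
abbreviation alpha where "alpha \<equiv> mpoly_eval const (\<lambda>j. var (f j)) :: 'k bipoly \<Rightarrow> ((nat, 'k) mpoly, (nat, 'k) mpoly) mpoly"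
definition evI :: "((nat, 'k) mpoly, (nat, 'k) mpoly) mpoly \<Rightarrow> (nat, 'k) mpoly poly" where
  "evI = mpoly_eval (\<lambda>r. [:r:]) (\<lambda>u. monom u 1)"
abbreviation pres where "pres \<equiv> sym_presentation R I f"

definition rep :: "(nat, 'k) mpoly \<Rightarrow> nat \<Rightarrow> (nat, 'k) mpoly" where
  "rep u = (SOME a. (\<forall>l<Suc d. a l \<in> R) \<and> (\<Sum>l<Suc d. a l * f l) = u)"

text \<open>Inverse to \<open>alpha\<close> modulo the defining ideals. The choice made in
  \<open>rep\<close> is immaterial modulo \<open>L\<close>, by \<open>lin_cong_L\<close>.\<close>

definition psi :: "((nat, 'k) mpoly, (nat, 'k) mpoly) mpoly \<Rightarrow> 'k bipoly" where
  "psi = mpoly_eval const (\<lambda>u. lin (Suc d) (rep u))"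

lemma rep: "u \<in> I \<Longrightarrow> (\<forall>l<Suc d. rep u l \<in> R) \<and> (\<Sum>l<Suc d. rep u l * f l) = u"
proof -
  assume "u \<in> I"
  then obtain a where "\<forall>l<Suc d. a l \<in> R" "u = (\<Sum>l<Suc d. a l * f l)" unfolding J_iff by blast
  from conjI[OF this(1) this(2)[symmetric]] show ?thesis
    unfolding rep_def by (rule someI[where P = "\<lambda>a. (\<forall>l<Suc d. a l \<in> R) \<and> (\<Sum>l<Suc d. a l * f l) = u"])
qed

lemma submod_I: "submod R I" and I_R: "I \<subseteq> R"
  using submod_J J_subset by auto

lemma f_I: "l \<le> d \<Longrightarrow> f l \<in> I"
  unfolding J_def by (intro subsetD[OF gen_superset[OF subr_R]]) auto

lemma subr_SA: "subr SA"
  by (rule subr_mpolys[OF subr_R])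

sublocale sSA: subr SA by (rule subr_SA)

lemma const_SA: "r \<in> R \<Longrightarrow> const r \<in> SA" and var_SA: "u \<in> I \<Longrightarrow> var u \<in> SA"
  using RR.B.zero RR.B.one by (auto intro: const_mpolys var_mpolys)

lemma rel_add_SA: "u \<in> I \<Longrightarrow> v \<in> I \<Longrightarrow> var (u + v) - var u - var v \<in> SA"
  and rel_mult_SA: "r \<in> R \<Longrightarrow> u \<in> I \<Longrightarrow> var (r * u) - const r * var u \<in> SA"
  using submod_add[OF submod_I] submod_mult[OF submod_I] var_SA const_SA sSA.diff sSA.mult by simp_all

lemma SR_eq: "SR = gen SA ({var (u + v) - var u - var v |u v. u \<in> I \<and> v \<in> I} \<union> {var (r * u) - const r * var u |r u. r \<in> R \<and> u \<in> I})"
  unfolding sym_relations_def by (rule genideal_ring_on[OF subr_SA]) (auto simp: rel_add_SA rel_mult_SA)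

lemma submod_SR: "submod SA SR"
  unfolding SR_eq by (rule submod_gen[OF subr_SA])

lemma SR_leI:
  assumes "submod SA Q" "\<And>u v. u \<in> I \<Longrightarrow> v \<in> I \<Longrightarrow> var (u + v) - var u - var v \<in> Q"
    and "\<And>r u. r \<in> R \<Longrightarrow> u \<in> I \<Longrightarrow> var (r * u) - const r * var u \<in> Q"
  shows "SR \<subseteq> Q"
  unfolding SR_eq using assms by (intro gen_least) auto

lemma SR_add: "u \<in> I \<Longrightarrow> v \<in> I \<Longrightarrow> var (u + v) - var u - var v \<in> SR"
  and SR_mult: "r \<in> R \<Longrightarrow> u \<in> I \<Longrightarrow> var (r * u) - const r * var u \<in> SR"
  unfolding SR_eq by (rule subsetD[OF gen_superset[OF subr_SA]], blast)+

lemma SR_SA: "SR \<subseteq> SA"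
  by (intro SR_leI submod_self subr_SA rel_add_SA rel_mult_SA)

lemmas rhom_alpha = hconst.rhom_eval[where g = "\<lambda>j. var (f j)"]

lemma rhom_evI: "rhom evI"
  unfolding evI_def by (rule hpCons.rhom_eval)

sublocale halpha: rhom alpha by (rule rhom_alpha)
sublocale hevI: rhom evI by (rule rhom_evI)

lemma evI_const: "evI (const r) = [:r:]" and evI_var: "evI (var u) = monom u 1"
  by (simp_all add: evI_def hpCons.eval_const hpCons.eval_var)

lemma rhom_psi: "rhom psi"
  unfolding psi_def by (rule hconst.rhom_eval)

sublocale hpsi: rhom psi by (rule rhom_psi)

lemma psi_const: "psi (const r) = const r" and psi_var: "psi (var u) = lin (Suc d) (rep u)"
  by (simp_all add: psi_def hconst.eval_const hconst.eval_var)

lemma alpha_const: "alpha (const r) = const r" and alpha_var: "alpha (var l) = var (f l)"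
  by (simp_all add: hconst.eval_const hconst.eval_var)

lemma alpha_SA: "b \<in> B \<Longrightarrow> alpha b \<in> SA"
  unfolding B_def using mpolys_coef mpolys_keys f_I
  by (intro hconst.eval_in[OF subr_SA] const_SA var_SA) fastforce+

lemma lin_B: "(\<And>l. l < Suc d \<Longrightarrow> a l \<in> R) \<Longrightarrow> lin (Suc d) a \<in> B"
  unfolding lin_def by (intro sB.sum sB.mult const_B var_B) auto

lemma psi_B: "z \<in> SA \<Longrightarrow> psi z \<in> B"
  unfolding psi_def using mpolys_coef mpolys_keys rep
  by (intro hconst.eval_in[OF subr_B] const_B lin_B) fastforce+

lemma var_sum_SR:
  fixes r :: nat
  assumes "\<And>l. l < r \<Longrightarrow> a l \<in> R" "\<And>l. l < r \<Longrightarrow> u l \<in> I"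
  shows "var (\<Sum>l<r. a l * u l) - (\<Sum>l<r. const (a l) * var (u l)) \<in> SR"
  using assms
proof (induction r)
  case 0
  \<comment> \<open>The relation for \<open>0 + 0\<close> shows that \<open>var 0\<close> lies in
    \<open>SR\<close>.\<close>
  show ?case using SR_add[of 0 0] submod_uminus[OF subr_SA submod_SR] submod_zero[OF submod_I] by fastforce
next
  case (Suc r)
  let ?s = "\<Sum>l<r. a l * u l"
  have s: "?s \<in> I" "a r * u r \<in> I" using Suc.prems by (auto intro!: submod_sum[OF submod_I] submod_mult[OF submod_I])
  have "(var ?s - (\<Sum>l<r. const (a l) * var (u l))) + (var (?s + a r * u r) - var ?s - var (a r * u r))
      + (var (a r * u r) - const (a r) * var (u r)) \<in> SR"
    using Suc.IH Suc.prems by (intro submod_add[OF submod_SR] SR_add[OF s] SR_mult) auto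
  thus ?case by (simp add: algebra_simps)
qed

lemma alpha_lin: "alpha (lin (Suc d) a) = (\<Sum>l<Suc d. const (a l) * var (f l))"
  unfolding lin_def by (simp add: halpha.h_sum halpha.h_mult halpha.h_add alpha_const alpha_var)

lemma alpha_psi: "z \<in> SA \<Longrightarrow> z - alpha (psi z) \<in> SR"
proof (rule rhom_congruent[OF subr_R subr_SA submod_SR rhom_id rhom_comp[OF rhom_psi rhom_alpha]])
  show "const r \<in> SA \<and> alpha (psi (const r)) \<in> SA \<and> const r - alpha (psi (const r)) \<in> SR" if "r \<in> R" for r
    using const_SA[OF that] submod_zero[OF submod_SR] by (simp add: psi_const alpha_const)
  show "var u \<in> SA \<and> alpha (psi (var u)) \<in> SA \<and> var u - alpha (psi (var u)) \<in> SR" if u: "u \<in> I" for u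
    using var_sum_SR[of "Suc d" "rep u" f] rep[OF u] f_I var_SA[OF u] alpha_SA[OF psi_B[OF var_SA[OF u]]]
    by (simp add: psi_var alpha_lin del: sum.lessThan_Suc)
qed

lemma lin_diff: "lin r (\<lambda>l. a l - b l) = lin r a - lin r b"
  by (simp add: lin_def const_diff left_diff_distrib sum_subtractf)

lemma lin_cong_L:
  assumes "\<And>l. l < Suc d \<Longrightarrow> a l \<in> R" "\<And>l. l < Suc d \<Longrightarrow> b l \<in> R" "(\<Sum>l<Suc d. a l * f l) = (\<Sum>l<Suc d. b l * f l)"
  shows "lin (Suc d) a - lin (Suc d) b \<in> L"
proof -
  have "syz (Suc d) (\<lambda>l. a l - b l)"
    using assms RR.B.diff by (simp add: syz_def left_diff_distrib sum_subtractf del: sum.lessThan_Suc)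
  from lin_in_M[OF this] show ?thesis unfolding lin_diff .
qed

text \<open>Both kinds of defining relations become differences of linear forms with the same value
  at \<open>f\<close>, and such differences lie in \<open>L\<close>.\<close>

lemma psi_SR: "z \<in> SR \<Longrightarrow> psi z \<in> L"
proof -
  have "submod SA {z \<in> SA. psi z \<in> L}"
    using submod_zero[OF submod_M] submod_add[OF submod_M] submod_mult[OF submod_M] psi_B
    by (intro submodI) (auto simp: sSA.zero hpsi.h_zero hpsi.h_add hpsi.h_mult
        intro: sSA.add sSA.mult)
  hence "SR \<subseteq> {z \<in> SA. psi z \<in> L}"
  proof (rule SR_leI)
    fix u v assume uv: "u \<in> I" "v \<in> I"
    hence uv': "u + v \<in> I" by (rule submod_add[OF submod_I])
    have "lin (Suc d) (rep (u + v)) - lin (Suc d) (\<lambda>l. rep u l + rep v l) \<in> L"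
      using rep[OF uv(1)] rep[OF uv(2)] rep[OF uv'] RR.B.add
      by (intro lin_cong_L) (auto simp: distrib_right sum.distrib simp del: sum.lessThan_Suc)
    moreover have "var (u + v) - var u - var v \<in> SR" using uv by (rule SR_add)
    ultimately show "var (u + v) - var u - var v \<in> {z \<in> SA. psi z \<in> L}"
      using SR_SA by (auto simp: hpsi.h_diff hpsi.h_add psi_var lin_add diff_diff_eq)
  next
    fix r u assume ru: "r \<in> R" "u \<in> I"
    hence ru': "r * u \<in> I" by (rule submod_mult[OF submod_I])
    have "lin (Suc d) (rep (r * u)) - lin (Suc d) (\<lambda>l. r * rep u l) \<in> L"
      using rep[OF ru(2)] rep[OF ru'] RR.B.mult[OF ru(1)]
      by (intro lin_cong_L) (auto simp: mult.assoc sum_distrib_left[symmetric] simp del: sum.lessThan_Suc)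
    moreover have "var (r * u) - const r * var u \<in> SR" using ru by (rule SR_mult)
    ultimately show "var (r * u) - const r * var u \<in> {z \<in> SA. psi z \<in> L}"
      using SR_SA by (auto simp: hpsi.h_diff hpsi.h_mult psi_var psi_const lin_mult)
  qed
  thus "z \<in> SR \<Longrightarrow> psi z \<in> L" by auto
qed

lemma psi_alpha: "b \<in> B \<Longrightarrow> psi (alpha b) - b \<in> L"
  unfolding B_def
proof (rule rhom_congruent[OF subr_R subr_B submod_M rhom_comp[OF rhom_alpha rhom_psi] rhom_id])
  show "psi (alpha (const r)) \<in> B \<and> const r \<in> B \<and> psi (alpha (const r)) - const r \<in> L" if "r \<in> R" for r
    using const_B[OF that] submod_zero[OF submod_M] by (simp add: psi_const alpha_const)
  fix l assume "l \<in> {..d}"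
  hence l: "l \<le> d" by simp
  have "(\<Sum>k<Suc d. (if k = l then 1 else 0) * f k) = f l"
    using l by (simp add: if_distrib[of "\<lambda>t. t * _"] del: sum.lessThan_Suc cong: if_cong)
  hence "lin (Suc d) (rep (f l)) - lin (Suc d) (\<lambda>k. if k = l then 1 else 0) \<in> L"
    using rep[OF f_I[OF l]] RR.B.zero RR.B.one by (intro lin_cong_L) auto
  moreover have "lin (Suc d) (\<lambda>k. if k = l then 1 else 0) = var l"
    unfolding lin_def using l by (simp add: if_distrib[of const] if_distrib[of "\<lambda>t. t * _"] del: sum.lessThan_Suc cong: if_cong)
  ultimately show "psi (alpha (var l)) \<in> B \<and> var l \<in> B \<and> psi (alpha (var l)) - var l \<in> L"
    using rep[OF f_I[OF l]] l lin_B var_B by (simp add: alpha_var psi_var)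
qed

text \<open>Identifies \<open>L\<close> as the kernel of the presentation of \<open>Sym(I)\<close>.
  One direction uses the inverse \<open>psi\<close>, the other that linear relations of the
  \<open>f l\<close> hold among the variables \<open>var (f l)\<close> modulo
  \<open>SR\<close>.\<close>

lemma alpha_SR_iff: "b \<in> B \<Longrightarrow> alpha b \<in> SR \<longleftrightarrow> b \<in> L"
proof
  assume b: "b \<in> B" and "alpha b \<in> SR"
  thus "b \<in> L" using psi_SR psi_alpha[OF b] submod_diff_iff[OF subr_B submod_M] by blast
next
  have "submod B {b \<in> B. alpha b \<in> SR}"
    using submod_zero[OF submod_SR] submod_add[OF submod_SR] submod_mult[OF submod_SR] alpha_SA
    by (intro submodI) (auto simp: sB.zero halpha.h_zero halpha.h_add halpha.h_mult
        intro: sB.add sB.mult)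
  moreover have "alpha (lin (Suc d) a) \<in> SR" if "syz (Suc d) a" for a
  proof -
    have z: "var 0 \<in> SR" using var_sum_SR[of 0 undefined undefined] by simp
    have "var (\<Sum>l<Suc d. a l * f l) - alpha (lin (Suc d) a) \<in> SR"
      unfolding alpha_lin using that f_I by (intro var_sum_SR) (auto simp: syz_def)
    hence "var 0 - alpha (lin (Suc d) a) \<in> SR" using that by (simp add: syz_def del: sum.lessThan_Suc)
    thus ?thesis using submod_diff_iff[OF subr_SA submod_SR] z by blast
  qed
  ultimately have "L \<subseteq> {b \<in> B. alpha b \<in> SR}"
    unfolding M_def using lin_B by (intro gen_least) (auto simp: syz_def)
  thus "b \<in> L \<Longrightarrow> alpha b \<in> SR" by auto
qed

lemma evI_alpha: "evI (alpha b) = ev b"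
  unfolding rhom_eval_comp[OF rhom_const rhom_evI] by (simp add: ev_def evI_const evI_var)

lemma evI_SR: "z \<in> SR \<Longrightarrow> evI z = 0"
proof -
  have "submod SA {z \<in> SA. evI z = 0}"
    by (intro submodI) (auto simp: sSA.zero hevI.h_zero hevI.h_add hevI.h_mult
        intro: sSA.add sSA.mult)
  hence "SR \<subseteq> {z \<in> SA. evI z = 0}"
  proof (rule SR_leI)
    show "var (u + v) - var u - var v \<in> {z \<in> SA. evI z = 0}" if "u \<in> I" "v \<in> I" for u v
      using subsetD[OF SR_SA SR_add[OF that]] by (simp add: hevI.h_diff evI_var add_monom[symmetric])
    show "var (r * u) - const r * var u \<in> {z \<in> SA. evI z = 0}" if "r \<in> R" "u \<in> I" for r u
      using subsetD[OF SR_SA SR_mult[OF that]]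
      by (simp add: hevI.h_diff hevI.h_mult evI_const evI_var smult_monom)
  qed
  thus "z \<in> SR \<Longrightarrow> evI z = 0" by auto
qed

section \<open>The presentation of the symmetric algebra and of the nonlinear relations\<close>

lemma ideal_SR: "ideal SR (ring_on SA)"
  using submod_SR SR_SA ideal_ring_on[OF subr_SA] by blast

lemma pres_eq_coset: "pres b = SR +>\<^bsub>ring_on SA\<^esub> alpha b"
  by (simp add: sym_presentation_def)

lemma pres_eq_iff: "b \<in> B \<Longrightarrow> c \<in> B \<Longrightarrow> pres b = pres c \<longleftrightarrow> b - c \<in> L"
  unfolding pres_eq_coset using coset_eq_iff[OF subr_SA submod_SR SR_SA alpha_SA alpha_SA, of b c]
    alpha_SR_iff[OF sB.diff, of b c] by (simp add: halpha.h_diff)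

lemma pres_hom:
  assumes "b \<in> B" "c \<in> B"
  shows "pres (b + c) = pres b \<oplus>\<^bsub>sym_alg R I\<^esub> pres c" "pres (b * c) = pres b \<otimes>\<^bsub>sym_alg R I\<^esub> pres c"
  using ring_hom_add[OF ideal.rcos_ring_hom[OF ideal_SR], of "alpha b" "alpha c"]
    ring_hom_mult[OF ideal.rcos_ring_hom[OF ideal_SR], of "alpha b" "alpha c"] alpha_SA[OF assms(1)] alpha_SA[OF assms(2)]
  by (simp_all add: sym_alg_def pres_eq_coset halpha.h_add halpha.h_mult)

lemma pres_zero: "pres 0 = \<zero>\<^bsub>sym_alg R I\<^esub>"
  by (simp add: pres_eq_coset sym_alg_def FactRing_def coset_ring_on halpha.h_zero)

lemma sym_alg_cosets: "carrier (sym_alg R I) = (+>\<^bsub>ring_on SA\<^esub>) SR ` SA"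
  unfolding sym_alg_def FactRing_def A_RCOSETS_def' by auto

lemma sym_alg_carrier: "carrier (sym_alg R I) = pres ` B"
proof (intro subset_antisym subsetI)
  fix X assume "X \<in> carrier (sym_alg R I)"
  then obtain z where z: "z \<in> SA" "X = SR +>\<^bsub>ring_on SA\<^esub> z" unfolding sym_alg_cosets by blast
  hence "X = pres (psi z)"
    unfolding pres_eq_coset using coset_eq_iff[OF subr_SA submod_SR SR_SA z(1) alpha_SA[OF psi_B[OF z(1)]]] alpha_psi[OF z(1)] by simp
  thus "X \<in> pres ` B" using psi_B[OF z(1)] by blast
next
  fix X assume "X \<in> pres ` B"
  thus "X \<in> carrier (sym_alg R I)" using alpha_SA unfolding sym_alg_cosets pres_eq_coset by blast
qed

text \<open>Relations evaluate to 0, so \<open>evI\<close> is constant on the coset and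
  \<open>the_elem\<close> is applied to a singleton.\<close>

lemma sym_to_rees_coset: "sym_to_rees (SR +>\<^bsub>ring_on SA\<^esub> z) = evI z"
proof -
  have "evI ` (SR +>\<^bsub>ring_on SA\<^esub> z) = (\<lambda>q. evI z) ` SR"
    unfolding coset_ring_on image_image by (rule image_cong[OF refl]) (simp add: hevI.h_add evI_SR)
  also have "\<dots> = {evI z}" using submod_zero[OF submod_SR] by blast
  finally show ?thesis unfolding sym_to_rees_def evI_def by (simp only: the_elem_eq)
qed

lemma sym_to_rees_pres: "sym_to_rees (pres b) = ev b"
  unfolding pres_eq_coset sym_to_rees_coset by (rule evI_alpha)

lemma nonlinear_relations_eq: "nonlinear_relations R I = pres ` P"
  by (auto simp: nonlinear_relations_def a_kernel_def kernel_def sym_alg_carrier sym_to_rees_pres P_def)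

abbreviation MT where "MT \<equiv> restrict_scalars pres (sym_alg R I) (nonlinear_relations R I)"

text \<open>The bridge from the module of nonlinear relations to the pair
  \<open>L \<subseteq> P\<close>, through which its lengths are computed in
  \<open>B\<close>.\<close>

lemma presented_T: "presented B P L pres MT"
proof (intro presented.intro presented_axioms.intro subr_B submod_P submod_M L_subset_P)
  show "pres ` P = carrier MT" "pres 0 = \<zero>\<^bsub>MT\<^esub>"
    by (simp_all add: restrict_scalars_def nonlinear_relations_eq pres_zero)
  show "pres (x + y) = pres x \<oplus>\<^bsub>MT\<^esub> pres y" "pres x = pres y \<longleftrightarrow> x - y \<in> L" if "x \<in> P" "y \<in> P" for x y
    using pres_hom[of x y] pres_eq_iff[of x y] that P_subset_B by (auto simp: restrict_scalars_def)
  show "pres (a * x) = a \<odot>\<^bsub>MT\<^esub> pres x" if "a \<in> B" "x \<in> P" for a x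
    using pres_hom[of a x] that P_subset_B by (auto simp: restrict_scalars_def)
qed

lemma biring_max_eq: "biring_max R {..<d} {..d} = gen B (y ` {..<m})"
proof -
  have "(\<lambda>v. const (var v)) ` {..<d} \<union> var ` {..d} = y ` {..<m}"
  proof (intro subset_antisym subsetI)
    fix x assume "x \<in> (\<lambda>v. const (var v)) ` {..<d} \<union> (var ` {..d} :: 'k bipoly set)"
    then consider u where "u < d" "x = const (var u)" | l where "l \<le> d" "x = var l" by auto
    thus "x \<in> y ` {..<m}"
    proof cases
      case 1 thus ?thesis by (intro image_eqI[of _ _ "Suc d + u"]) (auto simp: y_def)
    next
      case 2 thus ?thesis by (intro image_eqI[of _ _ l]) (auto simp: y_def)
    qed
  next
    fix x assume "x \<in> y ` {..<m}"
    then obtain v where v: "v < m" "x = y v" by auto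
    thus "x \<in> (\<lambda>v. const (var v)) ` {..<d} \<union> var ` {..d}"
    proof (cases "v \<le> d")
      case False
      hence "x = const (var (v - Suc d))" "v - Suc d < d" using v by (auto simp: y_def)
      thus ?thesis by blast
    qed (use v in \<open>auto simp: y_def\<close>)
  qed
  moreover have "y ` {..<m} \<subseteq> B" using K.y by auto
  ultimately show ?thesis unfolding biring_max_def B_def[symmetric] using genideal_ring_on[OF subr_B, of "y ` {..<m}"] by simp
qed

lemma hilbert_samuel_T:
  "mod_length (ring_on B) (quot_module MT (ideal_smult (ring_on B) (ideal_pow (ring_on B) (gen B (y ` {..<m})) k) MT))
    = len B (BB.Npow k P L) P"
proof -
  interpret T: presented B P L pres MT by (rule presented_T)
  have sub: "submod B (BB.Npow k P L)" "L \<subseteq> BB.Npow k P L" "BB.Npow k P L \<subseteq> P"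
    using BB.submod_Npow BB.L_Npow BB.Npow_subset[OF submod_P submod_M L_subset_P] by auto
  have pow: "ideal_pow (ring_on B) (gen B (y ` {..<m})) k = gen B (BB.mnm ` Mon m k)"
    by (rule ideal_pow_ring_on[OF subr_B K.y])
  have mnmB: "BB.mnm ` Mon m k \<subseteq> B" using BB.mnm_B by (auto simp: Mon_def)
  have "ideal_smult (ring_on B) (ideal_pow (ring_on B) (gen B (y ` {..<m})) k) MT = pres ` BB.Npow k P L"
    unfolding pow
  proof (rule T.ideal_smult_eq[OF sub])
    show "gen B (BB.mnm ` Mon m k) \<subseteq> B" using mnmB by (intro gen_least submod_self subr_B)
    show "a * x \<in> BB.Npow k P L" if a: "a \<in> gen B (BB.mnm ` Mon m k)" and x: "x \<in> P" for a x
      using a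
    proof (induction rule: gen.induct)
      case (step b u v)
      hence "u * x \<in> BB.Npow k P L" using BB.mnm_Npow[OF submod_P _ _ x] by (auto simp: Mon_def)
      hence "b * (u * x) + v * x \<in> BB.Npow k P L" using submod_add[OF sub(1) submod_mult[OF sub(1) step(1)] step.IH] by simp
      thus ?case by (simp add: algebra_simps)
    qed (simp add: submod_zero[OF sub(1)])
    show "BB.Npow k P L \<subseteq> N" if N: "submod B N" "L \<subseteq> N" "\<And>a x. a \<in> gen B (BB.mnm ` Mon m k) \<Longrightarrow> x \<in> P \<Longrightarrow> a * x \<in> N" for N
      unfolding BB.Npow_def using N gen_superset[OF subr_B, of "BB.mnm ` Mon m k"] by (intro gen_least) auto
  qed
  thus ?thesis using presented.mod_length_eq[OF T.quotient[OF sub]] by simp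
qed

text \<open>The described number is unique because every polynomial that eventually agrees with the
  length function has the same normalised leading coefficient.\<close>

lemma multiplicity_T: "module_multiplicity (ring_on B) (biring_max R {..<d} {..d}) MT = lam"
proof -
  obtain l p where lp: "\<And>N. len B (BB.Npow N P L) P = enat (l N)" "\<forall>\<^sub>F N in sequentially. real (l N) = poly p (real N)"
    "\<And>q. \<forall>\<^sub>F N in sequentially. real (l N) = poly q (real N) \<Longrightarrow> fact (degree q) * lead_coeff q = real lam"
    by (rule multiplicity) blast
  have iff: "hilbert_samuel (ring_on B) (biring_max R {..<d} {..d}) MT q \<longleftrightarrow> (\<forall>\<^sub>F N in sequentially. real (l N) = poly q (real N))" for q
    unfolding hilbert_samuel_def biring_max_eq hilbert_samuel_T lp(1) by simp
  show ?thesis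
    unfolding module_multiplicity_def
  proof (rule the_equality)
    show "\<exists>P. hilbert_samuel (ring_on B) (biring_max R {..<d} {..d}) MT P \<and> real lam = fact (degree P) * lead_coeff P"
      using lp(2) lp(3)[OF lp(2)] by (intro exI[of _ p]) (simp add: iff)
    show "e = lam" if h: "\<exists>P. hilbert_samuel (ring_on B) (biring_max R {..<d} {..d}) MT P \<and> real e = fact (degree P) * lead_coeff P" for e
    proof -
      obtain q where "\<forall>\<^sub>F N in sequentially. real (l N) = poly q (real N)" "real e = fact (degree q) * lead_coeff q"
        using h unfolding iff by blast
      thus ?thesis using lp(3)[of q] by simp
    qed
  qed
qed

lemma length_I_J: "mod_length (ring_on R) (quot_module (ideal_module (ring_on R) I) (J d)) = enat lam"
proof -
  interpret I: presented R I "{0}" "\<lambda>x. x" "ideal_module (ring_on R) I"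
    by (rule presented_ideal_module[OF subr_R submod_I])
  have "J d \<subseteq> I" unfolding J_def by (rule gen_mono[OF subr_R]) auto
  thus ?thesis
    using presented.mod_length_eq[OF I.quotient[OF submod_J, of d]] submod_zero[OF submod_J, of d] len_I_J by simp
qed

subsection \<open>The Rees algebra\<close>

text \<open>The \<open>i\<close>-th power of \<open>I\<close> is generated by the products of
  \<open>i\<close> of the \<open>f l\<close>, which are the values of the T-monomials of degree
  \<open>i\<close>.\<close>

lemma ev_image: "ev ` B = rees R I"
proof -
  have pow: "ideal_pow (ring_on R) I i = gen R (mev f ` Mon (Suc d) i)" for i
    unfolding J_def using f_in by (intro ideal_pow_ring_on[OF subr_R]) auto
  show ?thesis
  proof (intro subset_antisym subsetI)
    fix q assume "q \<in> ev ` B"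
    then obtain b where b: "b \<in> B" "q = ev b" by auto
    have "coeff (ev b) i \<in> gen R (mev f ` Mon (Suc d) i)" for i
      unfolding coeff_ev evf_expand
    proof (intro submod_sum[OF submod_gen[OF subr_R]] submod_mult[OF submod_gen[OF subr_R]])
      fix nu assume "nu \<in> keys (filt (dg i) b)"
      hence nu: "nu \<in> keys b" "deg nu = i" by (auto simp: keys_filt)
      hence "nu \<in> Mon (Suc d) i" using mpolys_keys[of b R "{..d}" nu] b(1) by (simp add: B_def Mon_def lessThan_Suc_atMost)
      thus "mev f nu \<in> gen R (mev f ` Mon (Suc d) i)" using gen_superset[OF subr_R] by blast
      show "coef (filt (dg i) b) nu \<in> R" using mpolys_coef[of b R "{..d}" nu] b(1) nu(2) by (simp add: B_def coef_filt)
    qed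
    thus "q \<in> rees R I" using b(2) pow by (simp add: rees_def)
  next
    fix q assume "q \<in> rees R I"
    hence q: "coeff q i \<in> gen R (mev f ` Mon (Suc d) i)" for i using pow by (simp add: rees_def)
    have "\<exists>b\<in>B. ev b = monom (coeff q i) i" for i
    proof -
      obtain a where a: "\<forall>nu\<in>Mon (Suc d) i. a nu \<in> R" "coeff q i = (\<Sum>nu\<in>Mon (Suc d) i. a nu * mev f nu)"
        using q[of i] unfolding gen_image_sum[OF subr_R finite_Mon] by auto
      have "ev (\<Sum>nu\<in>Mon (Suc d) i. single nu (a nu)) = (\<Sum>nu\<in>Mon (Suc d) i. monom (a nu * mev f nu) i)"
        unfolding ev_sum by (rule sum.cong) (auto simp: ev_single Mon_def)
      also have "\<dots> = monom (coeff q i) i" unfolding a(2) by (rule monom_sum[symmetric])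
      finally have "ev (\<Sum>nu\<in>Mon (Suc d) i. single nu (a nu)) = monom (coeff q i) i" .
      moreover have "(\<Sum>nu\<in>Mon (Suc d) i. single nu (a nu)) \<in> B"
        using a(1) RR.B.zero by (intro sB.sum) (auto simp: B_def Mon_def lessThan_Suc_atMost intro!: single_mpolys)
      ultimately show ?thesis by blast
    qed
    then obtain b where b: "\<And>i. b i \<in> B" "\<And>i. ev (b i) = monom (coeff q i) i" by metis
    have eq: "ev (\<Sum>i\<le>degree q. b i) = q" unfolding ev_sum b(2) by (rule poly_as_sum_of_monoms)
    have "ev (\<Sum>i\<le>degree q. b i) \<in> ev ` B" using b(1) by (intro imageI sB.sum)
    thus "q \<in> ev ` B" by (simp only: eq)
  qed
qed

lemma subr_rees: "subr (rees R I)"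
proof
  note ring = hev.h_add[symmetric] hev.h_mult[symmetric] hev.h_minus[symmetric]
  show "0 \<in> rees R I" "1 \<in> rees R I"
    unfolding ev_image[symmetric] using sB.zero sB.one hev.h_zero hev.h_one
    by (metis imageI)+
  show "x + y \<in> rees R I" "x * y \<in> rees R I" if "x \<in> rees R I" "y \<in> rees R I" for x y
    using that sB.add sB.mult unfolding ev_image[symmetric] by (auto simp: ring)
  show "- x \<in> rees R I" if "x \<in> rees R I" for x
    using that sB.uminus unfolding ev_image[symmetric] by (auto simp: ring)
qed

lemma ev_gen: "X \<subseteq> B \<Longrightarrow> ev ` gen B X = gen (rees R I) (ev ` X)"
proof (intro subset_antisym subsetI)
  assume X: "X \<subseteq> B"
  have sub: "submod (rees R I) (gen (rees R I) (ev ` X))" by (rule submod_gen[OF subr_rees])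
  have "ev b \<in> gen (rees R I) (ev ` X)" if "b \<in> gen B X" for b
    using that
  proof (induction rule: gen.induct)
    case (step a x b)
    hence "ev a * ev x + ev b \<in> gen (rees R I) (ev ` X)" using ev_image by (intro gen.step) auto
    thus ?case by (simp add: hev.h_add hev.h_mult)
  qed (simp add: hev.h_zero gen.zero)
  thus "q \<in> gen (rees R I) (ev ` X)" if "q \<in> ev ` gen B X" for q using that by auto
  fix q assume "q \<in> gen (rees R I) (ev ` X)"
  thus "q \<in> ev ` gen B X"
  proof (induction rule: gen.induct)
    case zero
    have "ev 0 \<in> ev ` gen B X" by (intro imageI gen.zero)
    thus ?case by (simp only: hev.h_zero)
  next
    case (step a x q)
    have "a \<in> ev ` B" using step(1) by (simp only: ev_image)
    then obtain a' where a': "a' \<in> B" "a = ev a'" by blast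
    obtain x' b where xb: "x' \<in> X" "x = ev x'" "b \<in> gen B X" "q = ev b" using step(2) step.IH by blast
    have "ev (a' * x' + b) \<in> ev ` gen B X" by (intro imageI gen.step a' xb)
    thus ?case by (simp only: a'(2) xb(2,4) hev.h_add hev.h_mult)
  qed
qed

lemma rees_max_lift: "rees_max R {..<d} I \<subseteq> ev ` gen B (y ` {..<m})"
proof -
  let ?X = "(\<lambda>v. [:var v:]) ` {..<d} \<union> (\<lambda>u. monom u 1) ` I"
  have sub: "submod B (gen B (y ` {..<m}))" by (rule submod_gen[OF subr_B])
  have sup: "y ` {..<m} \<subseteq> gen B (y ` {..<m})" by (rule gen_superset[OF subr_B])
  have yB: "y ` {..<m} \<subseteq> B" using K.y by auto
  have X: "?X \<subseteq> ev ` gen B (y ` {..<m})"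
  proof (intro Un_least subsetI)
    fix q :: "(nat, 'k) mpoly poly" assume "q \<in> (\<lambda>v. [:var v:]) ` {..<d}"
    then obtain v where v: "v < d" "q = [:var v:]" by auto
    have "y (Suc d + v) \<in> gen B (y ` {..<m})" using v by (intro subsetD[OF sup] imageI) simp
    moreover have "ev (y (Suc d + v)) = q" by (simp add: y_def v(2) ev_def hpCons.eval_const)
    ultimately show "q \<in> ev ` gen B (y ` {..<m})" by blast
  next
    fix q assume "q \<in> (\<lambda>u. monom u 1) ` I"
    then obtain u where u: "u \<in> I" "q = monom u 1" by auto
    have "const (rep u l) * y l \<in> gen B (y ` {..<m})" if "l < Suc d" for l
      using that rep[OF u(1)] by (intro submod_mult[OF sub] const_B subsetD[OF sup] imageI) auto
    hence "(\<Sum>l<Suc d. const (rep u l) * y l) \<in> gen B (y ` {..<m})" by (intro submod_sum[OF sub]) auto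
    hence "ev (\<Sum>l<Suc d. const (rep u l) * y l) \<in> ev ` gen B (y ` {..<m})" by (rule imageI)
    moreover have "ev (\<Sum>l<Suc d. const (rep u l) * y l) = monom (\<Sum>l<Suc d. rep u l * f l) 1"
      unfolding ev_sum monom_sum hev.h_mult
      by (intro sum.cong refl) (simp add: y_def ev_def hpCons.eval_const hpCons.eval_var smult_monom)
    ultimately show "q \<in> ev ` gen B (y ` {..<m})" using rep[OF u(1)] u(2) by (simp only:)
  qed
  have genB: "gen B (y ` {..<m}) \<subseteq> B" using yB by (intro gen_least submod_self subr_B)
  hence "?X \<subseteq> rees R I" using X ev_image by blast
  hence "rees_max R {..<d} I = gen (rees R I) ?X" unfolding rees_max_def by (rule genideal_ring_on[OF subr_rees])
  also have "\<dots> \<subseteq> ev ` gen B (y ` {..<m})"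
    unfolding ev_gen[OF yB] using X[unfolded ev_gen[OF yB]] by (intro gen_least submod_gen subr_rees)
  finally show ?thesis .
qed

text \<open>Elements of the maximal homogeneous ideal of the Rees algebra lift along
  \<open>ev\<close> to the ideal generated by the \<open>y v\<close>. As \<open>B / P\<close> is the
  Rees algebra, a regular sequence lifts to elements that are regular modulo \<open>P\<close>, as
  \<open>few_generators\<close> requires.\<close>

lemma depth_generators:
  assumes "enat d \<le> depth (ring_on (rees R I)) (rees_max R {..<d} I)"
  obtains gs where "length gs = lam" "set gs \<subseteq> P" "gen B (set gs \<union> L) = P"
proof -
  \<comment> \<open>Depth is a supremum, so this yields a regular sequence of length at least
    \<open>d\<close>; its first \<open>d\<close> members are used.\<close>
  obtain x where "x \<in> {enat (length xs) |xs. set xs \<subseteq> rees_max R {..<d} I \<and> regular_seq (ring_on (rees R I)) xs}" "enat d \<le> x"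
    by (rule enat_le_Sup_obtain[OF assms[unfolded depth_def]]) (use d_ge in simp)
  then obtain qs where qs: "d \<le> length qs" "set qs \<subseteq> rees_max R {..<d} I" "regular_seq (ring_on (rees R I)) qs" by auto
  have "\<exists>b\<in>gen B (y ` {..<m}). ev b = qs ! i" if "i < d" for i
  proof -
    have "qs ! i \<in> set qs" using that qs(1) by (intro nth_mem) simp
    hence "qs ! i \<in> ev ` gen B (y ` {..<m})" using qs(2) rees_max_lift by blast
    thus ?thesis by auto
  qed
  then obtain a where a: "\<And>i. i < d \<Longrightarrow> a i \<in> gen B (y ` {..<m})" "\<And>i. i < d \<Longrightarrow> ev (a i) = qs ! i" by metis
  have aB: "a i \<in> B" if "i < d" for i
    using a(1)[OF that] gen_least[OF submod_self[OF subr_B], of "y ` {..<m}"] K.y by auto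
  show thesis
  proof (rule few_generators[OF a(1)])
    fix i x assume i: "i < d" and x: "x \<in> B" and ax: "a i * x \<in> gen B (P \<union> a ` {..<i})"
    have aiB: "a ` {..<i} \<subseteq> B" using aB i by auto
    have take: "ev ` a ` {..<i} = set (take i qs)"
      using a(2) i qs(1) by (force simp: set_conv_nth image_image)
    have ev_P: "ev ` gen B (P \<union> a ` {..<i}) \<subseteq> gen (rees R I) (set (take i qs))"
    proof -
      have "ev ` (P \<union> a ` {..<i}) \<subseteq> gen (rees R I) (set (take i qs))"
        unfolding image_Un take using gen_superset[OF subr_rees, of "set (take i qs)"] gen.zero by (auto simp: P_def)
      thus ?thesis
        using ev_gen[of "P \<union> a ` {..<i}"] aiB P_subset_B gen_least[OF submod_gen[OF subr_rees]] by auto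
    qed
    have "set (take i qs) \<subseteq> rees R I" unfolding take[symmetric] ev_image[symmetric] using aiB by auto
    hence Idl: "Idl\<^bsub>ring_on (rees R I)\<^esub> (set (take i qs)) = gen (rees R I) (set (take i qs))"
      by (rule genideal_ring_on[OF subr_rees])
    have "qs ! i * ev x \<in> gen (rees R I) (set (take i qs))"
      using subsetD[OF ev_P imageI[OF ax]] a(2)[OF i] by (simp add: hev.h_mult)
    moreover have "ev x \<in> rees R I" using x ev_image by blast
    ultimately have "ev x \<in> gen (rees R I) (set (take i qs))"
      using qs(3) i qs(1) unfolding regular_seq_def Idl[symmetric] by auto
    then obtain x' where x': "x' \<in> gen B (a ` {..<i})" "ev x = ev x'" unfolding take[symmetric] ev_gen[OF aiB, symmetric] by auto
    have "x' \<in> B" using x'(1) gen_least[OF submod_self[OF subr_B] aiB] by auto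
    hence "x - x' \<in> P" using x x'(2) sB.diff by (simp add: P_def hev.h_diff)
    hence "x - x' \<in> gen B (P \<union> a ` {..<i})" using gen_superset[OF subr_B, of "P \<union> a ` {..<i}"] by blast
    moreover have "x' \<in> gen B (P \<union> a ` {..<i})" using x'(1) gen_mono[OF subr_B, of "a ` {..<i}" "P \<union> a ` {..<i}"] by blast
    ultimately show "x \<in> gen B (P \<union> a ` {..<i})" using submod_diff_iff[OF subr_B submod_gen[OF subr_B]] by blast
  qed (use that in auto)
qed

text \<open>That the nonlinear relations form an ideal is seen from the image of the kernel of
  \<open>evI\<close> in the quotient by \<open>SR\<close>. That they are the smallest ideal
  containing the classes of \<open>gs\<close> is tested on preimages in \<open>B\<close>.\<close>

lemma Idl_sym_alg:
  assumes "set gs \<subseteq> P" "gen B (set gs \<union> L) = P"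
  shows "Idl\<^bsub>sym_alg R I\<^esub> (set (map pres gs)) = nonlinear_relations R I"
  unfolding genideal_def
proof (rule antisym)
  interpret cring "ring_on SA" by (rule cring_ring_on[OF subr_SA])
  have "{z \<in> SA. evI z = 0} \<subseteq> SA" "submod SA {z \<in> SA. evI z = 0}"
    by (auto intro!: submodI simp: sSA.zero hevI.h_zero hevI.h_add hevI.h_mult
        intro: sSA.add sSA.mult)
  hence "ideal {z \<in> SA. evI z = 0} (ring_on SA)" using ideal_ring_on[OF subr_SA] by blast
  hence id: "ideal ((+>\<^bsub>ring_on SA\<^esub>) SR ` {z \<in> SA. evI z = 0}) (sym_alg R I)"
    unfolding sym_alg_def by (rule ring_ideal_imp_quot_ideal[OF ideal_SR])
  have "(+>\<^bsub>ring_on SA\<^esub>) SR ` {z \<in> SA. evI z = 0} = nonlinear_relations R I"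
  proof (intro subset_antisym subsetI)
    fix X assume "X \<in> (+>\<^bsub>ring_on SA\<^esub>) SR ` {z \<in> SA. evI z = 0}"
    then obtain z where z: "z \<in> SA" "evI z = 0" "X = SR +>\<^bsub>ring_on SA\<^esub> z" by auto
    hence "X \<in> carrier (sym_alg R I)" unfolding sym_alg_cosets by blast
    then obtain b where b: "b \<in> B" "X = pres b" unfolding sym_alg_carrier by auto
    have "ev b = 0" unfolding sym_to_rees_pres[symmetric] b(2)[symmetric] z(3) sym_to_rees_coset by (rule z(2))
    thus "X \<in> nonlinear_relations R I" using b by (auto simp: nonlinear_relations_eq P_def)
  next
    fix X assume "X \<in> nonlinear_relations R I"
    thus "X \<in> (+>\<^bsub>ring_on SA\<^esub>) SR ` {z \<in> SA. evI z = 0}"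
      using alpha_SA by (auto simp: nonlinear_relations_eq P_def pres_eq_coset evI_alpha)
  qed
  thus "\<Inter>{I'. ideal I' (sym_alg R I) \<and> set (map pres gs) \<subseteq> I'} \<subseteq> nonlinear_relations R I"
    using id assms(1) by (intro Inter_lower) (auto simp: nonlinear_relations_eq)
  show "nonlinear_relations R I \<subseteq> \<Inter>{I'. ideal I' (sym_alg R I) \<and> set (map pres gs) \<subseteq> I'}"
  proof (rule Inter_greatest, clarify)
    fix I' X assume I': "ideal I' (sym_alg R I)" "set (map pres gs) \<subseteq> I'" and X: "X \<in> nonlinear_relations R I"
    interpret I': ideal I' "sym_alg R I" by (rule I'(1))
    have "submod B {b \<in> B. pres b \<in> I'}"
      using I'.zero_closed I'.a_closed I'.I_l_closed sym_alg_carrier sB.zero sB.add sB.mult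
      by (intro submodI) (auto simp: pres_zero pres_hom)
    moreover have "pres l \<in> I'" if "l \<in> L" for l
      using pres_eq_iff[of l 0] that L_subset_P P_subset_B sB.zero pres_zero I'.zero_closed by auto
    ultimately have "gen B (set gs \<union> L) \<subseteq> {b \<in> B. pres b \<in> I'}"
      using I'(2) assms(1) L_subset_P P_subset_B by (intro gen_least) auto
    thus "X \<in> I'" using X assms(2) by (auto simp: nonlinear_relations_eq)
  qed
qed

lemma depth_T:
  assumes depth: "enat d \<le> depth (ring_on (rees R I)) (rees_max R {..<d} I)"
  shows "\<exists>gs. set gs \<subseteq> nonlinear_relations R I \<and> enat (length gs) = enat lam \<and> Idl\<^bsub>sym_alg R I\<^esub> (set gs) = nonlinear_relations R I"
proof (rule depth_generators[OF depth])
  fix gs assume gs: "length gs = lam" "set gs \<subseteq> P" "gen B (set gs \<union> L) = P"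
  have "set (map pres gs) \<subseteq> nonlinear_relations R I"
    unfolding nonlinear_relations_eq set_map using gs(2) by (rule image_mono)
  moreover have "enat (length (map pres gs)) = enat lam" unfolding length_map gs(1) ..
  ultimately show ?thesis using Idl_sym_alg[OF gs(2,3)] by blast
qed

lemmas main = multiplicity_T[unfolded B_def J_def] length_I_J[unfolded J_def] depth_T[unfolded J_def]

end

theorem corollary3p21:
  fixes d n :: nat
    and f :: "nat \<Rightarrow> (nat, 'k::field) mpoly"
    and R I J :: "(nat, 'k) mpoly set"
    and B :: "(nat, (nat, 'k) mpoly) mpoly ring"
    and T :: "((nat, 'k) mpoly, (nat, 'k) mpoly) mpoly set set"
  assumes "d \<ge> 1"
    and R: "R = mpolys UNIV {..<d}"
    and forms: "\<And>j. j \<le> d \<Longrightarrow> f j \<in> R \<and> form n (f j)"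
    and J: "J = Idl\<^bsub>ring_on R\<^esub> (f ` {..<d})"
    and I: "I = Idl\<^bsub>ring_on R\<^esub> (f ` {..d})"
    and complete_intersection: "regular_seq (ring_on R) (map f [0..<d])"
    and almost: "f d \<notin> J"
    and finite_colength:
      "mod_length (ring_on R) (quot_module (ideal_module (ring_on R) R) I) < \<infinity>"
    and B: "B = ring_on (mpolys R {..d})"
    and T: "T = nonlinear_relations R I"
  shows "enat (module_multiplicity B (biring_max R {..<d} {..d})
                (restrict_scalars (sym_presentation R I f) (sym_alg R I) T))
           = mod_length (ring_on R) (quot_module (ideal_module (ring_on R) I) J) \<and>
         (enat d \<le> depth (ring_on (rees R I)) (rees_max R {..<d} I) \<longrightarrow>
           (\<exists>gs. set gs \<subseteq> T \<and>
             enat (length gs) = mod_length (ring_on R) (quot_module (ideal_module (ring_on R) I) J) \<and>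
             Idl\<^bsub>sym_alg R I\<^esub> (set gs) = T))"
proof -
  have subR: "subr R" unfolding R by (rule subr_mpolys[OF subr_UNIV])
  have fR: "f j \<in> R" if "j \<le> d" for j using forms[OF that] by simp
  have Idl: "Idl\<^bsub>ring_on R\<^esub> (f ` {..<r}) = gen R (f ` {..<r})" if "r \<le> Suc d" for r
    using fR that by (intro genideal_ring_on[OF subR]) auto
  have take: "set (take r (map f [0..<d])) = f ` {..<r}" if "r \<le> d" for r
    using that by (simp add: take_map take_upt atLeast0LessThan)
  have reg: "c \<in> gen R (f ` {..<r})" if "r < d" "c \<in> R" "f r * c \<in> gen R (f ` {..<r})" for r c
    using complete_intersection that take[of r] Idl[of r] unfolding regular_seq_def by auto
  have one: "1 \<notin> gen R (f ` {..<d})"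
  proof
    assume "1 \<in> gen R (f ` {..<d})"
    hence "c \<in> gen R (f ` {..<d})" if "c \<in> R" for c
      using submod_mult[OF submod_gen[OF subR] that] by fastforce
    moreover have "gen R (f ` {..<d}) \<subseteq> R" using fR by (intro gen_least submod_self subR) auto
    ultimately show False using complete_intersection Idl[of d] take[of d] by (auto simp: regular_seq_def)
  qed
  \<comment> \<open>For \<open>n = 0\<close> the form \<open>f 0\<close> would be a constant: if
    zero, it is not regular in a proper ideal; if nonzero, it is a unit and the ideal is not
    proper.\<close>
  have "n \<noteq> 0"
  proof
    assume "n = 0"
    hence c: "f 0 = const (coef (f 0) 0)" using forms[of 0] by (intro form_0_const) auto
    have f0: "f 0 \<in> gen R (f ` {..<d})" using assms(1) by (intro subsetD[OF gen_superset[OF subR]]) auto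
    show False
    proof (cases "coef (f 0) 0 = 0")
      case True
      hence "f 0 = 0" using c by simp
      hence "1 \<in> gen R (f ` {..<0})" using reg[of 0 1] assms(1) subr.one[OF subR] gen.zero by auto
      thus False using gen_mono[OF subR, of "f ` {..<0}" "f ` {..<d}"] one by auto
    next
      case False
      have "const (inverse (coef (f 0) 0)) * f 0 \<in> gen R (f ` {..<d})"
        using f0 by (intro submod_mult[OF submod_gen[OF subR]]) (auto simp: R intro: const_mpolys)
      moreover have "const (inverse (coef (f 0) 0)) * f 0 = 1"
        using False by (subst c) (simp flip: const_mult)
      ultimately show False using one by simp
    qed
  qed
  hence aci: "aci d n f"
    using assms(1) forms reg almost Idl[of d] by unfold_locales (auto simp: R J)
  show ?thesis
    unfolding T B
    using Idl[of d] Idl[of "Suc d"] aci.main[OF aci] by (simp add: R I J lessThan_Suc_atMost)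
qed

end
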